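(* Let $\omega$ be a weight function, $m\in\mathbb{R}$, $0<\rho\le 1$, and assume that there is a weight function $\sigma$ with $\omega(t^{1/\rho})=O(\sigma(t))$ as $t\to+\infty$. Let $r>0$ and let $a(x,y,\xi)\in \mathrm{GA}^{m,\omega}_{\rho}$ be an amplitude. Then the formal kernel $$K(x,y):=\int_{\mathbb{R}^d} e^{i(x-y)\cdot\xi}\,a(x,y,\xi)\,d\xi$$ satisfies, with $\Delta_r:=\{(x,y)\in\mathbb{R}^{2d}: |x-y|<r\}$: (1) $K(x,y)\in C^\infty(\mathbb{R}^{2d}\setminus\overline{\Delta_r})$; (2) for every $\lambda>0$ there exists $C_\lambda>0$ (depending on $r$) such that for all $(x,y)\in\mathbb{R}^{2d}\setminus\Delta_r$ and all $\alpha,\beta\in\mathbb{N}_0^d$, $$|D_x^\alpha D_y^\beta K(x,y)|\le C_\lambda\, e^{\lambda\varphi^*\left(\frac{|\alpha+\beta|}{\lambda}\right)}e^{-\lambda\omega(x)}e^{-\lambda\omega(y)}.$$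
   Context: Notation: $\mathbb{N}=\{1,2,\dots\}$, $\mathbb{N}_0=\mathbb{N}\cup\{0\}$; $D_{x_j}=-i\,\partial/\partial x_j$, $D^\alpha=D_{x_1}^{\alpha_1}\cdots D_{x_d}^{\alpha_d}$; $|x|$ is the Euclidean norm and $\langle x\rangle=(1+|x|^2)^{1/2}$. Weight functions: a weight function is a continuous increasing (non-decreasing) function $\omega:[0,\infty)\to[0,\infty)$ such that ($\alpha$) there is $L\ge1$ with $\omega(2t)\le L(\omega(t)+1)$ for all $t\ge0$; ($\beta$) $\int_1^\infty \omega(t)t^{-2}\,dt<\infty$; ($\gamma$) $\log t=o(\omega(t))$ as $t\to\infty$; ($\delta$) $\varphi:t\mapsto\omega(e^t)$ is convex. Throughout, $\omega|_{[0,1]}\equiv0$, and $\omega$ is extended radially by $\omega(\xi)=\omega(|\xi|)$. The Young conjugate is $\varphi^*(t)=\sup_{s\ge0}\{st-\varphi(s)\}$, $t\ge0$. The space $\mathcal{S}_\omega(\mathbb{R}^d)$ is the set of $u\in L^1(\mathbb{R}^d)$ such that $u$ and $\widehat u(\xi)=\int u(x)e^{-ix\cdot\xi}dx$ are $C^\infty$ and, for all $\lambda>0$, $\alpha\in\mathbb{N}_0^d$, $\sup_x e^{\lambda\omega(x)}|D^\alpha u(x)|<\infty$ and $\sup_\xi e^{\lambda\omega(\xi)}|D^\alpha\widehat u(\xi)|<\infty$. It is a Fréchet space with the seminorms $|f|_\lambda=\sup_{\alpha}\sup_x|D^\alpha f(x)|e^{-\lambda\varphi^*(|\alpha|/\lambda)}e^{\lambda\omega(x)}$,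 $\lambda>0$; its dual is $\mathcal{S}'_\omega(\mathbb{R}^d)$. An amplitude in $\mathrm{GA}^{m,\omega}_\rho$ is a function $a(x,y,\xi)\in C^\infty(\mathbb{R}^{3d})$ such that for all $n\in\mathbb{N}$ there is $C_n>0$ with $$|D_x^\alpha D_y^\beta D_\xi^\gamma a(x,y,\xi)|\le C_n\frac{\langle x-y\rangle^{\rho|\alpha+\beta+\gamma|}}{\langle(x,y,\xi)\rangle^{\rho|\alpha+\beta+\gamma|}}e^{n\rho\varphi^*\left(\frac{|\alpha+\beta+\gamma|}{n}\right)}e^{m(\omega(x)+\omega(y)+\omega(\xi))}$$ for all $(x,y,\xi)\in\mathbb{R}^{3d}$, $(\alpha,\beta,\gamma)\in\mathbb{N}_0^{3d}$. The pseudodifferential operator with amplitude $a$ is the continuous linear operator $A:\mathcal{S}_\omega(\mathbb{R}^d)\to\mathcal{S}_\omega(\mathbb{R}^d)$, $Af(x)=\int_{\mathbb{R}^d}\big(\int_{\mathbb{R}^d}e^{i(x-y)\cdot\xi}a(x,y,\xi)f(y)\,dy\big)d\xi$. The integral defining $K$ is formal: $K$ is the element of $\mathcal{S}'_\omega(\mathbb{R}^{2d})$ that is the kernel of $A$, i.e. $\langle K, u\otimes f\rangle=\int u(x)\,Af(x)\,dx$ for $u,f\in\mathcal{S}_\omega(\mathbb{R}^d)$. Statement (1) means that $K$ restricted to the open set is given by a $C^\infty$ function (as $r>0$ is arbitrary, $K$ is a $C^\infty$ function off the diagonal, so the derivatives in (2) make sense also at points with $|x-y|=r$). *)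

theory Defs
  imports "HOL-Analysis.Analysis" "HOL-Library.Landau_Symbols"
begin

text \<open>Euclidean spaces are types of class \<^class>\<open>euclidean_space\<close>; the norm on a product type is again
  the Euclidean one, so \<open>'a \<times> 'a\<close> and \<open>'a \<times> 'a \<times> 'a\<close> serve as the spaces of dimension
  \<open>2d\<close> and \<open>3d\<close>.\<close>

definition jbracket :: "'a::real_normed_vector \<Rightarrow> real"  (\<open>\<langle>_\<rangle>\<close>)
  where "\<langle>x\<rangle> = sqrt (1 + (norm x)\<^sup>2)"


subsection \<open>Derivatives\<close>

definition has_partial :: "'a::euclidean_space \<Rightarrow> ('a \<Rightarrow> complex) \<Rightarrow> 'a \<Rightarrow> bool"
  where "has_partial b f x \<longleftrightarrow> (\<lambda>t::real. f (x + t *\<^sub>R b)) differentiable (at 0)"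

definition Dpartial :: "'a::euclidean_space \<Rightarrow> ('a \<Rightarrow> complex) \<Rightarrow> 'a \<Rightarrow> complex"
  where "Dpartial b f x = - \<i> * vector_derivative (\<lambda>t::real. f (x + t *\<^sub>R b)) (at 0)"

text \<open>\<^term>\<open>C_on k S f\<close>: the function is of class \<open>C\<^sup>k\<close> on the (open) set \<open>S\<close>.\<close>

primrec C_on :: "nat \<Rightarrow> 'a::euclidean_space set \<Rightarrow> ('a \<Rightarrow> complex) \<Rightarrow> bool" where
  "C_on 0 S f \<longleftrightarrow> continuous_on S f"
| "C_on (Suc k) S f \<longleftrightarrow> continuous_on S f \<and>
     (\<forall>b\<in>Basis. (\<forall>x\<in>S. has_partial b f x) \<and> C_on k S (Dpartial b f))"

definition Cinf_on :: "'a::euclidean_space set \<Rightarrow> ('a \<Rightarrow> complex) \<Rightarrow> bool"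
  where "Cinf_on S f \<longleftrightarrow> (\<forall>k. C_on k S f)"

text \<open>A multi-index is a function on the basis vectors; its values off \<^term>\<open>Basis\<close> are never used.
  The order in which the coordinates are processed is immaterial for smooth functions, so an
  arbitrary enumeration of the basis is fixed.\<close>

type_synonym 'a multi_index = "'a \<Rightarrow> nat"

definition basis_list :: "'a::euclidean_space list"
  where "basis_list = (SOME bs. distinct bs \<and> set bs = Basis)"

definition mi_size :: "'a::euclidean_space multi_index \<Rightarrow> nat"
  where "mi_size \<alpha> = (\<Sum>b\<in>Basis. \<alpha> b)"

definition Dmulti :: "'a::euclidean_space multi_index \<Rightarrow> ('a \<Rightarrow> complex) \<Rightarrow> 'a \<Rightarrow> complex"
  where "Dmulti \<alpha> f = foldr (\<lambda>b. Dpartial b ^^ \<alpha> b) basis_list f"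


subsection \<open>Weight functions\<close>

text \<open>Only the values on \<open>[0,\<infinity>)\<close> matter. The normalisation \<open>\<omega> = 0\<close> on \<open>[0,1]\<close> is kept separate.\<close>

definition weight_function :: "(real \<Rightarrow> real) \<Rightarrow> bool" where
  "weight_function \<omega> \<longleftrightarrow>
     continuous_on {0..} \<omega> \<and> mono_on {0..} \<omega> \<and> (\<forall>t\<ge>0. 0 \<le> \<omega> t) \<and>
     (\<exists>L\<ge>1. \<forall>t\<ge>0. \<omega> (2 * t) \<le> L * (\<omega> t + 1)) \<and>
     set_integrable lborel {1..} (\<lambda>t. \<omega> t / t\<^sup>2) \<and>
     (\<lambda>t. ln t) \<in> o[at_top](\<omega>) \<and>
     convex_on UNIV (\<lambda>t. \<omega> (exp t))"

definition normalised :: "(real \<Rightarrow> real) \<Rightarrow> bool"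
  where "normalised \<omega> \<longleftrightarrow> (\<forall>t\<in>{0..1}. \<omega> t = 0)"

text \<open>The Young conjugate \<open>\<phi>\<^sup>*\<close> of \<open>\<phi>(s) = \<omega>(e\<^sup>s)\<close>; the supremum is finite for weight functions.\<close>

definition phi_star :: "(real \<Rightarrow> real) \<Rightarrow> real \<Rightarrow> real"
  where "phi_star \<omega> t = (SUP s\<in>{0..}. s * t - \<omega> (exp s))"


subsection \<open>The space of test functions and its dual\<close>

definition fourier :: "('a::euclidean_space \<Rightarrow> complex) \<Rightarrow> 'a \<Rightarrow> complex"
  where "fourier u \<xi> = (LINT x|lborel. u x * exp (- \<i> * complex_of_real (x \<bullet> \<xi>)))"

definition S_space :: "(real \<Rightarrow> real) \<Rightarrow> ('a::euclidean_space \<Rightarrow> complex) set" where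
  "S_space \<omega> = {u. integrable lborel u \<and> Cinf_on UNIV u \<and> Cinf_on UNIV (fourier u) \<and>
     (\<forall>\<mu>>0. \<forall>\<alpha>. bdd_above (range (\<lambda>x. exp (\<mu> * \<omega> (norm x)) * norm (Dmulti \<alpha> u x))) \<and>
       bdd_above (range (\<lambda>\<xi>. exp (\<mu> * \<omega> (norm \<xi>)) * norm (Dmulti \<alpha> (fourier u) \<xi>))))}"

definition S_seminorm :: "(real \<Rightarrow> real) \<Rightarrow> real \<Rightarrow> ('a::euclidean_space \<Rightarrow> complex) \<Rightarrow> ennreal" where
  "S_seminorm \<omega> \<mu> f = (SUP \<alpha>. SUP x. ennreal
     (norm (Dmulti \<alpha> f x) * exp (- \<mu> * phi_star \<omega> (real (mi_size \<alpha>) / \<mu>)) * exp (\<mu> * \<omega> (norm x))))"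

text \<open>The locally convex topology of the seminorms, generated by all their open balls.\<close>

definition S_topology :: "(real \<Rightarrow> real) \<Rightarrow> ('a::euclidean_space \<Rightarrow> complex) topology" where
  "S_topology \<omega> = topology_generated_by
     {{g \<in> S_space \<omega>. S_seminorm \<omega> \<mu> (\<lambda>x. g x - f x) < ennreal \<epsilon>} | f \<mu> \<epsilon>.
        f \<in> S_space \<omega> \<and> \<mu> > 0 \<and> \<epsilon> > 0}"

text \<open>Functionals are represented by total functions; only their values on \<^const>\<open>S_space\<close> matter.\<close>

definition S_dual :: "(real \<Rightarrow> real) \<Rightarrow> (('a::euclidean_space \<Rightarrow> complex) \<Rightarrow> complex) set" where
  "S_dual \<omega> = {T.
     (\<forall>f\<in>S_space \<omega>. \<forall>g\<in>S_space \<omega>. T (\<lambda>x. f x + g x) = T f + T g) \<and>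
     (\<forall>c. \<forall>f\<in>S_space \<omega>. T (\<lambda>x. c * f x) = c * T f) \<and>
     continuous_map (S_topology \<omega>) euclidean T}"

text \<open>The restriction of the functional \<open>T\<close> to the open set \<open>U\<close> is given by the function \<open>k\<close>:
  tested, as usual, against the test functions with compact support in \<open>U\<close>.\<close>

definition given_by_on ::
  "(real \<Rightarrow> real) \<Rightarrow> (('a::euclidean_space \<Rightarrow> complex) \<Rightarrow> complex) \<Rightarrow> 'a set \<Rightarrow> ('a \<Rightarrow> complex) \<Rightarrow> bool"
  where "given_by_on \<omega> T U k \<longleftrightarrow>
    (\<forall>F\<in>S_space \<omega>. compact (closure {z. F z \<noteq> 0}) \<and> closure {z. F z \<noteq> 0} \<subseteq> U \<longrightarrow>
       T F = (LINT z|lborel. k z * F z))"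


subsection \<open>Amplitudes, operators and kernels\<close>

definition GA :: "real \<Rightarrow> (real \<Rightarrow> real) \<Rightarrow> real \<Rightarrow> ('a::euclidean_space \<times> 'a \<times> 'a \<Rightarrow> complex) set" where
  "GA m \<omega> \<rho> = {a. Cinf_on UNIV a \<and>
     (\<forall>n::nat. n \<ge> 1 \<longrightarrow> (\<exists>C>0. \<forall>x y \<xi> \<alpha> \<beta> \<gamma>.
        let k = real (mi_size (\<lambda>i. \<alpha> i + \<beta> i + \<gamma> i)) in
        norm (Dmulti \<alpha> (\<lambda>x. Dmulti \<beta> (\<lambda>y. Dmulti \<gamma> (\<lambda>\<xi>. a (x, y, \<xi>)) \<xi>) y) x)
          \<le> C * (\<langle>x - y\<rangle> powr (\<rho> * k) / \<langle>(x, y, \<xi>)\<rangle> powr (\<rho> * k))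
              * exp (real n * \<rho> * phi_star \<omega> (k / real n))
              * exp (m * (\<omega> (norm x) + \<omega> (norm y) + \<omega> (norm \<xi>)))))}"

definition pdo :: "('a::euclidean_space \<times> 'a \<times> 'a \<Rightarrow> complex) \<Rightarrow> ('a \<Rightarrow> complex) \<Rightarrow> 'a \<Rightarrow> complex" where
  "pdo a f x = (LINT \<xi>|lborel. (LINT y|lborel.
      exp (\<i> * complex_of_real ((x - y) \<bullet> \<xi>)) * a (x, y, \<xi>) * f y))"

definition is_kernel_of ::
  "(real \<Rightarrow> real) \<Rightarrow> (('a::euclidean_space \<times> 'a \<Rightarrow> complex) \<Rightarrow> complex) \<Rightarrow>
    (('a \<Rightarrow> complex) \<Rightarrow> 'a \<Rightarrow> complex) \<Rightarrow> bool" where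
  "is_kernel_of \<omega> K A \<longleftrightarrow> K \<in> S_dual \<omega> \<and>
     (\<forall>u\<in>S_space \<omega>. \<forall>f\<in>S_space \<omega>. K (\<lambda>(x, y). u x * f y) = (LINT x|lborel. u x * A f x))"

definition Delta :: "real \<Rightarrow> ('a::euclidean_space \<times> 'a) set"
  where "Delta r = {(x, y). norm (x - y) < r}"

end

theory Submission imports Defs "HOL-Probability.Probability" "HOL-Complex_Analysis.Complex_Analysis" "HOL-Real_Asymp.Real_Asymp" begin

text \<open>Outside the diagonal the oscillatory integral \<open>\<integral> e\<^sup>i\<^sup>(\<^sup>x\<^sup>-\<^sup>y\<^sup>)\<^sup>\<xi> a(x,y,\<xi>) d\<xi>\<close> is cut into dyadic
  shells \<open>|\<xi>| \<approx> t = 2\<^sup>j\<close> by smooth cutoffs all of whose derivatives up to an order \<open>N\<close> grow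
  geometrically, with \<open>N\<close> about \<open>sqrt (t \<omega>(t))\<close>. Integrating by parts \<open>n P\<close> times in a coordinate in
  which \<open>x\<close> and \<open>y\<close> differ by a fixed amount, where \<open>P\<close> is the slope of \<open>s \<mapsto> \<omega>(e\<^sup>s)\<close> at
  \<open>ln t\<close>, turns the amplitude bounds into a factor \<open>e\<^sup>-\<^sup>\<Lambda>\<^sup>\<omega>\<^sup>(\<^sup>t\<^sup>)\<close> with \<open>\<Lambda>\<close> as large as desired once
  \<open>n\<close> is large. Hence the shells sum up to a smooth function with the required decay.

  On the other hand, the iterated integral of the amplitude against a function of \<open>(x, y)\<close> is
  continuous for one of the seminorms and agrees with \<open>K\<close> on tensor products, in particular on
  Gaussian functions. Mollification and Riemann sums approximate a compactly supported test
  function by linear combinations of Gaussians, so both functionals agree on it; if its support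
  avoids the diagonal, summing the shells identifies the value.\<close>

section \<open>Weight functions\<close>

text \<open>The number of partial integrations has to grow with the frequency, while each one
  differentiates a product of the amplitude, powers of \<xi> and a cutoff. At a fixed scale t every
  factor is bounded geometrically in the order of differentiation, and geometric bounds multiply by
  adding their ratios.

  The cutoff order N must exceed every multiple of P, where P is at most about \<omega>(t). Yet the
  derivative ratio 4N/t must stay below the gain e^{-\<omega>(t)/(4P)} of one step. The geometric
  mean sqrt(t \<omega>(t)) meets both demands because \<omega>(t) = o(t), so cutoffs of finite order
  suffice.

  Since \<rho> \<le> 1, the loss \<langle>x-y\<rangle>^\<rho> per derivative is at most
  \<langle>x-y\<rangle>. Off the diagonal this is comparable to the coordinate of x - y by which one
  divides, so the constants stay uniform for large |x-y|.

  \<open>K\<close> is prescribed on tensor products only. A Gaussian on the product space is such a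
  tensor product, which makes Gaussians the right approximants. The iterated integral keeps the
  order of integration of the operator; integrals are interchanged only after a cutoff in \<xi> and
  for compact support in (x, y).\<close>

locale weight =
  fixes \<omega> :: "real \<Rightarrow> real"
  assumes weight: "weight_function \<omega>" and normalised: "normalised \<omega>"
begin

lemma w_nonneg: "0 \<le> t \<Longrightarrow> 0 \<le> \<omega> t"
  using weight by (auto simp: weight_function_def)

lemma w_mono: "0 \<le> s \<Longrightarrow> s \<le> t \<Longrightarrow> \<omega> s \<le> \<omega> t"
  using weight by (auto simp: weight_function_def mono_on_def)

lemma w_01: "0 \<le> t \<Longrightarrow> t \<le> 1 \<Longrightarrow> \<omega> t = 0"
  using normalised by (auto simp: normalised_def)

text \<open>Condition (\<alpha>) is iterated until 2^k exceeds \<open>c\<close>. Any fixed dilation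
  of the argument thus costs a factor and an additive constant.\<close>

lemma w_scale: "\<exists>L\<ge>1. \<forall>t\<ge>0. \<omega> (c * t) \<le> L * (\<omega> t + 1)" if c: "c \<ge> 0" for c :: real
proof -
  obtain L where L: "L \<ge> 1" "\<And>t. t \<ge> 0 \<Longrightarrow> \<omega> (2 * t) \<le> L * (\<omega> t + 1)"
    using weight by (auto simp: weight_function_def)
  have pow: "\<exists>M\<ge>1. \<forall>t\<ge>0. \<omega> (2 ^ k * t) \<le> M * (\<omega> t + 1)" for k
  proof (induction k)
    case 0
    show ?case by (intro exI[of _ 1]) auto
  next
    case (Suc k)
    then obtain M where M: "M \<ge> 1" "\<And>t. t \<ge> 0 \<Longrightarrow> \<omega> (2 ^ k * t) \<le> M * (\<omega> t + 1)"
      by blast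
    have "\<omega> (2 ^ Suc k * t) \<le> (L * M + L) * (\<omega> t + 1)" if "t \<ge> 0" for t
    proof -
      have "\<omega> (2 ^ Suc k * t) \<le> L * (\<omega> (2 ^ k * t) + 1)"
        using L(2)[of "2 ^ k * t"] that by (simp add: mult.assoc)
      also have "\<dots> \<le> L * (M * (\<omega> t + 1) + (\<omega> t + 1))"
        using L(1) M(2)[OF that] w_nonneg[OF that] by (intro mult_left_mono) auto
      finally show ?thesis by (simp add: algebra_simps)
    qed
    moreover have "L * M + L \<ge> 1" using L(1) M(1)
      by (smt (verit) mult_le_cancel_left1)
    ultimately show ?case by blast
  qed
  obtain k where k: "c \<le> 2 ^ k"
    using real_arch_pow[of 2 c] less_imp_le by auto
  obtain M where M: "M \<ge> 1" "\<And>t. t \<ge> 0 \<Longrightarrow> \<omega> (2 ^ k * t) \<le> M * (\<omega> t + 1)"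
    using pow[of k] by blast
  have "\<omega> (c * t) \<le> M * (\<omega> t + 1)" if "t \<ge> 0" for t
    using M(2)[OF that] w_mono[of "c * t" "2 ^ k * t"] c k that
    by (smt (verit) mult_nonneg_nonneg mult_right_mono)
  then show ?thesis using M(1) by blast
qed

text \<open>Condition (\<gamma>) made global: past \<open>T'\<close> the little-o bound applies,
  below \<open>T'\<close> the additive constant takes over. Powers of t can then be paid for by
  exp(\<omega>(t)).\<close>

lemma w_ln: "\<exists>C\<ge>0. \<forall>t\<ge>1. k * ln t \<le> \<omega> t + C" for k :: real
proof -
  define k' where "k' = max k 1"
  have "(\<lambda>t. ln t) \<in> o[at_top](\<omega>)" using weight by (auto simp: weight_function_def)
  then have "\<forall>\<^sub>F t in at_top. norm (ln t) \<le> (1 / k') * norm (\<omega> t)"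
    by (rule landau_o.smallD) (auto simp: k'_def)
  then obtain T where T: "\<And>t. t \<ge> T \<Longrightarrow> norm (ln t) \<le> (1 / k') * norm (\<omega> t)"
    by (auto simp: eventually_at_top_linorder)
  define T' where "T' = max T 1"
  have "k * ln t \<le> \<omega> t + k' * ln T'" if t: "t \<ge> 1" for t
  proof (cases "t \<ge> T'")
    case True
    have "k * ln t \<le> k' * ln t" using t by (intro mult_right_mono) (auto simp: k'_def)
    also have "\<dots> \<le> \<omega> t" using T[of t] True t w_nonneg[of t]
      by (auto simp: T'_def k'_def field_simps)
    finally have "k * ln t \<le> \<omega> t" .
    moreover have "0 \<le> k' * ln T'" by (auto simp: k'_def T'_def)
    ultimately show ?thesis by simp
  next
    case False
    have "k * ln t \<le> k' * ln t" using t by (intro mult_right_mono) (auto simp: k'_def)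
    also have "\<dots> \<le> k' * ln T'" using False t by (intro mult_left_mono) (auto simp: k'_def)
    finally show ?thesis using w_nonneg[of t] t by simp
  qed
  moreover have "0 \<le> k' * ln T'" by (auto simp: k'_def T'_def)
  ultimately show ?thesis by blast
qed

text \<open>Non-quasianalyticity enters only through \<open>\<omega>(t) = o(t)\<close>, which follows from
  \<open>\<omega>(t) / (4 t) \<le> \<integral>\<^sub>t\<^sup>2\<^sup>t \<omega>(s) / s\<^sup>2 ds\<close>.\<close>

lemma w_small_eventually:
  assumes "\<epsilon> > 0" shows "\<forall>\<^sub>F t in at_top. \<omega> t \<le> \<epsilon> * t"
proof -
  define f where "f = (\<lambda>t. \<omega> t / t\<^sup>2)"
  define I where "I = (\<lambda>b. set_lebesgue_integral lborel {1..b} f)"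
  have int: "set_integrable lborel {1..} f"
    using weight by (auto simp: weight_function_def f_def)
  have lim: "(I \<longlongrightarrow> set_lebesgue_integral lborel {1..} f) at_top"
    unfolding I_def by (rule tendsto_set_lebesgue_integral_at_top) (use int in auto)
  have "((\<lambda>t. I (2 * t) - I t) \<longlongrightarrow> set_lebesgue_integral lborel {1..} f - set_lebesgue_integral lborel {1..} f) at_top"
    by (intro tendsto_diff lim filterlim_compose[OF lim]) real_asymp
  then have "\<forall>\<^sub>F t in at_top. I (2 * t) - I t < \<epsilon> / 4"
    using assms by (auto dest!: order_tendstoD(2)[where a = "\<epsilon> / 4"])
  then show ?thesis using eventually_ge_at_top[of 1]
  proof eventually_elim
    case (elim t)
    have si: "set_integrable lborel {1..2*t} f" "set_integrable lborel {1..t} f" "set_integrable lborel {t<..2*t} f"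
      using elim by (auto intro!: set_integrable_subset[OF int])
    have "I (2 * t) = set_lebesgue_integral lborel ({1..t} \<union> {t<..2*t}) f"
      unfolding I_def using elim by (intro arg_cong2[where f="\<lambda>A. set_lebesgue_integral lborel A"]) auto
    also have "\<dots> = I t + set_lebesgue_integral lborel {t<..2*t} f"
      unfolding I_def using si by (intro set_integral_Un) auto
    finally have eq: "I (2 * t) - I t = set_lebesgue_integral lborel {t<..2*t} f" by simp
    have "\<omega> t / (4 * t) = set_lebesgue_integral lborel {t<..2*t} (\<lambda>s. \<omega> t / (4 * t\<^sup>2))"
      using elim by (simp add: set_lebesgue_integral_def power2_eq_square)
    also have "\<dots> \<le> set_lebesgue_integral lborel {t<..2*t} f"
    proof (rule set_integral_mono)
      show "set_integrable lborel {t<..2*t} (\<lambda>s. \<omega> t / (4 * t\<^sup>2))"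
        using elim by (simp add: set_integrable_def)
      fix s assume s: "s \<in> {t<..2*t}"
      have "\<omega> t / (4 * t\<^sup>2) \<le> \<omega> s / (4 * t\<^sup>2)"
        using s elim by (intro divide_right_mono w_mono) auto
      also have "s\<^sup>2 \<le> (2 * t)\<^sup>2" using s elim by (intro power_mono) auto
      then have "\<omega> s / (4 * t\<^sup>2) \<le> f s"
        unfolding f_def using s elim by (intro divide_left_mono w_nonneg) (auto simp: power2_eq_square)
      finally show "\<omega> t / (4 * t\<^sup>2) \<le> f s" .
    qed fact
    also have "\<dots> < \<epsilon> / 4" using elim eq by simp
    finally show ?case using elim by (simp add: field_simps)
  qed
qed

lemma w_small: assumes "\<epsilon> > 0" shows "\<exists>C\<ge>0. \<forall>t\<ge>0. \<omega> t \<le> \<epsilon> * t + C"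
proof -
  obtain T where T: "\<And>t. t \<ge> T \<Longrightarrow> \<omega> t \<le> \<epsilon> * t"
    using w_small_eventually[OF assms] by (auto simp: eventually_at_top_linorder)
  define T' where "T' = max T 1"
  have T': "T' \<ge> T" "T' \<ge> 1" by (auto simp: T'_def)
  have "\<omega> t \<le> \<epsilon> * t + \<omega> T'" if "t \<ge> 0" for t
  proof (cases "t \<ge> T'")
    case True
    then show ?thesis using T[of t] w_nonneg[of T'] T' by linarith
  next
    case False
    then show ?thesis using w_mono[of t T'] that assms by (smt (verit) mult_nonneg_nonneg)
  qed
  then show ?thesis using w_nonneg[of T'] T' by (intro exI[of _ "\<omega> T'"]) simp
qed

text \<open>Convexity (\<delta>) gives a supporting line of s \<mapsto> \<omega>(e^s) at ln t,
  written with v = e^s. Its slope is nonnegative by monotonicity, as the point v = t/2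
  shows.\<close>

lemma w_subgradient:
  assumes "t > 0"
  shows "\<exists>P\<ge>0. \<forall>v>0. \<omega> t + P * (ln v - ln t) \<le> \<omega> v"
proof -
  define \<phi> where "\<phi> = (\<lambda>s. \<omega> (exp s))"
  have conv: "convex_on UNIV \<phi>" using weight by (auto simp: weight_function_def \<phi>_def)
  obtain P where P: "\<And>u. \<phi> u \<ge> \<phi> (ln t) + P * (u - ln t)"
    using convex_le_Inf_differential[OF conv, of "ln t"] by auto
  have main: "\<omega> t + P * (ln v - ln t) \<le> \<omega> v" if "v > 0" for v
    using P[of "ln v"] that assms by (simp add: \<phi>_def)
  have "\<omega> t + P * (ln (t/2) - ln t) \<le> \<omega> t"
    using main[of "t/2"] w_mono[of "t/2" t] assms by auto
  then have "P * ln 2 \<ge> 0" using assms by (simp add: ln_div)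
  then have "P \<ge> 0" by (simp add: zero_le_mult_iff)
  with main show ?thesis by blast
qed

subsection \<open>The growth function of the Young conjugate\<close>

text \<open>For \<mu> > 0 and with t = e^s this is the supremum of t^k e^{-\<mu>\<omega>(t)} over t
  \<ge> 1. It plays the part of k! in the derivative bounds, and the exponential form turns additive
  inequalities for the conjugate into multiplicative ones.\<close>

definition young_exp :: "real \<Rightarrow> real \<Rightarrow> real"
  where "young_exp \<mu> k = exp (\<mu> * phi_star \<omega> (k / \<mu>))"

text \<open>A supremum of reals is informative only for a set that is bounded above; (\<gamma>) with
  the factor k provides the bound.\<close>

lemma phi_bdd: "bdd_above ((\<lambda>s. s * k - \<omega> (exp s)) ` {0..})"
proof -
  obtain C where C: "\<And>t. t \<ge> 1 \<Longrightarrow> k * ln t \<le> \<omega> t + C" using w_ln[of k] by blast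
  show ?thesis
    by (rule bdd_aboveI[of _ C]) (use C[of "exp _"] in \<open>auto simp: algebra_simps\<close>)
qed

lemma young_exp_pos [simp]: "young_exp \<mu> k > 0" by (simp add: young_exp_def)
lemma young_exp_nonneg [simp]: "young_exp \<mu> k \<ge> 0" by (simp add: young_exp_def)

text \<open>With \<open>young_exp_le\<close> this characterises \<open>young_exp\<close> as a least
  upper bound. Lower bounds then come from a well chosen s, upper bounds from a case analysis on
  s.\<close>

lemma young_exp_ge: assumes "\<mu> > 0" "s \<ge> 0" shows "exp (s * k - \<mu> * \<omega> (exp s)) \<le> young_exp \<mu> k"
proof -
  have "s * (k / \<mu>) - \<omega> (exp s) \<le> phi_star \<omega> (k / \<mu>)"
    unfolding phi_star_def by (rule cSUP_upper[OF _ phi_bdd]) (use assms in auto)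
  then have "\<mu> * (s * (k / \<mu>) - \<omega> (exp s)) \<le> \<mu> * phi_star \<omega> (k / \<mu>)"
    using assms by (intro mult_left_mono) auto
  then show ?thesis using assms by (simp add: young_exp_def right_diff_distrib)
qed

lemma young_exp_le: assumes "\<mu> > 0" "\<And>s. s \<ge> 0 \<Longrightarrow> exp (s * k - \<mu> * \<omega> (exp s)) \<le> c" "c > 0"
  shows "young_exp \<mu> k \<le> c"
proof -
  have "phi_star \<omega> (k / \<mu>) \<le> ln c / \<mu>"
    unfolding phi_star_def
  proof (rule cSUP_least)
    fix s :: real assume "s \<in> {0..}"
    then have "s * k - \<mu> * \<omega> (exp s) \<le> ln c"
      using assms(2)[of s] assms(3) by (simp add: ln_ge_iff)
    then have "(s * k - \<mu> * \<omega> (exp s)) / \<mu> \<le> ln c / \<mu>" using assms(1) by (intro divide_right_mono) auto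
    then show "s * (k / \<mu>) - \<omega> (exp s) \<le> ln c / \<mu>" using assms(1) by (simp add: diff_divide_distrib)
  qed auto
  then have "\<mu> * phi_star \<omega> (k / \<mu>) \<le> ln c" using assms(1) by (simp add: field_simps)
  then show ?thesis using assms(3) by (simp add: young_exp_def ln_ge_iff)
qed

text \<open>The point s = 0, where the normalisation gives \<omega>(1) = 0.\<close>

lemma young_exp_ge1: "\<mu> > 0 \<Longrightarrow> 1 \<le> young_exp \<mu> k"
  using young_exp_ge[of \<mu> 0 k] w_01[of 1] by simp

lemma young_exp_power: assumes "\<mu> > 0" "t \<ge> 1" shows "t ^ k \<le> young_exp \<mu> (real k) * exp (\<mu> * \<omega> t)"
proof -
  have "t ^ k = exp (ln t * k)" using assms by (simp add: exp_of_nat2_mult)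
  also have "\<dots> = exp (ln t * k - \<mu> * \<omega> (exp (ln t))) * exp (\<mu> * \<omega> t)"
    using assms by (simp add: mult_exp_exp)
  also have "\<dots> \<le> young_exp \<mu> k * exp (\<mu> * \<omega> t)"
    using assms by (intro mult_right_mono young_exp_ge) auto
  finally show ?thesis .
qed

lemma young_exp_antimono: assumes "0 < \<mu>'" "\<mu>' \<le> \<mu>" shows "young_exp \<mu> k \<le> young_exp \<mu>' k"
proof (rule young_exp_le)
  fix s :: real assume "s \<ge> 0"
  have "exp (s * k - \<mu> * \<omega> (exp s)) \<le> exp (s * k - \<mu>' * \<omega> (exp s))"
    using assms w_nonneg[of "exp s"] by (auto intro!: mult_right_mono)
  also have "\<dots> \<le> young_exp \<mu>' k" by (rule young_exp_ge) (use assms \<open>s \<ge> 0\<close> in auto)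
  finally show "exp (s * k - \<mu> * \<omega> (exp s)) \<le> young_exp \<mu>' k" .
qed (use assms in auto)

text \<open>The supremum is split at s = ln t. Above it, t^p \<le> e^{sp} joins the exponent. Below
  it, e^{sk} t^p \<le> t^{k+p}, which is the exponential at s = ln t up to exp(\<mu> \<omega>(t)).
  This absorbs the powers of \<xi> that appear when the oscillating factor is
  differentiated.\<close>

lemma young_exp_add_power: assumes "\<mu> > 0" "t \<ge> 1" "k \<ge> 0"
  shows "t ^ p * young_exp \<mu> k \<le> exp (\<mu> * \<omega> t) * young_exp \<mu> (k + real p)"
proof -
  have "young_exp \<mu> k \<le> exp (\<mu> * \<omega> t) * young_exp \<mu> (k + real p) / t ^ p"
  proof (rule young_exp_le)
    fix s :: real assume s: "s \<ge> 0"
    have tp: "t ^ p = exp (p * ln t)" using assms by (simp add: exp_of_nat_mult)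
    have "exp (s * k - \<mu> * \<omega> (exp s)) * t ^ p \<le> exp (\<mu> * \<omega> t) * young_exp \<mu> (k + real p)"
    proof (cases "s \<ge> ln t")
      case True
      have "exp (s * k - \<mu> * \<omega> (exp s)) * t ^ p \<le> exp (s * (k + real p) - \<mu> * \<omega> (exp s))"
        using mult_right_mono[OF True, of "real p"] by (auto simp: tp mult_exp_exp algebra_simps)
      also have "\<dots> \<le> young_exp \<mu> (k + real p)" using assms s by (intro young_exp_ge)
      also have "\<dots> \<le> exp (\<mu> * \<omega> t) * young_exp \<mu> (k + real p)"
        using assms w_nonneg[of t] by (intro mult_le_cancel_right1[THEN iffD2]) (auto simp: less_le_not_le)
      finally show ?thesis .
    next
      case False
      have "exp (s * k - \<mu> * \<omega> (exp s)) * t ^ p \<le> exp (s * k) * t ^ p"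
        using assms w_nonneg[of "exp s"] by (intro mult_right_mono) auto
      also have "\<dots> \<le> exp (ln t * k) * t ^ p"
        using False assms by (auto intro!: mult_right_mono)
      also have "\<dots> = exp (\<mu> * \<omega> t) * exp (ln t * (k + real p) - \<mu> * \<omega> (exp (ln t)))"
        using assms by (simp add: tp mult_exp_exp algebra_simps)
      also have "\<dots> \<le> exp (\<mu> * \<omega> t) * young_exp \<mu> (k + real p)"
        using assms by (intro mult_left_mono young_exp_ge) auto
      finally show ?thesis .
    qed
    then show "exp (s * k - \<mu> * \<omega> (exp s)) \<le> exp (\<mu> * \<omega> t) * young_exp \<mu> (k + real p) / t ^ p"
      using assms by (simp add: field_simps)
  qed (use assms in auto)
  then show ?thesis using assms by (simp add: field_simps)
qed

text \<open>Half of \<mu>\<omega> is given to each of the two orders. In this way derivatives in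
  \<xi> and derivatives in (x, y) are later treated separately.\<close>

lemma young_exp_split: assumes "\<mu> > 0" shows "young_exp \<mu> (k + l) \<le> young_exp (\<mu>/2) k * young_exp (\<mu>/2) l"
proof (rule young_exp_le)
  fix s :: real assume s: "s \<ge> 0"
  have "exp (s * (k + l) - \<mu> * \<omega> (exp s)) = exp (s * k - \<mu> / 2 * \<omega> (exp s)) * exp (s * l - \<mu> / 2 * \<omega> (exp s))"
    by (simp add: mult_exp_exp algebra_simps)
  also have "\<dots> \<le> young_exp (\<mu>/2) k * young_exp (\<mu>/2) l"
    using assms s by (intro mult_mono young_exp_ge) auto
  finally show "exp (s * (k + l) - \<mu> * \<omega> (exp s)) \<le> young_exp (\<mu>/2) k * young_exp (\<mu>/2) l" .
qed (use assms in auto)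

text \<open>Replacing s by s + ln c turns c^k into a part of the power, and (\<alpha>) pays for the
  dilation by passing to \<mu>' = L\<mu>. It removes geometric factors such as 12^k from the final
  estimate.\<close>

lemma young_exp_absorb: assumes "c \<ge> 1" "\<mu> > 0"
  shows "\<exists>C\<ge>1. \<exists>\<mu>'\<ge>\<mu>. \<forall>k::nat. c ^ k * young_exp \<mu>' (real k) \<le> C * young_exp \<mu> (real k)"
proof -
  obtain L where L: "L \<ge> 1" "\<And>t. t \<ge> 0 \<Longrightarrow> \<omega> (c * t) \<le> L * (\<omega> t + 1)"
    using w_scale[of c] assms by auto
  have "c ^ k * young_exp (L * \<mu>) (real k) \<le> exp (L * \<mu>) * young_exp \<mu> (real k)" for k :: nat
  proof -
    have "young_exp (L * \<mu>) (real k) \<le> exp (L * \<mu>) * young_exp \<mu> (real k) / c ^ k"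
    proof (rule young_exp_le)
      fix s :: real assume s: "s \<ge> 0"
      have "\<mu> * \<omega> (exp (s + ln c)) \<le> \<mu> * (L * (\<omega> (exp s) + 1))"
        using L(2)[of "exp s"] assms by (intro mult_left_mono) (auto simp: exp_add mult.commute)
      then have "exp (s * k - L * \<mu> * \<omega> (exp s)) * c ^ k \<le> exp (L * \<mu>) * exp ((s + ln c) * k - \<mu> * \<omega> (exp (s + ln c)))"
        using assms by (simp add: mult_exp_exp powr_realpow[symmetric] powr_def algebra_simps)
      also have "\<dots> \<le> exp (L * \<mu>) * young_exp \<mu> (real k)"
        using assms s by (intro mult_left_mono young_exp_ge) auto
      finally show "exp (s * k - L * \<mu> * \<omega> (exp s)) \<le> exp (L * \<mu>) * young_exp \<mu> (real k) / c ^ k"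
        using assms by (simp add: field_simps)
    qed (use assms L in auto)
    then show ?thesis using assms by (simp add: field_simps)
  qed
  moreover have "L * \<mu> \<ge> \<mu>" using L assms by simp
  moreover have "exp (L * \<mu>) \<ge> 1" using L assms by simp
  ultimately show ?thesis by blast
qed

text \<open>Evaluate at t = e k and use \<omega>(t) \<le> t/(e \<mu>) + C: the weight costs k, which
  the e in e k compensates. Hence functions with derivatives of size k!, such as Gaussians, satisfy
  the derivative bounds for every \<mu>.\<close>

lemma young_exp_fact: assumes "\<mu> > 0" shows "\<exists>C\<ge>1. \<forall>k::nat. fact k \<le> C * young_exp \<mu> (real k)"
proof -
  obtain C where C: "C \<ge> 0" "\<And>t. t \<ge> 0 \<Longrightarrow> \<omega> t \<le> (1 / (exp 1 * \<mu>)) * t + C"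
    using w_small[of "1 / (exp 1 * \<mu>)"] assms by auto
  have "fact k \<le> exp (\<mu> * C) * young_exp \<mu> (real k)" for k :: nat
  proof (cases "k = 0")
    case True
    have "1 * 1 \<le> exp (\<mu> * C) * young_exp \<mu> (real k)"
      using assms C by (intro mult_mono young_exp_ge1) auto
    then show ?thesis using True by simp
  next
    case False
    have "fact k \<le> real k ^ k"
      unfolding fact_prod of_nat_prod by (rule order.trans[OF prod_mono[where g = "\<lambda>_. real k"]]) auto
    also have "\<dots> = exp (real k * ln (real k))" using False by (simp add: exp_of_nat_mult)
    also have "\<dots> \<le> exp (\<mu> * C + ((ln k + 1) * k - \<mu> * \<omega> (exp (ln k + 1))))"
    proof -
      have "\<mu> * \<omega> (exp 1 * k) \<le> \<mu> * ((1 / (exp 1 * \<mu>)) * (exp 1 * k) + C)"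
        using C(2)[of "exp 1 * k"] assms by (intro mult_left_mono) auto
      then show ?thesis using assms False by (simp add: exp_add algebra_simps)
    qed
    also have "\<dots> \<le> exp (\<mu> * C) * young_exp \<mu> (real k)"
      using young_exp_ge[of \<mu> "ln k + 1" k] assms False by (simp add: exp_add[of "\<mu> * C"])
    finally show ?thesis .
  qed
  moreover have "exp (\<mu> * C) \<ge> 1" using C assms by simp
  ultimately show ?thesis by blast
qed

text \<open>Here \<open>P\<close> is a subgradient of \<open>s \<mapsto> \<omega>(e\<^sup>s)\<close> at \<open>s = ln t\<close>: up to the order \<open>n P\<close>, the
  growth of \<^const>\<open>young_exp\<close> is dominated by a geometric one of ratio \<open>t e\<^sup>-\<^sup>\<omega>\<^sup>(\<^sup>t\<^sup>)\<^sup>/\<^sup>P\<close>.\<close>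

definition rate :: "real \<Rightarrow> real \<Rightarrow> bool" where
  "rate t P \<longleftrightarrow> 1 \<le> P \<and> P \<le> \<omega> (exp 1 * t) \<and> \<omega> t \<le> P * (1 + ln (t / P)) \<and>
     (\<forall>n>0. \<forall>l::nat. real l \<le> n * P \<longrightarrow> young_exp n (real l) \<le> (t * exp (- \<omega> t / P)) ^ l)"

text \<open>All clauses are read off the supporting line of slope P at ln t: at v = e t it gives P
  \<le> \<omega>(e t), at v = P together with \<omega>(P) \<le> P it gives the logarithmic clause,
  and scaled by l/P it controls the Young exponentials.\<close>

lemma rate_exists: "\<forall>\<^sub>F t in at_top. \<exists>P. rate t P"
proof -
  obtain T where T: "\<And>t. t \<ge> T \<Longrightarrow> \<omega> t \<le> 1 * t"
    using w_small_eventually[of 1] by (auto simp: eventually_at_top_linorder)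
  define P0 where "P0 = max T 1"
  obtain C where C: "\<And>t. t \<ge> 1 \<Longrightarrow> (P0 + 1) * ln t \<le> \<omega> t + C" using w_ln[of "P0 + 1"] by blast
  have "\<forall>\<^sub>F t::real in at_top. ln t \<ge> C" by real_asymp
  then show ?thesis using eventually_gt_at_top[of 1]
  proof eventually_elim
    case (elim t)
    obtain P where P: "P \<ge> 0" "\<And>v. v > 0 \<Longrightarrow> \<omega> t + P * (ln v - ln t) \<le> \<omega> v"
      using w_subgradient[of t] elim by auto
    \<comment> \<open>By (\<gamma>) the weight exceeds P0 ln t, while the line at v = 1, where
      \<omega> vanishes, bounds it by P ln t. So P is as large as desired once t is large.\<close>
    have "P0 * ln t \<le> \<omega> t" using C[of t] elim by (simp add: algebra_simps)
    also have "\<omega> t \<le> P * ln t" using P(2)[of 1] w_01[of 1] by (simp add: algebra_simps)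
    finally have PP0: "P \<ge> P0" using elim by simp
    then have P1: "P \<ge> 1" "P \<ge> T" by (auto simp: P0_def)
    have a: "P \<le> \<omega> (exp 1 * t)"
      using P(2)[of "exp 1 * t"] elim w_nonneg[of t] by (simp add: ln_mult)
    have b: "\<omega> t \<le> P * (1 + ln (t / P))"
      using P(2)[of P] T[of P] P1 elim by (simp add: ln_div algebra_simps)
    have "young_exp n (real l) \<le> (t * exp (- \<omega> t / P)) ^ l" if n: "n > 0" "real l \<le> n * P" for n l
    proof (rule young_exp_le)
      fix s :: real assume s: "s \<ge> 0"
      \<comment> \<open>The supporting line times l/P. The condition l \<le> n P makes this factor
        at most n, so n \<omega>(e^s) dominates.\<close>
      have "(real l / P) * (\<omega> t + P * (s - ln t)) \<le> (real l / P) * \<omega> (exp s)"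
        using P(2)[of "exp s"] P1 by (intro mult_left_mono) auto
      also have "\<dots> \<le> n * \<omega> (exp s)"
        using n P1 by (intro mult_right_mono w_nonneg) (auto simp: field_simps)
      finally have "s * real l - n * \<omega> (exp s) \<le> real l * (ln t - \<omega> t / P)"
        using P1 by (simp add: field_simps)
      then have "exp (s * real l - n * \<omega> (exp s)) \<le> exp (real l * (ln t - \<omega> t / P))" by simp
      also have "\<dots> = (t * exp (- \<omega> t / P)) ^ l"
        using elim by (subst exp_of_nat_mult) (simp add: exp_diff exp_minus divide_inverse)
      finally show "exp (s * real l - n * \<omega> (exp s)) \<le> (t * exp (- \<omega> t / P)) ^ l" .
    qed (use n elim in auto)
    then show ?case unfolding rate_def using P1 a b by blast
  qed
qed

text \<open>Since B \<ge> e, the slope at t/B is at most \<omega>(t). The square of n \<omega>(t) is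
  below t \<omega>(t) because \<omega>(t) = o(t). Hence cutoffs of order sqrt(t \<omega>(t)) allow n
  P partial integrations for any fixed n.\<close>

lemma rate_order:
  assumes "B \<ge> exp 1"
  shows "\<forall>\<^sub>F t in at_top. \<forall>P. rate (t / B) P \<longrightarrow> n * P \<le> sqrt (t * \<omega> t)"
proof -
  have B: "B > 0" using assms by (smt (verit) exp_gt_zero)
  have "\<forall>\<^sub>F t in at_top. \<omega> t \<le> (1 / (n\<^sup>2 + 1)) * t"
    by (intro w_small_eventually) (auto simp: add_nonneg_pos)
  then show ?thesis using eventually_gt_at_top[of 1]
  proof eventually_elim
    case (elim t)
    show ?case
    proof (intro allI impI)
      fix P assume P: "rate (t / B) P"
      have "P \<le> \<omega> (exp 1 * (t / B))" using P by (simp add: rate_def)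
      also have "\<dots> \<le> \<omega> t" using elim assms B by (intro w_mono) (auto simp: field_simps)
      finally have P1: "P \<le> \<omega> t" .
      have P0: "P \<ge> 1" using P by (simp add: rate_def)
      have "(n * P)\<^sup>2 \<le> n\<^sup>2 * (\<omega> t)\<^sup>2"
        using P1 P0 by (simp add: power_mult_distrib mult_left_mono power_mono)
      also have "\<dots> \<le> (n\<^sup>2 + 1) * \<omega> t * \<omega> t" by (simp add: power2_eq_square algebra_simps)
      also have "\<dots> \<le> t * \<omega> t"
        using elim P1 P0 by (intro mult_right_mono) (auto simp: pos_le_divide_eq add_nonneg_pos mult.commute)
      finally show "n * P \<le> sqrt (t * \<omega> t)" by (rule real_le_rsqrt)
    qed
  qed
qed

text \<open>With X = t/(B P) the logarithmic clause of \<open>rate\<close> gives \<omega>(t/B)/P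
  \<le> 1 + ln X. The left side is then O(sqrt(ln X / X)), whereas the exponential on the right is
  at least a constant times X^{-1/4}.\<close>

lemma rate_cutoff:
  assumes "B \<ge> 1" "\<epsilon> > 0"
  shows "\<forall>\<^sub>F t in at_top. \<forall>P. rate (t / B) P \<longrightarrow>
    sqrt (\<omega> (2 * t) / t) + 1 / t \<le> \<epsilon> * exp (- \<omega> (t / B) / P / 4)"
proof -
  obtain L where L: "L \<ge> 1" "\<And>t. t \<ge> 0 \<Longrightarrow> \<omega> (2 * B * t) \<le> L * (\<omega> t + 1)"
    using w_scale[of "2 * B"] assms by auto
  have "((\<lambda>X. (sqrt (L * (2 + ln X) / X) + 1 / X) / exp (- (1 + ln X) / 4)) \<longlongrightarrow> 0) at_top"
    using L(1) by real_asymp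
  then have "\<forall>\<^sub>F X in at_top. (sqrt (L * (2 + ln X) / X) + 1 / X) / exp (- (1 + ln X) / 4) < \<epsilon>"
    using assms by (auto dest: order_tendstoD)
  then obtain X0 where X0: "\<And>X. X \<ge> X0 \<Longrightarrow> (sqrt (L * (2 + ln X) / X) + 1 / X) / exp (- (1 + ln X) / 4) < \<epsilon>"
    by (auto simp: eventually_at_top_linorder)
  define X1 where "X1 = max X0 1"
  have X1: "X1 \<ge> 1" by (simp add: X1_def)
  have "\<forall>\<^sub>F t in at_top. \<omega> t \<le> (1 / (exp 1 * X1)) * t"
    by (intro w_small_eventually) (auto simp: X1_def)
  then have "\<forall>\<^sub>F t in at_top. \<omega> (exp 1 * (t / B)) \<le> (1 / (exp 1 * X1)) * (exp 1 * (t / B))"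
    by (rule eventually_compose_filterlim) (use assms in real_asymp)
  then show ?thesis using eventually_gt_at_top[of 0]
  proof eventually_elim
    case (elim t)
    show ?case
    proof (intro allI impI)
      fix P assume P: "rate (t / B) P"
      define X where "X = t / B / P"
      have P1: "P \<ge> 1" "\<omega> (t/B) \<le> P * (1 + ln X)" using P by (auto simp: rate_def X_def)
      \<comment> \<open>The clause P \<le> \<omega>(e t / B) and \<omega>(t) = o(t) make P small
        against t, which pushes X beyond \<open>X1\<close>.\<close>
      have "P \<le> (1 / (exp 1 * X1)) * (exp 1 * (t / B))" using P elim by (auto simp: rate_def)
      then have "B * P * X1 \<le> t" using X1 assms by (simp add: field_simps)
      then have "X \<ge> X1" using P1 assms elim by (simp add: X_def pos_le_divide_eq mult_ac)
      then have X: "X \<ge> X0" "X \<ge> 1" by (auto simp: X1_def)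
      have t: "t = B * P * X" using assms P1 by (simp add: X_def)
      have BP: "B * P \<ge> 1" using assms P1 by (metis mult_mono' mult_1 zero_le_one)
      have "\<omega> (2 * t) \<le> L * (\<omega> (t/B) + 1)" using L(2)[of "t/B"] assms elim by simp
      also have "\<dots> \<le> L * (P * (2 + ln X))" using L(1) P1 by (intro mult_left_mono) (auto simp: algebra_simps)
      finally have "\<omega> (2 * t) / t \<le> L * (P * (2 + ln X)) / t" using elim by (intro divide_right_mono) auto
      also have "\<dots> = L * (2 + ln X) / (B * X)" using P1 assms X unfolding t by (simp add: field_simps)
      also have "\<dots> \<le> L * (2 + ln X) / X" using assms X L by (intro divide_left_mono) auto
      finally have 1: "sqrt (\<omega> (2 * t) / t) \<le> sqrt (L * (2 + ln X) / X)" by simp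
      have 2: "1 / t \<le> 1 / X" unfolding t using BP X by (simp add: divide_simps)
      have "sqrt (\<omega> (2 * t) / t) + 1 / t \<le> \<epsilon> * exp (- (1 + ln X) / 4)"
        using X0[OF X(1), unfolded pos_divide_less_eq[OF exp_gt_zero]] 1 2 by linarith
      also have "\<dots> \<le> \<epsilon> * exp (- \<omega> (t / B) / P / 4)"
        using P1 assms by (auto simp: field_simps)
      finally show "sqrt (\<omega> (2 * t) / t) + 1 / t \<le> \<epsilon> * exp (- \<omega> (t / B) / P / 4)" .
    qed
  qed
qed

end

section \<open>Partial derivatives along words of basis vectors\<close>

text \<open>Words over the basis replace multi-indices, because an induction can then add one
  derivative at a time without reference to an enumeration of the basis. \<open>Dmulti_eq\<close>
  and \<open>Dw_mset\<close> translate between the two.\<close>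

definition Dw :: "'a::euclidean_space list \<Rightarrow> ('a \<Rightarrow> complex) \<Rightarrow> 'a \<Rightarrow> complex"
  where "Dw w f = foldr Dpartial w f"

lemma Dw_simps [simp]: "Dw [] f = f" "Dw (b # w) f = Dpartial b (Dw w f)"
  by (auto simp: Dw_def)

lemma Dw_append: "Dw (v @ w) f = Dw v (Dw w f)"
  by (simp add: Dw_def)

lemma Dw_replicate: "Dw (replicate n b) f = (Dpartial b ^^ n) f"
  by (induction n) auto

lemma has_partialI:
  assumes "((\<lambda>t::real. f (x + t *\<^sub>R b)) has_vector_derivative D) (at 0)"
  shows "has_partial b f x" "Dpartial b f x = - \<i> * D"
  using assms by (auto simp: has_partial_def Dpartial_def differentiableI_vector vector_derivative_at)

lemma has_partialD:
  assumes "has_partial b f x"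
  shows "((\<lambda>t::real. f (x + t *\<^sub>R b)) has_vector_derivative \<i> * Dpartial b f x) (at 0)"
  using assms by (auto simp: has_partial_def Dpartial_def vector_derivative_works)

lemma has_partial_shift:
  assumes "has_partial b f (x + s *\<^sub>R b)"
  shows "((\<lambda>t::real. f (x + t *\<^sub>R b)) has_vector_derivative \<i> * Dpartial b f (x + s *\<^sub>R b)) (at s within A)"
proof -
  have "((\<lambda>t. f (x + s *\<^sub>R b + t *\<^sub>R b)) has_vector_derivative \<i> * Dpartial b f (x + s *\<^sub>R b)) (at (s - s))"
    using has_partialD[OF assms] by simp
  moreover have "((\<lambda>t. t - s) has_vector_derivative 1) (at s)"
    by (auto intro!: derivative_eq_intros)
  ultimately have "((\<lambda>t. f (x + s *\<^sub>R b + (t - s) *\<^sub>R b)) has_vector_derivative \<i> * Dpartial b f (x + s *\<^sub>R b)) (at s)"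
    using vector_diff_chain_at by (fastforce simp: o_def)
  then show ?thesis
    by (simp add: algebra_simps has_vector_derivative_at_within)
qed

lemma Dpartial_add:
  assumes "has_partial b f x" "has_partial b g x"
  shows "has_partial b (\<lambda>x. f x + g x) x" "Dpartial b (\<lambda>x. f x + g x) x = Dpartial b f x + Dpartial b g x"
  using has_partialI[OF has_vector_derivative_add[OF assms[THEN has_partialD]]]
  by (auto simp: algebra_simps)

lemma Dpartial_mult:
  assumes "has_partial b f x" "has_partial b g x"
  shows "has_partial b (\<lambda>x. f x * g x) x"
    "Dpartial b (\<lambda>x. f x * g x) x = Dpartial b f x * g x + f x * Dpartial b g x"
  using has_partialI[OF has_vector_derivative_mult[OF assms[THEN has_partialD]]]
  by (auto simp: algebra_simps)

lemma Dpartial_const: "has_partial b (\<lambda>x. c) x" "Dpartial b (\<lambda>x. c) x = 0"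
  using has_partialI[of "\<lambda>_. c" x b 0] by auto

lemma Dpartial_cmult:
  assumes "has_partial b f x"
  shows "has_partial b (\<lambda>x. c * f x) x" "Dpartial b (\<lambda>x. c * f x) x = c * Dpartial b f x"
  using Dpartial_mult[OF Dpartial_const(1)[of b c x] assms] by (auto simp: Dpartial_const)

lemma Dpartial_minus:
  assumes "has_partial b f x" "has_partial b g x"
  shows "has_partial b (\<lambda>x. f x - g x) x" "Dpartial b (\<lambda>x. f x - g x) x = Dpartial b f x - Dpartial b g x"
  using has_partialI[OF has_vector_derivative_diff[OF assms[THEN has_partialD]]]
  by (auto simp: algebra_simps)

lemma Dpartial_sum:
  assumes "\<And>i. i \<in> I \<Longrightarrow> has_partial b (f i) x"
  shows "has_partial b (\<lambda>x. \<Sum>i\<in>I. f i x) x" "Dpartial b (\<lambda>x. \<Sum>i\<in>I. f i x) x = (\<Sum>i\<in>I. Dpartial b (f i) x)"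
  using has_partialI[OF has_vector_derivative_sum[OF has_partialD[OF assms]]]
  by (auto simp: sum_distrib_left sum_negf)

lemma Dpartial_cong_open:
  assumes "open S" "x \<in> S" "\<And>y. y \<in> S \<Longrightarrow> f y = g y"
  shows "has_partial b f x \<longleftrightarrow> has_partial b g x" "Dpartial b f x = Dpartial b g x"
proof -
  have "open ((\<lambda>t::real. x + t *\<^sub>R b) -` S)"
    using assms(1) by (intro open_vimage continuous_intros)
  then have ev: "\<forall>\<^sub>F t::real in nhds 0. f (x + t *\<^sub>R b) = g (x + t *\<^sub>R b)"
    unfolding eventually_nhds using assms(2,3) by (intro exI[of _ "(\<lambda>t::real. x + t *\<^sub>R b) -` S"]) auto
  have eq: "((\<lambda>t. f (x + t *\<^sub>R b)) has_vector_derivative D) (at 0) \<longleftrightarrow>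
     ((\<lambda>t. g (x + t *\<^sub>R b)) has_vector_derivative D) (at 0)" for D
    by (rule has_vector_derivative_cong_ev) (use ev assms in \<open>auto elim: eventually_mono\<close>)
  show "has_partial b f x \<longleftrightarrow> has_partial b g x"
    unfolding has_partial_def using eq by (meson differentiableI_vector vector_derivative_works)
  show "Dpartial b f x = Dpartial b g x"
    unfolding Dpartial_def vector_derivative_def eq ..
qed

lemma Dpartial_pair:
  "Dpartial (b, 0) F (x, y) = Dpartial b (\<lambda>x. F (x, y)) x"
  "Dpartial (0, c) F (x, y) = Dpartial c (\<lambda>y. F (x, y)) y"
  "has_partial (b, 0) F (x, y) \<longleftrightarrow> has_partial b (\<lambda>x. F (x, y)) x"
  "has_partial (0, c) F (x, y) \<longleftrightarrow> has_partial c (\<lambda>y. F (x, y)) y"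
  by (auto simp: Dpartial_def has_partial_def)

lemma Dw_pair1: "Dw w (\<lambda>x. F (x, y)) x = Dw (map (\<lambda>b. (b, 0)) w) F (x, y)"
proof -
  have "Dw w (\<lambda>x. F (x, y)) = (\<lambda>x. Dw (map (\<lambda>b. (b, 0)) w) F (x, y))"
    by (induction w) (auto simp: Dpartial_pair)
  then show ?thesis by metis
qed

lemma Dw_pair2: "Dw w (\<lambda>y. F (x, y)) y = Dw (map (\<lambda>b. (0, b)) w) F (x, y)"
proof -
  have "Dw w (\<lambda>y. F (x, y)) = (\<lambda>y. Dw (map (\<lambda>b. (0, b)) w) F (x, y))"
    by (induction w) (auto simp: Dpartial_pair)
  then show ?thesis by metis
qed

subsection \<open>Smooth functions\<close>

text \<open>The recursion in \<open>C_on\<close> peels off the derivative that is applied first, so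
  words grow at their right end. This is why words are analysed from the back.\<close>

lemma C_on_char:
  fixes f :: "'a::euclidean_space \<Rightarrow> complex"
  shows "C_on k S f \<longleftrightarrow> (\<forall>w. set w \<subseteq> Basis \<longrightarrow> length w \<le> k \<longrightarrow> continuous_on S (Dw w f)) \<and>
    (\<forall>w. set w \<subseteq> Basis \<longrightarrow> length w < k \<longrightarrow> (\<forall>b\<in>Basis. \<forall>x\<in>S. has_partial b (Dw w f) x))"
proof (induction k arbitrary: f)
  case 0
  show ?case by auto
next
  case (Suc k)
  show ?case
  proof (intro iffI conjI allI impI ballI)
    assume C: "C_on (Suc k) S f"
    have *: "continuous_on S f" "\<And>b x. b \<in> Basis \<Longrightarrow> x \<in> S \<Longrightarrow> has_partial b f x"
       "\<And>w b. b \<in> Basis \<Longrightarrow> set w \<subseteq> Basis \<Longrightarrow> length w \<le> k \<Longrightarrow> continuous_on S (Dw (w @ [b]) f)"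
       "\<And>w b c x. b \<in> Basis \<Longrightarrow> set w \<subseteq> Basis \<Longrightarrow> length w < k \<Longrightarrow> c \<in> Basis \<Longrightarrow> x \<in> S \<Longrightarrow> has_partial c (Dw (w @ [b]) f) x"
      using C unfolding C_on.simps Suc.IH by (auto simp: Dw_append)
    fix w :: "'a list" assume w: "set w \<subseteq> Basis"
    show "continuous_on S (Dw w f)" if "length w \<le> Suc k"
      using *(1,3) w that by (cases w rule: rev_cases) auto
    fix b x :: 'a assume "b \<in> Basis" "x \<in> S"
    then show "has_partial b (Dw w f) x" if "length w < Suc k"
      using *(2,4) w that by (cases w rule: rev_cases) auto
  next
    assume R: "(\<forall>w. set w \<subseteq> Basis \<longrightarrow> length w \<le> Suc k \<longrightarrow> continuous_on S (Dw w f)) \<and>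
    (\<forall>w. set w \<subseteq> Basis \<longrightarrow> length w < Suc k \<longrightarrow> (\<forall>b\<in>Basis. \<forall>x\<in>S. has_partial b (Dw w f) x))"
    have "C_on k S (Dpartial b f)" if "b \<in> Basis" for b
    proof -
      have "continuous_on S (Dw (w @ [b]) f)" if "set w \<subseteq> Basis" "length w \<le> k" for w
        using R that \<open>b \<in> Basis\<close> by (auto simp del: Dw_simps)
      moreover have "has_partial c (Dw (w @ [b]) f) x" if "set w \<subseteq> Basis" "length w < k" "c \<in> Basis" "x \<in> S" for w c x
        using R that \<open>b \<in> Basis\<close> by (auto simp del: Dw_simps)
      ultimately show ?thesis unfolding Suc.IH by (auto simp: Dw_append)
    qed
    moreover have "continuous_on S f" using R[THEN conjunct1, rule_format, of "[]"] by simp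
    moreover have "\<forall>b\<in>Basis. \<forall>x\<in>S. has_partial b f x" using R[THEN conjunct2, rule_format, of "[]"] by simp
    ultimately show "C_on (Suc k) S f" by simp
  qed
qed

lemma Cinf_iff:
  "Cinf_on S f \<longleftrightarrow> (\<forall>w. set w \<subseteq> Basis \<longrightarrow> continuous_on S (Dw w f) \<and>
     (\<forall>b\<in>Basis. \<forall>x\<in>S. has_partial b (Dw w f) x))"
  unfolding Cinf_on_def C_on_char by (meson le_refl lessI)

lemma Cinf_cont: "Cinf_on S f \<Longrightarrow> set w \<subseteq> Basis \<Longrightarrow> continuous_on S (Dw w f)"
  and Cinf_partial: "Cinf_on S f \<Longrightarrow> set w \<subseteq> Basis \<Longrightarrow> b \<in> Basis \<Longrightarrow> x \<in> S \<Longrightarrow> has_partial b (Dw w f) x"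
  by (auto simp: Cinf_iff)

lemma Cinf_Dw: "Cinf_on S f \<Longrightarrow> set w \<subseteq> Basis \<Longrightarrow> Cinf_on S (Dw w f)"
  by (simp add: Cinf_iff Dw_append[symmetric])

text \<open>A coinduction principle: a family of continuous candidates that is closed under
  differentiation certifies smoothness and at the same time identifies all derivatives. Sums,
  parameter integrals and the limit kernel are all treated in this way.\<close>

lemma Cinf_coinduct:
  fixes f :: "'a::euclidean_space \<Rightarrow> complex"
  assumes "open S" and "\<And>x. x \<in> S \<Longrightarrow> G [] x = f x"
    and "\<And>w. set w \<subseteq> Basis \<Longrightarrow> continuous_on S (G w)"
    and "\<And>w b x. set w \<subseteq> Basis \<Longrightarrow> b \<in> Basis \<Longrightarrow> x \<in> S \<Longrightarrow> has_partial b (G w) x \<and> Dpartial b (G w) x = G (b # w) x"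
  shows "Cinf_on S f" "set w \<subseteq> Basis \<Longrightarrow> x \<in> S \<Longrightarrow> Dw w f x = G w x"
proof -
  have eq: "Dw w f x = G w x" if "set w \<subseteq> Basis" "x \<in> S" for w x
    using that
  proof (induction w arbitrary: x)
    case (Cons b w)
    then show ?case
      using Dpartial_cong_open(2)[OF assms(1), of x "Dw w f" "G w"] assms(4)[of w b x] by auto
  qed (use assms(2) in auto)
  show "Cinf_on S f"
    unfolding Cinf_iff
  proof (intro allI impI conjI ballI)
    fix w :: "'a list" assume w: "set w \<subseteq> Basis"
    show "continuous_on S (Dw w f)"
      using assms(3)[OF w] by (subst continuous_on_cong[OF refl eq[OF w]])
    fix b x :: 'a assume "b \<in> Basis" "x \<in> S"
    then have "has_partial b (G w) x" using assms(4)[OF w] by simp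
    then show "has_partial b (Dw w f) x"
      by (subst Dpartial_cong_open(1)[OF assms(1) \<open>x \<in> S\<close> eq[OF w]])
  qed
  show "set w \<subseteq> Basis \<Longrightarrow> x \<in> S \<Longrightarrow> Dw w f x = G w x" by (rule eq)
qed

lemma Cinf_add:
  assumes "Cinf_on UNIV f" "Cinf_on UNIV g"
  shows "Cinf_on UNIV (\<lambda>x. f x + g x)" "set w \<subseteq> Basis \<Longrightarrow> Dw w (\<lambda>x. f x + g x) x = Dw w f x + Dw w g x"
proof -
  define G where "G = (\<lambda>w x. Dw w f x + Dw w g x)"
  have c: "continuous_on UNIV (G w)" if "set w \<subseteq> Basis" for w
    unfolding G_def by (intro continuous_on_add Cinf_cont assms that)
  have d: "has_partial b (G w) x \<and> Dpartial b (G w) x = G (b # w) x" if "set w \<subseteq> Basis" "b \<in> Basis" for w b x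
    unfolding G_def using that by (simp add: Dpartial_add Cinf_partial[where S = UNIV] assms)
  show "Cinf_on UNIV (\<lambda>x. f x + g x)"
    by (rule Cinf_coinduct(1)[OF open_UNIV, of G]) (use c d in \<open>simp_all add: G_def\<close>)
  show "Dw w (\<lambda>x. f x + g x) x = Dw w f x + Dw w g x" if "set w \<subseteq> Basis"
    by (rule Cinf_coinduct(2)[OF open_UNIV, of G, unfolded G_def]) (use c d that in \<open>simp_all add: G_def\<close>)
qed

lemma Cinf_minus:
  assumes "Cinf_on UNIV f" "Cinf_on UNIV g"
  shows "Cinf_on UNIV (\<lambda>x. f x - g x)" "set w \<subseteq> Basis \<Longrightarrow> Dw w (\<lambda>x. f x - g x) x = Dw w f x - Dw w g x"
proof -
  define G where "G = (\<lambda>w x. Dw w f x - Dw w g x)"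
  have c: "continuous_on UNIV (G w)" if "set w \<subseteq> Basis" for w
    unfolding G_def by (intro continuous_on_diff Cinf_cont assms that)
  have d: "has_partial b (G w) x \<and> Dpartial b (G w) x = G (b # w) x" if "set w \<subseteq> Basis" "b \<in> Basis" for w b x
    unfolding G_def using that by (simp add: Dpartial_minus Cinf_partial[where S = UNIV] assms)
  show "Cinf_on UNIV (\<lambda>x. f x - g x)"
    by (rule Cinf_coinduct(1)[OF open_UNIV, of G]) (use c d in \<open>simp_all add: G_def\<close>)
  show "Dw w (\<lambda>x. f x - g x) x = Dw w f x - Dw w g x" if "set w \<subseteq> Basis"
    by (rule Cinf_coinduct(2)[OF open_UNIV, of G, unfolded G_def]) (use c d that in \<open>simp_all add: G_def\<close>)
qed

lemma Cinf_cmult: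
  assumes "Cinf_on UNIV f"
  shows "Cinf_on UNIV (\<lambda>x. c * f x)" "set w \<subseteq> Basis \<Longrightarrow> Dw w (\<lambda>x. c * f x) x = c * Dw w f x"
proof -
  define G where "G = (\<lambda>w x. c * Dw w f x)"
  have c: "continuous_on UNIV (G w)" if "set w \<subseteq> Basis" for w
    unfolding G_def by (intro continuous_on_mult continuous_on_const Cinf_cont assms that)
  have d: "has_partial b (G w) x \<and> Dpartial b (G w) x = G (b # w) x" if "set w \<subseteq> Basis" "b \<in> Basis" for w b x
    unfolding G_def using that by (simp add: Dpartial_cmult Cinf_partial[where S = UNIV] assms)
  show "Cinf_on UNIV (\<lambda>x. c * f x)"
    by (rule Cinf_coinduct(1)[OF open_UNIV, of G]) (use c d in \<open>simp_all add: G_def\<close>)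
  show "Dw w (\<lambda>x. c * f x) x = c * Dw w f x" if "set w \<subseteq> Basis"
    by (rule Cinf_coinduct(2)[OF open_UNIV, of G, unfolded G_def]) (use c d that in \<open>simp_all add: G_def\<close>)
qed

lemma Cinf_sum:
  assumes "\<And>i. i \<in> I \<Longrightarrow> Cinf_on UNIV (f i)"
  shows "Cinf_on UNIV (\<lambda>x. \<Sum>i\<in>I. f i x)" "set w \<subseteq> Basis \<Longrightarrow> Dw w (\<lambda>x. \<Sum>i\<in>I. f i x) x = (\<Sum>i\<in>I. Dw w (f i) x)"
proof -
  define G where "G = (\<lambda>w x. \<Sum>i\<in>I. Dw w (f i) x)"
  have c: "continuous_on UNIV (G w)" if "set w \<subseteq> Basis" for w
    unfolding G_def by (intro continuous_on_sum Cinf_cont assms that)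
  have d: "has_partial b (G w) x \<and> Dpartial b (G w) x = G (b # w) x" if "set w \<subseteq> Basis" "b \<in> Basis" for w b x
    unfolding G_def using that by (simp add: Dpartial_sum Cinf_partial[where S = UNIV] assms)
  show "Cinf_on UNIV (\<lambda>x. \<Sum>i\<in>I. f i x)"
    by (rule Cinf_coinduct(1)[OF open_UNIV, of G]) (use c d in \<open>simp_all add: G_def\<close>)
  show "Dw w (\<lambda>x. \<Sum>i\<in>I. f i x) x = (\<Sum>i\<in>I. Dw w (f i) x)" if "set w \<subseteq> Basis"
    by (rule Cinf_coinduct(2)[OF open_UNIV, of G, unfolded G_def]) (use c d that in \<open>simp_all add: G_def\<close>)
qed

lemma Cinf_cont_compose:
  assumes "Cinf_on UNIV f" "set w \<subseteq> Basis" "continuous_on A g"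
  shows "continuous_on A (\<lambda>z. Dw w f (g z))"
  using continuous_on_compose2[OF Cinf_cont[OF assms(1,2)] assms(3)] by auto

text \<open>Schwarz's theorem. The increment of f along c is the integral of its c-derivative.
  Differentiating in s under the integral sign writes an increment of the b-derivative as an
  integral over t, whose t-derivative at 0 is the claim.\<close>

lemma Dpartial_commute:
  fixes f :: "'a::euclidean_space \<Rightarrow> complex"
  assumes f: "Cinf_on UNIV f" and b: "b \<in> Basis" and c: "c \<in> Basis"
  shows "Dpartial b (Dpartial c f) x = Dpartial c (Dpartial b f) x"
proof -
  note hp = Cinf_partial[OF f, of _ _ _, OF _ _ UNIV_I]
  have ct1: "continuous_on A (\<lambda>z. Dpartial c f (g z))" if "continuous_on A g" for A :: "real set" and g
    using Cinf_cont_compose[OF f, of "[c]", OF _ that] c by simp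
  have ct2: "continuous_on A (\<lambda>z. Dpartial b (Dpartial c f) (g z))" if "continuous_on A g" for A :: "(real \<times> real) set" and g
    using Cinf_cont_compose[OF f, of "[b, c]", OF _ that] b c by simp
  have ct3: "continuous_on A (\<lambda>z. Dpartial b (Dpartial c f) (g z))" if "continuous_on A g" for A :: "real set" and g
    using Cinf_cont_compose[OF f, of "[b, c]", OF _ that] b c by simp
  \<comment> \<open>The lower limit -1 makes t = 0 an interior point, so that one-sided derivatives
    at 0 are two-sided ones.\<close>
  define I where "I = (\<lambda>s t. integral (cbox (-1) t) (\<lambda>\<tau>. \<i> * Dpartial c f (x + \<tau> *\<^sub>R c + s *\<^sub>R b)))"
  have I: "I s t = f (x + s *\<^sub>R b + t *\<^sub>R c) - f (x + s *\<^sub>R b + (-1) *\<^sub>R c)" if "t \<ge> -1" for s t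
  proof -
    have "((\<lambda>\<tau>. \<i> * Dpartial c f (x + s *\<^sub>R b + \<tau> *\<^sub>R c)) has_integral
      f (x + s *\<^sub>R b + t *\<^sub>R c) - f (x + s *\<^sub>R b + (-1) *\<^sub>R c)) {-1..t}"
      by (rule fundamental_theorem_of_calculus[OF that])
         (use hp[of "[]" c] c in \<open>auto intro!: has_partial_shift\<close>)
    from integral_unique[OF this] show ?thesis unfolding I_def cbox_interval
      by (simp only: add_ac)
  qed
  have d1: "((\<lambda>s. I s t) has_vector_derivative integral (cbox (-1) t) (\<lambda>\<tau>. \<i> * (\<i> * Dpartial b (Dpartial c f) (x + \<tau> *\<^sub>R c + 0 *\<^sub>R b)))) (at 0 within UNIV)" for t
    unfolding I_def
  proof (rule leibniz_rule_vector_derivative)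
    fix s \<tau> :: real
    show "((\<lambda>s. \<i> * Dpartial c f (x + \<tau> *\<^sub>R c + s *\<^sub>R b)) has_vector_derivative
        \<i> * (\<i> * Dpartial b (Dpartial c f) (x + \<tau> *\<^sub>R c + s *\<^sub>R b))) (at s within UNIV)"
      using hp[of "[c]" b] b c by (intro has_vector_derivative_mult_right has_partial_shift) auto
    show "(\<lambda>\<tau>. \<i> * Dpartial c f (x + \<tau> *\<^sub>R c + s *\<^sub>R b)) integrable_on cbox (- 1) t"
      by (intro integrable_continuous continuous_intros ct1)
    show "continuous_on (UNIV \<times> cbox (- 1) t) (\<lambda>(s, \<tau>). \<i> * (\<i> * Dpartial b (Dpartial c f) (x + \<tau> *\<^sub>R c + s *\<^sub>R b)))"
      unfolding split_beta by (intro continuous_intros ct2)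
  qed auto
  define J where "J = (\<lambda>t. \<i> * Dpartial b f (x + t *\<^sub>R c) - \<i> * Dpartial b f (x - c))"
  have d2: "((\<lambda>s. I s t) has_vector_derivative J t) (at 0 within UNIV)" if "t \<ge> -1" for t
  proof -
    have "((\<lambda>s. f (x + t *\<^sub>R c + s *\<^sub>R b) - f (x - c + s *\<^sub>R b)) has_vector_derivative J t) (at 0)"
      unfolding J_def using hp[of "[]" b] b by (intro has_vector_derivative_diff has_partialD) auto
    then show ?thesis using that by (simp add: I algebra_simps)
  qed
  have J: "J t = integral {-1..t} (\<lambda>\<tau>. \<i> * (\<i> * Dpartial b (Dpartial c f) (x + \<tau> *\<^sub>R c)))" if "t \<ge> -1" for t
    using vector_derivative_unique_at[OF d2[OF that] d1] by simp
  have "((\<lambda>t. integral {-1..t} (\<lambda>\<tau>. \<i> * (\<i> * Dpartial b (Dpartial c f) (x + \<tau> *\<^sub>R c)))) has_vector_derivative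
      \<i> * (\<i> * Dpartial b (Dpartial c f) (x + 0 *\<^sub>R c))) (at 0 within {-1..1})"
    by (intro integral_has_vector_derivative continuous_intros ct3) auto
  moreover have "x + 0 *\<^sub>R c = x" by simp
  moreover have "J t = integral {-1..t} (\<lambda>\<tau>. \<i> * (\<i> * Dpartial b (Dpartial c f) (x + \<tau> *\<^sub>R c)))" if "t \<in> {-1..1}" for t
    by (rule J) (use that in simp)
  ultimately have "(J has_vector_derivative \<i> * (\<i> * Dpartial b (Dpartial c f) x)) (at 0 within {-1..1})"
    by (metis (no_types, lifting) has_vector_derivative_transform atLeastAtMost_iff neg_le_0_iff_le zero_le_one)
  moreover have "(at 0 within {-1..1::real}) = at 0"
    by (rule at_within_interior) (auto simp: interior_atLeastAtMost_real)
  moreover have "(J has_vector_derivative \<i> * (\<i> * Dpartial c (Dpartial b f) x) - 0) (at 0)"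
    unfolding J_def using hp[of "[b]" c] b c
    by (intro has_vector_derivative_diff has_vector_derivative_mult_right has_partialD has_vector_derivative_const) auto
  ultimately have "\<i> * (\<i> * Dpartial b (Dpartial c f) x) = \<i> * (\<i> * Dpartial c (Dpartial b f) x) - 0"
    by (metis vector_derivative_unique_at)
  then show ?thesis by simp
qed

lemma Dw_rotate:
  assumes "Cinf_on UNIV f" "set w \<subseteq> Basis" "b \<in> Basis" "set v \<subseteq> Basis"
  shows "Dw (w @ b # v) f = Dw (b # w @ v) f"
  using assms(2)
proof (induction w)
  case (Cons c w)
  have "Dw ((c # w) @ b # v) f = Dpartial c (Dpartial b (Dw (w @ v) f))"
    using Cons by simp
  also have "\<dots> = Dpartial b (Dpartial c (Dw (w @ v) f))"
    using Cons.prems assms by (intro ext Dpartial_commute Cinf_Dw) auto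
  finally show ?case by simp
qed auto

lemma Dw_mset:
  assumes "Cinf_on UNIV f" "set w \<subseteq> Basis" "mset w = mset w'"
  shows "Dw w f = Dw w' f"
  using assms(2,3)
proof (induction w arbitrary: w')
  case (Cons b w)
  then have "b \<in> set w'" by (metis list.set_intros(1) mset_eq_setD)
  then obtain u v where w': "w' = u @ b # v" by (meson split_list)
  have "set w' \<subseteq> Basis" using Cons by (metis mset_eq_setD)
  then have "Dw w' f = Dw (b # u @ v) f"
    unfolding w' by (intro Dw_rotate assms) auto
  moreover have "Dw (u @ v) f = Dw w f"
    using Cons.IH[of "u @ v"] Cons.prems by (auto simp: w')
  ultimately show ?case by simp
qed auto

subsection \<open>Multi-indices\<close>

definition mword :: "'a::euclidean_space multi_index \<Rightarrow> 'a list"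
  where "mword \<alpha> = concat (map (\<lambda>b. replicate (\<alpha> b) b) basis_list)"

lemma basis_list: "distinct (basis_list :: 'a::euclidean_space list)" "set (basis_list :: 'a list) = Basis"
proof -
  have "\<exists>bs::'a list. distinct bs \<and> set bs = Basis"
    using finite_distinct_list[OF finite_Basis] by blast
  then have "distinct (basis_list :: 'a list) \<and> set (basis_list :: 'a list) = Basis"
    unfolding basis_list_def by (rule someI_ex)
  then show "distinct (basis_list :: 'a list)" "set (basis_list :: 'a list) = Basis" by auto
qed

lemma Dmulti_eq: "Dmulti \<alpha> f = Dw (mword \<alpha>) f"
proof -
  have "foldr (\<lambda>b. Dpartial b ^^ \<alpha> b) bs f = Dw (concat (map (\<lambda>b. replicate (\<alpha> b) b) bs)) f" for bs
    by (induction bs) (auto simp: Dw_append Dw_replicate)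
  then show ?thesis by (simp add: Dmulti_def mword_def)
qed

lemma set_mword: "set (mword \<alpha>) \<subseteq> Basis"
  by (simp add: mword_def basis_list set_replicate_conv_if UN_subset_iff)

lemma length_mword: "length (mword \<alpha>) = mi_size \<alpha>"
proof -
  have "length (concat (map (\<lambda>b. replicate (\<alpha> b) b) bs)) = sum_list (map \<alpha> bs)" for bs
    by (induction bs) auto
  then show ?thesis by (simp add: mword_def mi_size_def sum_list_distinct_conv_sum_set basis_list)
qed

lemma count_mword: "b \<in> Basis \<Longrightarrow> count (mset (mword \<alpha>)) b = \<alpha> b"
proof -
  assume b: "b \<in> Basis"
  have "count (mset (concat (map (\<lambda>b. replicate (\<alpha> b) b) bs))) b = (\<Sum>c\<leftarrow>bs. if b = c then \<alpha> c else 0)" for bs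
    by (induction bs) (auto simp: count_mset)
  then have "count (mset (mword \<alpha>)) b = (\<Sum>c\<in>Basis. if b = c then \<alpha> c else 0)"
    by (simp add: mword_def sum_list_distinct_conv_sum_set basis_list)
  then show ?thesis using b by simp
qed

lemma mset_mword_count: 
  assumes "set w \<subseteq> Basis" shows "mset (mword (count (mset w))) = mset w"
proof (rule multiset_eqI)
  fix b show "count (mset (mword (count (mset w)))) b = count (mset w) b"
  proof (cases "b \<in> Basis")
    case False
    then have "b \<notin> set (mword (count (mset w)))" "b \<notin> set w" using assms set_mword by blast+
    then show ?thesis by (metis count_mset_0_iff)
  qed (simp add: count_mword)
qed

lemma Dmulti_pair:
  "Dmulti \<alpha> (\<lambda>x. Dmulti \<beta> (\<lambda>y. k (x, y)) y) x =
     Dw (map (\<lambda>b. (b, 0)) (mword \<alpha>) @ map (\<lambda>b. (0, b)) (mword \<beta>)) k (x, y)"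
proof -
  have "Dmulti \<alpha> (\<lambda>x. Dmulti \<beta> (\<lambda>y. k (x, y)) y) x = Dw (mword \<alpha>) (\<lambda>x. Dw (map (\<lambda>b. (0, b)) (mword \<beta>)) k (x, y)) x"
    by (simp add: Dmulti_eq Dw_pair2[of _ k])
  then show ?thesis by (simp add: Dw_pair1 Dw_append)
qed

lemma Dmulti_triple:
  "Dmulti \<alpha> (\<lambda>x. Dmulti \<beta> (\<lambda>y. Dmulti \<gamma> (\<lambda>\<xi>. a (x, y, \<xi>)) \<xi>) y) x =
     Dw (map (\<lambda>b. (b, 0, 0)) (mword \<alpha>) @ map (\<lambda>b. (0, b, 0)) (mword \<beta>) @ map (\<lambda>b. (0, 0, b)) (mword \<gamma>)) a (x, y, \<xi>)"
proof -
  have 1: "Dmulti \<gamma> (\<lambda>\<xi>. a (x, y, \<xi>)) \<xi> = Dw (map (\<lambda>b. (0, 0, b)) (mword \<gamma>)) a (x, y, \<xi>)" for x y \<xi>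
    using Dw_pair2[of "mword \<gamma>" "\<lambda>z. a (x, z)" y \<xi>] Dw_pair2[of "map (Pair 0) (mword \<gamma>)" a x "(y, \<xi>)"]
    by (simp add: Dmulti_eq o_def)
  have 2: "Dw (mword \<beta>) (\<lambda>y. G (x, y, \<xi>)) y = Dw (map (\<lambda>b. (0, b, 0)) (mword \<beta>)) G (x, y, \<xi>)" for G x y \<xi>
    using Dw_pair1[of "mword \<beta>" "\<lambda>z. G (x, z)" \<xi> y] Dw_pair2[of "map (\<lambda>b. (b, 0)) (mword \<beta>)" G x "(y, \<xi>)"]
    by (simp add: o_def)
  have 3: "Dw (mword \<alpha>) (\<lambda>x. G (x, y, \<xi>)) x = Dw (map (\<lambda>b. (b, 0, 0)) (mword \<alpha>)) G (x, y, \<xi>)" for G y \<xi>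
    using Dw_pair1[of "mword \<alpha>" G "(y, \<xi>)" x] by (simp add: zero_prod_def)
  show ?thesis unfolding 1 unfolding Dmulti_eq 2 3 Dw_append ..
qed

section \<open>Integrals over Euclidean spaces\<close>

text \<open>A function that is not integrable has integral 0 by convention, so the bound covers that
  case too.\<close>

lemma integral_norm_le:
  fixes f :: "'b \<Rightarrow> 'c::{banach, second_countable_topology}"
  assumes "integrable M g" "\<And>x. norm (f x) \<le> g x"
  shows "norm (integral\<^sup>L M f) \<le> integral\<^sup>L M g"
proof (cases "integrable M f")
  case True
  have "norm (integral\<^sup>L M f) \<le> (LINT x|M. norm (f x))" by (rule integral_norm_bound)
  also have "\<dots> \<le> integral\<^sup>L M g" using assms True by (intro integral_mono) auto
  finally show ?thesis .
next
  case False
  have "integral\<^sup>L M g \<ge> 0" using assms(2) norm_ge_zero order.trans by (intro integral_nonneg_AE) (blast intro: AE_I2)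
  then show ?thesis using False by (simp add: not_integrable_integral_eq)
qed

lemma vector_mvt:
  fixes f :: "real \<Rightarrow> 'b::real_normed_vector"
  assumes "\<And>t. t \<in> S \<Longrightarrow> (f has_vector_derivative f' t) (at t)" "convex S" "a \<in> S" "b \<in> S"
    and "\<And>t. t \<in> S \<Longrightarrow> norm (f' t) \<le> B"
  shows "norm (f b - f a) \<le> B * \<bar>b - a\<bar>"
proof -
  have "norm (f b - f a) \<le> B * norm (b - a)"
  proof (rule differentiable_bound[where S = S and f' = "\<lambda>t h. h *\<^sub>R f' t"])
    fix t assume t: "t \<in> S"
    show "(f has_derivative (\<lambda>h. h *\<^sub>R f' t)) (at t within S)"
      using assms(1)[OF t] by (auto simp: has_vector_derivative_def intro: has_derivative_at_withinI)
    show "onorm (\<lambda>h. h *\<^sub>R f' t) \<le> B"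
      using assms(5)[OF t] by (intro onorm_le) (simp add: mult.commute[of B] mult_left_mono)
  qed (use assms in auto)
  then show ?thesis by simp
qed

text \<open>The form with difference quotients is the one to which dominated convergence
  applies.\<close>

lemma has_vector_derivative_quotient:
  fixes F :: "real \<Rightarrow> complex"
  shows "(F has_vector_derivative D) (at 0) \<longleftrightarrow> ((\<lambda>t. (F t - F 0) /\<^sub>R t) \<longlongrightarrow> D) (at 0)"
proof -
  have eq: "norm ((1 / norm (t - 0)) *\<^sub>R (F t - (F 0 + (t - 0) *\<^sub>R D))) = norm ((F t - F 0) /\<^sub>R t - D)"
    if "t \<noteq> 0" for t
  proof -
    have "F t - (F 0 + (t - 0) *\<^sub>R D) = t *\<^sub>R ((F t - F 0) /\<^sub>R t - D)"
      using that by (simp add: scaleR_diff_right)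
    then show ?thesis using that by simp
  qed
  have "(F has_vector_derivative D) (at 0) \<longleftrightarrow>
    ((\<lambda>t. norm ((1 / norm (t - 0)) *\<^sub>R (F t - (F 0 + (t - 0) *\<^sub>R D)))) \<longlongrightarrow> 0) (at 0)"
    unfolding has_vector_derivative_def has_derivative_within tendsto_norm_zero_iff
    by (simp add: bounded_linear_scaleR_left)
  also have "\<dots> \<longleftrightarrow> ((\<lambda>t. norm ((F t - F 0) /\<^sub>R t - D)) \<longlongrightarrow> 0) (at 0)"
    by (rule tendsto_cong) (use eq in \<open>auto simp: eventually_at_filter simp del: norm_scaleR\<close>)
  also have "\<dots> \<longleftrightarrow> ((\<lambda>t. (F t - F 0) /\<^sub>R t) \<longlongrightarrow> D) (at 0)"
    unfolding tendsto_norm_zero_iff by (simp add: LIM_zero_iff)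
  finally show ?thesis .
qed

text \<open>Differentiation under the integral by dominated convergence along sequences. The mean
  value inequality bounds all difference quotients by \<open>g\<close>, and measurability of the
  derivative follows from its being their pointwise limit.\<close>

lemma has_vector_derivative_integral:
  fixes h :: "real \<Rightarrow> 'u \<Rightarrow> complex"
  assumes deriv: "\<And>t u. \<bar>t\<bar> < 1 \<Longrightarrow> ((\<lambda>t. h t u) has_vector_derivative h' t u) (at t)"
    and bound: "\<And>t u. \<bar>t\<bar> < 1 \<Longrightarrow> norm (h' t u) \<le> g u"
    and g: "integrable M g"
    and int: "\<And>t. \<bar>t\<bar> < 1 \<Longrightarrow> integrable M (h t)"
  shows "((\<lambda>t. LINT u|M. h t u) has_vector_derivative (LINT u|M. h' 0 u)) (at 0)" "integrable M (h' 0)"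
proof -
  define q where "q = (\<lambda>t u. (h t u - h 0 u) /\<^sub>R t)"
  have q: "((\<lambda>t. q t u) \<longlongrightarrow> h' 0 u) (at 0)" for u
    using deriv[of 0 u] unfolding has_vector_derivative_quotient q_def by simp
  have qb: "norm (q t u) \<le> g u" if "\<bar>t\<bar> < 1" for t u
  proof -
    have "norm (h t u - h 0 u) \<le> g u * \<bar>t - 0\<bar>"
      by (rule vector_mvt[where S = "{-1<..<1}" and f' = "\<lambda>t. h' t u"]) (use deriv bound that in auto)
    then have "norm (q t u) \<le> g u" if "t \<noteq> 0"
      using that by (simp add: q_def divide_inverse[symmetric] mult.commute[of "inverse _"] pos_divide_le_eq)
    moreover have "g u \<ge> 0" using order.trans[OF norm_ge_zero bound[of 0 u]] by simp
    ultimately show ?thesis by (cases "t = 0") (simp_all add: q_def)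
  qed
  have main: "(\<lambda>n. LINT u|M. q (Y n) u) \<longlonglongrightarrow> (LINT u|M. h' 0 u) \<and> integrable M (h' 0)"
    if Y: "Y \<longlonglongrightarrow> 0" "\<And>n. Y n \<noteq> 0" "\<And>n. \<bar>Y n\<bar> < 1" for Y
  proof -
    have lim: "(\<lambda>n. q (Y n) u) \<longlonglongrightarrow> h' 0 u" for u
      using q[of u] Y(1,2) by (auto simp: tendsto_at_iff_sequentially o_def)
    have m: "q (Y n) \<in> borel_measurable M" for n
      unfolding q_def using int[of "Y n"] int[of 0] Y(3)[of n] by (intro borel_measurable_scaleR borel_measurable_diff) auto
    have m': "h' 0 \<in> borel_measurable M"
      by (rule borel_measurable_LIMSEQ_metric[OF m lim])
    show ?thesis
      using lim qb Y
      by (intro conjI integral_dominated_convergence[of "h' 0" M "\<lambda>n. q (Y n)" g]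
          integrable_dominated_convergence[of "h' 0" M "\<lambda>n. q (Y n)" g] m m' g) auto
  qed
  define Y0 where "Y0 = (\<lambda>n. 1 / real (n + 2))"
  have "Y0 \<longlonglongrightarrow> 0" unfolding Y0_def by real_asymp
  from main[OF this] show "integrable M (h' 0)" by (auto simp: Y0_def)
  have "((\<lambda>t. LINT u|M. q t u) \<longlongrightarrow> (LINT u|M. h' 0 u)) (at 0)"
    unfolding tendsto_at_iff_sequentially o_def
  proof (intro allI impI)
    fix X assume X: "\<forall>i. X i \<in> UNIV - {0::real}" "X \<longlonglongrightarrow> 0"
    \<comment> \<open>The domination holds for |t| < 1 only. A null sequence leaves this range
      finitely often, and there its terms are replaced by 1/2.\<close>
    define Y where "Y = (\<lambda>n. if \<bar>X n\<bar> < 1 then X n else 1/2)"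
    have ev: "\<forall>\<^sub>F n in sequentially. Y n = X n"
      using tendstoD[OF X(2), of 1] by (auto simp: Y_def dist_norm elim: eventually_mono)
    have "(\<lambda>n. LINT u|M. q (Y n) u) \<longlonglongrightarrow> (LINT u|M. h' 0 u)"
      using main[of Y] X tendsto_cong[OF ev] by (auto simp: Y_def)
    then show "(\<lambda>n. LINT u|M. q (X n) u) \<longlonglongrightarrow> (LINT u|M. h' 0 u)"
      by (rule Lim_transform_eventually) (use ev in \<open>auto elim: eventually_mono\<close>)
  qed
  moreover have "\<forall>\<^sub>F t in at 0. (LINT u|M. q t u) = ((LINT u|M. h t u) - (LINT u|M. h 0 u)) /\<^sub>R t"
    unfolding eventually_at
    by (intro exI[of _ 1]) (auto simp: q_def dist_norm int)
  ultimately have "((\<lambda>t. ((LINT u|M. h t u) - (LINT u|M. h 0 u)) /\<^sub>R t) \<longlongrightarrow> (LINT u|M. h' 0 u)) (at 0)"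
    by (rule Lim_transform_eventually)
  then show "((\<lambda>t. LINT u|M. h t u) has_vector_derivative (LINT u|M. h' 0 u)) (at 0)"
    unfolding has_vector_derivative_quotient .
qed

lemma lborel_integral_shift:
  fixes f :: "'a::euclidean_space \<Rightarrow> complex"
  assumes "f \<in> borel_measurable borel"
  shows "(LINT y|lborel. f (y + c)) = (LINT y|lborel. f y)"
    "integrable lborel (\<lambda>y. f (y + c)) \<longleftrightarrow> integrable lborel f"
proof -
  have "(LINT y|distr lborel borel ((+) c). f y) = (LINT y|lborel. f (c + y))"
    by (rule integral_distr) (use assms in auto)
  then show "(LINT y|lborel. f (y + c)) = (LINT y|lborel. f y)" 
    by (simp add: lborel_distr_plus add.commute)
  have "integrable (distr lborel borel ((+) c)) f \<longleftrightarrow> integrable lborel (\<lambda>y. f (c + y))"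
    by (rule integrable_distr_eq) (use assms in auto)
  then show "integrable lborel (\<lambda>y. f (y + c)) \<longleftrightarrow> integrable lborel f"
    by (simp add: lborel_distr_plus add.commute)
qed

lemma lborel_prod_integral:
  fixes f :: "'a::euclidean_space \<Rightarrow> real \<Rightarrow> 'b::{real_normed_field, banach, second_countable_topology}"
  assumes int: "\<And>b. b \<in> Basis \<Longrightarrow> integrable lborel (f b)"
  shows "integrable lborel (\<lambda>z. \<Prod>b\<in>Basis. f b (z \<bullet> b))"
    "(LINT z|lborel. (\<Prod>b\<in>Basis. f b (z \<bullet> b))) = (\<Prod>b\<in>Basis. (LINT x|lborel. f b x))"
proof -
  interpret product_sigma_finite "\<lambda>_::'a. lborel :: real measure" ..
  have [measurable]: "b \<in> Basis \<Longrightarrow> f b \<in> borel_measurable borel" for b using int[of b] by auto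
  have m: "(\<lambda>g. \<Sum>b\<in>Basis. g b *\<^sub>R b) \<in> measurable (\<Pi>\<^sub>M b\<in>Basis. lborel) (borel :: 'a measure)"
    by measurable
  have m2: "(\<lambda>z::'a. \<Prod>b\<in>Basis. f b (z \<bullet> b)) \<in> borel_measurable borel" by measurable
  have eq: "(\<Prod>b\<in>Basis. f b ((\<Sum>c\<in>Basis. g c *\<^sub>R c) \<bullet> b)) = (\<Prod>b\<in>Basis. f b (g b))" for g :: "'a \<Rightarrow> real"
    by (rule prod.cong) auto
  show "integrable lborel (\<lambda>z. \<Prod>b\<in>Basis. f b (z \<bullet> b))"
    by (subst lborel_eq, subst integrable_distr_eq[OF m m2]) (simp only: eq, rule product_integrable_prod, auto simp: int)
  show "(LINT z|lborel. (\<Prod>b\<in>Basis. f b (z \<bullet> b))) = (\<Prod>b\<in>Basis. (LINT x|lborel. f b x))"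
    by (subst lborel_eq, subst integral_distr[OF m m2]) (simp only: eq, rule product_integral_prod, auto simp: int)
qed

text \<open>An integrable majorant of every rapidly decreasing function.\<close>

definition prod_majorant :: "'a::euclidean_space \<Rightarrow> real"
  where "prod_majorant y = (\<Prod>b\<in>Basis. 1 / (1 + (y \<bullet> b)\<^sup>2))"

lemma prod_majorant_integrable: "integrable lborel (prod_majorant :: 'a::euclidean_space \<Rightarrow> real)"
proof -
  have "integrable lborel (\<lambda>x::real. inverse (1 + x\<^sup>2))"
    using integrable_inverse_1_plus_square by (simp add: set_integrable_def einterval_def)
  then show ?thesis unfolding prod_majorant_def by (intro lborel_prod_integral) (simp add: divide_inverse)
qed

lemma prod_majorant_pos: "prod_majorant y > 0"
  by (auto simp: prod_majorant_def intro!: prod_pos add_pos_nonneg)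

lemma prod_majorant_le1: "prod_majorant y \<le> 1"
  unfolding prod_majorant_def by (intro prod_le_1) (auto simp: divide_le_eq_1 add_pos_nonneg)

lemma prod_majorant_cont: "continuous_on A prod_majorant"
  unfolding prod_majorant_def by (intro continuous_intros) (auto simp: add_nonneg_eq_0_iff)

text \<open>Comparability under short translations gives one integrable bound for all derivatives
  along a unit segment in direction b.\<close>

lemma prod_majorant_shift: 
  assumes "\<bar>t\<bar> \<le> 1" "b \<in> Basis" shows "prod_majorant (y + t *\<^sub>R b) \<le> 3 * prod_majorant y"
proof -
  have 1: "1 / (1 + (s + t)\<^sup>2) \<le> 3 * (1 / (1 + s\<^sup>2))" for s :: real
  proof -
    have "t\<^sup>2 \<le> 1" using assms by (simp add: abs_square_le_1)
    moreover have "s\<^sup>2 \<le> 2 * (s + t)\<^sup>2 + 2 * t\<^sup>2"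
    proof -
      \<comment> \<open>The identity that proves the previous inequality: the difference of its two
        sides is a square.\<close>
      have "2 * (s + t)\<^sup>2 + 2 * t\<^sup>2 - s\<^sup>2 = (s + 2 * t)\<^sup>2" by (simp add: power2_eq_square algebra_simps)
      then show ?thesis using zero_le_power2[of "s + 2 * t"] by linarith
    qed
    moreover have "1 + x \<le> 3 * (1 + A)" if "u \<le> 1" "x \<le> 2 * A + 2 * u" "0 \<le> A" for x A u :: real
      using that by simp
    ultimately have "1 + s\<^sup>2 \<le> 3 * (1 + (s + t)\<^sup>2)" using zero_le_power2[of "s + t"] by blast
    then show ?thesis by (simp add: divide_simps add_pos_nonneg) 
  qed
  have "prod_majorant (y + t *\<^sub>R b) = 1 / (1 + (y \<bullet> b + t)\<^sup>2) * (\<Prod>c\<in>Basis - {b}. 1 / (1 + (y \<bullet> c)\<^sup>2))"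
    unfolding prod_majorant_def using assms by (subst prod.remove[OF _ assms(2)]) (auto simp: inner_simps inner_Basis intro!: prod.cong split: if_splits)
  also have "\<dots> \<le> 3 * (1 / (1 + (y \<bullet> b)\<^sup>2)) * (\<Prod>c\<in>Basis - {b}. 1 / (1 + (y \<bullet> c)\<^sup>2))"
    by (intro mult_right_mono 1 prod_nonneg) auto
  also have "\<dots> = 3 * prod_majorant y"
    unfolding prod_majorant_def using assms by (subst prod.remove[OF _ assms(2)]) auto
  finally show ?thesis .
qed

lemma prod_majorant_integrable_bound:
  fixes f :: "'a::euclidean_space \<Rightarrow> 'b::{banach, second_countable_topology}"
  assumes "f \<in> borel_measurable borel" "\<And>x. norm (f x) \<le> C * prod_majorant x"
  shows "integrable lborel f"
proof (rule Bochner_Integration.integrable_bound)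
  show "integrable lborel (\<lambda>x::'a. C * prod_majorant x)" by (intro integrable_mult_right prod_majorant_integrable)
  show "AE x in lborel. norm (f x) \<le> norm (C * prod_majorant x)"
    using assms(2) by (intro AE_I2) (auto intro: order.trans[OF _ abs_ge_self])
qed (use assms(1) in simp)

text \<open>Each coordinate is at most the norm, so the reciprocal of the majorant is bounded by
  this polynomial. This turns polynomial decay, or a bound on a cube, into a bound by the
  majorant.\<close>

lemma prod_majorant_lower: "1 \<le> (1 + (norm y)\<^sup>2) ^ DIM('a) * prod_majorant (y :: 'a::euclidean_space)"
proof -
  have "(\<Prod>b\<in>(Basis::'a set). 1 + (y \<bullet> b)\<^sup>2) \<le> (\<Prod>b\<in>(Basis::'a set). 1 + (norm y)\<^sup>2)"
    by (intro prod_mono) (auto intro!: power_mono simp: Basis_le_norm abs_le_square_iff[symmetric])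
  moreover have "(\<Prod>b\<in>(Basis::'a set). 1 + (y \<bullet> b)\<^sup>2) * prod_majorant y = 1"
    unfolding prod_majorant_def prod.distrib[symmetric] by (rule prod.neutral) (auto simp: add_nonneg_eq_0_iff)
  ultimately show ?thesis using prod_majorant_pos[of y]
      mult_right_mono[of "\<Prod>b\<in>(Basis::'a set). 1 + (y \<bullet> b)\<^sup>2" "\<Prod>b\<in>(Basis::'a set). 1 + (norm y)\<^sup>2" "prod_majorant y"]
    by simp
qed

text \<open>By (\<gamma>) the factor e^{-\<omega>} decays faster than |y|^{-2 DIM}. So a single
  factor e^{-\<omega>} always buys integrability.\<close>

lemma (in weight) prod_majorant_weight: "\<exists>C\<ge>1. \<forall>y::'a::euclidean_space. exp (- \<omega> (norm y)) \<le> C * prod_majorant y"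
proof -
  obtain C where C: "C \<ge> 0" "\<And>t. t \<ge> 1 \<Longrightarrow> real (2 * DIM('a)) * ln t \<le> \<omega> t + C"
    using w_ln[of "real (2 * DIM('a))"] by blast
  have "exp (- \<omega> (norm y)) \<le> exp C * 2 ^ DIM('a) * prod_majorant y" for y :: 'a
  proof -
    have "(1 + (norm y)\<^sup>2) ^ DIM('a) \<le> exp C * 2 ^ DIM('a) * exp (\<omega> (norm y))"
    proof (cases "norm y \<ge> 1")
      case True
      have "(1 + (norm y)\<^sup>2) ^ DIM('a) \<le> (2 * (norm y)\<^sup>2) ^ DIM('a)"
        using True one_le_power[OF True, of 2] by (intro power_mono) auto
      also have "\<dots> = 2 ^ DIM('a) * norm y ^ (2 * DIM('a))" by (simp add: power_mult_distrib power_mult)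
      also have "norm y ^ (2 * DIM('a)) = exp (real (2 * DIM('a)) * ln (norm y))"
        using True by (subst exp_of_nat_mult) (subst exp_ln, auto)
      also have "\<dots> \<le> exp (\<omega> (norm y) + C)" using C(2)[OF True] by simp
      finally show ?thesis by (simp add: exp_add mult_ac)
    next
      case False
      have "(1 + (norm y)\<^sup>2) ^ DIM('a) \<le> 2 ^ DIM('a)"
        using False by (intro power_mono) (auto simp: abs_square_le_1)
      also have "\<dots> \<le> exp C * 2 ^ DIM('a) * exp (\<omega> (norm y))"
        using C w_nonneg[of "norm y"] by (auto simp: mult_exp_exp mult.commute mult.left_commute intro!: mult_le_cancel_left1[THEN iffD2])
      finally show ?thesis .
    qed
    then have "1 \<le> exp C * 2 ^ DIM('a) * exp (\<omega> (norm y)) * prod_majorant y"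
      using prod_majorant_lower[of y] prod_majorant_pos[of y] by (meson mult_right_mono less_imp_le order.trans)
    then show ?thesis by (simp add: exp_minus field_simps)
  qed
  moreover have "exp C * 2 ^ DIM('a) \<ge> 1"
    using mult_mono[of 1 "exp C" 1 "2 ^ DIM('a)"] C by simp
  ultimately show ?thesis by blast
qed

subsection \<open>Integration by parts\<close>

text \<open>By translation invariance the integral of f(x + t b) does not depend on t, and its
  derivative at t = 0 is the integral of the partial derivative.\<close>

lemma integral_Dpartial:
  fixes f :: "'a::euclidean_space \<Rightarrow> complex"
  assumes hp: "\<And>x. has_partial b f x" and c: "continuous_on UNIV f" and c': "continuous_on UNIV (Dpartial b f)"
    and b: "b \<in> Basis" and bd: "\<And>x. norm (f x) \<le> C * prod_majorant x" and bd': "\<And>x. norm (Dpartial b f x) \<le> C * prod_majorant x"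
  shows "(LINT x|lborel. Dpartial b f x) = 0"
proof -
  have m: "f \<in> borel_measurable borel" "Dpartial b f \<in> borel_measurable borel"
    using c c' by (auto intro: borel_measurable_continuous_onI)
  have fi: "integrable lborel f" by (rule prod_majorant_integrable_bound[OF m(1) bd])
  have C: "C \<ge> 0" using bd[of 0] prod_majorant_pos[of "0::'a"] by (smt (verit) norm_ge_zero zero_le_mult_iff)
  have "((\<lambda>t. LINT x|lborel. f (x + t *\<^sub>R b)) has_vector_derivative (LINT x|lborel. \<i> * Dpartial b f (x + 0 *\<^sub>R b))) (at 0)"
  proof (rule has_vector_derivative_integral(1))
    show "integrable lborel (\<lambda>x. C * (3 * prod_majorant x))" by (intro integrable_mult_right prod_majorant_integrable)
    fix t :: real and x assume t: "\<bar>t\<bar> < 1"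
    show "((\<lambda>t. f (x + t *\<^sub>R b)) has_vector_derivative \<i> * Dpartial b f (x + t *\<^sub>R b)) (at t)"
      by (rule has_partial_shift[OF hp])
    have "norm (\<i> * Dpartial b f (x + t *\<^sub>R b)) \<le> C * prod_majorant (x + t *\<^sub>R b)"
      using bd' by (simp add: norm_mult)
    also have "\<dots> \<le> C * (3 * prod_majorant x)" using t b C by (intro mult_left_mono prod_majorant_shift) auto
    finally show "norm (\<i> * Dpartial b f (x + t *\<^sub>R b)) \<le> C * (3 * prod_majorant x)" .
  qed (use lborel_integral_shift(2)[OF m(1)] fi in auto)
  moreover have "(\<lambda>t. LINT x|lborel. f (x + t *\<^sub>R b)) = (\<lambda>t. LINT x|lborel. f x)"
    using lborel_integral_shift(1)[OF m(1)] by auto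
  ultimately have "((\<lambda>t::real. LINT x|lborel. f x) has_vector_derivative \<i> * (LINT x|lborel. Dpartial b f x)) (at 0)"
    by simp
  then have "\<i> * (LINT x|lborel. Dpartial b f x) = 0"
    using vector_derivative_unique_at[OF _ has_vector_derivative_const] by blast
  then show ?thesis by simp
qed

text \<open>Finite differentiability in one direction only: the cutoffs have finitely many
  derivatives, and each partial integration uses a single coordinate.\<close>

primrec diff_along :: "'a::euclidean_space \<Rightarrow> nat \<Rightarrow> ('a \<Rightarrow> complex) \<Rightarrow> bool" where
  "diff_along b 0 f \<longleftrightarrow> continuous_on UNIV f"
| "diff_along b (Suc N) f \<longleftrightarrow> continuous_on UNIV f \<and> (\<forall>x. has_partial b f x) \<and> diff_along b N (Dpartial b f)"

lemma diff_along_cont: "diff_along b N f \<Longrightarrow> continuous_on UNIV f"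
  by (cases N) auto

lemma diff_along_le: "diff_along b N f \<Longrightarrow> M \<le> N \<Longrightarrow> diff_along b M f"
proof (induction N arbitrary: M f)
  case (Suc N)
  then show ?case by (cases M) auto
qed simp

lemma diff_along_Dcont: "diff_along b N f \<Longrightarrow> l \<le> N \<Longrightarrow> continuous_on UNIV ((Dpartial b ^^ l) f)"
proof (induction l arbitrary: N f)
  case (Suc l)
  then obtain M where "N = Suc M" by (metis Suc_le_D)
  then show ?case using Suc by (auto simp: funpow_Suc_right simp del: funpow.simps)
qed (auto simp: diff_along_cont)

lemma diff_along_add: "diff_along b N f \<Longrightarrow> diff_along b N g \<Longrightarrow> diff_along b N (\<lambda>x. f x + g x)"
proof (induction N arbitrary: f g)
  case (Suc N)
  have "Dpartial b (\<lambda>x. f x + g x) = (\<lambda>x. Dpartial b f x + Dpartial b g x)"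
    using Suc.prems by (auto simp: fun_eq_iff Dpartial_add)
  then show ?case using Suc by (auto intro!: continuous_intros Dpartial_add(1))
qed (auto intro!: continuous_intros)

lemma diff_along_mult: "diff_along b N f \<Longrightarrow> diff_along b N g \<Longrightarrow> diff_along b N (\<lambda>x. f x * g x)"
proof (induction N arbitrary: f g)
  case (Suc N)
  have "Dpartial b (\<lambda>x. f x * g x) = (\<lambda>x. Dpartial b f x * g x + f x * Dpartial b g x)"
    using Suc.prems by (auto simp: fun_eq_iff Dpartial_mult)
  moreover have "diff_along b N f" "diff_along b N g" using Suc.prems diff_along_le[of b "Suc N" _ N] by auto
  ultimately show ?case using Suc by (auto intro!: continuous_intros Dpartial_mult(1) diff_along_add)
qed (auto intro!: continuous_intros)

text \<open>The bound is pointwise, because constants differ inside and outside the region where a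
  cutoff lives; A = 0 expresses that all these derivatives vanish at x. Geometric bounds are closed
  under products, with ratios added.\<close>

definition geo_bounded :: "'a::euclidean_space \<Rightarrow> nat \<Rightarrow> 'a \<Rightarrow> real \<Rightarrow> real \<Rightarrow> ('a \<Rightarrow> complex) \<Rightarrow> bool"
  where "geo_bounded b N x A r f \<longleftrightarrow> (\<forall>l\<le>N. norm ((Dpartial b ^^ l) f x) \<le> A * r ^ l)"

lemma geo_bounded_0: "geo_bounded b 0 x A r f \<longleftrightarrow> norm (f x) \<le> A"
  by (simp add: geo_bounded_def)

lemma geo_bounded_Suc: "geo_bounded b (Suc N) x A r f \<longleftrightarrow> norm (f x) \<le> A \<and> geo_bounded b N x (A * r) r (Dpartial b f)"
proof -
  have "geo_bounded b (Suc N) x A r f \<longleftrightarrow> norm (f x) \<le> A \<and> (\<forall>k\<le>N. norm ((Dpartial b ^^ Suc k) f x) \<le> A * r ^ Suc k)"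
    unfolding geo_bounded_def less_Suc_eq_le[symmetric] by (subst All_less_Suc2) simp
  then show ?thesis by (simp add: geo_bounded_def funpow_Suc_right mult.assoc del: funpow.simps)
qed

lemma geo_bounded_le: "geo_bounded b N x A r f \<Longrightarrow> M \<le> N \<Longrightarrow> geo_bounded b M x A r f"
  by (simp add: geo_bounded_def)

lemma geo_bounded_mono: 
  assumes "geo_bounded b N x A r f" "A \<le> A'" "0 \<le> r" "r \<le> r'" "0 \<le> A" 
  shows "geo_bounded b N x A' r' f"
  unfolding geo_bounded_def
proof (intro allI impI)
  fix l assume "l \<le> N"
  then have "norm ((Dpartial b ^^ l) f x) \<le> A * r ^ l" using assms by (simp add: geo_bounded_def)
  also have "\<dots> \<le> A' * r' ^ l" using assms by (intro mult_mono power_mono) auto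
  finally show "norm ((Dpartial b ^^ l) f x) \<le> A' * r' ^ l" .
qed

text \<open>Finitely many orders always admit some constant. It is used at points where the other
  factor of a product has the constant 0.\<close>

lemma geo_bounded_exists: assumes "r > 0" shows "\<exists>A\<ge>0. geo_bounded b N x A r f"
proof (intro exI conjI)
  let ?A = "\<Sum>l\<le>N. norm ((Dpartial b ^^ l) f x) / r ^ l"
  show "?A \<ge> 0" using assms by (intro sum_nonneg) auto
  show "geo_bounded b N x ?A r f"
    unfolding geo_bounded_def
  proof (intro allI impI)
    fix l assume "l \<le> N"
    then have "norm ((Dpartial b ^^ l) f x) / r ^ l \<le> ?A"
      using assms by (intro member_le_sum) auto
    then show "norm ((Dpartial b ^^ l) f x) \<le> ?A * r ^ l" using assms by (simp add: field_simps)
  qed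
qed

lemma geo_bounded_add:
  assumes "diff_along b N f" "diff_along b N g" "geo_bounded b N x A r f" "geo_bounded b N x B r g"
  shows "geo_bounded b N x (A + B) r (\<lambda>x. f x + g x)"
  using assms
proof (induction N arbitrary: f g A B)
  case 0
  then show ?case by (auto simp: geo_bounded_0 intro: norm_triangle_le)
next
  case (Suc N)
  have "Dpartial b (\<lambda>x. f x + g x) = (\<lambda>x. Dpartial b f x + Dpartial b g x)"
    using Suc.prems by (auto simp: fun_eq_iff Dpartial_add)
  moreover have "geo_bounded b N x (A * r + B * r) r (\<lambda>x. Dpartial b f x + Dpartial b g x)"
    using Suc.prems by (intro Suc.IH) (auto simp: geo_bounded_Suc)
  ultimately show ?case using Suc.prems by (auto simp: geo_bounded_Suc algebra_simps intro: norm_triangle_le)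
qed

text \<open>The induction shifts one derivative onto a factor at a time, so that no binomial coefficients appear.\<close>

lemma geo_bounded_mult:
  assumes "diff_along b N f" "diff_along b N g" "geo_bounded b N x A r f" "geo_bounded b N x B s g" "0 \<le> A" "0 \<le> B" "0 \<le> r" "0 \<le> s"
  shows "geo_bounded b N x (A * B) (r + s) (\<lambda>x. f x * g x)"
  using assms
proof (induction N arbitrary: f g A B)
  case 0
  then show ?case by (auto simp: geo_bounded_0 norm_mult mult_mono)
next
  case (Suc N)
  have D: "Dpartial b (\<lambda>x. f x * g x) = (\<lambda>x. Dpartial b f x * g x + f x * Dpartial b g x)"
    using Suc.prems by (auto simp: fun_eq_iff Dpartial_mult)
  have reg: "diff_along b N f" "diff_along b N g" "diff_along b N (Dpartial b f)" "diff_along b N (Dpartial b g)"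
    using Suc.prems diff_along_le[of b "Suc N" _ N] by auto
  have g: "geo_bounded b N x A r f" "geo_bounded b N x B s g" "geo_bounded b N x (A * r) r (Dpartial b f)" "geo_bounded b N x (B * s) s (Dpartial b g)"
    using Suc.prems geo_bounded_le[of b "Suc N"] by (auto simp: geo_bounded_Suc)
  have "geo_bounded b N x (A * r * B + A * (B * s)) (r + s) (\<lambda>x. Dpartial b f x * g x + f x * Dpartial b g x)"
    by (intro geo_bounded_add diff_along_mult reg Suc.IH g mult_nonneg_nonneg Suc.prems)
  moreover have "norm (f x * g x) \<le> A * B"
    using Suc.prems by (auto simp: geo_bounded_Suc norm_mult intro!: mult_mono)
  ultimately show ?case by (auto simp: geo_bounded_Suc D algebra_simps)
qed

lemma exp_inner_partial:
  "has_partial b (\<lambda>y. exp (\<i> * complex_of_real (y \<bullet> v))) y"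
  "Dpartial b (\<lambda>y. exp (\<i> * complex_of_real (y \<bullet> v))) y = complex_of_real (b \<bullet> v) * exp (\<i> * complex_of_real (y \<bullet> v))"
proof -
  have "((\<lambda>t::real. exp (\<i> * complex_of_real ((y + t *\<^sub>R b) \<bullet> v))) has_vector_derivative
      \<i> * complex_of_real (b \<bullet> v) * exp (\<i> * complex_of_real (y \<bullet> v))) (at 0)"
  proof -
    have "((\<lambda>t. exp (\<i> * complex_of_real (y \<bullet> v) + of_real t * (\<i> * complex_of_real (b \<bullet> v)))) has_vector_derivative
      1 * (\<i> * complex_of_real (b \<bullet> v) * exp (\<i> * complex_of_real (y \<bullet> v)))) (at 0)"
      by (rule has_vector_derivative_real_field) (auto intro!: derivative_eq_intros simp: algebra_simps)
    then show ?thesis by (simp add: inner_simps algebra_simps)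
  qed
  from has_partialI[OF this]
  show "has_partial b (\<lambda>y. exp (\<i> * complex_of_real (y \<bullet> v))) y"
    "Dpartial b (\<lambda>y. exp (\<i> * complex_of_real (y \<bullet> v))) y = complex_of_real (b \<bullet> v) * exp (\<i> * complex_of_real (y \<bullet> v))"
    by (simp_all add: mult.assoc[symmetric])
qed

text \<open>The derivative of e g along b integrates to 0, and the exponential reproduces itself
  with the factor b \<bullet> v. Repeating this trades |v \<bullet> b|^N for N derivatives of
  g.\<close>

lemma integral_exp_parts:
  fixes g :: "'a::euclidean_space \<Rightarrow> complex"
  assumes b: "b \<in> Basis"
    and "diff_along b N g" "\<And>l x. l \<le> N \<Longrightarrow> norm ((Dpartial b ^^ l) g x) \<le> C * prod_majorant x"
  shows "norm (LINT y|lborel. exp (\<i> * complex_of_real (y \<bullet> v)) * g y) * \<bar>v \<bullet> b\<bar> ^ N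
    \<le> (LINT y|lborel. norm ((Dpartial b ^^ N) g y))"
  using assms(2,3)
proof (induction N arbitrary: g)
  case 0
  have "norm (LINT y|lborel. exp (\<i> * complex_of_real (y \<bullet> v)) * g y) \<le> (LINT y|lborel. norm (exp (\<i> * complex_of_real (y \<bullet> v)) * g y))"
    by (rule integral_norm_bound)
  also have "\<dots> = (LINT y|lborel. norm (g y))" by (simp add: norm_mult)
  finally show ?case by simp
next
  case (Suc N)
  define e where "e = (\<lambda>y::'a. exp (\<i> * complex_of_real (y \<bullet> v)))"
  have e: "has_partial b e y" "Dpartial b e y = complex_of_real (b \<bullet> v) * e y" "norm (e y) = 1" for y
    using exp_inner_partial[of b v y] by (auto simp: e_def)
  have ec: "continuous_on UNIV e" unfolding e_def by (intro continuous_intros)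
  have g: "\<And>x. has_partial b g x" "continuous_on UNIV g" "continuous_on UNIV (Dpartial b g)"
    using Suc.prems(1) diff_along_cont by auto
  have bg: "norm (g x) \<le> C * prod_majorant x" "norm (Dpartial b g x) \<le> C * prod_majorant x" for x
    using Suc.prems(2)[of 0 x] Suc.prems(2)[of 1 x] by auto
  have C: "C \<ge> 0" using bg(1)[of 0] prod_majorant_pos[of "0::'a"] by (smt (verit) norm_ge_zero zero_le_mult_iff)
  have D: "Dpartial b (\<lambda>y. e y * g y) = (\<lambda>y. (b \<bullet> v) * (e y * g y) + e y * Dpartial b g y)"
    using e g by (auto simp: fun_eq_iff Dpartial_mult algebra_simps)
  have i: "integrable lborel (\<lambda>y. e y * g y)" "integrable lborel (\<lambda>y. e y * Dpartial b g y)"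
    using bg by (auto intro!: prod_majorant_integrable_bound[where C = C] borel_measurable_continuous_onI continuous_intros ec g simp: norm_mult e)
  have "(LINT y|lborel. Dpartial b (\<lambda>y. e y * g y) y) = 0"
  proof (rule integral_Dpartial[OF _ _ _ b])
    show "norm (e x * g x) \<le> (1 + \<bar>b \<bullet> v\<bar>) * C * prod_majorant x" for x
    proof -
      have "norm (e x * g x) \<le> C * prod_majorant x" using bg(1)[of x] by (simp add: norm_mult e)
      also have "\<dots> \<le> (1 + \<bar>b \<bullet> v\<bar>) * (C * prod_majorant x)" using C prod_majorant_pos[of x] by (simp add: mult_le_cancel_right1 algebra_simps)
      finally show ?thesis by (simp add: mult.assoc)
    qed
    show "norm (Dpartial b (\<lambda>y. e y * g y) x) \<le> (1 + \<bar>b \<bullet> v\<bar>) * C * prod_majorant x" for x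
    proof -
      have "norm (Dpartial b (\<lambda>y. e y * g y) x) \<le> \<bar>b \<bullet> v\<bar> * norm (g x) + norm (Dpartial b g x)"
        unfolding D by (rule norm_triangle_le) (simp add: norm_mult e)
      also have "\<dots> \<le> \<bar>b \<bullet> v\<bar> * (C * prod_majorant x) + C * prod_majorant x" by (intro add_mono mult_left_mono bg) auto
      finally show ?thesis by (simp add: algebra_simps)
    qed
    show "continuous_on UNIV (Dpartial b (\<lambda>y. e y * g y))"
      unfolding D by (intro continuous_intros ec g)
  qed (auto intro!: Dpartial_mult e g continuous_intros ec)
  also have "(LINT y|lborel. Dpartial b (\<lambda>y. e y * g y) y) = (b \<bullet> v) * (LINT y|lborel. e y * g y) + (LINT y|lborel. e y * Dpartial b g y)"
    unfolding D using i by simp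
  finally have "(LINT y|lborel. e y * Dpartial b g y) = - ((b \<bullet> v) * (LINT y|lborel. e y * g y))"
    by (simp add: eq_neg_iff_add_eq_0 add.commute)
  then have "norm (LINT y|lborel. e y * g y) * \<bar>v \<bullet> b\<bar> = norm (LINT y|lborel. e y * Dpartial b g y)"
    by (simp add: norm_mult inner_commute mult.commute)
  then have "norm (LINT y|lborel. e y * g y) * \<bar>v \<bullet> b\<bar> ^ Suc N = norm (LINT y|lborel. e y * Dpartial b g y) * \<bar>v \<bullet> b\<bar> ^ N"
    by (simp add: mult.assoc[symmetric])
  also have "\<dots> \<le> (LINT y|lborel. norm ((Dpartial b ^^ N) (Dpartial b g) y))"
    unfolding e_def
  proof (rule Suc.IH)
    show "norm ((Dpartial b ^^ l) (Dpartial b g) x) \<le> C * prod_majorant x" if "l \<le> N" for l x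
      using Suc.prems(2)[of "Suc l" x] that by (simp add: funpow_Suc_right del: funpow.simps)
  qed (use Suc.prems in auto)
  finally show ?case by (simp add: e_def funpow_Suc_right del: funpow.simps)
qed

section \<open>Cutoff functions\<close>

lemma antiderivative_real:
  fixes f :: "real \<Rightarrow> real"
  assumes f: "continuous_on UNIV f"
  shows "\<exists>U. \<forall>s. (U has_real_derivative f s) (at s)"
proof (intro exI allI)
  \<comment> \<open>For s on either side of 0 one of the two intervals is empty or a point, so this
    is the signed integral from 0 to s.\<close>
  define U where "U = (\<lambda>s. integral {0..s} f - integral {s..0} f)"
  fix s :: real
  define M where "M = \<bar>s\<bar> + 1"
  have int: "f integrable_on {a..b}" for a b
    using f by (intro integrable_continuous_real) (auto intro: continuous_on_subset)
  have U: "U u = integral {-M..u} f - integral {-M..0} f" if "u \<in> {-M..M}" for u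
  proof (cases "u \<ge> 0")
    case True
    have "integral {-M..0} f + integral {0..u} f = integral {-M..u} f"
      by (rule Henstock_Kurzweil_Integration.integral_combine) (use that True int in \<open>auto simp: M_def\<close>)
    moreover have "integral {u..0} f = 0" using True by (cases "u = 0") auto
    ultimately show ?thesis by (simp add: U_def)
  next
    case False
    have "integral {-M..u} f + integral {u..0} f = integral {-M..0} f"
      by (rule Henstock_Kurzweil_Integration.integral_combine) (use that False int in auto)
    then show ?thesis using False by (simp add: U_def)
  qed
  have "((\<lambda>u. integral {-M..u} f - integral {-M..0} f) has_vector_derivative f s - 0) (at s within {-M..M})"
    using f by (intro has_vector_derivative_diff integral_has_vector_derivative has_vector_derivative_const)
      (auto simp: M_def intro: continuous_on_subset)
  then have "(U has_vector_derivative f s) (at s within {-M..M})"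
    by (intro has_vector_derivative_transform[of s "{-M..M}" U "\<lambda>u. integral {-M..u} f - integral {-M..0} f"] U) (auto simp: M_def)
  moreover have "at s within {-M..M} = at s" by (rule at_within_interior) (auto simp: M_def)
  ultimately show "(U has_real_derivative f s) (at s)" 
    by (simp add: has_real_derivative_iff_has_vector_derivative)
qed

text \<open>Hoermander's cutoffs: each average over an interval of length \<open>h\<close> buys one derivative,
  at the cost of a factor \<open>2 / h\<close>.\<close>

definition cutoff_stage :: "real \<Rightarrow> real \<Rightarrow> nat \<Rightarrow> (nat \<Rightarrow> real \<Rightarrow> real) \<Rightarrow> bool" where
  "cutoff_stage t h i \<theta> \<longleftrightarrow>
    (\<forall>l<i. \<forall>s. (\<theta> l has_real_derivative \<theta> (Suc l) s) (at s)) \<and>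
    (\<forall>l\<le>i. continuous_on UNIV (\<theta> l)) \<and>
    (\<forall>l\<le>i. \<forall>s. \<bar>\<theta> l s\<bar> \<le> (2 / h) ^ l) \<and> (\<forall>s. 0 \<le> \<theta> 0 s \<and> \<theta> 0 s \<le> 1) \<and>
    (\<forall>s. -t \<le> s \<and> s \<le> 3 * t / 2 - i * h \<longrightarrow> \<theta> 0 s = 1) \<and>
    (\<forall>s. s \<le> - 3 * t / 2 - i * h \<or> s \<ge> 2 * t \<longrightarrow> \<theta> 0 s = 0)"

text \<open>The next stage averages over [s, s + h]; its derivatives are difference quotients of the
  previous stage, whence the factor 2/h. Looking only to the right moves the end of the plateau and
  the beginning of the support left by h at each stage.\<close>

lemma cutoff_step:
  fixes t h :: real
  assumes t: "t > 0" and h: "h > 0"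
  shows "real i * h \<le> t / 2 \<Longrightarrow> \<exists>\<theta>. cutoff_stage t h i \<theta>"
proof (induction i)
  case 0
  \<comment> \<open>A trapezoid equal to 1 on [-t, 3t/2] and to 0 outside [-3t/2, 2t]. It is
    lopsided to make room for a total shift by t/2 to the left, after which plateau and support fit
    [-t, t] and [-2t, 2t].\<close>
  define f where "f = (\<lambda>s::real. max 0 (min 1 (min (2 * s / t + 3) (4 - 2 * s / t))))"
  have "continuous_on UNIV f" unfolding f_def using t by (intro continuous_intros) auto
  moreover have "0 \<le> f s \<and> f s \<le> 1" "\<bar>f s\<bar> \<le> 1" for s by (auto simp: f_def)
  moreover have "f s = 1" if "-t \<le> s" "s \<le> 3 * t / 2" for s
  proof -
    have "2 * s / t + 3 \<ge> 1" "4 - 2 * s / t \<ge> 1" using that t by (auto simp: field_simps)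
    then show ?thesis by (simp add: f_def)
  qed
  moreover have "f s = 0" if "s \<le> - 3 * t / 2 \<or> s \<ge> 2 * t" for s
  proof -
    have "2 * s / t + 3 \<le> 0 \<or> 4 - 2 * s / t \<le> 0" using that t by (auto simp: field_simps)
    then show ?thesis by (auto simp: f_def)
  qed
  ultimately show ?case by (intro exI[of _ "\<lambda>_. f"]) (auto simp: cutoff_stage_def)
next
  case (Suc i)
  have ih: "real i * h \<le> t / 2" using Suc.prems h by (simp add: algebra_simps)
  obtain \<theta> where "cutoff_stage t h i \<theta>" using Suc.IH[OF ih] by blast
  then have d: "\<And>l s. l < i \<Longrightarrow> (\<theta> l has_real_derivative \<theta> (Suc l) s) (at s)"
    and c: "\<And>l. l \<le> i \<Longrightarrow> continuous_on UNIV (\<theta> l)"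
    and b: "\<And>l s. l \<le> i \<Longrightarrow> \<bar>\<theta> l s\<bar> \<le> (2 / h) ^ l" and b0: "\<And>s. 0 \<le> \<theta> 0 s \<and> \<theta> 0 s \<le> 1"
    and one: "\<And>s. -t \<le> s \<Longrightarrow> s \<le> 3 * t / 2 - i * h \<Longrightarrow> \<theta> 0 s = 1"
    and zero: "\<And>s. s \<le> - 3 * t / 2 - i * h \<or> s \<ge> 2 * t \<Longrightarrow> \<theta> 0 s = 0"
    unfolding cutoff_stage_def by blast+
  obtain U where U: "\<And>s. (U has_real_derivative \<theta> 0 s) (at s)"
    using antiderivative_real[OF c[of 0]] by auto
  define \<eta> where "\<eta> = (\<lambda>l s. case l of 0 \<Rightarrow> (U (s + h) - U s) / h | Suc l \<Rightarrow> (\<theta> l (s + h) - \<theta> l s) / h)"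
  \<comment> \<open>The average is a value of the previous stage at some point of the interval.
    Bounds, plateau and zeros all pass to the average through this point.\<close>
  have mv: "\<exists>z. s < z \<and> z < s + h \<and> \<eta> 0 s = \<theta> 0 z" for s
    using MVT2[of s "s + h" U "\<theta> 0"] U h by (auto simp: \<eta>_def)
  have "(\<eta> l has_real_derivative \<eta> (Suc l) s) (at s)" if "l < Suc i" for l s
  proof (cases l)
    case 0
    have "((\<lambda>s. U (s + h)) has_real_derivative \<theta> 0 (s + h)) (at s)"
      using U[of "s + h"] by (simp add: DERIV_shift)
    then have "((\<lambda>s. (U (s + h) - U s) / h) has_real_derivative (\<theta> 0 (s + h) - \<theta> 0 s) / h) (at s)"
      by (intro DERIV_cdivide DERIV_diff U)
    then show ?thesis by (simp add: 0 \<eta>_def)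
  next
    case (Suc k)
    have "((\<lambda>s. \<theta> k (s + h)) has_real_derivative \<theta> (Suc k) (s + h)) (at s)"
      using d[of k "s + h"] that Suc by (simp add: DERIV_shift)
    then have "((\<lambda>s. (\<theta> k (s + h) - \<theta> k s) / h) has_real_derivative (\<theta> (Suc k) (s + h) - \<theta> (Suc k) s) / h) (at s)"
      using that Suc by (intro DERIV_cdivide DERIV_diff d) auto
    then show ?thesis by (simp add: Suc \<eta>_def)
  qed
  moreover have "continuous_on UNIV (\<eta> l)" if "l \<le> Suc i" for l
  proof (cases l)
    case 0
    have "continuous_on UNIV U" using U by (intro DERIV_continuous_on[where D = "\<theta> 0"]) auto
    then have "continuous_on UNIV (\<lambda>s. (U (s + h) - U s) / h)"
      using h by (intro continuous_intros continuous_on_compose2[OF \<open>continuous_on UNIV U\<close>]) auto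
    then show ?thesis by (simp add: 0 \<eta>_def)
  next
    case (Suc k)
    have "continuous_on UNIV (\<lambda>s. (\<theta> k (s + h) - \<theta> k s) / h)"
      using h Suc that by (intro continuous_intros continuous_on_compose2[OF c[of k]]) auto
    then show ?thesis by (simp add: Suc \<eta>_def)
  qed
  moreover have e01: "0 \<le> \<eta> 0 s \<and> \<eta> 0 s \<le> 1" for s
  proof -
    obtain z where "\<eta> 0 s = \<theta> 0 z" using mv[of s] by blast
    then show ?thesis using b0[of z] by simp
  qed
  moreover have "\<bar>\<eta> l s\<bar> \<le> (2 / h) ^ l" if "l \<le> Suc i" for l s
  proof (cases l)
    case 0
    then show ?thesis using e01[of s] by simp
  next
    case (Suc k)
    have "\<bar>\<theta> k (s + h) - \<theta> k s\<bar> \<le> 2 * (2 / h) ^ k"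
    proof -
      have "k \<le> i" using Suc that by simp
      have "\<bar>\<theta> k (s + h) - \<theta> k s\<bar> \<le> \<bar>\<theta> k (s + h)\<bar> + \<bar>\<theta> k s\<bar>" by (rule abs_triangle_ineq4)
      also have "\<dots> \<le> (2 / h) ^ k + (2 / h) ^ k" by (intro add_mono b \<open>k \<le> i\<close>)
      finally show ?thesis by (simp only: mult_2)
    qed
    then have "\<bar>\<theta> k (s + h) - \<theta> k s\<bar> / h \<le> 2 * (2 / h) ^ k / h"
      using h by (intro divide_right_mono) auto
    moreover have "\<bar>\<eta> l s\<bar> = \<bar>\<theta> k (s + h) - \<theta> k s\<bar> / h" using h by (simp add: Suc \<eta>_def)
    moreover have "2 * (2 / h) ^ k / h = (2 / h) ^ l" by (simp add: Suc)
    ultimately show ?thesis by simp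
  qed
  moreover have "\<eta> 0 s = 1" if "-t \<le> s" "s \<le> 3 * t / 2 - Suc i * h" for s
  proof -
    obtain z where z: "s < z" "z < s + h" "\<eta> 0 s = \<theta> 0 z" using mv[of s] by blast
    have "z \<le> 3 * t / 2 - i * h" using that z by (simp add: algebra_simps)
    then show ?thesis using one[of z] that z by simp
  qed
  moreover have "\<eta> 0 s = 0" if "s \<le> - 3 * t / 2 - Suc i * h \<or> s \<ge> 2 * t" for s
  proof -
    obtain z where z: "s < z" "z < s + h" "\<eta> 0 s = \<theta> 0 z" using mv[of s] by blast
    have "z \<le> - 3 * t / 2 - i * h \<or> z \<ge> 2 * t" using that z by (auto simp: algebra_simps)
    then show ?thesis using zero z by simp
  qed
  ultimately have "cutoff_stage t h (Suc i) \<eta>" unfolding cutoff_stage_def by blast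
  then show ?case by (intro exI[of _ \<eta>])
qed

definition is_cutoff :: "real \<Rightarrow> nat \<Rightarrow> (nat \<Rightarrow> real \<Rightarrow> real) \<Rightarrow> bool" where
  "is_cutoff t N \<theta> \<longleftrightarrow>
    (\<forall>l<N. \<forall>s. (\<theta> l has_real_derivative \<theta> (Suc l) s) (at s)) \<and>
    (\<forall>l\<le>N. continuous_on UNIV (\<theta> l)) \<and>
    (\<forall>l\<le>N. \<forall>s. \<bar>\<theta> l s\<bar> \<le> (4 * N / t) ^ l) \<and> (\<forall>s. 0 \<le> \<theta> 0 s \<and> \<theta> 0 s \<le> 1) \<and>
    (\<forall>s. \<bar>s\<bar> \<le> t \<longrightarrow> \<theta> 0 s = 1) \<and> (\<forall>l s. 0 < l \<and> l \<le> N \<and> \<bar>s\<bar> < t \<longrightarrow> \<theta> l s = 0) \<and>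
    (\<forall>l s. l \<le> N \<and> \<bar>s\<bar> > 2 * t \<longrightarrow> \<theta> l s = 0)"

lemma DERIV_locally_constant:
  fixes f :: "real \<Rightarrow> real"
  assumes "(f has_real_derivative D) (at s)" "open S" "s \<in> S" "\<And>x. x \<in> S \<Longrightarrow> f x = c"
  shows "D = 0"
proof -
  have "((\<lambda>_. c) has_real_derivative D) (at s)"
    by (rule has_field_derivative_transform_within_open[OF assms])
  then show ?thesis using DERIV_unique DERIV_const by blast
qed

lemma cutoff_exists:
  assumes t: "t > 0" and N: "N \<ge> 1"
  shows "\<exists>\<theta>. is_cutoff t N \<theta>"
proof -
  \<comment> \<open>N averages of this length use up exactly the slack t/2, and 2/h becomes
    4N/t.\<close>
  define h where "h = t / (2 * real N)"
  have h: "h > 0" "real N * h = t / 2" using t N by (auto simp: h_def)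
  obtain \<theta> where "cutoff_stage t h N \<theta>"
    using cutoff_step[OF t h(1) eq_refl[OF h(2)]] by blast
  then have d: "\<And>l s. l < N \<Longrightarrow> (\<theta> l has_real_derivative \<theta> (Suc l) s) (at s)"
    and c: "\<And>l. l \<le> N \<Longrightarrow> continuous_on UNIV (\<theta> l)"
    and b: "\<And>l s. l \<le> N \<Longrightarrow> \<bar>\<theta> l s\<bar> \<le> (2 / h) ^ l" and b0: "\<And>s. 0 \<le> \<theta> 0 s \<and> \<theta> 0 s \<le> 1"
    and one: "\<And>s. -t \<le> s \<Longrightarrow> s \<le> 3 * t / 2 - N * h \<Longrightarrow> \<theta> 0 s = 1"
    and zero: "\<And>s. s \<le> - 3 * t / 2 - N * h \<or> s \<ge> 2 * t \<Longrightarrow> \<theta> 0 s = 0"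
    unfolding cutoff_stage_def by blast+
  have "2 / h = 4 * N / t" by (simp add: h_def)
  moreover have "\<theta> 0 s = 1" if "\<bar>s\<bar> \<le> t" for s using one[of s] that h by auto
  moreover have z1: "\<theta> l s = 0" if "0 < l" "l \<le> N" "\<bar>s\<bar> < t" for l s
    using that
  proof (induction l arbitrary: s)
    case (Suc l)
    have "\<exists>c. \<forall>x. x \<in> {-t<..<t} \<longrightarrow> \<theta> l x = c"
    proof (cases "l = 0")
      case True
      then show ?thesis using one h by (intro exI[of _ 1]) auto
    next
      case False
      then show ?thesis using Suc by (intro exI[of _ 0]) auto
    qed
    then obtain c where "\<And>x. x \<in> {-t<..<t} \<Longrightarrow> \<theta> l x = c" by blast
    then show ?case
      by (intro DERIV_locally_constant[where S = "{-t<..<t}" and c = c, OF d]) (use Suc.prems in auto)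
  qed simp
  moreover have "\<theta> l s = 0" if "l \<le> N" "\<bar>s\<bar> > 2 * t" for l s
    using that
  proof (induction l arbitrary: s)
    case 0
    have "s \<le> - 3 * t / 2 - N * h \<or> s \<ge> 2 * t" using 0 h(2) t by linarith
    then show ?case by (rule zero)
  next
    case (Suc l)
    then show ?case
    proof (intro DERIV_locally_constant[where S = "{..<-2*t} \<union> {2*t<..}" and c = 0, OF d])
      show "\<theta> l x = 0" if "x \<in> {..<-2*t} \<union> {2*t<..}" for x
        using that Suc.prems t by (intro Suc.IH) auto
      show "s \<in> {..<-2*t} \<union> {2*t<..}" using Suc.prems(2) by (simp add: abs_real_def split: if_splits)
    qed (use Suc.prems in auto)
  qed
  ultimately show ?thesis unfolding is_cutoff_def using d c b b0 by (intro exI[of _ \<theta>]) auto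
qed

definition cutoff :: "real \<Rightarrow> nat \<Rightarrow> nat \<Rightarrow> real \<Rightarrow> real"
  where "cutoff t N = (SOME \<theta>. is_cutoff t N \<theta>)"

lemma is_cutoff_cutoff: "t > 0 \<Longrightarrow> N \<ge> 1 \<Longrightarrow> is_cutoff t N (cutoff t N)"
  unfolding cutoff_def using cutoff_exists someI_ex by metis

text \<open>A product over the coordinates, so that differentiating along a basis vector affects one
  factor only and keeps the one-dimensional bound.\<close>

definition chi :: "real \<Rightarrow> nat \<Rightarrow> 'a::euclidean_space \<Rightarrow> complex"
  where "chi t N \<xi> = complex_of_real (\<Prod>b\<in>Basis. cutoff t N 0 (\<xi> \<bullet> b))"

text \<open>The finite counterpart of \<open>Cinf_coinduct\<close> along one direction: an explicit
  list of candidates for the derivatives certifies them.\<close>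

lemma diff_along_chain:
  assumes "G 0 = f" "\<And>l x. l < N \<Longrightarrow> has_partial b (G l) x \<and> Dpartial b (G l) x = G (Suc l) x"
    and "\<And>l. l \<le> N \<Longrightarrow> continuous_on UNIV (G l)"
  shows "diff_along b N f" "l \<le> N \<Longrightarrow> (Dpartial b ^^ l) f = G l"
proof -
  have "diff_along b M (G (N - M))" if "M \<le> N" for M
    using that
  proof (induction M)
    case (Suc M)
    have "N - M = Suc (N - Suc M)" using Suc.prems by simp
    then have "Dpartial b (G (N - Suc M)) = G (N - M)" using assms(2)[of "N - Suc M"] Suc.prems by auto
    then show ?case using Suc assms(2)[of "N - Suc M"] assms(3) by auto
  qed (use assms(3) in auto)
  from this[of N] show "diff_along b N f" using assms(1) by simp
  show "(Dpartial b ^^ l) f = G l" if "l \<le> N"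
    using that by (induction l) (use assms in auto)
qed

section \<open>Derivatives of the product cutoff along one coordinate\<close>

context
  fixes t :: real and N :: nat and \<theta> :: "nat \<Rightarrow> real \<Rightarrow> real" and c :: "'a::euclidean_space"
  assumes t: "t > 0" and N: "N \<ge> 1" and c: "c \<in> Basis"
begin

lemmas cut = is_cutoff_cutoff[OF t N, unfolded is_cutoff_def]

lemma cut_one: "\<bar>s\<bar> \<le> t \<Longrightarrow> cutoff t N 0 s = 1"
  and cut_inside: "0 < l \<Longrightarrow> l \<le> N \<Longrightarrow> \<bar>s\<bar> < t \<Longrightarrow> cutoff t N l s = 0"
  and cut_outside: "l \<le> N \<Longrightarrow> 2 * t < \<bar>s\<bar> \<Longrightarrow> cutoff t N l s = 0"
  and cut_bound: "l \<le> N \<Longrightarrow> \<bar>cutoff t N l s\<bar> \<le> (4 * N / t) ^ l"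
  using cut by blast+

lemma chi_deriv:
  defines "G \<equiv> (\<lambda>l \<xi>::'a. (- \<i>) ^ l * complex_of_real (cutoff t N l (\<xi> \<bullet> c) * (\<Prod>b\<in>Basis - {c}. cutoff t N 0 (\<xi> \<bullet> b))))"
  shows "diff_along c N (chi t N)" "l \<le> N \<Longrightarrow> (Dpartial c ^^ l) (chi t N) = G l"
proof -
  have G0: "G 0 = chi t N"
    unfolding G_def chi_def using c by (auto simp: fun_eq_iff prod.remove[OF finite_Basis c])
  have Gd: "has_partial c (G l) \<xi> \<and> Dpartial c (G l) \<xi> = G (Suc l) \<xi>" if "l < N" for l \<xi>
  proof -
    define P where "P = (\<Prod>b\<in>Basis - {c}. cutoff t N 0 (\<xi> \<bullet> b))"
    have P: "(\<Prod>b\<in>Basis - {c}. cutoff t N 0 ((\<xi> + s *\<^sub>R c) \<bullet> b)) = P" for s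
      unfolding P_def using c by (intro prod.cong) (auto simp: inner_simps inner_Basis)
    have "((\<lambda>s. cutoff t N l (\<xi> \<bullet> c + s)) has_real_derivative cutoff t N (Suc l) (\<xi> \<bullet> c)) (at 0)"
      using cut that DERIV_shift[of "cutoff t N l" "cutoff t N (Suc l) (\<xi> \<bullet> c)" 0 "\<xi> \<bullet> c"]
      by (simp add: add.commute[of "\<xi> \<bullet> c"])
    then have "((\<lambda>s. cutoff t N l (\<xi> \<bullet> c + s) * P) has_vector_derivative cutoff t N (Suc l) (\<xi> \<bullet> c) * P) (at 0)"
      unfolding has_real_derivative_iff_has_vector_derivative[symmetric] by (rule DERIV_cmult_right)
    then have "((\<lambda>s. complex_of_real (cutoff t N l (\<xi> \<bullet> c + s) * P)) has_vector_derivative complex_of_real (cutoff t N (Suc l) (\<xi> \<bullet> c) * P)) (at 0)"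
      by (rule bounded_linear.has_vector_derivative[OF bounded_linear_of_real])
    then have "((\<lambda>s. (- \<i>) ^ l * complex_of_real (cutoff t N l (\<xi> \<bullet> c + s) * P)) has_vector_derivative (- \<i>) ^ l * complex_of_real (cutoff t N (Suc l) (\<xi> \<bullet> c) * P)) (at 0)"
      by (rule has_vector_derivative_mult_right)
    moreover have "G l (\<xi> + s *\<^sub>R c) = (- \<i>) ^ l * complex_of_real (cutoff t N l (\<xi> \<bullet> c + s) * P)" for s
      unfolding G_def P using c by (simp only: inner_add_left inner_scaleR_left inner_same_Basis mult_1_right)
    ultimately have "((\<lambda>s. G l (\<xi> + s *\<^sub>R c)) has_vector_derivative (- \<i>) ^ l * complex_of_real (cutoff t N (Suc l) (\<xi> \<bullet> c) * P)) (at 0)"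
      by simp
    from has_partialI[OF this] show ?thesis by (simp add: G_def P_def)
  qed
  have Gc: "continuous_on UNIV (G l)" if "l \<le> N" for l
  proof -
    have cc: "continuous_on UNIV (cutoff t N l)" "continuous_on UNIV (cutoff t N 0)" using cut that by auto
    show ?thesis unfolding G_def
      by (intro continuous_intros continuous_on_compose2[OF cc(1)] continuous_on_compose2[OF cc(2)]) auto
  qed
  show "diff_along c N (chi t N)" by (rule diff_along_chain(1)[OF G0 Gd Gc])
  show "(Dpartial c ^^ l) (chi t N) = G l" if "l \<le> N" by (rule diff_along_chain(2)[OF G0 Gd Gc that])
qed

lemma cutoff_prod: "0 \<le> (\<Prod>b\<in>A. cutoff t N 0 (\<xi> \<bullet> b)) \<and> (\<Prod>b\<in>A. cutoff t N 0 (\<xi> \<bullet> b)) \<le> 1"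
  using cut by (auto intro!: prod_nonneg prod_le_1)

lemma chi_geo_bounded: "geo_bounded c N \<xi> 1 (4 * N / t) (chi t N)"
  unfolding geo_bounded_def
proof (intro allI impI)
  fix l assume l: "l \<le> N"
  have "norm ((Dpartial c ^^ l) (chi t N) \<xi>) = \<bar>cutoff t N l (\<xi> \<bullet> c)\<bar> * \<bar>\<Prod>b\<in>Basis - {c}. cutoff t N 0 (\<xi> \<bullet> b)\<bar>"
    using l by (simp add: chi_deriv(2) norm_mult norm_power abs_mult del: of_real_prod)
  also have "\<dots> \<le> (4 * N / t) ^ l * 1"
    using cut_bound[OF l] cutoff_prod[of \<xi> "Basis - {c}"] t by (intro mult_mono) auto
  finally show "norm ((Dpartial c ^^ l) (chi t N) \<xi>) \<le> 1 * (4 * N / t) ^ l" by simp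
qed

lemma chi_inside:
  assumes "\<And>b. b \<in> Basis \<Longrightarrow> \<bar>\<xi> \<bullet> b\<bar> < t" "l \<le> N"
  shows "(Dpartial c ^^ l) (chi t N) \<xi> = (if l = 0 then 1 else 0)"
proof -
  have "(\<Prod>b\<in>Basis - {c}. cutoff t N 0 (\<xi> \<bullet> b)) = 1"
    using assms(1) by (intro prod.neutral ballI cut_one) (simp add: less_imp_le)
  moreover have "cutoff t N l (\<xi> \<bullet> c) = (if l = 0 then 1 else 0)"
    using cut_one[of "\<xi> \<bullet> c"] cut_inside[of l "\<xi> \<bullet> c"] assms(1)[OF c] assms(2) by simp
  ultimately show ?thesis using assms(2) by (simp add: chi_deriv(2) del: of_real_prod)
qed

lemma chi_outside:
  assumes "b \<in> Basis" "\<bar>\<xi> \<bullet> b\<bar> > 2 * t" "l \<le> N"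
  shows "(Dpartial c ^^ l) (chi t N) \<xi> = 0"
proof (cases "b = c")
  case True
  then show ?thesis using cut_outside[of l "\<xi> \<bullet> c"] assms by (simp add: chi_deriv(2))
next
  case False
  then have "(\<Prod>b\<in>Basis - {c}. cutoff t N 0 (\<xi> \<bullet> b)) = 0"
    using assms by (intro prod_zero bexI[of _ b] cut_outside) auto
  then show ?thesis using assms(3) by (simp add: chi_deriv(2) del: of_real_prod)
qed

end

lemma chi_cont: "t > 0 \<Longrightarrow> N \<ge> 1 \<Longrightarrow> continuous_on UNIV (chi t N :: 'a::euclidean_space \<Rightarrow> complex)"
  using diff_along_cont[OF chi_deriv(1)] SOME_Basis by blast

lemma chi_norm: "t > 0 \<Longrightarrow> N \<ge> 1 \<Longrightarrow> norm (chi t N \<xi>) \<le> 1"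
  using chi_geo_bounded[OF _ _ SOME_Basis, of t N \<xi>] by (auto simp: geo_bounded_def)

lemma chi_eq_1: "t > 0 \<Longrightarrow> N \<ge> 1 \<Longrightarrow> (\<And>b. b \<in> Basis \<Longrightarrow> \<bar>\<xi> \<bullet> b\<bar> < t) \<Longrightarrow> chi t N \<xi> = 1"
  using chi_inside[OF _ _ SOME_Basis, of t N \<xi> 0] by auto

lemma chi_eq_0: "t > 0 \<Longrightarrow> N \<ge> 1 \<Longrightarrow> b \<in> Basis \<Longrightarrow> \<bar>\<xi> \<bullet> b\<bar> > 2 * t \<Longrightarrow> chi t N \<xi> = 0"
  using chi_outside[OF _ _ SOME_Basis, of t N b \<xi> 0] by auto

lemma geo_bounded_minus:
  assumes "diff_along b N f" "diff_along b N g" "geo_bounded b N x A r f" "geo_bounded b N x B r g"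
  shows "geo_bounded b N x (A + B) r (\<lambda>x. f x - g x)"
    "diff_along b N (\<lambda>x. f x - g x)" "l \<le> N \<Longrightarrow> (Dpartial b ^^ l) (\<lambda>x. f x - g x) x = (Dpartial b ^^ l) f x - (Dpartial b ^^ l) g x"
  using assms
proof (induction N arbitrary: f g A B l)
  case 0
  { case 1 then show ?case by (auto simp: geo_bounded_0 intro: norm_triangle_le_diff) }
  { case 2 then show ?case by (auto intro: continuous_intros) }
  { case 3 then show ?case by simp }
next
  case (Suc N)
  have D: "Dpartial b (\<lambda>x. f x - g x) = (\<lambda>x. Dpartial b f x - Dpartial b g x)" if "diff_along b (Suc N) f" "diff_along b (Suc N) g" for f g
    using that by (auto simp: fun_eq_iff Dpartial_minus)
  { case 1
    then have "geo_bounded b N x (A * r + B * r) r (\<lambda>x. Dpartial b f x - Dpartial b g x)"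
      by (intro Suc.IH(1)) (auto simp: geo_bounded_Suc)
    then show ?case using 1 by (auto simp: geo_bounded_Suc D[OF 1(1,2)] algebra_simps intro: norm_triangle_le_diff) }
  { case 2
    then have "diff_along b N (\<lambda>x. Dpartial b f x - Dpartial b g x)"
      by (intro Suc.IH(2)) (auto simp: geo_bounded_Suc)
    then show ?case using 2 D[OF 2(1,2)] by (auto intro!: continuous_intros Dpartial_minus(1)) }
  { case 3
    then show ?case
    proof (cases l)
      case (Suc k)
      have "(Dpartial b ^^ k) (\<lambda>x. Dpartial b f x - Dpartial b g x) x = (Dpartial b ^^ k) (Dpartial b f) x - (Dpartial b ^^ k) (Dpartial b g) x"
        using 3 Suc by (intro Suc.IH(3)) (auto simp: geo_bounded_Suc)
      then show ?thesis using D[OF 3(2,3)] by (simp add: Suc funpow_Suc_right del: funpow.simps)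
    qed simp }
qed

section \<open>Amplitudes\<close>

definition emb :: "'a::euclidean_space \<times> 'a \<Rightarrow> 'a \<times> 'a \<times> 'a"
  where "emb c = (fst c, snd c, 0)"

lemma emb_Basis: "c \<in> Basis \<Longrightarrow> emb c \<in> Basis"
  by (auto simp: emb_def Basis_prod_def zero_prod_def)

lemma emb_word: "set v \<subseteq> Basis \<Longrightarrow> set (map emb v) \<subseteq> Basis"
  unfolding set_map using emb_Basis by blast

lemma Basis_third: "b \<in> Basis \<Longrightarrow> (0, 0, b) \<in> (Basis :: ('a::euclidean_space \<times> 'a \<times> 'a) set)"
  by (auto simp: Basis_prod_def zero_prod_def)

lemma jbracket_ge1: "1 \<le> \<langle>x\<rangle>"
  by (simp add: jbracket_def)

lemma norm_le_jbracket: "norm x \<le> \<langle>x\<rangle>"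
  unfolding jbracket_def by (rule real_le_rsqrt) simp

lemma jbracket_mono: "norm x \<le> norm y \<Longrightarrow> \<langle>x\<rangle> \<le> \<langle>y\<rangle>"
  unfolding jbracket_def by (simp add: power_mono)

text \<open>The quotient in the amplitude condition therefore never exceeds 2, and each derivative
  in (x, y) loses at most a factor 2.\<close>

lemma jbracket_diff: "\<langle>x - y\<rangle> \<le> 2 * \<langle>(x, y, \<xi>)\<rangle>"
proof -
  have "norm (x - y) \<le> norm x + norm y" by (rule norm_triangle_ineq4)
  also have "norm x \<le> norm (x, y, \<xi>)" by (rule norm_fst_le)
  also have "norm y \<le> norm (x, y, \<xi>)"
    using norm_fst_le[of y \<xi>] norm_snd_le[of "(y, \<xi>)" x] by linarith
  finally have "(norm (x - y))\<^sup>2 \<le> (2 * norm (x, y, \<xi>))\<^sup>2" by (intro power_mono) auto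
  then have "1 + (norm (x - y))\<^sup>2 \<le> 4 * (1 + (norm (x, y, \<xi>))\<^sup>2)" by (simp add: power_mult_distrib)
  then have "\<langle>x - y\<rangle> \<le> sqrt (4 * (1 + (norm (x, y, \<xi>))\<^sup>2))" unfolding jbracket_def by simp
  then show ?thesis unfolding jbracket_def real_sqrt_mult by simp
qed

lemma triple_word:
  assumes "set W \<subseteq> (Basis :: ('a::euclidean_space \<times> 'a \<times> 'a) set)"
  shows "\<exists>u v w. set u \<subseteq> Basis \<and> set v \<subseteq> Basis \<and> set w \<subseteq> Basis \<and>
    mset W = mset (map (\<lambda>b. (b, 0, 0)) u @ map (\<lambda>b. (0, b, 0)) v @ map (\<lambda>b. (0, 0, b)) w)"
  using assms
proof (induction W)
  case (Cons c W)
  then obtain u v w where IH: "set u \<subseteq> Basis" "set v \<subseteq> Basis" "set w \<subseteq> Basis"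
    "mset W = mset (map (\<lambda>b. (b, 0, 0)) u @ map (\<lambda>b. (0, b, 0)) v @ map (\<lambda>b. (0, 0, b)) w)" by auto
  from Cons.prems consider b where "b \<in> Basis" "c = (b, 0, 0)" | b where "b \<in> Basis" "c = (0, b, 0)" | b where "b \<in> Basis" "c = (0, 0, b)"
    by (auto simp: Basis_prod_def zero_prod_def)
  then show ?case
  proof cases
    case (1 b) with IH show ?thesis by (intro exI[of _ "b # u"] exI[of _ v] exI[of _ w]) auto
  next
    case (2 b) with IH show ?thesis by (intro exI[of _ u] exI[of _ "b # v"] exI[of _ w]) auto
  next
    case (3 b) with IH show ?thesis by (intro exI[of _ u] exI[of _ v] exI[of _ "b # w"]) auto
  qed
qed auto

lemma linear_partial:
  "has_partial b (\<lambda>\<xi>. complex_of_real (u \<bullet> \<xi>)) \<xi>" "Dpartial b (\<lambda>\<xi>. complex_of_real (u \<bullet> \<xi>)) \<xi> = - \<i> * complex_of_real (u \<bullet> b)"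
proof -
  have "((\<lambda>t. complex_of_real (u \<bullet> \<xi>) + of_real t * complex_of_real (u \<bullet> b)) has_vector_derivative 1 * complex_of_real (u \<bullet> b)) (at 0)"
    by (rule has_vector_derivative_real_field) (auto intro!: derivative_eq_intros)
  then have "((\<lambda>t. complex_of_real (u \<bullet> (\<xi> + t *\<^sub>R b))) has_vector_derivative complex_of_real (u \<bullet> b)) (at 0)"
    by (simp add: inner_simps)
  from has_partialI[OF this]
  show "has_partial b (\<lambda>\<xi>. complex_of_real (u \<bullet> \<xi>)) \<xi>" "Dpartial b (\<lambda>\<xi>. complex_of_real (u \<bullet> \<xi>)) \<xi> = - \<i> * complex_of_real (u \<bullet> b)"
    by auto
qed

lemma diff_along_const: "diff_along b N (\<lambda>_. k)"
proof (induction N arbitrary: k)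
  case (Suc N)
  have "Dpartial b (\<lambda>_. k) = (\<lambda>_. 0)" by (auto simp: Dpartial_const)
  then show ?case using Suc by (auto simp: Dpartial_const)
qed auto

lemma diff_along_linear: "diff_along b N (\<lambda>\<xi>. complex_of_real (u \<bullet> \<xi>))"
proof (cases N)
  case (Suc M)
  have "Dpartial b (\<lambda>\<xi>. complex_of_real (u \<bullet> \<xi>)) = (\<lambda>_. - \<i> * complex_of_real (u \<bullet> b))"
    by (auto simp: linear_partial)
  then show ?thesis using Suc diff_along_const by (auto simp: linear_partial intro!: continuous_intros)
qed (auto intro!: continuous_intros)

text \<open>In Leibniz' rule for a factor linear in \<xi> only two terms survive. For l = 0 the
  truncated l - 1 does no harm since its coefficient is 0.\<close>

lemma Dpartial_pow_linear:
  assumes "diff_along b N f" "l \<le> N"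
  shows "(Dpartial b ^^ l) (\<lambda>\<xi>. complex_of_real (u \<bullet> \<xi>) * f \<xi>) =
    (\<lambda>\<xi>. complex_of_real (u \<bullet> \<xi>) * (Dpartial b ^^ l) f \<xi> + of_nat l * (- \<i> * complex_of_real (u \<bullet> b)) * (Dpartial b ^^ (l - 1)) f \<xi>)"
  using assms(2)
proof (induction l)
  case (Suc l)
  have hp: "has_partial b ((Dpartial b ^^ k) f) \<xi>" if "k < N" for k \<xi>
    using assms(1) that
  proof (induction k arbitrary: N f)
    case 0
    then show ?case by (cases N) auto
  next
    case (Suc k)
    then obtain M where "N = Suc M" by (cases N) auto
    then show ?case using Suc.prems Suc.IH[of M "Dpartial b f"] by (simp add: funpow_Suc_right del: funpow.simps)
  qed
  let ?d = "- \<i> * complex_of_real (u \<bullet> b)"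
  have h1: "has_partial b (\<lambda>\<xi>. complex_of_real (u \<bullet> \<xi>) * (Dpartial b ^^ l) f \<xi>) \<xi>"
     "Dpartial b (\<lambda>\<xi>. complex_of_real (u \<bullet> \<xi>) * (Dpartial b ^^ l) f \<xi>) \<xi> = ?d * (Dpartial b ^^ l) f \<xi> + complex_of_real (u \<bullet> \<xi>) * (Dpartial b ^^ Suc l) f \<xi>" for \<xi>
    using Dpartial_mult[OF linear_partial(1)[of b u \<xi>] hp[of l \<xi>]] Suc.prems by (auto simp: linear_partial)
  have h2: "has_partial b (\<lambda>\<xi>. of_nat l * ?d * (Dpartial b ^^ (l - 1)) f \<xi>) \<xi>"
     "Dpartial b (\<lambda>\<xi>. of_nat l * ?d * (Dpartial b ^^ (l - 1)) f \<xi>) \<xi> = of_nat l * ?d * (Dpartial b ^^ l) f \<xi>" for \<xi>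
  proof -
    have "has_partial b ((Dpartial b ^^ (l - 1)) f) \<xi>" using Suc.prems by (intro hp) auto
    note c = Dpartial_cmult[OF this, of "of_nat l * ?d"]
    show "has_partial b (\<lambda>\<xi>. of_nat l * ?d * (Dpartial b ^^ (l - 1)) f \<xi>) \<xi>" by (rule c(1))
    show "Dpartial b (\<lambda>\<xi>. of_nat l * ?d * (Dpartial b ^^ (l - 1)) f \<xi>) \<xi> = of_nat l * ?d * (Dpartial b ^^ l) f \<xi>"
      unfolding c(2) by (cases l) auto
  qed
  have "(Dpartial b ^^ Suc l) (\<lambda>\<xi>. complex_of_real (u \<bullet> \<xi>) * f \<xi>) =
    Dpartial b (\<lambda>\<xi>. complex_of_real (u \<bullet> \<xi>) * (Dpartial b ^^ l) f \<xi> + of_nat l * ?d * (Dpartial b ^^ (l - 1)) f \<xi>)"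
    using Suc by simp
  also have "\<dots> = (\<lambda>\<xi>. ?d * (Dpartial b ^^ l) f \<xi> + complex_of_real (u \<bullet> \<xi>) * (Dpartial b ^^ Suc l) f \<xi> + of_nat l * ?d * (Dpartial b ^^ l) f \<xi>)"
    by (rule ext) (simp only: Dpartial_add(2)[OF h1(1) h2(1)] h1(2) h2(2))
  finally show ?case by (simp add: algebra_simps)
qed auto

text \<open>The factor itself contributes at most 4t. In the second Leibniz term l \<le> N \<le> r t
  turns l r^{l-1} into at most t r^l. Together they give 5t with the ratio unchanged.\<close>

lemma geo_bounded_linear:
  assumes "diff_along b N f" "geo_bounded b N \<xi> B r f" "\<bar>u \<bullet> \<xi>\<bar> \<le> 4 * t" "\<bar>u \<bullet> b\<bar> \<le> 1" "real N \<le> r * t" "0 \<le> r" "0 \<le> B" "0 \<le> t"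
  shows "geo_bounded b N \<xi> (5 * t * B) r (\<lambda>\<xi>. complex_of_real (u \<bullet> \<xi>) * f \<xi>)"
  unfolding geo_bounded_def
proof (intro allI impI)
  fix l assume l: "l \<le> N"
  have "norm ((Dpartial b ^^ l) (\<lambda>\<xi>. complex_of_real (u \<bullet> \<xi>) * f \<xi>) \<xi>) \<le>
     \<bar>u \<bullet> \<xi>\<bar> * norm ((Dpartial b ^^ l) f \<xi>) + l * \<bar>u \<bullet> b\<bar> * norm ((Dpartial b ^^ (l - 1)) f \<xi>)"
    unfolding Dpartial_pow_linear[OF assms(1) l] by (rule norm_triangle_le) (simp add: norm_mult)
  also have "\<dots> \<le> 4 * t * (B * r ^ l) + l * 1 * (B * r ^ (l - 1))"
    using assms l by (intro add_mono mult_mono mult_left_mono) (auto simp: geo_bounded_def mult_left_le)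
  also have "l * 1 * (B * r ^ (l - 1)) \<le> t * (B * r ^ l)"
  proof (cases l)
    case (Suc k)
    have "real l \<le> r * t" using assms(5) l by linarith
    then have "real l * (B * r ^ k) \<le> (r * t) * (B * r ^ k)" using assms by (intro mult_right_mono) auto
    then show ?thesis by (simp add: Suc mult_ac)
  qed (use assms in auto)
  finally show "norm ((Dpartial b ^^ l) (\<lambda>\<xi>. complex_of_real (u \<bullet> \<xi>) * f \<xi>) \<xi>) \<le> 5 * t * B * r ^ l"
    by (simp add: algebra_simps)
qed

locale amplitude = weight \<omega> for \<omega> +
  fixes a :: "'a::euclidean_space \<times> 'a \<times> 'a \<Rightarrow> complex" and m \<rho> :: real
  assumes GA: "a \<in> GA m \<omega> \<rho>" and rho: "0 < \<rho>" "\<rho> \<le> 1"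
begin

lemma a_smooth: "Cinf_on UNIV a"
  using GA by (simp add: GA_def)

abbreviation mfactor :: "'a \<Rightarrow> 'a \<Rightarrow> 'a \<Rightarrow> real"
  where "mfactor x y \<xi> \<equiv> exp (m * (\<omega> (norm x) + \<omega> (norm y) + \<omega> (norm \<xi>)))"

text \<open>The amplitude condition is stated for derivatives ordered as x, y, \<xi>. Smoothness
  allows the letters of an arbitrary word to be sorted, and e^{n\<rho>...} becomes a power \<rho> of
  \<open>young_exp\<close>.\<close>

lemma a_bound:
  assumes "n \<ge> 1"
  shows "\<exists>C>0. \<forall>x y \<xi> W. set W \<subseteq> Basis \<longrightarrow> norm (Dw W a (x, y, \<xi>)) \<le>
    C * (\<langle>x - y\<rangle> / \<langle>(x, y, \<xi>)\<rangle>) powr (\<rho> * length W) * young_exp (real n) (length W) powr \<rho> * mfactor x y \<xi>"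
proof -
  obtain C where C: "C > 0" "\<And>x y \<xi> \<alpha> \<beta> \<gamma>. let k = real (mi_size (\<lambda>i. \<alpha> i + \<beta> i + \<gamma> i)) in
        norm (Dmulti \<alpha> (\<lambda>x. Dmulti \<beta> (\<lambda>y. Dmulti \<gamma> (\<lambda>\<xi>. a (x, y, \<xi>)) \<xi>) y) x)
          \<le> C * (\<langle>x - y\<rangle> powr (\<rho> * k) / \<langle>(x, y, \<xi>)\<rangle> powr (\<rho> * k))
              * exp (real n * \<rho> * phi_star \<omega> (k / real n)) * mfactor x y \<xi>"
    using GA assms unfolding GA_def by blast
  show ?thesis
  proof (intro exI[of _ C] conjI allI impI C)
    fix x y \<xi> and W :: "('a \<times> 'a \<times> 'a) list" assume W: "set W \<subseteq> Basis"
    obtain u v w where uvw: "set u \<subseteq> Basis" "set v \<subseteq> Basis" "set w \<subseteq> Basis"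
      "mset W = mset (map (\<lambda>b. (b, 0, 0)) u @ map (\<lambda>b. (0, b, 0)) v @ map (\<lambda>b. (0, 0, b)) w)"
      using triple_word[OF W] by blast
    define \<alpha> \<beta> \<gamma> where "\<alpha> = count (mset u)" and "\<beta> = count (mset v)" and "\<gamma> = count (mset w)"
    have ms: "mset (mword \<alpha>) = mset u" "mset (mword \<beta>) = mset v" "mset (mword \<gamma>) = mset w"
      using uvw by (auto simp: \<alpha>_def \<beta>_def \<gamma>_def mset_mword_count)
    have "mset W = mset (map (\<lambda>b. (b, 0, 0)) (mword \<alpha>) @ map (\<lambda>b. (0, b, 0)) (mword \<beta>) @ map (\<lambda>b. (0, 0, b)) (mword \<gamma>))"
      by (simp only: uvw(4) mset_append mset_map ms)
    from Dw_mset[OF a_smooth W this]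
    have eq: "Dw W a (x, y, \<xi>) = Dmulti \<alpha> (\<lambda>x. Dmulti \<beta> (\<lambda>y. Dmulti \<gamma> (\<lambda>\<xi>. a (x, y, \<xi>)) \<xi>) y) x"
      by (simp only: Dmulti_triple)
    have "mi_size (\<lambda>i. \<alpha> i + \<beta> i + \<gamma> i) = mi_size \<alpha> + mi_size \<beta> + mi_size \<gamma>"
      by (simp add: mi_size_def sum.distrib)
    also have "\<dots> = length W"
      using mset_eq_length[OF uvw(4)] ms[THEN mset_eq_length] by (simp add: length_mword)
    finally have k: "mi_size (\<lambda>i. \<alpha> i + \<beta> i + \<gamma> i) = length W" .
    have P: "exp (real n * \<rho> * phi_star \<omega> (real (length W) / real n)) = young_exp (real n) (length W) powr \<rho>"
      by (simp add: young_exp_def powr_def mult_ac)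
    have R: "\<langle>x - y\<rangle> powr (\<rho> * length W) / \<langle>(x, y, \<xi>)\<rangle> powr (\<rho> * length W) = (\<langle>x - y\<rangle> / \<langle>(x, y, \<xi>)\<rangle>) powr (\<rho> * length W)"
      using jbracket_ge1[of "x - y"] jbracket_ge1[of "(x, y, \<xi>)"] by (simp add: powr_divide)
    show "norm (Dw W a (x, y, \<xi>)) \<le>
      C * (\<langle>x - y\<rangle> / \<langle>(x, y, \<xi>)\<rangle>) powr (\<rho> * length W) * young_exp (real n) (length W) powr \<rho> * mfactor x y \<xi>"
      using C(2)[of \<alpha> \<beta> \<gamma> \<xi> y x] by (simp only: Let_def k P R eq[symmetric])
  qed
qed

text \<open>\<open>H w v\<close> is defined such that \<open>D\<^sup>w (e\<^sup>i\<^sup>(\<^sup>x\<^sup>-\<^sup>y\<^sup>)\<^sup>\<xi> D\<^sup>v a) = e\<^sup>i\<^sup>(\<^sup>x\<^sup>-\<^sup>y\<^sup>)\<^sup>\<xi> H w v\<close> for derivatives in \<open>x\<close> and \<open>y\<close>.\<close>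

primrec H :: "('a \<times> 'a) list \<Rightarrow> ('a \<times> 'a) list \<Rightarrow> 'a \<times> 'a \<times> 'a \<Rightarrow> complex" where
  "H [] v = Dw (map emb v) a"
| "H (c # w) v = (\<lambda>z. complex_of_real ((fst c - snd c) \<bullet> snd (snd z)) * H w v z + H w (v @ [c]) z)"

lemma H_cont:
  assumes "set w \<subseteq> Basis" "set v \<subseteq> Basis" shows "continuous_on UNIV (H w v)"
  using assms
proof (induction w arbitrary: v)
  case Nil
  then show ?case using emb_word by (auto intro!: Cinf_cont[OF a_smooth] simp del: set_map)
next
  case (Cons c w)
  then show ?case by (auto intro!: continuous_intros)
qed

lemma linear_partial3:
  "has_partial (emb c) (\<lambda>z. complex_of_real (u \<bullet> snd (snd z))) z" "Dpartial (emb c) (\<lambda>z. complex_of_real (u \<bullet> snd (snd z))) z = 0"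
  using has_partialI[of "\<lambda>z. complex_of_real (u \<bullet> snd (snd z))" z "emb c" 0] by (auto simp: emb_def)

text \<open>The derivative puts its letter in front of v, while the recursion of \<open>H\<close>
  appends at the end; the two operations commute, which closes the induction. For v = [] both give
  the one-letter word, and only this case is needed for the oscillatory integrand.\<close>

lemma H_partial:
  assumes "set w \<subseteq> Basis" "set v \<subseteq> Basis" "c \<in> Basis"
  shows "has_partial (emb c) (H w v) z \<and> Dpartial (emb c) (H w v) z = H w (c # v) z"
  using assms
proof (induction w arbitrary: v)
  case Nil
  then show ?case using Cinf_partial[OF a_smooth emb_word emb_Basis] by simp
next
  case (Cons d w)
  have h: "has_partial (emb c) (H w v) z" "has_partial (emb c) (H w (v @ [d])) z"
    "Dpartial (emb c) (H w v) z = H w (c # v) z" "Dpartial (emb c) (H w (v @ [d])) z = H w (c # v @ [d]) z"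
    using Cons.IH[of v] Cons.IH[of "v @ [d]"] Cons.prems by auto
  note l = linear_partial3[of c "fst d - snd d" z]
  show ?case
    using Dpartial_add[OF Dpartial_mult(1)[OF l(1) h(1)] h(2)] Dpartial_mult(2)[OF l(1) h(1)] by (simp add: h l)
qed

lemma H_diff_along:
  assumes "set w \<subseteq> Basis" "set v \<subseteq> Basis" "b \<in> Basis"
  shows "diff_along b N (\<lambda>\<xi>. H w v (x, y, \<xi>))"
  using assms(1,2)
proof (induction w arbitrary: v)
  case Nil
  have "diff_along b N (\<lambda>\<xi>. Dw W a (x, y, \<xi>))" if "set W \<subseteq> Basis" for W
    using that
  proof (induction N arbitrary: W)
    case 0
    then show ?case by (auto intro!: Cinf_cont_compose[OF a_smooth] continuous_intros)
  next
    case (Suc N)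
    have hp: "has_partial (0, 0, b) (Dw W a) (x, y, \<xi>)" for \<xi>
      using Suc.prems Basis_third[OF assms(3)] by (intro Cinf_partial[OF a_smooth]) auto
    have D: "Dpartial b (\<lambda>\<xi>. Dw W a (x, y, \<xi>)) = (\<lambda>\<xi>. Dw ((0, 0, b) # W) a (x, y, \<xi>))"
      by (auto simp: Dpartial_def)
    show ?case
      using hp Suc.prems Suc.IH[of "(0, 0, b) # W"] Basis_third[OF assms(3)]
      by (auto simp: D has_partial_def intro!: Cinf_cont_compose[OF a_smooth] continuous_intros)
  qed
  from this[OF emb_word[OF Nil(2)]] show ?case by simp
next
  case (Cons c w)
  then show ?case by (auto intro!: diff_along_add diff_along_mult diff_along_linear)
qed

text \<open>Each letter of w yields either a factor linear in \<xi>, costing 5t, or one more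
  derivative of the amplitude; 5 + 1 = 6. The estimate is carried for t^p B with all p at once,
  because the first alternative calls the hypothesis with p + 1.\<close>

lemma H_geo_bounded:
  assumes b: "b \<in> Basis" and \<xi>: "\<And>c. c \<in> Basis \<Longrightarrow> \<bar>\<xi> \<bullet> c\<bar> \<le> 4 * t" and t: "0 \<le> t" "0 \<le> r" "real N \<le> r * t"
    and Q: "\<And>v. set v \<subseteq> Basis \<Longrightarrow> geo_bounded b N \<xi> (Q (length v)) r (\<lambda>\<xi>. Dw (map emb v) a (x, y, \<xi>))" "\<And>k. 0 \<le> Q k"
    and S: "\<And>k p. t ^ p * Q k \<le> S (k + p)"
    and "set w \<subseteq> Basis" "set v \<subseteq> Basis"
  shows "\<exists>B\<ge>0. geo_bounded b N \<xi> B r (\<lambda>\<xi>. H w v (x, y, \<xi>)) \<and> (\<forall>p. t ^ p * B \<le> 6 ^ length w * S (length w + length v + p))"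
  using assms(9,10)
proof (induction w arbitrary: v)
  case Nil
  then show ?case using Q S by (intro exI[of _ "Q (length v)"]) auto
next
  case (Cons c w)
  have c: "c \<in> Basis" and w: "set w \<subseteq> Basis" using Cons.prems by auto
  obtain B1 where B1: "B1 \<ge> 0" "geo_bounded b N \<xi> B1 r (\<lambda>\<xi>. H w v (x, y, \<xi>))" "\<And>p. t ^ p * B1 \<le> 6 ^ length w * S (length w + length v + p)"
    using Cons.IH[OF w Cons.prems(2)] by blast
  obtain B2 where B2: "B2 \<ge> 0" "geo_bounded b N \<xi> B2 r (\<lambda>\<xi>. H w (v @ [c]) (x, y, \<xi>))" "\<And>p. t ^ p * B2 \<le> 6 ^ length w * S (length w + length (v @ [c]) + p)"
    using Cons.IH[OF w, of "v @ [c]"] Cons.prems by auto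
  have u: "\<bar>(fst c - snd c) \<bullet> \<xi>\<bar> \<le> 4 * t" "\<bar>(fst c - snd c) \<bullet> b\<bar> \<le> 1"
  proof -
    \<comment> \<open>The phase depends on x - y only, so a letter in x and a letter in y act as
      plus or minus the same basis vector.\<close>
    have "fst c - snd c \<in> Basis \<or> - (fst c - snd c) \<in> Basis" using c by (auto simp: Basis_prod_def)
    then obtain d s where d: "d \<in> Basis" "fst c - snd c = s *\<^sub>R d" "\<bar>s\<bar> = 1"
      by (metis abs_minus_cancel abs_one minus_minus scaleR_minus1_left scaleR_one)
    then show "\<bar>(fst c - snd c) \<bullet> \<xi>\<bar> \<le> 4 * t" using \<xi>[of d] by (simp add: abs_mult inner_commute)
    show "\<bar>(fst c - snd c) \<bullet> b\<bar> \<le> 1" using d b by (simp add: abs_mult inner_Basis)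
  qed
  have "geo_bounded b N \<xi> (5 * t * B1 + B2) r (\<lambda>\<xi>. complex_of_real ((fst c - snd c) \<bullet> \<xi>) * H w v (x, y, \<xi>) + H w (v @ [c]) (x, y, \<xi>))"
  proof (rule geo_bounded_add)
    show "geo_bounded b N \<xi> (5 * t * B1) r (\<lambda>\<xi>. complex_of_real ((fst c - snd c) \<bullet> \<xi>) * H w v (x, y, \<xi>))"
      using B1 u t w Cons.prems b by (intro geo_bounded_linear H_diff_along) auto
    show "diff_along b N (\<lambda>\<xi>. H w (v @ [c]) (x, y, \<xi>))" using w Cons.prems b by (intro H_diff_along) auto
    show "diff_along b N (\<lambda>\<xi>. complex_of_real ((fst c - snd c) \<bullet> \<xi>) * H w v (x, y, \<xi>))"
      using w Cons.prems b by (intro diff_along_mult diff_along_linear H_diff_along) auto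
  qed fact
  moreover have "t ^ p * (5 * t * B1 + B2) \<le> 6 ^ length (c # w) * S (length (c # w) + length v + p)" for p
    using B1(3)[of "Suc p"] B2(3)[of p] by (simp add: algebra_simps)
  moreover have "0 \<le> 5 * t * B1 + B2" using B1 B2 t by auto
  ultimately show ?case by (intro exI[of _ "5 * t * B1 + B2"]) auto
qed

end

lemma (in weight) young_exp_0: "\<mu> > 0 \<Longrightarrow> young_exp \<mu> 0 = 1"
  by (intro antisym young_exp_le young_exp_ge1) (auto intro!: mult_nonneg_nonneg w_nonneg)

lemma norm_le_DIM:
  fixes x :: "'a::euclidean_space"
  assumes "\<And>b. b \<in> Basis \<Longrightarrow> \<bar>x \<bullet> b\<bar> \<le> c"
  shows "norm x \<le> real DIM('a) * c"
proof -
  have "norm x \<le> (\<Sum>b\<in>Basis. \<bar>x \<bullet> b\<bar>)" by (rule norm_le_l1)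
  also have "\<dots> \<le> (\<Sum>b\<in>(Basis::'a set). c)" by (intro sum_mono assms)
  finally show ?thesis by simp
qed

lemma exists_large_coordinate:
  fixes x :: "'a::euclidean_space"
  obtains b where "b \<in> Basis" "norm x \<le> real DIM('a) * \<bar>x \<bullet> b\<bar>"
proof -
  define c where "c = Max ((\<lambda>b. \<bar>x \<bullet> b\<bar>) ` Basis)"
  have "c \<in> (\<lambda>b. \<bar>x \<bullet> b\<bar>) ` Basis" unfolding c_def by (intro Max_in) auto
  then obtain b where "b \<in> Basis" "c = \<bar>x \<bullet> b\<bar>" by auto
  moreover have "norm x \<le> real DIM('a) * c"
    by (rule norm_le_DIM) (auto simp: c_def)
  ultimately show ?thesis using that by metis
qed

section \<open>Estimate of a single dyadic piece of the oscillatory integral\<close>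

context amplitude
begin

text \<open>A common bound for the derivative ratios 4N/t of the cutoffs at the scales t and 2t,
  whose orders are at most sqrt(t \<omega>(t)) + 2 at the respective scale.\<close>

definition cutoff_rate :: "real \<Rightarrow> real" where "cutoff_rate t = 8 * (sqrt (\<omega> (2 * t) / t) + 1 / t)"

text \<open>The second condition makes the denominator in the amplitude bound at least t. It holds
  on a shell |\<xi>| \<ge> t, or for all \<xi> if (x, y) is itself that large.\<close>

definition cutset :: "real \<Rightarrow> 'a \<Rightarrow> 'a \<Rightarrow> 'a set"
  where "cutset t x y = {\<xi>. (\<forall>b\<in>Basis. \<bar>\<xi> \<bullet> b\<bar> \<le> 4 * t) \<and> t \<le> \<langle>(x, y, \<xi>)\<rangle>}"

text \<open>A common description of the first truncation and of the differences of consecutive ones.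
  The constant 2 is the sum of two cutoffs bounded by 1; outside the region all derivatives
  vanish.\<close>

definition goodcut :: "real \<Rightarrow> ('a \<Rightarrow> complex) \<Rightarrow> 'a \<Rightarrow> 'a \<Rightarrow> bool" where
  "goodcut t \<psi> x y \<longleftrightarrow> (\<exists>N::nat. sqrt (t * \<omega> t) \<le> N \<and> (\<forall>b\<in>Basis. diff_along b N \<psi> \<and>
     (\<forall>\<xi>. geo_bounded b N \<xi> 2 (cutoff_rate t) \<psi>) \<and> (\<forall>\<xi>. \<xi> \<notin> cutset t x y \<longrightarrow> geo_bounded b N \<xi> 0 (cutoff_rate t) \<psi>)))"

lemma cutoff_rate_pos: "t > 0 \<Longrightarrow> cutoff_rate t > 0"
  using w_nonneg[of "2 * t"] by (auto simp: cutoff_rate_def intro!: add_nonneg_pos)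

lemma Dpartial_pow_third:
  "(Dpartial b ^^ l) (\<lambda>\<xi>. Dw W a (x, y, \<xi>)) = (\<lambda>\<xi>. Dw (replicate l (0, 0, b) @ W) a (x, y, \<xi>))"
proof (induction l)
  case (Suc l)
  have "Dpartial b (\<lambda>\<xi>. Dw V a (x, y, \<xi>)) = (\<lambda>\<xi>. Dw ((0, 0, b) # V) a (x, y, \<xi>))" for V
    by (auto simp: Dpartial_def)
  then show ?case using Suc by simp
qed simp

abbreviation growth :: "real \<Rightarrow> real \<Rightarrow> real"
  where "growth d t \<equiv> exp (\<bar>m\<bar> * (2 * \<omega> (2 * t) + \<omega> (4 * d * t)))"

lemma mfactor_le:
  assumes "t \<ge> 1" "norm x \<le> 2 * t" "norm y \<le> 2 * t" "\<xi> \<in> cutset t x y"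
  shows "mfactor x y \<xi> \<le> growth (real DIM('a)) t"
proof -
  have "norm \<xi> \<le> real DIM('a) * (4 * t)"
    by (rule norm_le_DIM) (use assms in \<open>auto simp: cutset_def\<close>)
  then have "\<omega> (norm x) \<le> \<omega> (2 * t)" "\<omega> (norm y) \<le> \<omega> (2 * t)" "\<omega> (norm \<xi>) \<le> \<omega> (4 * real DIM('a) * t)"
    using assms by (auto intro!: w_mono simp: mult_ac)
  moreover have "0 \<le> \<omega> (norm x)" "0 \<le> \<omega> (norm y)" "0 \<le> \<omega> (norm \<xi>)" by (auto intro: w_nonneg)
  ultimately have "m * (\<omega> (norm x) + \<omega> (norm y) + \<omega> (norm \<xi>)) \<le> \<bar>m\<bar> * (2 * \<omega> (2 * t) + \<omega> (4 * real DIM('a) * t))"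
    by (intro mult_mono) auto
  then show ?thesis by simp
qed

text \<open>Partial integration with N and the ratio r still free. Splitting n into halves leaves
  n/2 for the \<xi>-derivatives, measured by r, and n/2 \<ge> \<mu> for those in (x, y). The base 12
  is 2 from \<open>jbracket_diff\<close> times 6 from \<open>H_geo_bounded\<close>.\<close>

lemma piece_parts:
  fixes n :: nat
  assumes n: "n \<ge> 1" and mu: "0 < \<mu>" "\<mu> \<le> n / 2"
    and C: "C > 0" "\<And>x y \<xi> W. set W \<subseteq> Basis \<Longrightarrow> norm (Dw W a (x, y, \<xi>)) \<le>
      C * (\<langle>x - y\<rangle> / \<langle>(x, y, \<xi>)\<rangle>) powr (\<rho> * length W) * young_exp (real n) (length W) powr \<rho> * mfactor x y \<xi>"
    and t: "t \<ge> 1" "norm x \<le> 2 * t" "norm y \<le> 2 * t" and cut: "goodcut t \<psi> x y"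
    and b: "b \<in> Basis" and N: "real N \<le> sqrt (t * \<omega> t)" and r: "r > 0" "real N \<le> r * t"
    and rl: "\<And>l. l \<le> N \<Longrightarrow> (\<langle>x - y\<rangle> / t) powr (\<rho> * l) * young_exp (n / 2) l powr \<rho> \<le> r ^ l"
    and w: "set w \<subseteq> Basis"
  shows "norm (LINT \<xi>|lborel. exp (\<i> * complex_of_real (\<xi> \<bullet> (x - y))) * (\<psi> \<xi> * H w [] (x, y, \<xi>))) * \<bar>(x - y) \<bullet> b\<bar> ^ N
    \<le> 2 * (C * growth (real DIM('a)) t * exp (\<mu> * \<omega> t) * 12 ^ length w * young_exp \<mu> (length w)) * (cutoff_rate t + r) ^ N *
       ((1 + (4 * real DIM('a) * t)\<^sup>2) ^ DIM('a) * (LINT \<xi>|lborel. prod_majorant (\<xi>::'a)))"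
proof -
  obtain dyadic_order :: nat where dyadic_order: "sqrt (t * \<omega> t) \<le> dyadic_order" and cutb: "diff_along b dyadic_order \<psi>" "\<And>\<xi>. geo_bounded b dyadic_order \<xi> 2 (cutoff_rate t) \<psi>"
    "\<And>\<xi>. \<xi> \<notin> cutset t x y \<Longrightarrow> geo_bounded b dyadic_order \<xi> 0 (cutoff_rate t) \<psi>"
    using cut b unfolding goodcut_def by blast
  have "N \<le> dyadic_order" using N dyadic_order by linarith
  then have ch: "diff_along b N \<psi>" "\<And>\<xi>. geo_bounded b N \<xi> 2 (cutoff_rate t) \<psi>" "\<And>\<xi>. \<xi> \<notin> cutset t x y \<Longrightarrow> geo_bounded b N \<xi> 0 (cutoff_rate t) \<psi>"
    using cutb diff_along_le geo_bounded_le by blast+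
  have R0: "cutoff_rate t > 0" using t by (intro cutoff_rate_pos) simp
  define M where "M = growth (real DIM('a)) t"
  have M0: "M > 0" by (simp add: M_def)
  \<comment> \<open>\<open>Q\<close> bounds the amplitude after k derivatives in (x, y), and
    \<open>S\<close> the same after powers of t have been absorbed by
    \<open>young_exp_add_power\<close>.\<close>
  define Q where "Q = (\<lambda>k. C * M * 2 ^ k * young_exp (n / 2) (real k))"
  define S where "S = (\<lambda>k. C * M * exp (\<mu> * \<omega> t) * 2 ^ k * young_exp \<mu> (real k))"
  define h where "h = (\<lambda>\<xi>. H w [] (x, y, \<xi>))"
  define A where "A = 6 ^ length w * S (length w)"
  have A0: "A \<ge> 0" using C M0 by (simp add: A_def S_def)
  have hreg: "diff_along b N h" unfolding h_def using w b by (intro H_diff_along) auto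
  have hgb: "geo_bounded b N \<xi> A r h" if xi: "\<xi> \<in> cutset t x y" for \<xi>
  proof -
    have base: "geo_bounded b N \<xi> (Q (length v)) r (\<lambda>\<xi>. Dw (map emb v) a (x, y, \<xi>))" if v: "set v \<subseteq> Basis" for v
      unfolding geo_bounded_def
    proof (intro allI impI)
      fix l assume l: "l \<le> N"
      let ?k = "length v" and ?j = "\<langle>x - y\<rangle> / \<langle>(x, y, \<xi>)\<rangle>"
      have j0: "?j > 0" using jbracket_ge1[of "x - y"] jbracket_ge1[of "(x, y, \<xi>)"] by simp
      have j2: "?j \<le> 2" using jbracket_diff[of x y \<xi>] jbracket_ge1[of "(x, y, \<xi>)"] by (simp add: divide_le_eq)
      have jt: "?j \<le> \<langle>x - y\<rangle> / t"
        using xi t jbracket_ge1[of "x - y"] by (intro divide_left_mono) (auto simp: cutset_def)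
      have "?j powr (\<rho> * real (l + ?k)) = ?j powr (\<rho> * l) * ?j powr (\<rho> * ?k)"
        by (simp add: powr_add[symmetric] distrib_left)
      also have "\<dots> \<le> (\<langle>x - y\<rangle> / t) powr (\<rho> * l) * 2 ^ ?k"
      proof (intro mult_mono)
        show "?j powr (\<rho> * l) \<le> (\<langle>x - y\<rangle> / t) powr (\<rho> * l)"
          using jt j0 rho by (intro powr_mono2) auto
        have "?j powr (\<rho> * ?k) \<le> 2 powr (\<rho> * ?k)" using j2 j0 rho by (intro powr_mono2) auto
        also have "\<dots> \<le> 2 powr (1 * real ?k)" using rho by (intro powr_mono mult_right_mono) auto
        finally show "?j powr (\<rho> * ?k) \<le> 2 ^ ?k" by (simp add: powr_realpow)
      qed auto
      finally have 1: "?j powr (\<rho> * real (l + ?k)) \<le> (\<langle>x - y\<rangle> / t) powr (\<rho> * l) * 2 ^ ?k" .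
      have "young_exp n (real (l + ?k)) powr \<rho> \<le> (young_exp (n / 2) l * young_exp (n / 2) ?k) powr \<rho>"
        using young_exp_split[of n l ?k] n rho by (intro powr_mono2) auto
      also have "\<dots> = young_exp (n / 2) l powr \<rho> * young_exp (n / 2) ?k powr \<rho>" by (simp add: powr_mult)
      also have "young_exp (n / 2) ?k powr \<rho> \<le> young_exp (n / 2) ?k powr 1"
        using young_exp_ge1[of "n/2" ?k] n rho by (intro powr_mono) auto
      finally have 2: "young_exp n (real (l + ?k)) powr \<rho> \<le> young_exp (n / 2) l powr \<rho> * young_exp (n / 2) ?k"
        by (simp add: mult_left_mono)
      have "norm ((Dpartial b ^^ l) (\<lambda>\<xi>. Dw (map emb v) a (x, y, \<xi>)) \<xi>) \<le>
        C * ?j powr (\<rho> * real (l + ?k)) * young_exp n (real (l + ?k)) powr \<rho> * mfactor x y \<xi>"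
      proof -
        have "set (replicate l (0, 0, b) @ map emb v) \<subseteq> Basis"
          using emb_word[OF v] Basis_third[OF b] by (simp add: set_replicate_conv_if)
        from C(2)[OF this, of x y \<xi>] show ?thesis by (simp add: Dpartial_pow_third)
      qed
      also have "\<dots> \<le> C * ((\<langle>x - y\<rangle> / t) powr (\<rho> * l) * 2 ^ ?k) * (young_exp (n / 2) l powr \<rho> * young_exp (n / 2) ?k) * M"
        using 1 2 mfactor_le[OF t xi] C(1) unfolding M_def by (intro mult_mono) auto
      also have "\<dots> = Q ?k * ((\<langle>x - y\<rangle> / t) powr (\<rho> * l) * young_exp (n / 2) l powr \<rho>)"
        by (simp add: Q_def)
      also have "\<dots> \<le> Q ?k * r ^ l" using rl[OF l] C(1) M0 by (intro mult_left_mono) (auto simp: Q_def)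
      finally show "norm ((Dpartial b ^^ l) (\<lambda>\<xi>. Dw (map emb v) a (x, y, \<xi>)) \<xi>) \<le> Q ?k * r ^ l" .
    qed
    have step: "t ^ p * Q k \<le> S (k + p)" for k p
    proof -
      have "t ^ p * young_exp (n / 2) k \<le> t ^ p * young_exp \<mu> k"
        using mu t by (intro mult_left_mono young_exp_antimono) auto
      also have "\<dots> \<le> exp (\<mu> * \<omega> t) * young_exp \<mu> (real k + real p)" using mu t by (intro young_exp_add_power) auto
      finally have "(t ^ p * young_exp (n / 2) k) * 2 ^ k \<le> (exp (\<mu> * \<omega> t) * young_exp \<mu> (real (k + p))) * 2 ^ (k + p)"
        using t by (intro mult_mono[of _ "exp _ * _"] power_increasing) auto
      then have "(C * M) * ((t ^ p * young_exp (n / 2) k) * 2 ^ k) \<le> (C * M) * ((exp (\<mu> * \<omega> t) * young_exp \<mu> (real (k + p))) * 2 ^ (k + p))"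
        using C(1) M0 by (intro mult_left_mono) auto
      then show ?thesis by (simp add: Q_def S_def mult_ac)
    qed
    have xi4: "\<bar>\<xi> \<bullet> c\<bar> \<le> 4 * t" if "c \<in> Basis" for c using xi that by (auto simp: cutset_def)
    have Q0: "0 \<le> Q k" for k using C(1) M0 by (simp add: Q_def)
    obtain B where B: "B \<ge> 0" "geo_bounded b N \<xi> B r h" "\<forall>p. t ^ p * B \<le> 6 ^ length w * S (length w + length ([]::('a\<times>'a) list) + p)"
      using H_geo_bounded[OF b xi4 _ _ r(2) base Q0 step w, of "[]"] t r by (auto simp: h_def)
    have "B \<le> A" using B(3)[rule_format, of 0] by (simp add: A_def)
    then show ?thesis using geo_bounded_mono[OF B(2)] B(1) r by simp
  qed
  define G where "G = (\<lambda>\<xi>. \<psi> \<xi> * h \<xi>)"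
  have Greg: "diff_along b N G" unfolding G_def by (intro diff_along_mult ch hreg)
  \<comment> \<open>On the cube V times the majorant is at least 1. The bound by a constant there
    thus becomes an integrable one, at a polynomial price in t.\<close>
  define V where "V = (1 + (4 * real DIM('a) * t)\<^sup>2) ^ DIM('a)"
  have Gb: "norm ((Dpartial b ^^ l) G \<xi>) \<le> 2 * A * (cutoff_rate t + r) ^ l * (V * prod_majorant \<xi>)" if l: "l \<le> N" for l \<xi>
  proof (cases "\<xi> \<in> cutset t x y")
    case True
    have "geo_bounded b N \<xi> (2 * A) (cutoff_rate t + r) G"
      unfolding G_def using R0 r A0 by (intro geo_bounded_mult ch hreg hgb True) auto
    then have "norm ((Dpartial b ^^ l) G \<xi>) \<le> 2 * A * (cutoff_rate t + r) ^ l * 1" using l by (simp add: geo_bounded_def)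
    also have "\<dots> \<le> 2 * A * (cutoff_rate t + r) ^ l * (V * prod_majorant \<xi>)"
    proof (rule mult_left_mono)
      have "norm \<xi> \<le> real DIM('a) * (4 * t)"
        by (rule norm_le_DIM) (use True in \<open>auto simp: cutset_def\<close>)
      then have "(1 + (norm \<xi>)\<^sup>2) ^ DIM('a) \<le> V"
        unfolding V_def by (intro power_mono add_left_mono) (auto simp: mult_ac)
      then show "1 \<le> V * prod_majorant \<xi>" using prod_majorant_lower[of \<xi>] prod_majorant_pos[of \<xi>]
        by (meson less_imp_le mult_right_mono order.trans)
    qed (use A0 R0 r in auto)
    finally show ?thesis .
  next
    case False
    \<comment> \<open>Off the region the cutoff has constant 0, so any finite constant for the other
      factor makes the product vanish.\<close>
    obtain B where B: "B \<ge> 0" "geo_bounded b N \<xi> B r h" using geo_bounded_exists[OF r(1)] by blast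
    have "geo_bounded b N \<xi> (0 * B) (cutoff_rate t + r) G"
      unfolding G_def using R0 r B by (intro geo_bounded_mult ch hreg False) auto
    then have "norm ((Dpartial b ^^ l) G \<xi>) \<le> 0" using l by (simp add: geo_bounded_def)
    also have "0 \<le> 2 * A * (cutoff_rate t + r) ^ l * (V * prod_majorant \<xi>)"
      using A0 R0 r prod_majorant_pos[of \<xi>] by (auto simp: V_def intro!: mult_nonneg_nonneg)
    finally show ?thesis .
  qed
  have VJ: "0 \<le> V * prod_majorant \<xi>" for \<xi> :: 'a using prod_majorant_pos[of \<xi>] by (simp add: V_def)
  have "norm (LINT \<xi>|lborel. exp (\<i> * complex_of_real (\<xi> \<bullet> (x - y))) * G \<xi>) * \<bar>(x - y) \<bullet> b\<bar> ^ N
    \<le> (LINT \<xi>|lborel. norm ((Dpartial b ^^ N) G \<xi>))"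
  proof (rule integral_exp_parts[OF b Greg])
    fix l and \<xi> :: 'a assume l: "l \<le> N"
    have "(cutoff_rate t + r) ^ l \<le> (1 + (cutoff_rate t + r)) ^ N"
      using R0 r l by (intro order.trans[OF power_mono[of "cutoff_rate t + r" "1 + (cutoff_rate t + r)"]] power_increasing) auto
    then have "2 * A * (cutoff_rate t + r) ^ l * (V * prod_majorant \<xi>) \<le> 2 * A * (1 + (cutoff_rate t + r)) ^ N * (V * prod_majorant \<xi>)"
      using A0 VJ by (intro mult_right_mono mult_left_mono) auto
    then show "norm ((Dpartial b ^^ l) G \<xi>) \<le> (2 * A * (1 + (cutoff_rate t + r)) ^ N * V) * prod_majorant \<xi>"
      using Gb[OF l, of \<xi>] by (simp add: mult.assoc)
  qed
  also have "\<dots> \<le> (LINT \<xi>|lborel. 2 * A * (cutoff_rate t + r) ^ N * (V * prod_majorant (\<xi>::'a)))"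
  proof (rule integral_mono)
    show i: "integrable lborel (\<lambda>\<xi>::'a. 2 * A * (cutoff_rate t + r) ^ N * (V * prod_majorant \<xi>))"
      by (intro integrable_mult_right prod_majorant_integrable)
    have "continuous_on UNIV ((Dpartial b ^^ N) G)" by (rule diff_along_Dcont[OF Greg]) simp
    then show "integrable lborel (\<lambda>\<xi>. norm ((Dpartial b ^^ N) G \<xi>))"
      using Gb[of N] by (intro Bochner_Integration.integrable_bound[OF i])
        (auto intro!: AE_I2 borel_measurable_continuous_onI continuous_intros order.trans[OF _ abs_ge_self])
  qed (use Gb in auto)
  also have "\<dots> = 2 * A * (cutoff_rate t + r) ^ N * (V * (LINT \<xi>|lborel. prod_majorant (\<xi>::'a)))"
    by simp
  also have "A = C * growth (real DIM('a)) t * exp (\<mu> * \<omega> t) * 12 ^ length w * young_exp \<mu> (length w)"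
  proof -
    have "(12::real) ^ k = 2 ^ k * 6 ^ k" for k by (simp add: power_mult_distrib[symmetric])
    then show ?thesis by (simp add: A_def S_def M_def mult_ac)
  qed
  finally show ?thesis unfolding G_def h_def V_def .
qed

text \<open>Let q = e^{-\<omega>(t/B)/P}. Each partial integration has ratio at most |(x-y)
  \<bullet> b| q^{\<rho>/4}, so N \<ge> n P / 4 of them gain e^{-\<rho> n \<omega>(t/B)/16}. The
  index n is chosen so that this beats \<Lambda> and all growth terms.\<close>

lemma piece_bound:
  assumes r0: "r0 > 0" and mu: "\<mu> > 0" and La: "\<Lambda> > 0"
  shows "\<exists>C>0. \<forall>t\<ge>1. \<forall>\<psi> x y w. r0 \<le> norm (x - y) \<longrightarrow> norm x \<le> 2 * t \<longrightarrow> norm y \<le> 2 * t \<longrightarrow>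
    goodcut t \<psi> x y \<longrightarrow> set w \<subseteq> Basis \<longrightarrow>
    norm (LINT \<xi>|lborel. exp (\<i> * complex_of_real (\<xi> \<bullet> (x - y))) * (\<psi> \<xi> * H w [] (x, y, \<xi>)))
      \<le> C * exp (- \<Lambda> * \<omega> t) * (12 ^ length w * young_exp \<mu> (length w))"
proof -
  define d where "d = real DIM('a)"
  have d: "d \<ge> 1" by (simp add: d_def Suc_leI)
  \<comment> \<open>The power \<rho> of B must exceed twice the quotient of \<langle>x-y\<rangle> by
    the largest coordinate of x - y, which is at most (1 + 1/r0) d. The bound B \<ge> e is what
    \<open>rate_order\<close> asks for.\<close>
  define B where "B = max (exp 1) ((2 * (1 + 1 / r0) * d) powr (1 / \<rho>))"
  have B: "B \<ge> exp 1" by (simp add: B_def)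
  have B1: "B \<ge> 1" using B one_le_exp_iff[of 1] by linarith
  have c0: "2 * (1 + 1 / r0) * d > 0" using d r0 by (auto intro!: mult_pos_pos add_pos_pos)
  have "((2 * (1 + 1 / r0) * d) powr (1 / \<rho>)) powr \<rho> \<le> B powr \<rho>"
    using rho by (intro powr_mono2) (auto simp: B_def)
  then have Brho: "2 * (1 + 1 / r0) * d \<le> B powr \<rho>" using c0 rho by (simp add: powr_powr)
  obtain L where L: "L \<ge> 1" "\<And>s. s \<ge> 0 \<Longrightarrow> \<omega> (B * s) \<le> L * (\<omega> s + 1)"
    using w_scale[of B] B1 by auto
  obtain L1 where L1: "L1 \<ge> 1" "\<And>s. s \<ge> 0 \<Longrightarrow> \<omega> (4 * d * s) \<le> L1 * (\<omega> s + 1)"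
    using w_scale[of "4 * d"] d by auto
  obtain Cv where Cv: "Cv \<ge> 0" "\<And>t. t \<ge> 1 \<Longrightarrow> real (2 * DIM('a)) * ln t \<le> \<omega> t + Cv"
    using w_ln[of "real (2 * DIM('a))"] by blast
  \<comment> \<open>The losses in units of \<omega>(t): three weights in the amplitude bound,
    exp(\<mu>\<omega>(t)) from the powers of \<xi>, and one unit for the polynomial volume
    factor.\<close>
  define E where "E = 3 * \<bar>m\<bar> * L1 + \<mu> + 1"
  have E: "E \<ge> 0" using L1 mu by (simp add: E_def)
  obtain n :: nat where n: "real n \<ge> max 2 (max (2 * \<mu>) (16 * L * (\<Lambda> + E) / \<rho>))"
    using real_arch_simple by blast
  have n2: "n \<ge> 1" "real n \<ge> 2" "\<mu> \<le> n / 2" using n by auto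
  have nL: "\<Lambda> + E \<le> \<rho> * n / (16 * L)"
  proof -
    have "16 * L * (\<Lambda> + E) / \<rho> \<le> n" using n by simp
    then show ?thesis using rho L by (simp add: field_simps)
  qed
  obtain C where C: "C > 0" "\<And>x y \<xi> W. set W \<subseteq> Basis \<Longrightarrow> norm (Dw W a (x, y, \<xi>)) \<le>
      C * (\<langle>x - y\<rangle> / \<langle>(x, y, \<xi>)\<rangle>) powr (\<rho> * length W) * young_exp (real n) (length W) powr \<rho> * mfactor x y \<xi>"
    using a_bound[OF n2(1)] by blast
  define I where "I = (LINT \<xi>|lborel. prod_majorant (\<xi>::'a))"
  have I: "I \<ge> 0" unfolding I_def by (intro integral_nonneg_AE AE_I2 less_imp_le[OF prod_majorant_pos])
  have "\<forall>\<^sub>F t in at_top. \<exists>P. rate (t / B) P"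
    by (rule eventually_compose_filterlim[OF rate_exists]) (use B1 in real_asymp)
  moreover have "\<forall>\<^sub>F t in at_top. \<forall>P. rate (t / B) P \<longrightarrow> real n * P \<le> sqrt (t * \<omega> t)" by (rule rate_order[OF B])
  moreover have "\<forall>\<^sub>F t in at_top. \<forall>P. rate (t / B) P \<longrightarrow>
    sqrt (\<omega> (2 * t) / t) + 1 / t \<le> r0 / (32 * d) * exp (- \<omega> (t / B) / P / 4)"
    using r0 d B1 by (intro rate_cutoff) auto
  ultimately have "\<forall>\<^sub>F t in at_top. (\<exists>P. rate (t / B) P) \<and> (\<forall>P. rate (t / B) P \<longrightarrow> real n * P \<le> sqrt (t * \<omega> t)) \<and>
    (\<forall>P. rate (t / B) P \<longrightarrow> sqrt (\<omega> (2 * t) / t) + 1 / t \<le> r0 / (32 * d) * exp (- \<omega> (t / B) / P / 4))"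
    by (intro eventually_conj)
  then obtain T where T: "\<And>t. t \<ge> T \<Longrightarrow> \<exists>P. rate (t / B) P" 
     "\<And>t P. t \<ge> T \<Longrightarrow> rate (t / B) P \<Longrightarrow> real n * P \<le> sqrt (t * \<omega> t)"
     "\<And>t P. t \<ge> T \<Longrightarrow> rate (t / B) P \<Longrightarrow> sqrt (\<omega> (2 * t) / t) + 1 / t \<le> r0 / (32 * d) * exp (- \<omega> (t / B) / P / 4)"
    unfolding eventually_at_top_linorder by blast
  define T1 where "T1 = max T 1"
  \<comment> \<open>The first summand serves large t, the second makes the claim trivial on the
    bounded range t < T1.\<close>
  define F where "F = exp (\<rho> * n / 16) + exp ((\<Lambda> + E) * \<omega> T1)"
  have F0: "F > 0" by (simp add: F_def add_pos_pos)
  define K where "K = 2 * C * exp (3 * \<bar>m\<bar> * L1) * ((17 * d\<^sup>2) ^ DIM('a) * exp Cv * (I + 1))"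
  have K0: "K > 0" using C d I by (auto simp: K_def intro!: mult_pos_pos)
  show ?thesis
  proof (intro exI[of _ "K * F"] conjI allI impI)
    fix t :: real and \<psi> x y and w :: "('a \<times> 'a) list"
    assume t: "1 \<le> t" and xy: "r0 \<le> norm (x - y)" "norm x \<le> 2 * t" "norm y \<le> 2 * t"
      and cut: "goodcut t \<psi> x y" and w: "set w \<subseteq> Basis"
    define X where "X = norm (LINT \<xi>|lborel. exp (\<i> * complex_of_real (\<xi> \<bullet> (x - y))) * (\<psi> \<xi> * H w [] (x, y, \<xi>)))"
    define V where "V = (1 + (4 * d * t)\<^sup>2) ^ DIM('a)"
    define D where "D = 12 ^ length w * young_exp \<mu> (length w)"
    have D0: "D > 0" by (simp add: D_def)
    obtain b where b: "b \<in> Basis" "norm (x - y) \<le> d * \<bar>(x - y) \<bullet> b\<bar>"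
      unfolding d_def using exists_large_coordinate by metis
    have zb: "\<bar>(x - y) \<bullet> b\<bar> > 0" using b xy r0 d
      by (metis abs_ge_zero less_eq_real_def linorder_not_less mult_zero_right order.trans zero_less_abs_iff)
    note parts = piece_parts[OF n2(1) mu n2(3) C t xy(2,3) cut b(1) _ _ _ _ w, folded X_def d_def I_def, folded V_def]
    have V: "V \<le> (17 * d\<^sup>2) ^ DIM('a) * exp Cv * exp (\<omega> t)"
    proof -
      have "1 + (4 * d * t)\<^sup>2 \<le> 17 * d\<^sup>2 * t\<^sup>2"
        using one_le_power[OF d, of 2] one_le_power[OF t, of 2] mult_mono[of 1 "d\<^sup>2" 1 "t\<^sup>2"]
        by (simp add: power_mult_distrib)
      then have "V \<le> (17 * d\<^sup>2 * t\<^sup>2) ^ DIM('a)" unfolding V_def by (intro power_mono) auto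
      also have "\<dots> = (17 * d\<^sup>2) ^ DIM('a) * t ^ (2 * DIM('a))" by (simp add: power_mult_distrib power_mult)
      also have "\<dots> \<le> (17 * d\<^sup>2) ^ DIM('a) * exp (\<omega> t + Cv)"
      proof (rule mult_left_mono)
        have "t ^ (2 * DIM('a)) = exp (real (2 * DIM('a)) * ln t)"
          using t by (subst exp_of_nat_mult) (subst exp_ln, auto)
        also have "\<dots> \<le> exp (\<omega> t + Cv)" using Cv(2)[OF t] by simp
        finally show "t ^ (2 * DIM('a)) \<le> exp (\<omega> t + Cv)" .
      qed simp
      finally show ?thesis by (simp add: exp_add mult_ac)
    qed
    have Gr: "growth d t \<le> exp (3 * \<bar>m\<bar> * L1) * exp (3 * \<bar>m\<bar> * L1 * \<omega> t)"
    proof -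
      have "\<omega> (2 * t) \<le> \<omega> (4 * d * t)" using t d by (intro w_mono) auto
      then have "2 * \<omega> (2 * t) + \<omega> (4 * d * t) \<le> 3 * (L1 * (\<omega> t + 1))" using L1(2)[of t] t by linarith
      then have "\<bar>m\<bar> * (2 * \<omega> (2 * t) + \<omega> (4 * d * t)) \<le> \<bar>m\<bar> * (3 * (L1 * (\<omega> t + 1)))"
        by (rule mult_left_mono) simp
      then show ?thesis by (simp add: mult_exp_exp algebra_simps)
    qed
    have const: "2 * (C * growth d t * exp (\<mu> * \<omega> t) * 12 ^ length w * young_exp \<mu> (length w)) * (V * I) \<le> K * exp (E * \<omega> t) * D"
    proof -
      have "2 * (C * growth d t * exp (\<mu> * \<omega> t) * 12 ^ length w * young_exp \<mu> (length w)) * (V * I)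
        \<le> 2 * (C * (exp (3 * \<bar>m\<bar> * L1) * exp (3 * \<bar>m\<bar> * L1 * \<omega> t)) * exp (\<mu> * \<omega> t) * 12 ^ length w * young_exp \<mu> (length w)) *
          (((17 * d\<^sup>2) ^ DIM('a) * exp Cv * exp (\<omega> t)) * (I + 1))"
        using C(1) Gr V I by (intro mult_mono mult_left_mono) (auto simp: V_def)
      also have "\<dots> = K * (exp (3 * \<bar>m\<bar> * L1 * \<omega> t) * exp (\<mu> * \<omega> t) * exp (\<omega> t)) * D"
        by (simp add: K_def D_def)
      also have "exp (3 * \<bar>m\<bar> * L1 * \<omega> t) * exp (\<mu> * \<omega> t) * exp (\<omega> t) = exp (E * \<omega> t)"
        by (simp add: E_def mult_exp_exp algebra_simps)
      finally show ?thesis .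
    qed
    have gain: "X \<le> K * exp (E * \<omega> t) * D * (F * exp (- (\<Lambda> + E) * \<omega> t))"
    proof (cases "t \<ge> T1")
      case True
      then have tT: "t \<ge> T" by (simp add: T1_def)
      obtain P where P: "rate (t / B) P" using T(1)[OF tT] by blast
      have P1: "P \<ge> 1" "\<And>l::nat. real l \<le> n / 2 * P \<Longrightarrow> young_exp (n / 2) l \<le> (t / B * exp (- \<omega> (t / B) / P)) ^ l"
        using P n2 unfolding rate_def by auto
      define q where "q = exp (- \<omega> (t / B) / P)"
      have q: "0 < q" "q \<le> 1" using P1 B1 t w_nonneg[of "t / B"] by (auto simp: q_def)
      \<comment> \<open>Half of n P, because only young_exp with index n/2 is available for the
        \<xi>-derivatives. Rounding down loses at most another half, as n P / 2 \<ge> 1.\<close>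
      define N where "N = nat \<lfloor>n / 2 * P\<rfloor>"
      have nP: "n / 2 * P \<ge> 1" using mult_mono[of 1 "n/2" 1 P] n2 P1 by simp
      have "1 \<le> \<lfloor>n / 2 * P\<rfloor>" using nP by (simp add: le_floor_iff)
      then have N1: "real N = of_int \<lfloor>n / 2 * P\<rfloor>" "real N \<ge> 1" by (simp_all add: N_def)
      have N: "real N \<le> n / 2 * P" unfolding N1 by (rule of_int_floor_le)
      have "n / 2 * P < real N + 1" unfolding N1 by (rule real_of_int_floor_add_one_gt)
      then have N': "n / 4 * P \<le> real N" using N1(2) by simp
      have RRq: "cutoff_rate t \<le> r0 / (4 * d) * q powr (1/4)"
        using T(3)[OF tT P] by (simp add: cutoff_rate_def q_def powr_def field_simps)
      have R0: "cutoff_rate t > 0" using t by (intro cutoff_rate_pos) simp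
      define z where "z = \<langle>x - y\<rangle>"
      have z: "z \<ge> 1" "z \<le> (1 + 1 / r0) * norm (x - y)"
      proof -
        show "z \<ge> 1" unfolding z_def by (rule jbracket_ge1)
        have "z \<le> sqrt ((1 + norm (x - y))\<^sup>2)" unfolding z_def jbracket_def
          by (intro real_sqrt_le_mono) (simp add: power2_eq_square algebra_simps)
        also have "\<dots> = 1 + norm (x - y)" by simp
        also have "\<dots> \<le> norm (x - y) / r0 + norm (x - y)" using xy r0 by simp
        finally show "z \<le> (1 + 1 / r0) * norm (x - y)" by (simp add: algebra_simps)
      qed
      \<comment> \<open>The amplitude loses z/t and the Young bound gives (t/B) q per derivative;
        their product z q / B does not contain t.\<close>
      define r1 where "r1 = (z * q / B) powr \<rho>"
      have r1: "0 < r1" using z q B1 by (simp add: r1_def)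
      have Nsq: "real N \<le> sqrt (t * \<omega> t)"
        using N T(2)[OF tT P] n2 P1 by (simp add: mult_ac)
      \<comment> \<open>Differentiating the powers of \<xi> requires N \<le> r t. The ratio of the
        cutoffs achieves this and is therefore added to \<open>r1\<close>, besides its own
        contribution in the product with the cutoff.\<close>
      have Nr: "real N \<le> (r1 + cutoff_rate t) * t"
      proof -
        have "sqrt (t * \<omega> t) = t * sqrt (\<omega> t / t)"
        proof -
          have "t * \<omega> t = t\<^sup>2 * (\<omega> t / t)" using t by (simp add: power2_eq_square)
          then have "sqrt (t * \<omega> t) = sqrt (t\<^sup>2) * sqrt (\<omega> t / t)" by (simp only: real_sqrt_mult)
          then show ?thesis using t by simp
        qed
        also have "\<dots> \<le> t * cutoff_rate t"
        proof -
          have "sqrt (\<omega> t / t) \<le> sqrt (\<omega> (2 * t) / t)"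
            using t by (intro real_sqrt_le_mono divide_right_mono w_mono) auto
          also have "\<dots> \<le> cutoff_rate t" using t w_nonneg[of "2 * t"] by (simp add: cutoff_rate_def)
          finally show ?thesis using t by (intro mult_left_mono) auto
        qed
        also have "\<dots> \<le> (r1 + cutoff_rate t) * t" using t r1 by (simp add: mult.commute mult_left_mono)
        finally show ?thesis using Nsq by linarith
      qed
      have rl: "(\<langle>x - y\<rangle> / t) powr (\<rho> * l) * young_exp (n / 2) l powr \<rho> \<le> (r1 + cutoff_rate t) ^ l" if l: "l \<le> N" for l
      proof -
        have "young_exp (n / 2) l powr \<rho> \<le> ((t / B * q) ^ l) powr \<rho>"
          using P1(2)[of l] l N rho by (intro powr_mono2) (auto simp: q_def)
        then have "(z / t) powr (\<rho> * l) * young_exp (n / 2) l powr \<rho> \<le> (z / t) powr (\<rho> * l) * ((t / B * q) ^ l) powr \<rho>"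
          by (rule mult_left_mono) simp
        also have "\<dots> = (z / t) powr (\<rho> * l) * (t / B * q) powr (\<rho> * l)"
          using t B1 q by (simp add: powr_realpow[symmetric] powr_powr mult.commute)
        also have "\<dots> = (z / t * (t / B * q)) powr (\<rho> * l)"
          using z t B1 q by (subst powr_mult) auto
        also have "z / t * (t / B * q) = z * q / B" using t by simp
        also have "(z * q / B) powr (\<rho> * l) = r1 ^ l"
          using r1 by (simp add: r1_def powr_realpow[symmetric] powr_powr)
        also have "\<dots> \<le> (r1 + cutoff_rate t) ^ l" using r1 R0 by (intro power_mono) auto
        finally show ?thesis by (simp add: z_def)
      qed
      have "X * \<bar>(x - y) \<bullet> b\<bar> ^ N \<le> 2 * (C * growth d t * exp (\<mu> * \<omega> t) * 12 ^ length w * young_exp \<mu> (length w)) * (cutoff_rate t + (r1 + cutoff_rate t)) ^ N * (V * I)"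
        using r1 R0 by (intro parts Nsq Nr rl) auto
      also have "\<dots> = (2 * (C * growth d t * exp (\<mu> * \<omega> t) * 12 ^ length w * young_exp \<mu> (length w)) * (V * I)) * (r1 + 2 * cutoff_rate t) ^ N"
        by (simp add: mult_ac add.commute[of r1])
      also have "\<dots> \<le> (K * exp (E * \<omega> t) * D) * (r1 + 2 * cutoff_rate t) ^ N"
        using const r1 R0 by (intro mult_right_mono) auto
      also have "(r1 + 2 * cutoff_rate t) ^ N \<le> (\<bar>(x - y) \<bullet> b\<bar> * q powr (\<rho> / 4)) ^ N"
      proof (intro power_mono)
        have zB: "z \<le> \<bar>(x - y) \<bullet> b\<bar> * (B powr \<rho> / 2)"
        proof -
          have "z \<le> (1 + 1 / r0) * (d * \<bar>(x - y) \<bullet> b\<bar>)"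
            using z(2) b(2) r0 by (meson add_nonneg_nonneg divide_nonneg_pos mult_left_mono order.trans zero_le_one)
          also have "\<dots> = \<bar>(x - y) \<bullet> b\<bar> * ((2 * (1 + 1 / r0) * d) / 2)" by simp
          also have "\<dots> \<le> \<bar>(x - y) \<bullet> b\<bar> * (B powr \<rho> / 2)"
            using Brho by (intro mult_left_mono divide_right_mono) auto
          finally show ?thesis .
        qed
        have "r1 = z powr \<rho> * q powr \<rho> / B powr \<rho>"
          using z q B1 by (simp add: r1_def powr_divide powr_mult)
        \<comment> \<open>As z \<ge> 1 and \<rho> \<le> 1, the power \<rho> of z is at most z. As q
          \<le> 1, its exponent may be lowered to \<rho>/4, the one that the cutoff ratio
          allows.\<close>
        also have "\<dots> \<le> z powr 1 * q powr (\<rho> / 4) / B powr \<rho>"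
          using z q rho by (intro divide_right_mono mult_mono powr_mono powr_mono') auto
        also have "\<dots> \<le> \<bar>(x - y) \<bullet> b\<bar> * (B powr \<rho> / 2) * q powr (\<rho> / 4) / B powr \<rho>"
          using zB z by (intro divide_right_mono mult_right_mono) auto
        also have "\<dots> = \<bar>(x - y) \<bullet> b\<bar> * q powr (\<rho> / 4) / 2" using B1 by simp
        finally have 1: "r1 \<le> \<bar>(x - y) \<bullet> b\<bar> * q powr (\<rho> / 4) / 2" .
        have "2 * cutoff_rate t \<le> r0 / d * q powr (1/4) / 2" using RRq by simp
        also have "\<dots> \<le> r0 / d * q powr (\<rho>/4) / 2"
          using q rho r0 d by (intro divide_right_mono mult_left_mono powr_mono') auto
        also have "\<dots> \<le> \<bar>(x - y) \<bullet> b\<bar> * q powr (\<rho>/4) / 2"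
          using b xy d by (intro divide_right_mono mult_right_mono) (auto simp: divide_le_eq mult.commute)
        finally show "r1 + 2 * cutoff_rate t \<le> \<bar>(x - y) \<bullet> b\<bar> * q powr (\<rho> / 4)" using 1 by simp
      qed (use r1 R0 in auto)
      finally have "X * \<bar>(x - y) \<bullet> b\<bar> ^ N \<le> (K * exp (E * \<omega> t) * D) * (q powr (\<rho> / 4)) ^ N * \<bar>(x - y) \<bullet> b\<bar> ^ N"
        using K0 D0 by (simp add: power_mult_distrib mult_ac)
      then have "X \<le> (K * exp (E * \<omega> t) * D) * (q powr (\<rho> / 4)) ^ N" using zb by simp
      also have "(q powr (\<rho> / 4)) ^ N \<le> F * exp (- (\<Lambda> + E) * \<omega> t)"
      proof -
        have "(q powr (\<rho> / 4)) ^ N = exp (- (\<omega> (t / B) * \<rho> / (4 * P) * N))"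
          by (simp add: q_def powr_def exp_of_nat_mult[symmetric] mult_ac)
        also have "\<dots> \<le> exp (- (\<omega> (t / B) * \<rho> / (4 * P) * (n / 4 * P)))"
        proof -
          have "0 \<le> \<omega> (t / B) * \<rho> / (4 * P)" using w_nonneg[of "t / B"] t B1 rho P1 by simp
          from mult_left_mono[OF N' this] show ?thesis by (simp only: exp_le_cancel_iff neg_le_iff_le)
        qed
        also have "\<dots> = exp (- (\<rho> * n / 16 * \<omega> (t / B)))" using P1 by (simp add: mult_ac)
        also have "\<dots> \<le> exp (\<rho> * n / 16 - (\<Lambda> + E) * \<omega> t)"
        proof -
          have "\<omega> t \<le> L * (\<omega> (t / B) + 1)" using L(2)[of "t / B"] t B1 by simp
          then have "\<omega> t / L \<le> \<omega> (t / B) + 1" using L by (simp add: divide_le_eq mult.commute)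
          then have "\<rho> * n / 16 * (\<omega> t / L) \<le> \<rho> * n / 16 * (\<omega> (t / B) + 1)"
            using rho by (intro mult_left_mono) auto
          then have 1: "\<rho> * n / 16 * (\<omega> t / L) \<le> \<rho> * n / 16 * \<omega> (t / B) + \<rho> * n / 16"
            by (simp only: distrib_left mult_1_right)
          have "(\<Lambda> + E) * \<omega> t \<le> \<rho> * n / (16 * L) * \<omega> t"
            using nL t by (intro mult_right_mono w_nonneg) auto
          also have "\<dots> = \<rho> * n / 16 * (\<omega> t / L)" by simp
          finally have "- (\<rho> * n / 16 * \<omega> (t / B)) \<le> \<rho> * n / 16 - (\<Lambda> + E) * \<omega> t" using 1 by linarith
          then show ?thesis by (simp only: exp_le_cancel_iff)
        qed
        also have "\<dots> = exp (\<rho> * n / 16) * exp (- (\<Lambda> + E) * \<omega> t)" by (simp add: mult_exp_exp algebra_simps)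
        also have "\<dots> \<le> F * exp (- (\<Lambda> + E) * \<omega> t)" by (intro mult_right_mono) (auto simp: F_def)
        finally show ?thesis .
      qed
      finally show ?thesis using K0 D0 by (simp add: mult_left_mono)
    next
      case False
      have R0: "cutoff_rate t > 0" using t by (intro cutoff_rate_pos) simp
      \<comment> \<open>For bounded t the integral is estimated directly, with no partial
        integration.\<close>
      have "X * \<bar>(x - y) \<bullet> b\<bar> ^ 0 \<le> 2 * (C * growth d t * exp (\<mu> * \<omega> t) * 12 ^ length w * young_exp \<mu> (length w)) * (cutoff_rate t + 1) ^ 0 * (V * I)"
        by (rule parts) (use t w_nonneg[of t] young_exp_0[of "n/2"] n2 jbracket_ge1[of "x - y"] in auto)
      then have "X \<le> K * exp (E * \<omega> t) * D * 1" using const by simp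
      also have "\<dots> \<le> K * exp (E * \<omega> t) * D * (F * exp (- (\<Lambda> + E) * \<omega> t))"
      proof (rule mult_left_mono)
        have "(\<Lambda> + E) * \<omega> t \<le> (\<Lambda> + E) * \<omega> T1" using False t La E by (intro mult_left_mono w_mono) auto
        then have "1 \<le> exp ((\<Lambda> + E) * \<omega> T1) * exp (- (\<Lambda> + E) * \<omega> t)"
          by (simp add: mult_exp_exp algebra_simps)
        also have "\<dots> \<le> F * exp (- (\<Lambda> + E) * \<omega> t)" by (intro mult_right_mono) (auto simp: F_def)
        finally show "1 \<le> F * exp (- (\<Lambda> + E) * \<omega> t)" .
      qed (use K0 D0 in auto)
      finally show ?thesis .
    qed
    have "exp (E * \<omega> t) * exp (- (\<Lambda> + E) * \<omega> t) = exp (- \<Lambda> * \<omega> t)"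
      by (simp add: mult_exp_exp algebra_simps)
    then have eq: "K * exp (E * \<omega> t) * D * (F * exp (- (\<Lambda> + E) * \<omega> t)) = K * F * exp (- \<Lambda> * \<omega> t) * D"
      by (metis (no_types, opaque_lifting) mult.assoc mult.commute)
    have "X \<le> K * F * exp (- \<Lambda> * \<omega> t) * D" using gain by (simp only: eq)
    then show "norm (LINT \<xi>|lborel. exp (\<i> * complex_of_real (\<xi> \<bullet> (x - y))) * (\<psi> \<xi> * H w [] (x, y, \<xi>)))
      \<le> K * F * exp (- \<Lambda> * \<omega> t) * (12 ^ length w * young_exp \<mu> (length w))"
      by (simp only: X_def D_def)
  qed (use K0 F0 in auto)
qed

end

section \<open>The kernel off the diagonal\<close>

lemma integral_compact_support:
  fixes f :: "'a::euclidean_space \<Rightarrow> complex"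
  assumes "continuous_on UNIV f" "\<And>\<xi>. \<xi> \<notin> cbox a b \<Longrightarrow> f \<xi> = 0"
  shows "integrable lborel f" "(LINT \<xi>|lborel. f \<xi>) = integral (cbox a b) f"
proof -
  have eq: "(\<lambda>\<xi>. indicator (cbox a b) \<xi> *\<^sub>R f \<xi>) = f" using assms(2) by (auto simp: indicator_def)
  have "integrable lborel (\<lambda>\<xi>. indicator (cbox a b) \<xi> *\<^sub>R f \<xi>)"
    by (rule borel_integrable_compact) (auto intro: continuous_on_subset[OF assms(1)])
  then have s: "set_integrable lborel (cbox a b) f" by (simp add: set_integrable_def)
  then show "integrable lborel f" unfolding set_integrable_def eq .
  show "(LINT \<xi>|lborel. f \<xi>) = integral (cbox a b) f"
    using set_borel_integral_eq_integral(2)[OF s] unfolding set_lebesgue_integral_def eq .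
qed

lemma continuous_slice:
  assumes "continuous_on UNIV (\<lambda>(z, \<xi>). f z \<xi>)" shows "continuous_on UNIV (f z)"
proof -
  have "continuous_on UNIV (\<lambda>\<xi>. case (z, \<xi>) of (z, \<xi>) \<Rightarrow> f z \<xi>)"
    by (rule continuous_on_compose2[OF assms]) (auto intro!: continuous_on_Pair continuous_on_const continuous_on_id simp del: split_conv)
  then show ?thesis by simp
qed

lemma has_partial_integral:
  fixes f g :: "'z::euclidean_space \<Rightarrow> 'a::euclidean_space \<Rightarrow> complex"
  assumes f: "continuous_on UNIV (\<lambda>(z, \<xi>). f z \<xi>)" "\<And>z \<xi>. \<xi> \<notin> cbox a b \<Longrightarrow> f z \<xi> = 0"
    and g: "continuous_on UNIV (\<lambda>(z, \<xi>). g z \<xi>)"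
    and d: "\<And>z \<xi>. has_partial c (\<lambda>z. f z \<xi>) z \<and> Dpartial c (\<lambda>z. f z \<xi>) z = g z \<xi>"
  shows "has_partial c (\<lambda>z. LINT \<xi>|lborel. f z \<xi>) z"
    "Dpartial c (\<lambda>z. LINT \<xi>|lborel. f z \<xi>) z = (LINT \<xi>|lborel. g z \<xi>)"
proof -
  have f1: "continuous_on UNIV (f z)" and g1: "continuous_on UNIV (g z)" for z
    using continuous_slice[OF f(1)] continuous_slice[OF g] by auto
  have g0: "g z \<xi> = 0" if "\<xi> \<notin> cbox a b" for z \<xi>
  proof -
    have "(\<lambda>z. f z \<xi>) = (\<lambda>_. 0)" using f(2)[OF that] by auto
    then show ?thesis using d[of \<xi> z] by (simp add: Dpartial_const)
  qed
  have "((\<lambda>t. integral (cbox a b) (f (z + t *\<^sub>R c))) has_vector_derivative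
      integral (cbox a b) (\<lambda>\<xi>. \<i> * g (z + 0 *\<^sub>R c) \<xi>)) (at 0 within UNIV)"
  proof (rule leibniz_rule_vector_derivative)
    fix t \<xi>
    show "((\<lambda>t. f (z + t *\<^sub>R c) \<xi>) has_vector_derivative \<i> * g (z + t *\<^sub>R c) \<xi>) (at t within UNIV)"
      using has_partial_shift[of c "\<lambda>z. f z \<xi>" z t] d by simp
    show "f (z + t *\<^sub>R c) integrable_on cbox a b"
      by (rule integrable_continuous) (auto intro: continuous_on_subset[OF f1])
    have "continuous_on (UNIV \<times> cbox a b) (\<lambda>p. (case (z + fst p *\<^sub>R c, snd p) of (z, \<xi>) \<Rightarrow> g z \<xi>))"
      by (rule continuous_on_compose2[OF g]) (auto intro!: continuous_intros)
    then show "continuous_on (UNIV \<times> cbox a b) (\<lambda>(t, \<xi>). \<i> * g (z + t *\<^sub>R c) \<xi>)"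
      unfolding case_prod_unfold by (intro continuous_intros) auto
  qed auto
  then have "((\<lambda>t. LINT \<xi>|lborel. f (z + t *\<^sub>R c) \<xi>) has_vector_derivative \<i> * (LINT \<xi>|lborel. g z \<xi>)) (at 0)"
    using integral_compact_support(2)[OF f1 f(2)] integral_compact_support(2)[OF g1 g0] by simp
  from has_partialI[OF this]
  show "has_partial c (\<lambda>z. LINT \<xi>|lborel. f z \<xi>) z"
    "Dpartial c (\<lambda>z. LINT \<xi>|lborel. f z \<xi>) z = (LINT \<xi>|lborel. g z \<xi>)" by auto
qed

lemma continuous_integral_compact:
  fixes f :: "'z::euclidean_space \<Rightarrow> 'a::euclidean_space \<Rightarrow> complex"
  assumes f: "continuous_on UNIV (\<lambda>(z, \<xi>). f z \<xi>)" "\<And>z \<xi>. \<xi> \<notin> cbox a b \<Longrightarrow> f z \<xi> = 0"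
  shows "continuous_on UNIV (\<lambda>z. LINT \<xi>|lborel. f z \<xi>)"
proof -
  have "continuous_on UNIV (f z)" for z
    by (rule continuous_slice[OF f(1)])
  then have eq: "(\<lambda>z. LINT \<xi>|lborel. f z \<xi>) = (\<lambda>z. integral (cbox a b) (f z))"
    by (intro ext integral_compact_support(2)) (simp_all add: f(2))
  show ?thesis
    unfolding eq by (rule integral_continuous_on_param) (rule continuous_on_subset[OF f(1)], simp)
qed

lemma has_vector_derivative_limit:
  fixes f :: "nat \<Rightarrow> real \<Rightarrow> complex"
  assumes e: "e > 0" and d: "\<And>j t. \<bar>t\<bar> < e \<Longrightarrow> (f j has_vector_derivative f' j t) (at t)"
    and lim: "\<And>t. \<bar>t\<bar> < e \<Longrightarrow> (\<lambda>j. f j t) \<longlonglongrightarrow> F t"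
    and unif: "\<And>j t. j \<ge> J \<Longrightarrow> \<bar>t\<bar> < e \<Longrightarrow> norm (f' j t - G t) \<le> \<epsilon> j" and eps: "\<epsilon> \<longlonglongrightarrow> 0"
  shows "(F has_vector_derivative G 0) (at 0)"
proof -
  define S where "S = {-e<..<e}"
  have S: "t \<in> S \<longleftrightarrow> \<bar>t\<bar> < e" for t by (auto simp: S_def)
  have "\<exists>g. \<forall>t\<in>S. (\<lambda>n. f n t) \<longlonglongrightarrow> g t \<and> (g has_derivative (\<lambda>h. h *\<^sub>R G t)) (at t within S)"
  proof (rule has_derivative_sequence[where f' = "\<lambda>j t h. h *\<^sub>R f' j t"])
    show "convex S" by (simp add: S_def)
    show "(f n has_derivative (\<lambda>h. h *\<^sub>R f' n t)) (at t within S)" if "t \<in> S" for n t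
      using d[of t n] that S by (auto simp: has_vector_derivative_def intro: has_derivative_at_withinI)
    show "\<forall>\<^sub>F n in sequentially. \<forall>t\<in>S. \<forall>h. norm (h *\<^sub>R f' n t - h *\<^sub>R G t) \<le> e' * norm h" if "e' > 0" for e'
    proof -
      have "\<forall>\<^sub>F n in sequentially. \<epsilon> n < e'" using eps that by (rule order_tendstoD)
      then show ?thesis using eventually_ge_at_top[of J]
      proof eventually_elim
        case (elim n)
        show ?case
        proof (intro ballI allI)
          fix t h assume "t \<in> S"
          then have "norm (f' n t - G t) \<le> e'" using unif[of n t] elim S by auto
          then show "norm (h *\<^sub>R f' n t - h *\<^sub>R G t) \<le> e' * norm h"
            by (simp add: scaleR_diff_right[symmetric] mult.commute[of e'] mult_left_mono del: real_scaleR_def)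
        qed
      qed
    qed
    show "0 \<in> S" "(\<lambda>n. f n 0) \<longlonglongrightarrow> F 0" using e lim[of 0] S by auto
  qed
  then obtain g where g: "\<And>t. t \<in> S \<Longrightarrow> (\<lambda>n. f n t) \<longlonglongrightarrow> g t" "\<And>t. t \<in> S \<Longrightarrow> (g has_derivative (\<lambda>h. h *\<^sub>R G t)) (at t within S)"
    by blast
  have o: "open S" "0 \<in> S" using e S by (auto simp: S_def)
  have "g t = F t" if "t \<in> S" for t using LIMSEQ_unique[OF g(1)[OF that] lim[of t]] that S by auto
  moreover have "(g has_derivative (\<lambda>h. h *\<^sub>R G 0)) (at 0)"
    using g(2)[OF o(2)] at_within_open[OF o(2,1)] by simp
  ultimately show ?thesis unfolding has_vector_derivative_def
    using has_derivative_transform_within_open[OF _ o] by blast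
qed

lemma geometric_limit:
  fixes f :: "nat \<Rightarrow> complex"
  assumes "\<And>j. j \<ge> J \<Longrightarrow> norm (f (Suc j) - f j) \<le> D * (1/2) ^ j"
  shows "convergent f" "j \<ge> J \<Longrightarrow> norm (f j - lim f) \<le> 2 * D * (1/2) ^ j"
proof -
  have D: "D \<ge> 0" using assms[of J] by (smt (verit) norm_ge_zero order.refl zero_less_power divide_pos_pos zero_le_mult_iff)
  \<comment> \<open>A telescoping sum. Keeping the remaining tail on the right lets the induction
    close without loss.\<close>
  have step: "norm (f (j + k) - f j) \<le> 2 * D * (1/2) ^ j - 2 * D * (1/2) ^ (j + k)" if "j \<ge> J" for j k
  proof (induction k)
    case (Suc k)
    have "norm (f (j + Suc k) - f j) \<le> norm (f (Suc (j + k)) - f (j + k)) + norm (f (j + k) - f j)"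
      using norm_triangle_ineq[of "f (Suc (j + k)) - f (j + k)" "f (j + k) - f j"] by simp
    also have "\<dots> \<le> D * (1/2) ^ (j + k) + (2 * D * (1/2) ^ j - 2 * D * (1/2) ^ (j + k))"
      using assms[of "j + k"] that Suc by (intro add_mono) auto
    finally show ?case by simp
  qed simp
  have step': "norm (f k - f j) \<le> 2 * D * (1/2) ^ j" if "J \<le> j" "j \<le> k" for j k
  proof -
    have "0 \<le> 2 * D * (1/2) ^ k" using D by simp
    then show ?thesis using step[OF that(1), of "k - j"] that(2) by simp
  qed
  have "Cauchy f"
  proof (rule CauchyI')
    fix e :: real assume e: "e > 0"
    have "(\<lambda>j. 2 * D * (1/2) ^ j) \<longlonglongrightarrow> 2 * D * 0" by (intro tendsto_intros LIMSEQ_power_zero) auto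
    then have "\<forall>\<^sub>F j in sequentially. 2 * D * (1/2) ^ j < e" using e by (auto dest: order_tendstoD)
    then obtain M where M: "\<And>j. j \<ge> M \<Longrightarrow> 2 * D * (1/2) ^ j < e" by (auto simp: eventually_sequentially)
    show "\<exists>M. \<forall>m\<ge>M. \<forall>n>m. dist (f m) (f n) < e"
    proof (intro exI[of _ "max M J"] allI impI)
      fix m n assume "m \<ge> max M J" "n > m"
      then show "dist (f m) (f n) < e" unfolding dist_norm using step'[of m n] M[of m] by (simp add: norm_minus_commute)
    qed
  qed
  then show "convergent f" by (rule Cauchy_convergent)
  then have l: "f \<longlonglongrightarrow> lim f" by (simp add: convergent_LIMSEQ_iff)
  show "norm (f j - lim f) \<le> 2 * D * (1/2) ^ j" if "j \<ge> J"
  proof (rule LIMSEQ_le_const2)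
    show "(\<lambda>k. norm (f j - f k)) \<longlonglongrightarrow> norm (f j - lim f)" by (intro tendsto_intros l)
    show "\<exists>N. \<forall>k\<ge>N. norm (f j - f k) \<le> 2 * D * (1/2) ^ j"
      using step'[OF that] by (auto simp: norm_minus_commute)
  qed
qed

section \<open>Dyadic truncations of the kernel and their limit off the diagonal\<close>

context amplitude
begin

text \<open>The summand 1 keeps the order positive, as the cutoffs require, also where \<omega>
  vanishes.\<close>

definition dyadic_order :: "nat \<Rightarrow> nat" where "dyadic_order j = nat \<lceil>sqrt (2 ^ j * \<omega> (2 ^ j))\<rceil> + 1"

definition dyadic_cutoff :: "nat \<Rightarrow> 'a \<Rightarrow> complex" where "dyadic_cutoff j = chi (2 ^ j) (dyadic_order j)"

text \<open>The derivative along w, in z = (x, y), of the integrand of the formal kernel;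
  \<open>osc_deriv_partial\<close> confirms the closure under differentiation.\<close>

definition osc_deriv :: "('a \<times> 'a) list \<Rightarrow> 'a \<times> 'a \<Rightarrow> 'a \<Rightarrow> complex"
  where "osc_deriv w z \<xi> = exp (\<i> * complex_of_real (\<xi> \<bullet> (fst z - snd z))) * H w [] (fst z, snd z, \<xi>)"

definition kernel_trunc :: "nat \<Rightarrow> ('a \<times> 'a) list \<Rightarrow> 'a \<times> 'a \<Rightarrow> complex"
  where "kernel_trunc j w z = (LINT \<xi>|lborel. dyadic_cutoff j \<xi> * osc_deriv w z \<xi>)"

text \<open>Meaningful only where the truncations converge, which is shown off the diagonal. The
  word w stands for the derivative that this limit turns out to be.\<close>

definition kernel_lim :: "('a \<times> 'a) list \<Rightarrow> 'a \<times> 'a \<Rightarrow> complex"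
  where "kernel_lim w z = lim (\<lambda>j. kernel_trunc j w z)"

lemma dyadic_order_bounds: "sqrt (2 ^ j * \<omega> (2 ^ j)) \<le> dyadic_order j" "dyadic_order j \<le> sqrt (2 ^ j * \<omega> (2 ^ j)) + 2" "dyadic_order j \<ge> 1"
proof -
  have s: "0 \<le> sqrt (2 ^ j * \<omega> (2 ^ j))" using w_nonneg by simp
  then have eq: "real (dyadic_order j) = of_int \<lceil>sqrt (2 ^ j * \<omega> (2 ^ j))\<rceil> + 1"
    unfolding dyadic_order_def by simp
  show "sqrt (2 ^ j * \<omega> (2 ^ j)) \<le> dyadic_order j" "dyadic_order j \<le> sqrt (2 ^ j * \<omega> (2 ^ j)) + 2" unfolding eq by linarith+
qed (simp add: dyadic_order_def)

lemma dyadic_order_mono: "dyadic_order j \<le> dyadic_order (Suc j)"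
proof -
  have "sqrt (2 ^ j * \<omega> (2 ^ j)) \<le> sqrt (2 ^ Suc j * \<omega> (2 ^ Suc j))"
    by (intro real_sqrt_le_mono mult_mono w_mono w_nonneg) auto
  then show ?thesis unfolding dyadic_order_def by (intro add_right_mono nat_mono ceiling_mono)
qed

text \<open>Two consecutive cutoffs are compared at the scale of the smaller one, so both ratios are
  bounded by the rate at 2^j.\<close>

lemma dyadic_order_rate: "4 * dyadic_order j / 2 ^ j \<le> cutoff_rate (2 ^ j)" "4 * dyadic_order (Suc j) / 2 ^ Suc j \<le> cutoff_rate (2 ^ j)"
proof -
  define t :: real where "t = 2 ^ j"
  have t: "t > 0" by (simp add: t_def)
  have q: "sqrt (s * u) / s = sqrt (u / s)" if "s > 0" for s u :: real
    using that by (simp add: real_sqrt_mult real_sqrt_divide real_div_sqrt divide_simps)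
  have "4 * dyadic_order j / t \<le> 4 * (sqrt (t * \<omega> t) + 2) / t"
    using dyadic_order_bounds(2)[of j] t by (intro divide_right_mono mult_left_mono) (auto simp: t_def)
  also have "\<dots> = 4 * (sqrt (t * \<omega> t) / t) + 8 / t" by (simp add: add_divide_distrib distrib_left)
  also have "\<dots> = 4 * sqrt (\<omega> t / t) + 8 / t" using q[OF t] by simp
  also have "\<dots> \<le> 8 * sqrt (\<omega> (2 * t) / t) + 8 / t"
  proof -
    have "sqrt (\<omega> t / t) \<le> sqrt (\<omega> (2 * t) / t)"
      using t by (intro real_sqrt_le_mono divide_right_mono w_mono) auto
    moreover have "0 \<le> sqrt (\<omega> (2 * t) / t)" using t w_nonneg[of "2 * t"] by simp
    ultimately show ?thesis by linarith
  qed
  finally show "4 * dyadic_order j / 2 ^ j \<le> cutoff_rate (2 ^ j)" by (simp add: cutoff_rate_def t_def)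
  have "4 * dyadic_order (Suc j) / (2 * t) \<le> 4 * (sqrt ((2 * t) * \<omega> (2 * t)) + 2) / (2 * t)"
    using dyadic_order_bounds(2)[of "Suc j"] t by (intro divide_right_mono mult_left_mono) (auto simp: t_def)
  also have "\<dots> = 4 * (sqrt ((2 * t) * \<omega> (2 * t)) / (2 * t)) + 4 / t" using t by (simp add: field_simps)
  also have "\<dots> = 4 * sqrt (\<omega> (2 * t) / (2 * t)) + 4 / t" using q[of "2 * t"] t by simp
  also have "\<dots> \<le> 8 * sqrt (\<omega> (2 * t) / t) + 8 / t"
  proof -
    have "sqrt (\<omega> (2 * t) / (2 * t)) \<le> sqrt (\<omega> (2 * t) / t)"
      using t w_nonneg[of "2 * t"] by (intro real_sqrt_le_mono divide_left_mono) auto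
    moreover have "0 \<le> sqrt (\<omega> (2 * t) / t)" using t w_nonneg[of "2 * t"] by simp
    moreover have "4 / t \<le> 8 / t" using t by (simp add: divide_right_mono)
    ultimately show ?thesis by linarith
  qed
  finally show "4 * dyadic_order (Suc j) / 2 ^ Suc j \<le> cutoff_rate (2 ^ j)" by (simp add: cutoff_rate_def t_def)
qed

lemma dyadic_cutoff_cont: "continuous_on UNIV (dyadic_cutoff j)"
  unfolding dyadic_cutoff_def using dyadic_order_bounds(3) by (intro chi_cont) auto

lemma dyadic_cutoff_norm: "norm (dyadic_cutoff j \<xi>) \<le> 1"
  unfolding dyadic_cutoff_def using dyadic_order_bounds(3) by (intro chi_norm) auto

lemma dyadic_cutoff_diff_along: "b \<in> Basis \<Longrightarrow> diff_along b (dyadic_order j) (dyadic_cutoff j)"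
  unfolding dyadic_cutoff_def using dyadic_order_bounds(3) by (intro chi_deriv(1)) auto

lemma dyadic_cutoff_geo_bounded: assumes "b \<in> Basis" "4 * dyadic_order j / 2 ^ j \<le> R" shows "geo_bounded b (dyadic_order j) \<xi> 1 R (dyadic_cutoff j)"
  unfolding dyadic_cutoff_def by (rule geo_bounded_mono[OF chi_geo_bounded]) (use assms dyadic_order_bounds(3) in auto)

text \<open>When (x, y) is of size at least 2^j, the denominator in the amplitude bound is large for
  every \<xi>. The low frequencies then need no removal, and the truncation counts as one
  piece.\<close>

lemma goodcut_first:
  assumes "2 ^ j \<le> \<langle>(x, y)\<rangle>"
  shows "goodcut (2 ^ j) (dyadic_cutoff j) x y"
  unfolding goodcut_def
proof (intro exI[of _ "dyadic_order j"] conjI ballI allI impI dyadic_order_bounds dyadic_cutoff_diff_along)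
  fix b :: 'a and \<xi> assume b: "b \<in> Basis"
  show "geo_bounded b (dyadic_order j) \<xi> 2 (cutoff_rate (2 ^ j)) (dyadic_cutoff j)"
    by (rule geo_bounded_mono[OF dyadic_cutoff_geo_bounded[OF b dyadic_order_rate(1)]]) (auto intro!: less_imp_le[OF cutoff_rate_pos])
  assume xi: "\<xi> \<notin> cutset (2 ^ j) x y"
  have "norm (x, y) \<le> norm (x, y, \<xi>)" by (simp add: norm_Pair)
  then have "2 ^ j \<le> \<langle>(x, y, \<xi>)\<rangle>" using assms jbracket_mono order.trans by blast
  then obtain c where c: "c \<in> Basis" "\<bar>\<xi> \<bullet> c\<bar> > 4 * 2 ^ j" using xi by (force simp: cutset_def)
  have "\<bar>\<xi> \<bullet> c\<bar> > 2 * 2 ^ j" using c(2) zero_less_power[of "2::real" j] by linarith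
  then have "(Dpartial b ^^ l) (dyadic_cutoff j) \<xi> = 0" if "l \<le> dyadic_order j" for l
    unfolding dyadic_cutoff_def using chi_outside[of "2 ^ j" "dyadic_order j" b c \<xi> l] b c dyadic_order_bounds(3) that by auto
  then show "geo_bounded b (dyadic_order j) \<xi> 0 (cutoff_rate (2 ^ j)) (dyadic_cutoff j)" by (simp add: geo_bounded_def)
qed

text \<open>Both cutoffs are locally 1 where |\<xi>| < 2^j, and both vanish where a coordinate
  exceeds 4 times 2^j, so every derivative of the difference vanishes off the region. Only the
  smaller of the two orders is claimed.\<close>

lemma goodcut_step: "goodcut (2 ^ j) (\<lambda>\<xi>. dyadic_cutoff (Suc j) \<xi> - dyadic_cutoff j \<xi>) x y"
  unfolding goodcut_def
proof (intro exI[of _ "dyadic_order j"] conjI ballI allI impI dyadic_order_bounds)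
  fix b :: 'a and \<xi> assume b: "b \<in> Basis"
  note N1 = dyadic_order_bounds(3)[of j] dyadic_order_bounds(3)[of "Suc j"]
  have r: "diff_along b (dyadic_order j) (dyadic_cutoff (Suc j))" "diff_along b (dyadic_order j) (dyadic_cutoff j)"
    using dyadic_cutoff_diff_along[OF b] diff_along_le[OF dyadic_cutoff_diff_along[OF b] dyadic_order_mono] by auto
  have g: "geo_bounded b (dyadic_order j) \<xi> 1 (cutoff_rate (2 ^ j)) (dyadic_cutoff (Suc j))" "geo_bounded b (dyadic_order j) \<xi> 1 (cutoff_rate (2 ^ j)) (dyadic_cutoff j)"
    using geo_bounded_le[OF dyadic_cutoff_geo_bounded[OF b dyadic_order_rate(2)] dyadic_order_mono] dyadic_cutoff_geo_bounded[OF b dyadic_order_rate(1)] by auto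
  show "diff_along b (dyadic_order j) (\<lambda>\<xi>. dyadic_cutoff (Suc j) \<xi> - dyadic_cutoff j \<xi>)" by (rule geo_bounded_minus(2)[OF r g])
  show "geo_bounded b (dyadic_order j) \<xi> 2 (cutoff_rate (2 ^ j)) (\<lambda>\<xi>. dyadic_cutoff (Suc j) \<xi> - dyadic_cutoff j \<xi>)"
    using geo_bounded_minus(1)[OF r g] by simp
  assume xi: "\<xi> \<notin> cutset (2 ^ j) x y"
  have "(Dpartial b ^^ l) (dyadic_cutoff (Suc j)) \<xi> = (Dpartial b ^^ l) (dyadic_cutoff j) \<xi>" if l: "l \<le> dyadic_order j" for l
  proof (cases "\<exists>c\<in>Basis. \<bar>\<xi> \<bullet> c\<bar> > 4 * 2 ^ j")
    case True
    then obtain c where c: "c \<in> Basis" "\<bar>\<xi> \<bullet> c\<bar> > 4 * 2 ^ j" by blast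
    have "\<bar>\<xi> \<bullet> c\<bar> > 2 * 2 ^ j" using c(2) zero_less_power[of "2::real" j] by linarith
    then show ?thesis
      unfolding dyadic_cutoff_def using chi_outside[of "2 ^ j" "dyadic_order j" b c \<xi> l]
        chi_outside[of "2 ^ Suc j" "dyadic_order (Suc j)" b c \<xi> l] b c N1 l dyadic_order_mono[of j] by auto
  next
    case False
    then have "\<langle>(x, y, \<xi>)\<rangle> < 2 ^ j" using xi by (force simp: cutset_def)
    moreover have "norm \<xi> \<le> norm (x, y, \<xi>)"
      using norm_snd_le[of \<xi> y] norm_snd_le[of "(y, \<xi>)" x] by linarith
    ultimately have "norm \<xi> < 2 ^ j" using norm_le_jbracket[of "(x, y, \<xi>)"] by linarith
    then have "\<bar>\<xi> \<bullet> c\<bar> < 2 ^ j" if "c \<in> Basis" for c using Basis_le_norm[OF that, of \<xi>] by linarith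
    moreover from this have "\<bar>\<xi> \<bullet> c\<bar> < 2 ^ Suc j" if "c \<in> Basis" for c using that zero_less_power[of "2::real" j] by fastforce
    ultimately show ?thesis
      unfolding dyadic_cutoff_def using chi_inside[of "2 ^ j" "dyadic_order j" b \<xi> l]
        chi_inside[of "2 ^ Suc j" "dyadic_order (Suc j)" b \<xi> l] b N1 l dyadic_order_mono[of j] by auto
  qed
  then show "geo_bounded b (dyadic_order j) \<xi> 0 (cutoff_rate (2 ^ j)) (\<lambda>\<xi>. dyadic_cutoff (Suc j) \<xi> - dyadic_cutoff j \<xi>)"
    using geo_bounded_minus(3)[OF r g] by (simp add: geo_bounded_def)
qed

lemma dyadic_cutoff_outside:
  assumes "\<xi> \<notin> cbox (- (2 * 2 ^ j) *\<^sub>R One) ((2 * 2 ^ j) *\<^sub>R One)" shows "dyadic_cutoff j \<xi> = 0"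
proof -
  obtain b where "b \<in> Basis" "\<bar>\<xi> \<bullet> b\<bar> > 2 * 2 ^ j" using assms by (force simp: mem_box abs_le_iff not_le)
  then show ?thesis unfolding dyadic_cutoff_def using dyadic_order_bounds(3) by (intro chi_eq_0) auto
qed

lemma osc_deriv_cont:
  assumes "set w \<subseteq> Basis" shows "continuous_on UNIV (\<lambda>(z, \<xi>). osc_deriv w z \<xi>)"
proof -
  have "continuous_on UNIV (\<lambda>p::('a \<times> 'a) \<times> 'a. H w [] (fst (fst p), snd (fst p), snd p))"
    by (rule continuous_on_compose2[OF H_cont[OF assms, of "[]"]]) (auto intro!: continuous_intros)
  then show ?thesis unfolding osc_deriv_def case_prod_unfold by (intro continuous_intros)
qed

lemma dyadic_cutoff_osc_deriv_cont:
  assumes "set w \<subseteq> Basis" shows "continuous_on UNIV (\<lambda>(z, \<xi>). dyadic_cutoff j \<xi> * osc_deriv w z \<xi>)"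
proof -
  have "continuous_on UNIV (\<lambda>p::('a \<times> 'a) \<times> 'a. dyadic_cutoff j (snd p))"
    by (rule continuous_on_compose2[OF dyadic_cutoff_cont]) (auto intro!: continuous_intros)
  then show ?thesis using osc_deriv_cont[OF assms] unfolding case_prod_unfold by (intro continuous_intros)
qed

lemma osc_deriv_partial:
  assumes "set w \<subseteq> Basis" "c \<in> Basis"
  shows "has_partial c (\<lambda>z. osc_deriv w z \<xi>) z \<and> Dpartial c (\<lambda>z. osc_deriv w z \<xi>) z = osc_deriv (c # w) z \<xi>"
proof -
  define e where "e = (\<lambda>z::'a\<times>'a. exp (\<i> * complex_of_real (\<xi> \<bullet> (fst z - snd z))))"
  have "((\<lambda>t. exp (\<i> * complex_of_real (\<xi> \<bullet> (fst z - snd z)) + of_real t * (\<i> * complex_of_real (\<xi> \<bullet> (fst c - snd c)))))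
     has_vector_derivative 1 * (\<i> * complex_of_real (\<xi> \<bullet> (fst c - snd c)) * e z)) (at 0)"
    by (rule has_vector_derivative_real_field) (auto intro!: derivative_eq_intros simp: e_def algebra_simps)
  then have "((\<lambda>t. e (z + t *\<^sub>R c)) has_vector_derivative \<i> * complex_of_real (\<xi> \<bullet> (fst c - snd c)) * e z) (at 0)"
    by (simp add: e_def algebra_simps inner_diff_right inner_add_right)
  from has_partialI[OF this] have e: "has_partial c e z" "Dpartial c e z = complex_of_real ((fst c - snd c) \<bullet> \<xi>) * e z"
    by (simp_all add: inner_commute mult.assoc[symmetric])
  define h where "h = (\<lambda>z. H w [] (fst z, snd z, \<xi>))"
  have "has_partial c h z \<longleftrightarrow> has_partial (emb c) (H w []) (fst z, snd z, \<xi>)" "Dpartial c h z = Dpartial (emb c) (H w []) (fst z, snd z, \<xi>)"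
    by (simp_all add: has_partial_def Dpartial_def h_def emb_def)
  then have h: "has_partial c h z" "Dpartial c h z = H w [c] (fst z, snd z, \<xi>)"
    using H_partial[OF assms(1) _ assms(2), of "[]" "(fst z, snd z, \<xi>)"] by auto
  have "osc_deriv w z \<xi> = e z * h z" for z by (simp add: osc_deriv_def e_def h_def)
  then show ?thesis
    using Dpartial_mult[OF e(1) h(1)] by (simp add: e h osc_deriv_def algebra_simps) (simp add: e_def h_def algebra_simps)
qed

lemma kernel_trunc_partial:
  assumes "set w \<subseteq> Basis" "c \<in> Basis"
  shows "has_partial c (kernel_trunc j w) z" "Dpartial c (kernel_trunc j w) z = kernel_trunc j (c # w) z"
proof -
  have d: "has_partial c (\<lambda>z. dyadic_cutoff j \<xi> * osc_deriv w z \<xi>) z \<and> Dpartial c (\<lambda>z. dyadic_cutoff j \<xi> * osc_deriv w z \<xi>) z = dyadic_cutoff j \<xi> * osc_deriv (c # w) z \<xi>" for z \<xi>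
    using osc_deriv_partial[OF assms] Dpartial_cmult[of c "\<lambda>z. osc_deriv w z \<xi>" z "dyadic_cutoff j \<xi>"] by auto
  have cw: "set (c # w) \<subseteq> Basis" using assms by simp
  have z: "dyadic_cutoff j \<xi> * osc_deriv w z \<xi> = 0" if "\<xi> \<notin> cbox (- (2 * 2 ^ j) *\<^sub>R One) ((2 * 2 ^ j) *\<^sub>R One)" for z \<xi>
    using dyadic_cutoff_outside[OF that] by simp
  show "has_partial c (kernel_trunc j w) z" "Dpartial c (kernel_trunc j w) z = kernel_trunc j (c # w) z"
    using has_partial_integral[OF dyadic_cutoff_osc_deriv_cont[OF assms(1)] z dyadic_cutoff_osc_deriv_cont[OF cw] d]
    by (simp_all add: kernel_trunc_def[abs_def])
qed

lemma kernel_trunc_cont: assumes "set w \<subseteq> Basis" shows "continuous_on UNIV (kernel_trunc j w)"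
proof -
  have z: "dyadic_cutoff j \<xi> * osc_deriv w z \<xi> = 0" if "\<xi> \<notin> cbox (- (2 * 2 ^ j) *\<^sub>R One) ((2 * 2 ^ j) *\<^sub>R One)" for z \<xi>
    using dyadic_cutoff_outside[OF that] by simp
  show ?thesis using continuous_integral_compact[OF dyadic_cutoff_osc_deriv_cont[OF assms] z] by (simp add: kernel_trunc_def[abs_def])
qed

lemma dyadic_cutoff_osc_deriv_integrable: assumes "set w \<subseteq> Basis" shows "integrable lborel (\<lambda>\<xi>. dyadic_cutoff j \<xi> * osc_deriv w z \<xi>)"
proof (rule integral_compact_support(1)[where a = "- (2 * 2 ^ j) *\<^sub>R One" and b = "(2 * 2 ^ j) *\<^sub>R One"])
  show "continuous_on UNIV (\<lambda>\<xi>. dyadic_cutoff j \<xi> * osc_deriv w z \<xi>)"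
    by (rule continuous_slice[OF dyadic_cutoff_osc_deriv_cont[OF assms]])
qed (simp add: dyadic_cutoff_outside)

text \<open>By (\<gamma>) with factor 1, a spare e^{-\<omega>(2^j)} becomes geometric decay in
  j.\<close>

lemma exp_weight_summable: "\<exists>C>0. \<forall>j. exp (- \<omega> (2 ^ j)) \<le> C * (1/2) ^ j"
proof -
  obtain C where C: "\<And>t. t \<ge> 1 \<Longrightarrow> 1 * ln t \<le> \<omega> t + C" using w_ln[of 1] by blast
  have "exp (- \<omega> (2 ^ j)) \<le> exp C * (1/2) ^ j" for j
  proof -
    have "- \<omega> (2 ^ j) \<le> C - ln (2 ^ j)" using C[of "2 ^ j"] by simp
    then have "exp (- \<omega> (2 ^ j)) \<le> exp (C - ln (2 ^ j))" by simp
    also have "\<dots> = exp C * (1/2) ^ j" by (simp add: exp_diff power_divide)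
    finally show ?thesis .
  qed
  then show ?thesis by (intro exI[of _ "exp C"]) auto
qed

text \<open>The pieces are estimated with \<Lambda> + 1: one unit makes the series geometric, the
  rest stays in front, frozen at the scale J. Any J with |x| and |y| at most 2 times 2^J is
  admissible; if also (x, y) is of size at least 2^J, the truncation at J is itself a piece, which
  bounds the limit.\<close>

lemma kernel_trunc_limit:
  assumes r0: "r0 > 0" and mu: "\<mu> > 0" and La: "\<Lambda> > 0"
  shows "\<exists>C>0. \<forall>J x y w. r0 \<le> norm (x - y) \<longrightarrow> norm x \<le> 2 * 2 ^ J \<longrightarrow> norm y \<le> 2 * 2 ^ J \<longrightarrow> set w \<subseteq> Basis \<longrightarrow>
    (\<lambda>j. kernel_trunc j w (x, y)) \<longlonglongrightarrow> kernel_lim w (x, y) \<and>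
    (\<forall>j\<ge>J. norm (kernel_trunc j w (x, y) - kernel_lim w (x, y)) \<le> C * exp (- \<Lambda> * \<omega> (2 ^ J)) * (12 ^ length w * young_exp \<mu> (length w)) * (1/2) ^ j) \<and>
    (2 ^ J \<le> \<langle>(x, y)\<rangle> \<longrightarrow> norm (kernel_lim w (x, y)) \<le> C * exp (- \<Lambda> * \<omega> (2 ^ J)) * (12 ^ length w * young_exp \<mu> (length w)))"
proof -
  obtain C where C: "C > 0" "\<And>t \<psi> x y w. t \<ge> 1 \<Longrightarrow> r0 \<le> norm (x - y) \<Longrightarrow> norm x \<le> 2 * t \<Longrightarrow> norm y \<le> 2 * t \<Longrightarrow>
    goodcut t \<psi> x y \<Longrightarrow> set w \<subseteq> Basis \<Longrightarrow>
    norm (LINT \<xi>|lborel. exp (\<i> * complex_of_real (\<xi> \<bullet> (x - y))) * (\<psi> \<xi> * H w [] (x, y, \<xi>)))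
      \<le> C * exp (- (\<Lambda> + 1) * \<omega> t) * (12 ^ length w * young_exp \<mu> (length w))"
    using piece_bound[OF r0 mu, of "\<Lambda> + 1"] La by (auto simp del: minus_add_distrib)
  obtain C1 where C1: "C1 > 0" "\<And>j. exp (- \<omega> (2 ^ j)) \<le> C1 * (1/2) ^ j" using exp_weight_summable by blast
  show ?thesis
  proof (intro exI[of _ "C + 2 * C * C1"] conjI allI impI)
    show "C + 2 * C * C1 > 0" using C C1 by (simp add: add_pos_pos)
    fix J and x y :: 'a and w :: "('a \<times> 'a) list"
    assume xy: "r0 \<le> norm (x - y)" "norm x \<le> 2 * 2 ^ J" "norm y \<le> 2 * 2 ^ J" and w: "set w \<subseteq> Basis"
    define D where "D = 12 ^ length w * young_exp \<mu> (length w)"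
    have D: "D > 0" by (simp add: D_def)
    define X where "X = exp (- \<Lambda> * \<omega> (2 ^ J))"
    have jJ: "norm x \<le> 2 * 2 ^ j" "norm y \<le> 2 * 2 ^ j" if "j \<ge> J" for j
    proof -
      have "(2::real) ^ J \<le> 2 ^ j" using that by (intro power_increasing) auto
      then show "norm x \<le> 2 * 2 ^ j" "norm y \<le> 2 * 2 ^ j" using xy by linarith+
    qed
    have ex: "exp (- (\<Lambda> + 1) * \<omega> (2 ^ j)) \<le> X * exp (- \<omega> (2 ^ j))" if "j \<ge> J" for j
    proof -
      have "\<Lambda> * \<omega> (2 ^ J) \<le> \<Lambda> * \<omega> (2 ^ j)"
        using La that by (intro mult_left_mono w_mono power_increasing) auto
      then show ?thesis by (simp add: X_def mult_exp_exp algebra_simps)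
    qed
    have step: "norm (kernel_trunc (Suc j) w (x, y) - kernel_trunc j w (x, y)) \<le> C * C1 * X * D * (1/2) ^ j" if j: "j \<ge> J" for j
    proof -
      have "kernel_trunc (Suc j) w (x, y) - kernel_trunc j w (x, y) = (LINT \<xi>|lborel. dyadic_cutoff (Suc j) \<xi> * osc_deriv w (x, y) \<xi> - dyadic_cutoff j \<xi> * osc_deriv w (x, y) \<xi>)"
        unfolding kernel_trunc_def by (rule Bochner_Integration.integral_diff[symmetric]) (intro dyadic_cutoff_osc_deriv_integrable w)+
      also have "\<dots> = (LINT \<xi>|lborel. exp (\<i> * complex_of_real (\<xi> \<bullet> (x - y))) * ((dyadic_cutoff (Suc j) \<xi> - dyadic_cutoff j \<xi>) * H w [] (x, y, \<xi>)))"
        by (intro Bochner_Integration.integral_cong) (auto simp: osc_deriv_def algebra_simps)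
      also have "norm \<dots> \<le> C * exp (- (\<Lambda> + 1) * \<omega> (2 ^ j)) * D"
        unfolding D_def using jJ[OF j] xy w by (intro C goodcut_step) auto
      also have "\<dots> \<le> C * (X * (C1 * (1/2) ^ j)) * D"
        using ex[OF j] C1(2)[of j] C(1) D
        by (intro mult_right_mono mult_left_mono order.trans[OF ex[OF j]]) (auto simp: X_def)
      finally show ?thesis by (simp add: mult_ac)
    qed
    note lim = geometric_limit[OF step]
    show "(\<lambda>j. kernel_trunc j w (x, y)) \<longlonglongrightarrow> kernel_lim w (x, y)"
      using lim(1) by (simp add: convergent_LIMSEQ_iff kernel_lim_def)
    have XD: "X > 0" by (simp add: X_def)
    have near: "norm (kernel_trunc j w (x, y) - kernel_lim w (x, y)) \<le> 2 * C * C1 * X * D * (1/2) ^ j" if "j \<ge> J" for j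
      using lim(2)[OF _ that] by (simp add: kernel_lim_def mult_ac)
    then show "norm (kernel_trunc j w (x, y) - kernel_lim w (x, y)) \<le> (C + 2 * C * C1) * exp (- \<Lambda> * \<omega> (2 ^ J)) * (12 ^ length w * young_exp \<mu> (length w)) * (1/2) ^ j" if "j \<ge> J" for j
    proof -
      have "2 * C * C1 * X * D * (1/2) ^ j \<le> (C + 2 * C * C1) * X * D * (1/2) ^ j"
        using C C1 XD D by (intro mult_right_mono) auto
      then show ?thesis using near[OF that] unfolding X_def D_def by linarith
    qed
    assume J: "2 ^ J \<le> \<langle>(x, y)\<rangle>"
    have "kernel_trunc J w (x, y) = (LINT \<xi>|lborel. exp (\<i> * complex_of_real (\<xi> \<bullet> (x - y))) * (dyadic_cutoff J \<xi> * H w [] (x, y, \<xi>)))"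
      unfolding kernel_trunc_def by (intro Bochner_Integration.integral_cong) (auto simp: osc_deriv_def)
    also have "norm \<dots> \<le> C * exp (- (\<Lambda> + 1) * \<omega> (2 ^ J)) * D"
      unfolding D_def using xy w by (intro C goodcut_first J) auto
    also have "\<dots> \<le> C * X * D"
    proof (intro mult_right_mono mult_left_mono)
      show "exp (- (\<Lambda> + 1) * \<omega> (2 ^ J)) \<le> X" unfolding X_def using w_nonneg[of "2 ^ J"] by (simp add: algebra_simps)
    qed (use C D in auto)
    finally have "norm (kernel_trunc J w (x, y)) \<le> C * X * D" .
    moreover have "norm (kernel_lim w (x, y)) \<le> norm (kernel_trunc J w (x, y)) + norm (kernel_trunc J w (x, y) - kernel_lim w (x, y))"
      by (metis norm_minus_commute norm_triangle_sub)
    moreover have "2 * C * C1 * X * D * (1/2) ^ J \<le> 2 * C * C1 * X * D * 1"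
      using C C1 XD D by (intro mult_left_mono) (auto simp: power_le_one)
    ultimately show "norm (kernel_lim w (x, y)) \<le> (C + 2 * C * C1) * exp (- \<Lambda> * \<omega> (2 ^ J)) * (12 ^ length w * young_exp \<mu> (length w))"
      using near[of J] unfolding X_def[symmetric] D_def[symmetric] by (simp add: algebra_simps)
  qed
qed

definition offdiag :: "('a \<times> 'a) set" where "offdiag = {z. fst z \<noteq> snd z}"

lemma open_offdiag: "open offdiag"
  unfolding offdiag_def by (intro open_Collect_neq continuous_intros)

text \<open>Within |x-y|/4 of z, points keep at least half the distance to the diagonal measured by
  x - y. The radius and \<open>J\<close> are chosen before the word, since a word and its extension
  by a letter must be handled on the same ball.\<close>

lemma kernel_lim_locally_uniform:
  assumes z: "z \<in> offdiag"
  shows "\<exists>e>0. \<exists>J::nat. \<forall>w. set w \<subseteq> Basis \<longrightarrow> (\<exists>D. \<forall>z'. norm (z' - z) < e \<longrightarrow>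
    (\<lambda>j. kernel_trunc j w z') \<longlonglongrightarrow> kernel_lim w z' \<and> (\<forall>j\<ge>J. norm (kernel_trunc j w z' - kernel_lim w z') \<le> D * (1/2) ^ j))"
proof -
  obtain x y where xy: "z = (x, y)" by (cases z)
  define e where "e = norm (x - y) / 4"
  have e: "e > 0" using z by (simp add: e_def offdiag_def xy)
  obtain J where J: "norm x + norm y + e < 2 ^ J"
    using real_arch_pow[of 2 "norm x + norm y + e"] by auto
  have near: "2 * e \<le> norm (x' - y')" "norm x' \<le> 2 * 2 ^ J" "norm y' \<le> 2 * 2 ^ J" if "norm ((x', y') - z) < e" for x' y'
  proof -
    have "norm (x' - x) \<le> norm ((x', y') - z)" "norm (y' - y) \<le> norm ((x', y') - z)"
      using norm_fst_le[of "x' - x" "y' - y"] norm_snd_le[of "y' - y" "x' - x"] by (auto simp: xy)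
    then have n: "norm (x' - x) < e" "norm (y' - y) < e" using that by auto
    have "norm (x - y) \<le> norm (x' - y') + norm (x' - x) + norm (y' - y)"
      using norm_triangle_ineq4[of "x' - y'" "(x' - x) - (y' - y)"] norm_triangle_ineq4[of "x' - x" "y' - y"] by simp
    then show "2 * e \<le> norm (x' - y')" using n by (simp add: e_def)
    have "norm x' \<le> norm x + norm (x' - x)" "norm y' \<le> norm y + norm (y' - y)" by (simp_all add: norm_triangle_sub)
    then show "norm x' \<le> 2 * 2 ^ J" "norm y' \<le> 2 * 2 ^ J" using n J norm_ge_zero[of x] norm_ge_zero[of y] zero_less_power[of "2::real" J] by linarith+
  qed
  have e2: "2 * e > 0" using e by simp
  obtain C where C: "\<And>J x y w. 2 * e \<le> norm (x - y) \<Longrightarrow> norm x \<le> 2 * 2 ^ J \<Longrightarrow> norm y \<le> 2 * 2 ^ J \<Longrightarrow> set w \<subseteq> Basis \<Longrightarrow>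
    (\<lambda>j. kernel_trunc j w (x, y)) \<longlonglongrightarrow> kernel_lim w (x, y) \<and>
    (\<forall>j\<ge>J. norm (kernel_trunc j w (x, y) - kernel_lim w (x, y)) \<le> C * exp (- 1 * \<omega> (2 ^ J)) * (12 ^ length w * young_exp 1 (length w)) * (1/2) ^ j)"
    using kernel_trunc_limit[OF e2, of 1 1] by (meson zero_less_one)
  show ?thesis
  proof (rule exI[of _ e], intro conjI e exI[of _ J] allI impI)
    fix w :: "('a \<times> 'a) list" assume w: "set w \<subseteq> Basis"
    show "\<exists>D. \<forall>z'. norm (z' - z) < e \<longrightarrow>
      (\<lambda>j. kernel_trunc j w z') \<longlonglongrightarrow> kernel_lim w z' \<and> (\<forall>j\<ge>J. norm (kernel_trunc j w z' - kernel_lim w z') \<le> D * (1/2) ^ j)"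
    proof (intro exI[of _ "C * exp (- 1 * \<omega> (2 ^ J)) * (12 ^ length w * young_exp 1 (length w))"] allI impI)
      fix z' assume "norm (z' - z) < e"
      then show "(\<lambda>j. kernel_trunc j w z') \<longlonglongrightarrow> kernel_lim w z' \<and> (\<forall>j\<ge>J. norm (kernel_trunc j w z' - kernel_lim w z') \<le> C * exp (- 1 * \<omega> (2 ^ J)) * (12 ^ length w * young_exp 1 (length w)) * (1/2) ^ j)"
        using C[OF near w] by (cases z') auto
    qed
  qed
qed

lemma kernel_lim_cont:
  assumes w: "set w \<subseteq> Basis" shows "continuous_on offdiag (kernel_lim w)"
  unfolding continuous_on_eq_continuous_at[OF open_offdiag]
proof
  fix z assume z: "z \<in> offdiag"
  obtain e J D where e: "e > 0" and D: "\<And>z' j. norm (z' - z) < e \<Longrightarrow> j \<ge> J \<Longrightarrow> norm (kernel_trunc j w z' - kernel_lim w z') \<le> D * (1/2) ^ j"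
    using kernel_lim_locally_uniform[OF z] w by metis
  have "uniform_limit (ball z e) (\<lambda>j. kernel_trunc j w) (kernel_lim w) sequentially"
    unfolding uniform_limit_iff
  proof (intro allI impI)
    fix e' :: real assume e': "e' > 0"
    have "(\<lambda>j. D * (1/2) ^ j) \<longlonglongrightarrow> D * 0" by (intro tendsto_intros LIMSEQ_power_zero) auto
    then have "\<forall>\<^sub>F j in sequentially. D * (1/2) ^ j < e'" using e' by (auto dest: order_tendstoD)
    then show "\<forall>\<^sub>F j in sequentially. \<forall>z'\<in>ball z e. dist (kernel_trunc j w z') (kernel_lim w z') < e'"
      using eventually_ge_at_top[of J]
    proof eventually_elim
      case (elim j)
      show ?case
      proof
        fix z' assume "z' \<in> ball z e"
        then have "norm (z' - z) < e" by (simp add: dist_norm norm_minus_commute)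
        from D[OF this elim(2)] show "dist (kernel_trunc j w z') (kernel_lim w z') < e'" using elim(1) by (simp add: dist_norm)
      qed
    qed
  qed
  then have "continuous_on (ball z e) (kernel_lim w)"
    by (rule uniform_limit_theorem[rotated]) (auto intro!: always_eventually continuous_on_subset[OF kernel_trunc_cont[OF w]])
  then show "isCont (kernel_lim w) z" using e by (auto simp: continuous_on_eq_continuous_at)
qed

lemma kernel_lim_partial:
  assumes w: "set w \<subseteq> Basis" and c: "c \<in> Basis" and z: "z \<in> offdiag"
  shows "has_partial c (kernel_lim w) z \<and> Dpartial c (kernel_lim w) z = kernel_lim (c # w) z"
proof -
  obtain e J where e: "e > 0" and loc: "\<And>w. set w \<subseteq> Basis \<Longrightarrow> (\<exists>D. \<forall>z'. norm (z' - z) < e \<longrightarrow>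
    (\<lambda>j. kernel_trunc j w z') \<longlonglongrightarrow> kernel_lim w z' \<and> (\<forall>j\<ge>J. norm (kernel_trunc j w z' - kernel_lim w z') \<le> D * (1/2) ^ j))"
    using kernel_lim_locally_uniform[OF z] by blast
  have cw: "set (c # w) \<subseteq> Basis" using w c by simp
  obtain D where D: "\<And>z' j. norm (z' - z) < e \<Longrightarrow> j \<ge> J \<Longrightarrow> norm (kernel_trunc j (c # w) z' - kernel_lim (c # w) z') \<le> D * (1/2) ^ j"
    using loc[OF cw] by blast
  have lim: "\<And>z'. norm (z' - z) < e \<Longrightarrow> (\<lambda>j. kernel_trunc j w z') \<longlonglongrightarrow> kernel_lim w z'" using loc[OF w] by blast
  have nz: "norm ((z + t *\<^sub>R c) - z) < e" if "\<bar>t\<bar> < e" for t using that c by simp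
  have "((\<lambda>t. kernel_lim w (z + t *\<^sub>R c)) has_vector_derivative \<i> * kernel_lim (c # w) (z + 0 *\<^sub>R c)) (at 0)"
  proof (rule has_vector_derivative_limit[OF e])
    fix t :: real assume t: "\<bar>t\<bar> < e"
    show "((\<lambda>t. kernel_trunc j w (z + t *\<^sub>R c)) has_vector_derivative \<i> * kernel_trunc j (c # w) (z + t *\<^sub>R c)) (at t)" for j
      using has_partial_shift[OF kernel_trunc_partial(1)[OF w c]] by (simp add: kernel_trunc_partial(2)[OF w c])
    show "(\<lambda>j. kernel_trunc j w (z + t *\<^sub>R c)) \<longlonglongrightarrow> kernel_lim w (z + t *\<^sub>R c)" by (rule lim[OF nz[OF t]])
    show "norm (\<i> * kernel_trunc j (c # w) (z + t *\<^sub>R c) - \<i> * kernel_lim (c # w) (z + t *\<^sub>R c)) \<le> D * (1/2) ^ j" if "j \<ge> J" for j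
      using D[OF nz[OF t] that] by (simp add: right_diff_distrib[symmetric] norm_mult)
  next
    have "(\<lambda>j. D * (1/2) ^ j) \<longlonglongrightarrow> D * 0" by (intro tendsto_intros LIMSEQ_power_zero) auto
    then show "(\<lambda>j. D * (1/2) ^ j) \<longlonglongrightarrow> 0" by simp
  qed
  from has_partialI[OF this] show ?thesis by simp
qed

lemma kernel_lim_smooth:
  shows "Cinf_on offdiag (kernel_lim [])" "set w \<subseteq> Basis \<Longrightarrow> z \<in> offdiag \<Longrightarrow> Dw w (kernel_lim []) z = kernel_lim w z"
  by (rule Cinf_coinduct[OF open_offdiag, where G = kernel_lim]; simp add: kernel_lim_cont kernel_lim_partial)+

text \<open>J is the dyadic scale with 2^J \<le> \<langle>(x, y)\<rangle> < 2^(J+1). Then |x| and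
  |y| are at most 2 times 2^J, so (\<alpha>) bounds both weights by L(\<omega>(2^J) + 1), and
  \<Lambda> = 2 L \<mu> yields the decay in x and in y.\<close>

lemma kernel_lim_bound:
  assumes r0: "r0 > 0" and mu: "\<mu> > 0"
  shows "\<exists>C>0. \<forall>x y w. r0 \<le> norm (x - y) \<longrightarrow> set w \<subseteq> Basis \<longrightarrow>
    norm (kernel_lim w (x, y)) \<le> C * young_exp \<mu> (length w) * exp (- \<mu> * \<omega> (norm x)) * exp (- \<mu> * \<omega> (norm y))"
proof -
  obtain L where L: "L \<ge> 1" "\<And>s. s \<ge> 0 \<Longrightarrow> \<omega> (2 * s) \<le> L * (\<omega> s + 1)" using w_scale[of 2] by auto
  \<comment> \<open>The larger index \<mu>' leaves room to swallow the powers of 12.\<close>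
  obtain C1 \<mu>' where C1: "C1 \<ge> 1" "\<mu>' \<ge> \<mu>" "\<And>k::nat. 12 ^ k * young_exp \<mu>' (real k) \<le> C1 * young_exp \<mu> (real k)"
    using young_exp_absorb[of 12 \<mu>] mu by auto
  have mu': "\<mu>' > 0" using mu C1 by simp
  have La: "2 * L * \<mu> > 0" using L mu by simp
  obtain C where C: "C > 0" "\<And>J x y w. r0 \<le> norm (x - y) \<Longrightarrow> norm x \<le> 2 * 2 ^ J \<Longrightarrow> norm y \<le> 2 * 2 ^ J \<Longrightarrow> set w \<subseteq> Basis \<Longrightarrow>
    2 ^ J \<le> \<langle>(x, y)\<rangle> \<Longrightarrow> norm (kernel_lim w (x, y)) \<le> C * exp (- (2 * L * \<mu>) * \<omega> (2 ^ J)) * (12 ^ length w * young_exp \<mu>' (length w))"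
    using kernel_trunc_limit[OF r0 mu' La] by meson
  show ?thesis
  proof (intro exI[of _ "C * C1 * exp (2 * L * \<mu>)"] conjI allI impI)
    show "C * C1 * exp (2 * L * \<mu>) > 0" using C C1 by simp
    fix x y :: 'a and w :: "('a \<times> 'a) list" assume xy: "r0 \<le> norm (x - y)" and w: "set w \<subseteq> Basis"
    define s where "s = \<langle>(x, y)\<rangle>"
    have s1: "s \<ge> 1" unfolding s_def by (rule jbracket_ge1)
    define n where "n = (LEAST n. s < 2 ^ n)"
    have "\<exists>n. s < 2 ^ n" by (rule real_arch_pow) simp
    then have n: "s < 2 ^ n" unfolding n_def by (rule LeastI_ex)
    then have "n \<noteq> 0" using s1 by (intro notI) simp
    then obtain J where J: "n = Suc J" by (cases n) auto
    have J1: "2 ^ J \<le> s" using not_less_Least[of J "\<lambda>n. s < 2 ^ n"] J by (simp add: n_def)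
    have le: "norm x \<le> 2 * 2 ^ J" "norm y \<le> 2 * 2 ^ J"
      using norm_fst_le[of x y] norm_snd_le[of y x] norm_le_jbracket[of "(x, y)"] n J by (auto simp: s_def)
    have "\<omega> (norm x) \<le> L * (\<omega> (2 ^ J) + 1)" "\<omega> (norm y) \<le> L * (\<omega> (2 ^ J) + 1)"
      using w_mono[OF _ le(1)] w_mono[OF _ le(2)] L(2)[of "2 ^ J"] by auto
    then have "\<mu> * (\<omega> (norm x) + \<omega> (norm y)) \<le> \<mu> * (2 * L * (\<omega> (2 ^ J) + 1))"
      using mu by (intro mult_left_mono) auto
    then have ex: "exp (- (2 * L * \<mu>) * \<omega> (2 ^ J)) \<le> exp (2 * L * \<mu>) * (exp (- \<mu> * \<omega> (norm x)) * exp (- \<mu> * \<omega> (norm y)))"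
      by (simp add: mult_exp_exp algebra_simps)
    have "norm (kernel_lim w (x, y)) \<le> C * exp (- (2 * L * \<mu>) * \<omega> (2 ^ J)) * (12 ^ length w * young_exp \<mu>' (length w))"
      by (rule C(2)[OF xy le w J1[unfolded s_def]])
    also have "\<dots> \<le> C * (exp (2 * L * \<mu>) * (exp (- \<mu> * \<omega> (norm x)) * exp (- \<mu> * \<omega> (norm y)))) * (C1 * young_exp \<mu> (length w))"
      using C(1) C1(1) by (intro mult_mono mult_left_mono ex C1(3)) auto
    finally show "norm (kernel_lim w (x, y)) \<le> C * C1 * exp (2 * L * \<mu>) * young_exp \<mu> (length w) * exp (- \<mu> * \<omega> (norm x)) * exp (- \<mu> * \<omega> (norm y))"
      by (simp add: mult_ac)
  qed
qed

end

section \<open>The action of the operator as a functional\<close>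

lemma diff_along_slice:
  fixes h :: "'a::euclidean_space \<Rightarrow> 'z::euclidean_space"
  assumes F: "Cinf_on UNIV F" and c: "c \<in> Basis" and h: "continuous_on UNIV h" "\<And>y t. h (y + t *\<^sub>R b) = h y + t *\<^sub>R c"
    and W: "set W \<subseteq> Basis"
  shows "diff_along b N (\<lambda>y. Dw W F (h y))" "(Dpartial b ^^ l) (\<lambda>y. Dw W F (h y)) = (\<lambda>y. Dw (replicate l c @ W) F (h y))"
proof -
  have D: "Dpartial b (\<lambda>y. Dw V F (h y)) = (\<lambda>y. Dw (c # V) F (h y))" for V
    by (auto simp: Dpartial_def h(2))
  have hp: "has_partial b (\<lambda>y. Dw V F (h y)) y" if "set V \<subseteq> Basis" for V y
    using Cinf_partial[OF F that c, of "h y"] by (simp add: has_partial_def h(2))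
  show "diff_along b N (\<lambda>y. Dw W F (h y))"
    using W
  proof (induction N arbitrary: W)
    case (Suc N)
    have "diff_along b N (\<lambda>y. Dw (c # W) F (h y))" using Suc.prems c by (intro Suc.IH) auto
    then show ?case using Suc.prems hp D by (auto intro!: Cinf_cont_compose[OF F _ h(1)])
  qed (auto intro!: Cinf_cont_compose[OF F _ h(1)])
  show "(Dpartial b ^^ l) (\<lambda>y. Dw W F (h y)) = (\<lambda>y. Dw (replicate l c @ W) F (h y))"
    by (induction l) (auto simp: D)
qed

section \<open>Seminorm bounds as a predicate\<close>

context weight
begin

text \<open>The statement that the seminorm with index \<mu> is at most Q, in a form that avoids a
  possibly infinite supremum and includes smoothness. \<open>S_seminorm_le\<close> connects it with
  the topology.\<close>

definition sbound :: "real \<Rightarrow> real \<Rightarrow> ('z::euclidean_space \<Rightarrow> complex) \<Rightarrow> bool" where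
  "sbound \<mu> Q G \<longleftrightarrow> Cinf_on UNIV G \<and> (\<forall>w z. set w \<subseteq> Basis \<longrightarrow> norm (Dw w G z) \<le> Q * young_exp \<mu> (length w) * exp (- \<mu> * \<omega> (norm z)))"

lemma sbound_nonneg:
  fixes G :: "'z::euclidean_space \<Rightarrow> complex"
  assumes "sbound \<mu> Q G" shows "Q \<ge> 0"
proof -
  have "norm (Dw [] G 0) \<le> Q * young_exp \<mu> (length ([]::'z list)) * exp (- \<mu> * \<omega> (norm (0::'z)))"
    using assms unfolding sbound_def by (metis empty_set empty_subsetI)
  then have "0 \<le> Q * young_exp \<mu> (length ([]::'z list)) * exp (- \<mu> * \<omega> (norm (0::'z)))" using norm_ge_zero order.trans by blast
  then show ?thesis using young_exp_pos[of \<mu> 0] by (auto simp: zero_le_mult_iff simp del: young_exp_pos)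
qed

lemma sbound_add:
  assumes "sbound \<mu> Q f" "sbound \<mu> Q' g" shows "sbound \<mu> (Q + Q') (\<lambda>x. f x + g x)"
  using assms unfolding sbound_def
  by (auto simp: Cinf_add algebra_simps intro!: order.trans[OF norm_triangle_ineq] add_mono)

lemma sbound_cmult:
  assumes "sbound \<mu> Q f" shows "sbound \<mu> (norm c * Q) (\<lambda>x. c * f x)"
  using assms unfolding sbound_def
  by (auto simp: Cinf_cmult norm_mult mult.assoc intro!: mult_left_mono)

lemma sbound_0: "sbound \<mu> 0 (\<lambda>_::'z::euclidean_space. 0)"
proof -
  have "has_partial b (\<lambda>_. 0) x \<and> Dpartial b (\<lambda>_. 0) x = 0" for b x :: 'z by (simp add: Dpartial_const)
  then have "Cinf_on UNIV (\<lambda>_::'z. 0)" "\<And>w x. set w \<subseteq> Basis \<Longrightarrow> Dw w (\<lambda>_::'z. 0) x = 0"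
    using Cinf_coinduct[of UNIV "\<lambda>_ _. 0" "\<lambda>_::'z. 0"] by auto
  then show ?thesis by (simp add: sbound_def)
qed

end

section \<open>The iterated integral of the amplitude against a function of two variables\<close>

context amplitude
begin

definition kaction_density :: "('a \<times> 'a \<Rightarrow> complex) \<Rightarrow> 'a \<Rightarrow> 'a \<Rightarrow> complex" where
  "kaction_density G x \<xi> = (LINT y|lborel. exp (\<i> * complex_of_real ((x - y) \<bullet> \<xi>)) * a (x, y, \<xi>) * G (x, y))"

definition kaction :: "('a \<times> 'a \<Rightarrow> complex) \<Rightarrow> complex" where
  "kaction G = (LINT x|lborel. LINT \<xi>|lborel. kaction_density G x \<xi>)"

text \<open>The order of integration, first y, then \<xi>, then x, is that of \<open>pdo\<close>. So
  u x is simply pulled out of the inner integrals, and no interchange is involved.\<close>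

lemma kaction_tensor: "kaction (\<lambda>(x, y). u x * f y) = (LINT x|lborel. u x * pdo a f x)"
proof -
  have "kaction_density (\<lambda>(x, y). u x * f y) x = (\<lambda>\<xi>. u x * (LINT y|lborel. exp (\<i> * complex_of_real ((x - y) \<bullet> \<xi>)) * a (x, y, \<xi>) * f y))" for x
    unfolding kaction_density_def by (subst integral_mult_right_zero[symmetric]) (simp add: mult_ac)
  then show ?thesis unfolding kaction_def pdo_def by simp
qed

lemma a_slice:
  assumes "b \<in> Basis"
  shows "diff_along b N (\<lambda>y. a (x, y, \<xi>))" "(Dpartial b ^^ l) (\<lambda>y. a (x, y, \<xi>)) = (\<lambda>y. Dw (replicate l (0, b, 0)) a (x, y, \<xi>))"
proof -
  have c: "(0, b, 0) \<in> (Basis :: ('a \<times> 'a \<times> 'a) set)" using assms by (auto simp: Basis_prod_def zero_prod_def)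
  show "diff_along b N (\<lambda>y. a (x, y, \<xi>))" "(Dpartial b ^^ l) (\<lambda>y. a (x, y, \<xi>)) = (\<lambda>y. Dw (replicate l (0, b, 0)) a (x, y, \<xi>))"
    using diff_along_slice[OF a_smooth c, of "\<lambda>y. (x, y, \<xi>)" b "[]"]
      continuous_on_Pair[OF continuous_on_const continuous_on_Pair[OF continuous_on_id continuous_on_const], of UNIV x \<xi>] by auto
qed

lemma G_slice:
  fixes G :: "'a \<times> 'a \<Rightarrow> complex"
  assumes "b \<in> Basis" "Cinf_on UNIV G"
  shows "diff_along b N (\<lambda>y. G (x, y))" "(Dpartial b ^^ l) (\<lambda>y. G (x, y)) = (\<lambda>y. Dw (replicate l (0, b)) G (x, y))"
proof -
  have c: "(0, b) \<in> (Basis :: ('a \<times> 'a) set)" using assms by (auto simp: Basis_prod_def zero_prod_def)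
  have "continuous_on UNIV (\<lambda>y. (x, y))" by (intro continuous_on_Pair continuous_on_const continuous_on_id)
  then show "diff_along b N (\<lambda>y. G (x, y))" "(Dpartial b ^^ l) (\<lambda>y. G (x, y)) = (\<lambda>y. Dw (replicate l (0, b)) G (x, y))"
    using diff_along_slice[OF assms(2) c, of "\<lambda>y. (x, y)" b "[]"] by auto
qed

text \<open>Partial integration in y instead of \<xi>. The amplitude has ratio 2s and G has ratio s,
  together 3s. The index n \<ge> 2(|m| + 1) makes the decay of G outweigh the growth of the
  amplitude in x and y, with one factor e^{-\<omega>} to spare in each variable.\<close>

lemma kaction_density_parts:
  fixes n :: nat
  assumes n: "n \<ge> 1" "\<bar>m\<bar> + 1 \<le> n / 2"
    and C: "C > 0" "\<And>x y \<xi> W. set W \<subseteq> Basis \<Longrightarrow> norm (Dw W a (x, y, \<xi>)) \<le>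
      C * (\<langle>x - y\<rangle> / \<langle>(x, y, \<xi>)\<rangle>) powr (\<rho> * length W) * young_exp (real n) (length W) powr \<rho> * mfactor x y \<xi>"
    and CJ: "CJ \<ge> 1" "\<And>y::'a. exp (- \<omega> (norm y)) \<le> CJ * prod_majorant y"
    and G: "sbound (real n) Q G" and b: "b \<in> Basis" and s: "s \<ge> 0" "\<And>l::nat. l \<le> N \<Longrightarrow> young_exp (real n) l \<le> s ^ l"
  shows "norm (kaction_density G x \<xi>) * \<bar>\<xi> \<bullet> b\<bar> ^ N \<le>
    (C * Q * exp (\<bar>m\<bar> * \<omega> (norm \<xi>))) * (3 * s) ^ N * (CJ * prod_majorant x * (CJ * (LINT y|lborel. prod_majorant (y::'a))))"
    "integrable lborel (\<lambda>y. exp (\<i> * complex_of_real ((x - y) \<bullet> \<xi>)) * a (x, y, \<xi>) * G (x, y))"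
proof -
  have Q0: "Q \<ge> 0" by (rule sbound_nonneg[OF G])
  have GC: "Cinf_on UNIV G" using G by (simp add: sbound_def)
  define g where "g = (\<lambda>y. a (x, y, \<xi>) * G (x, y))"
  have greg: "diff_along b N g" unfolding g_def by (intro diff_along_mult a_slice(1) G_slice(1) b GC)
  define M where "M = C * Q * exp (\<bar>m\<bar> * \<omega> (norm \<xi>))"
  have M0: "M \<ge> 0" using C(1) Q0 by (simp add: M_def)
  have decay: "C * mfactor x y \<xi> * (Q * exp (- real n * \<omega> (norm (x, y)))) \<le> M * (CJ * prod_majorant x * (CJ * prod_majorant y))" for y
  proof -
    define A where "A = \<omega> (norm x) + \<omega> (norm y)"
    have A0: "A \<ge> 0" by (simp add: A_def w_nonneg)
    have "\<omega> (norm x) \<le> \<omega> (norm (x, y))" "\<omega> (norm y) \<le> \<omega> (norm (x, y))"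
      using norm_fst_le[of x y] norm_snd_le[of y x] by (auto intro!: w_mono)
    \<comment> \<open>The norm of the pair dominates both |x| and |y|, hence \<omega> there is at
      least the mean of the two weights; this is the origin of n/2.\<close>
    then have "A / 2 \<le> \<omega> (norm (x, y))" by (simp add: A_def)
    then have "real n * (A / 2) \<le> real n * \<omega> (norm (x, y))" by (intro mult_left_mono) auto
    moreover have "m * (A + \<omega> (norm \<xi>)) \<le> \<bar>m\<bar> * (A + \<omega> (norm \<xi>))" using A0 by (intro mult_right_mono add_nonneg_nonneg w_nonneg) auto
    moreover have "(\<bar>m\<bar> + 1) * A \<le> n / 2 * A" using n A0 by (intro mult_right_mono) auto
    ultimately have "m * (A + \<omega> (norm \<xi>)) + (- real n * \<omega> (norm (x, y))) \<le> \<bar>m\<bar> * \<omega> (norm \<xi>) + - A"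
      by (simp add: algebra_simps)
    then have "mfactor x y \<xi> * exp (- real n * \<omega> (norm (x, y))) \<le> exp (\<bar>m\<bar> * \<omega> (norm \<xi>)) * exp (- A)"
      unfolding A_def mult_exp_exp by (simp only: exp_le_cancel_iff add.assoc)
    also have "exp (- A) = exp (- \<omega> (norm x)) * exp (- \<omega> (norm y))" by (simp add: A_def mult_exp_exp)
    also have "exp (\<bar>m\<bar> * \<omega> (norm \<xi>)) * (exp (- \<omega> (norm x)) * exp (- \<omega> (norm y))) \<le> exp (\<bar>m\<bar> * \<omega> (norm \<xi>)) * ((CJ * prod_majorant x) * (CJ * prod_majorant y))"
      using CJ prod_majorant_pos[of x] by (intro mult_left_mono mult_mono CJ(2)) (auto simp: less_imp_le)
    finally have "(C * Q) * (mfactor x y \<xi> * exp (- real n * \<omega> (norm (x, y)))) \<le> (C * Q) * (exp (\<bar>m\<bar> * \<omega> (norm \<xi>)) * ((CJ * prod_majorant x) * (CJ * prod_majorant y)))"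
      using C(1) Q0 by (intro mult_left_mono) auto
    then show ?thesis by (simp add: M_def mult_ac)
  qed
  have gbound: "norm ((Dpartial b ^^ l) g y) \<le> M * (CJ * prod_majorant x * (CJ * prod_majorant y)) * (3 * s) ^ l"
    if N': "l \<le> N'" "\<And>l. l \<le> N' \<Longrightarrow> young_exp (real n) (real l) \<le> s ^ l" for l N' y
  proof -
    have ga: "geo_bounded b N' y (C * mfactor x y \<xi>) (2 * s) (\<lambda>y. a (x, y, \<xi>))"
      unfolding geo_bounded_def
    proof (intro allI impI)
      fix l assume l: "l \<le> N'"
      let ?j = "\<langle>x - y\<rangle> / \<langle>(x, y, \<xi>)\<rangle>"
      have j0: "?j > 0" using jbracket_ge1[of "x - y"] jbracket_ge1[of "(x, y, \<xi>)"] by simp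
      have j2: "?j \<le> 2" using jbracket_diff[of x y \<xi>] jbracket_ge1[of "(x, y, \<xi>)"] by (simp add: divide_le_eq)
      have "?j powr (\<rho> * l) \<le> 2 powr (\<rho> * l)" using j2 j0 rho by (intro powr_mono2) auto
      also have "\<dots> \<le> 2 powr (1 * real l)" using rho by (intro powr_mono mult_right_mono) auto
      finally have 1: "?j powr (\<rho> * l) \<le> 2 ^ l" by (simp add: powr_realpow)
      have "young_exp n (real l) powr \<rho> \<le> young_exp n (real l) powr 1"
        using young_exp_ge1[of n l] n rho by (intro powr_mono) auto
      then have 2: "young_exp n (real l) powr \<rho> \<le> s ^ l" using N'(2)[OF l] by simp
      have "set (replicate l (0, b, 0)) \<subseteq> (Basis :: ('a \<times> 'a \<times> 'a) set)"
        using b by (auto simp: set_replicate_conv_if Basis_prod_def zero_prod_def)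
      from C(2)[OF this, of x y \<xi>]
      have "norm ((Dpartial b ^^ l) (\<lambda>y. a (x, y, \<xi>)) y) \<le> C * ?j powr (\<rho> * l) * young_exp n (real l) powr \<rho> * mfactor x y \<xi>"
        by (simp add: a_slice(2)[OF b])
      also have "\<dots> \<le> C * 2 ^ l * s ^ l * mfactor x y \<xi>"
        using 1 2 C(1) by (intro mult_right_mono mult_mono) auto
      finally show "norm ((Dpartial b ^^ l) (\<lambda>y. a (x, y, \<xi>)) y) \<le> C * mfactor x y \<xi> * (2 * s) ^ l"
        by (simp add: power_mult_distrib mult_ac)
    qed
    have gG: "geo_bounded b N' y (Q * exp (- real n * \<omega> (norm (x, y)))) s (\<lambda>y. G (x, y))"
      unfolding geo_bounded_def
    proof (intro allI impI)
      fix l assume l: "l \<le> N'"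
      have "set (replicate l (0, b)) \<subseteq> (Basis :: ('a \<times> 'a) set)"
        using b by (auto simp: set_replicate_conv_if Basis_prod_def zero_prod_def)
      then have "norm ((Dpartial b ^^ l) (\<lambda>y. G (x, y)) y) \<le> Q * young_exp n (real (length (replicate l (0::'a, b)))) * exp (- real n * \<omega> (norm (x, y)))"
        using G unfolding sbound_def G_slice(2)[OF b GC] by blast
      also have "\<dots> \<le> Q * s ^ l * exp (- real n * \<omega> (norm (x, y)))"
        using N'(2)[OF l] Q0 by (intro mult_right_mono mult_left_mono) auto
      finally show "norm ((Dpartial b ^^ l) (\<lambda>y. G (x, y)) y) \<le> Q * exp (- real n * \<omega> (norm (x, y))) * s ^ l"
        by (simp add: mult_ac)
    qed
    have "geo_bounded b N' y (C * mfactor x y \<xi> * (Q * exp (- real n * \<omega> (norm (x, y))))) (2 * s + s) g"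
      unfolding g_def using C(1) Q0 s by (intro geo_bounded_mult a_slice(1) G_slice(1) b GC ga gG) auto
    then have "norm ((Dpartial b ^^ l) g y) \<le> C * mfactor x y \<xi> * (Q * exp (- real n * \<omega> (norm (x, y)))) * (2 * s + s) ^ l"
      using N'(1) by (simp add: geo_bounded_def)
    also have "\<dots> \<le> M * (CJ * prod_majorant x * (CJ * prod_majorant y)) * (2 * s + s) ^ l"
      using s by (intro mult_right_mono decay) auto
    finally show ?thesis by simp
  qed
  have CJx: "CJ * prod_majorant x \<ge> 0" using CJ prod_majorant_pos[of x] by simp
  have gN: "norm ((Dpartial b ^^ l) g y) \<le> (M * (CJ * prod_majorant x) * CJ * (1 + 3 * s) ^ N) * prod_majorant y" if "l \<le> N" for l y
  proof -
    have "(3 * s) ^ l \<le> (1 + 3 * s) ^ N"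
      using s(1) that by (intro order.trans[OF power_mono[of "3 * s" "1 + 3 * s"]] power_increasing) auto
    then have "M * (CJ * prod_majorant x * (CJ * prod_majorant y)) * (3 * s) ^ l \<le> M * (CJ * prod_majorant x * (CJ * prod_majorant y)) * (1 + 3 * s) ^ N"
      using M0 CJ prod_majorant_pos[of x] prod_majorant_pos[of y] by (intro mult_left_mono mult_nonneg_nonneg) auto
    then show ?thesis using gbound[of l N y] that s(2) by (simp add: mult_ac)
  qed
  have e: "exp (\<i> * complex_of_real ((x - y) \<bullet> \<xi>)) = exp (\<i> * complex_of_real (x \<bullet> \<xi>)) * exp (\<i> * complex_of_real (y \<bullet> (- \<xi>)))" for y
    by (simp add: exp_add[symmetric] inner_diff_left algebra_simps)
  have eq: "exp (\<i> * complex_of_real ((x - y) \<bullet> \<xi>)) * a (x, y, \<xi>) * G (x, y) =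
    exp (\<i> * complex_of_real (x \<bullet> \<xi>)) * (exp (\<i> * complex_of_real (y \<bullet> (- \<xi>))) * g y)" for y
    unfolding e by (simp add: g_def)
  have "norm (kaction_density G x \<xi>) = norm (LINT y|lborel. exp (\<i> * complex_of_real (y \<bullet> (- \<xi>))) * g y)"
    unfolding kaction_density_def eq by (simp add: norm_mult)
  also have "\<dots> * \<bar>(- \<xi>) \<bullet> b\<bar> ^ N \<le> (LINT y|lborel. norm ((Dpartial b ^^ N) g y))"
    by (rule integral_exp_parts[OF b greg gN])
  also have "\<dots> \<le> (LINT y|lborel. M * (CJ * prod_majorant x) * CJ * (3 * s) ^ N * prod_majorant (y::'a))"
  proof (rule integral_mono)
    have "continuous_on UNIV ((Dpartial b ^^ N) g)" by (rule diff_along_Dcont[OF greg]) simp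
    then show "integrable lborel (\<lambda>y. norm ((Dpartial b ^^ N) g y))"
      using gN[of N] by (intro integrable_norm prod_majorant_integrable_bound) (auto intro: borel_measurable_continuous_onI)
    show "integrable lborel (\<lambda>y::'a. M * (CJ * prod_majorant x) * CJ * (3 * s) ^ N * prod_majorant y)"
      by (intro integrable_mult_right prod_majorant_integrable)
    show "norm ((Dpartial b ^^ N) g y) \<le> M * (CJ * prod_majorant x) * CJ * (3 * s) ^ N * prod_majorant y" for y
      using gbound[of N N y] s(2) by (simp add: mult_ac)
  qed
  finally show "norm (kaction_density G x \<xi>) * \<bar>\<xi> \<bullet> b\<bar> ^ N \<le>
    (C * Q * exp (\<bar>m\<bar> * \<omega> (norm \<xi>))) * (3 * s) ^ N * (CJ * prod_majorant x * (CJ * (LINT y|lborel. prod_majorant (y::'a))))"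
    by (simp add: M_def mult_ac)
  have "integrable lborel (\<lambda>y. exp (\<i> * complex_of_real (y \<bullet> (- \<xi>))) * g y)"
  proof (rule prod_majorant_integrable_bound)
    have "continuous_on UNIV g" by (rule diff_along_cont[OF greg])
    then show "(\<lambda>y. exp (\<i> * complex_of_real (y \<bullet> (- \<xi>))) * g y) \<in> borel_measurable borel"
      by (intro borel_measurable_continuous_onI continuous_intros)
    show "norm (exp (\<i> * complex_of_real (y \<bullet> (- \<xi>))) * g y) \<le> (M * (CJ * prod_majorant x) * CJ * (1 + 3 * s) ^ N) * prod_majorant y" for y
      using gN[of 0 y] by (simp add: norm_mult)
  qed
  then show "integrable lborel (\<lambda>y. exp (\<i> * complex_of_real ((x - y) \<bullet> \<xi>)) * a (x, y, \<xi>) * G (x, y))"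
    unfolding eq by (rule integrable_mult_right)
qed

text \<open>The rate is taken at t = |\<xi>|/(3d): the largest coordinate of \<xi> is then at least
  3t and cancels the factor 3t of the ratio 3tq. About n P steps gain e^{-n\<omega>(t)/2}, which for
  n \<ge> 2L(|m| + 1) beats e^{|m|\<omega>(\<xi>)} and leaves e^{-\<omega>(\<xi>)} for
  integrability.\<close>

lemma kaction_density_bound:
  "\<exists>n::nat. n \<ge> 1 \<and> (\<exists>C>0. \<forall>G Q x \<xi>. sbound (real n) Q G \<longrightarrow> norm (kaction_density G x \<xi>) \<le> C * Q * (prod_majorant x * prod_majorant \<xi>) \<and>
    integrable lborel (\<lambda>y. exp (\<i> * complex_of_real ((x - y) \<bullet> \<xi>)) * a (x, y, \<xi>) * G (x, y)))"
proof -
  define d where "d = real DIM('a)"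
  have d: "d \<ge> 1" by (simp add: d_def Suc_leI)
  define B where "B = 3 * d"
  have B: "B > 0" "B \<ge> 0" using d by (auto simp: B_def)
  obtain L where L: "L \<ge> 1" "\<And>s. s \<ge> 0 \<Longrightarrow> \<omega> (B * s) \<le> L * (\<omega> s + 1)" using w_scale[OF B(2)] by auto
  obtain CJ where CJ: "CJ \<ge> 1" "\<And>y::'a. exp (- \<omega> (norm y)) \<le> CJ * prod_majorant y" using prod_majorant_weight by blast
  obtain n :: nat where n: "real n \<ge> 2 * L * (\<bar>m\<bar> + 1)" using real_arch_simple by blast
  have "2 * (\<bar>m\<bar> + 1) \<le> 2 * L * (\<bar>m\<bar> + 1)" using L(1) by (intro mult_right_mono) auto
  then have n1: "\<bar>m\<bar> + 1 \<le> n / 2" using n by simp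
  have nL: "\<bar>m\<bar> + 1 \<le> n / (2 * L)" using n L(1) by (simp add: field_simps)
  have n0: "n \<ge> 1" using n1 by (cases n) auto
  obtain C where C: "C > 0" "\<And>x y \<xi> W. set W \<subseteq> Basis \<Longrightarrow> norm (Dw W a (x, y, \<xi>)) \<le>
      C * (\<langle>x - y\<rangle> / \<langle>(x, y, \<xi>)\<rangle>) powr (\<rho> * length W) * young_exp (real n) (length W) powr \<rho> * mfactor x y \<xi>"
    using a_bound[OF n0] by blast
  obtain T where T: "\<And>t. t \<ge> T \<Longrightarrow> \<exists>P. rate t P" using rate_exists unfolding eventually_at_top_linorder by blast
  define T1 where "T1 = max T 1"
  define I where "I = (LINT y|lborel. prod_majorant (y::'a))"
  have I: "I \<ge> 0" unfolding I_def by (intro integral_nonneg_AE AE_I2 less_imp_le[OF prod_majorant_pos])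
  define E where "E = exp (n / 2) + exp ((\<bar>m\<bar> + 1) * \<omega> (B * T1))"
  have E: "E > 0" by (simp add: E_def add_pos_pos)
  have "norm (kaction_density G x \<xi>) \<le> C * E * CJ * CJ * CJ * (I + 1) * Q * (prod_majorant x * prod_majorant \<xi>) \<and>
    integrable lborel (\<lambda>y. exp (\<i> * complex_of_real ((x - y) \<bullet> \<xi>)) * a (x, y, \<xi>) * G (x, y))" if G: "sbound (real n) Q G" for G Q x \<xi>
  proof -
    obtain b where b: "b \<in> Basis" "norm \<xi> \<le> d * \<bar>\<xi> \<bullet> b\<bar>"
      unfolding d_def using exists_large_coordinate by metis
    note parts = kaction_density_parts[OF n0 n1 C(1) C(2) CJ G b(1)]
    have Q0: "Q \<ge> 0" by (rule sbound_nonneg[OF G])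
    define W where "W = CJ * prod_majorant x * (CJ * I)"
    have W: "W \<ge> 0" using CJ prod_majorant_pos[of x] I by (simp add: W_def)
    have P0: "young_exp (real n) (real l) \<le> 1 ^ l" if "l \<le> 0" for l using that young_exp_0[of n] n0 by simp
    have i: "integrable lborel (\<lambda>y. exp (\<i> * complex_of_real ((x - y) \<bullet> \<xi>)) * a (x, y, \<xi>) * G (x, y))"
      using parts(2)[of 1 0] P0 by simp
    have key: "norm (kaction_density G x \<xi>) \<le> C * Q * (E * exp (- \<omega> (norm \<xi>))) * W"
    proof (cases "norm \<xi> / B \<ge> T1")
      case True
      define t where "t = norm \<xi> / B"
      have t: "t \<ge> T" "t \<ge> 1" "norm \<xi> = B * t" using True B by (auto simp: t_def T1_def)
      obtain P where P: "rate t P" using T[OF t(1)] by blast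
      define q where "q = exp (- \<omega> t / P)"
      have P1: "P \<ge> 1" "\<And>l::nat. real l \<le> n * P \<Longrightarrow> young_exp n l \<le> (t * q) ^ l"
        using P n0 unfolding rate_def q_def by auto
      define N where "N = nat \<lfloor>n * P\<rfloor>"
      have nP: "n * P \<ge> 1" using mult_mono[of 1 "real n" 1 P] n0 P1 by simp
      have "1 \<le> \<lfloor>n * P\<rfloor>" using nP by (simp add: le_floor_iff)
      then have N1: "real N = of_int \<lfloor>n * P\<rfloor>" "real N \<ge> 1" by (simp_all add: N_def)
      have N: "real N \<le> n * P" unfolding N1 by (rule of_int_floor_le)
      have "n * P < real N + 1" unfolding N1 by (rule real_of_int_floor_add_one_gt)
      then have N': "n * P / 2 \<le> real N" using N1(2) by simp
      have q: "q > 0" by (simp add: q_def)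
      have xb: "3 * t \<le> \<bar>\<xi> \<bullet> b\<bar>" using b(2) t d by (simp add: B_def)
      have "norm (kaction_density G x \<xi>) * \<bar>\<xi> \<bullet> b\<bar> ^ N \<le> (C * Q * exp (\<bar>m\<bar> * \<omega> (norm \<xi>))) * (3 * (t * q)) ^ N * W"
        unfolding W_def I_def using t q P1(2) N by (intro parts(1)) auto
      also have "\<dots> \<le> (C * Q * exp (\<bar>m\<bar> * \<omega> (norm \<xi>))) * (\<bar>\<xi> \<bullet> b\<bar> * q) ^ N * W"
        using xb q t Q0 C(1) W by (intro mult_right_mono mult_left_mono power_mono) auto
      also have "\<dots> = (C * Q * exp (\<bar>m\<bar> * \<omega> (norm \<xi>)) * q ^ N * W) * \<bar>\<xi> \<bullet> b\<bar> ^ N" by (simp add: power_mult_distrib)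
      finally have "norm (kaction_density G x \<xi>) \<le> C * Q * (exp (\<bar>m\<bar> * \<omega> (norm \<xi>)) * q ^ N) * W"
        using xb t by (intro mult_right_le_imp_le[of "norm (kaction_density G x \<xi>)" "\<bar>\<xi> \<bullet> b\<bar> ^ N"]) (auto simp: mult.assoc)
      also have "exp (\<bar>m\<bar> * \<omega> (norm \<xi>)) * q ^ N \<le> E * exp (- \<omega> (norm \<xi>))"
      proof -
        have w0: "\<omega> t \<ge> 0" using t by (intro w_nonneg) simp
        have "q ^ N = exp (- (\<omega> t / P * N))" by (simp add: q_def exp_of_nat_mult[symmetric] mult_ac)
        moreover have "\<omega> t / P * (n * P / 2) \<le> \<omega> t / P * N" using w0 P1 by (intro mult_left_mono N') auto
        moreover have "\<omega> t / P * (n * P / 2) = n / 2 * \<omega> t" using P1 by simp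
        moreover have "(\<bar>m\<bar> + 1) * \<omega> (norm \<xi>) \<le> n / 2 * \<omega> t + n / 2"
        proof -
          have "(\<bar>m\<bar> + 1) * \<omega> (norm \<xi>) \<le> n / (2 * L) * (L * (\<omega> t + 1))"
            using L(2)[of t] t nL w_nonneg[OF norm_ge_zero[of \<xi>]] by (intro mult_mono) auto
          also have "\<dots> = n / 2 * \<omega> t + n / 2" using L(1) by (simp add: field_simps)
          finally show ?thesis .
        qed
        moreover have "\<bar>m\<bar> * \<omega> (norm \<xi>) = (\<bar>m\<bar> + 1) * \<omega> (norm \<xi>) - \<omega> (norm \<xi>)" by (simp add: algebra_simps)
        ultimately have "exp (\<bar>m\<bar> * \<omega> (norm \<xi>)) * q ^ N \<le> exp (n / 2) * exp (- \<omega> (norm \<xi>))"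
          by (simp add: mult_exp_exp)
        also have "\<dots> \<le> E * exp (- \<omega> (norm \<xi>))" by (intro mult_right_mono) (auto simp: E_def)
        finally show ?thesis .
      qed
      finally show ?thesis using C(1) Q0 W by (simp add: mult_left_mono mult_right_mono)
    next
      case False
      have "norm (kaction_density G x \<xi>) * \<bar>\<xi> \<bullet> b\<bar> ^ 0 \<le> (C * Q * exp (\<bar>m\<bar> * \<omega> (norm \<xi>))) * (3 * 1) ^ 0 * W"
        unfolding W_def I_def by (intro parts(1) P0) auto
      then have "norm (kaction_density G x \<xi>) \<le> C * Q * exp (\<bar>m\<bar> * \<omega> (norm \<xi>)) * W" by simp
      also have "exp (\<bar>m\<bar> * \<omega> (norm \<xi>)) \<le> E * exp (- \<omega> (norm \<xi>))"
      proof -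
        have "norm \<xi> \<le> B * T1" using False B by (simp add: field_simps)
        then have "(\<bar>m\<bar> + 1) * \<omega> (norm \<xi>) \<le> (\<bar>m\<bar> + 1) * \<omega> (B * T1)" by (intro mult_left_mono w_mono) auto
        then have "exp (\<bar>m\<bar> * \<omega> (norm \<xi>)) \<le> exp ((\<bar>m\<bar> + 1) * \<omega> (B * T1)) * exp (- \<omega> (norm \<xi>))"
          by (simp add: mult_exp_exp algebra_simps)
        also have "\<dots> \<le> E * exp (- \<omega> (norm \<xi>))" by (intro mult_right_mono) (auto simp: E_def)
        finally show ?thesis .
      qed
      finally show ?thesis using C(1) Q0 W by (simp add: mult_left_mono mult_right_mono)
    qed
    also have "\<dots> \<le> C * Q * (E * (CJ * prod_majorant \<xi>)) * (CJ * prod_majorant x * (CJ * (I + 1)))"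
      unfolding W_def using C(1) Q0 E CJ(1) prod_majorant_pos[of x] prod_majorant_pos[of \<xi>] I CJ(2)[of \<xi>]
      by (intro mult_mono mult_left_mono) (auto intro!: mult_nonneg_nonneg)
    finally show ?thesis using i by (simp add: mult_ac)
  qed
  moreover have "C * E * CJ * CJ * CJ * (I + 1) > 0" using C(1) E CJ(1) I by simp
  ultimately show ?thesis using n0 by blast
qed

text \<open>One fixed index suffices: the functional is continuous for a single seminorm.\<close>

definition kaction_order :: nat where "kaction_order = (SOME n. n \<ge> 1 \<and> (\<exists>C>0. \<forall>G Q x \<xi>. sbound (real n) Q G \<longrightarrow> norm (kaction_density G x \<xi>) \<le> C * Q * (prod_majorant x * prod_majorant \<xi>) \<and>
    integrable lborel (\<lambda>y. exp (\<i> * complex_of_real ((x - y) \<bullet> \<xi>)) * a (x, y, \<xi>) * G (x, y))))"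

lemma kaction_order: "kaction_order \<ge> 1" "\<exists>C>0. \<forall>G Q x \<xi>. sbound (real kaction_order) Q G \<longrightarrow> norm (kaction_density G x \<xi>) \<le> C * Q * (prod_majorant x * prod_majorant \<xi>) \<and>
    integrable lborel (\<lambda>y. exp (\<i> * complex_of_real ((x - y) \<bullet> \<xi>)) * a (x, y, \<xi>) * G (x, y))"
  using someI_ex[OF kaction_density_bound, folded kaction_order_def] by blast+

lemma kaction_density_measurable:
  assumes G: "Cinf_on UNIV G"
  shows "(\<lambda>(x, \<xi>). kaction_density G x \<xi>) \<in> borel_measurable (borel \<Otimes>\<^sub>M borel)" "kaction_density G x \<in> borel_measurable borel"
proof -
  have "continuous_on UNIV (\<lambda>p::('a \<times> 'a) \<times> 'a. a (fst (fst p), snd p, snd (fst p)))"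
    by (rule continuous_on_compose2[of UNIV a]) (use Cinf_cont[OF a_smooth, of "[]"] in \<open>auto intro!: continuous_intros\<close>)
  moreover have "continuous_on UNIV (\<lambda>p::('a \<times> 'a) \<times> 'a. G (fst (fst p), snd p))"
    by (rule continuous_on_compose2[of UNIV G]) (use Cinf_cont[OF G, of "[]"] in \<open>auto intro!: continuous_intros\<close>)
  ultimately have "continuous_on UNIV (\<lambda>p::('a \<times> 'a) \<times> 'a. exp (\<i> * complex_of_real ((fst (fst p) - snd p) \<bullet> snd (fst p))) * a (fst (fst p), snd p, snd (fst p)) * G (fst (fst p), snd p))"
    by (intro continuous_intros)
  then have "(\<lambda>p::('a \<times> 'a) \<times> 'a. exp (\<i> * complex_of_real ((fst (fst p) - snd p) \<bullet> snd (fst p))) * a (fst (fst p), snd p, snd (fst p)) * G (fst (fst p), snd p)) \<in> borel_measurable (borel :: (('a \<times> 'a) \<times> 'a) measure)"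
    by (rule borel_measurable_continuous_onI)
  then have "case_prod (\<lambda>p y. exp (\<i> * complex_of_real ((fst p - y) \<bullet> snd p)) * a (fst p, y, snd p) * G (fst p, y)) \<in> borel_measurable ((borel \<Otimes>\<^sub>M borel :: ('a \<times> 'a) measure) \<Otimes>\<^sub>M (lborel :: 'a measure))"
    by (simp add: borel_prod case_prod_unfold measurable_cong_sets[OF sets_pair_measure_cong[OF refl sets_lborel] refl])
  from lborel.borel_measurable_lebesgue_integral[OF this]
  show m: "(\<lambda>(x, \<xi>). kaction_density G x \<xi>) \<in> borel_measurable (borel \<Otimes>\<^sub>M borel)"
    by (simp add: kaction_density_def case_prod_unfold)
  have "(\<lambda>\<xi>. case (x, \<xi>) of (x, \<xi>) \<Rightarrow> kaction_density G x \<xi>) \<in> borel_measurable borel"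
    by (rule measurable_compose[OF _ m]) simp
  then show "kaction_density G x \<in> borel_measurable borel" by simp
qed

lemma kaction_integrable:
  assumes G: "sbound kaction_order Q G"
  shows "integrable lborel (kaction_density G x)" "integrable lborel (\<lambda>x. LINT \<xi>|lborel. kaction_density G x \<xi>)"
proof -
  obtain C where C: "C > 0" "\<And>G Q x \<xi>. sbound (real kaction_order) Q G \<Longrightarrow> norm (kaction_density G x \<xi>) \<le> C * Q * (prod_majorant x * prod_majorant \<xi>)" using kaction_order(2) by blast
  have GC: "Cinf_on UNIV G" using G by (simp add: sbound_def)
  have bd: "norm (kaction_density G x \<xi>) \<le> (C * Q * prod_majorant x) * prod_majorant \<xi>" for x \<xi> using C(2)[OF G, of x \<xi>] by (simp add: mult_ac)
  show "integrable lborel (kaction_density G x)" for x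
    using bd by (rule prod_majorant_integrable_bound[OF kaction_density_measurable(2)[OF GC]])
  have "case_prod (kaction_density G) \<in> borel_measurable ((borel :: 'a measure) \<Otimes>\<^sub>M (lborel :: 'a measure))"
    using kaction_density_measurable(1)[OF GC] by (simp add: measurable_cong_sets[OF sets_pair_measure_cong[OF refl sets_lborel] refl])
  from lborel.borel_measurable_lebesgue_integral[OF this]
  have m: "(\<lambda>x. LINT \<xi>|lborel. kaction_density G x \<xi>) \<in> borel_measurable borel" .
  have "norm (LINT \<xi>|lborel. kaction_density G x \<xi>) \<le> (C * Q * (LINT \<xi>|lborel. prod_majorant (\<xi>::'a))) * prod_majorant x" for x
    using integral_norm_le[OF integrable_mult_right[OF prod_majorant_integrable] bd, of x] by (simp add: mult_ac)
  then show "integrable lborel (\<lambda>x. LINT \<xi>|lborel. kaction_density G x \<xi>)"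
    by (rule prod_majorant_integrable_bound[OF m])
qed

lemma kaction_bound: "\<exists>C>0. \<forall>G Q. sbound kaction_order Q G \<longrightarrow> norm (kaction G) \<le> C * Q"
proof -
  obtain C where C: "C > 0" "\<And>G Q x \<xi>. sbound (real kaction_order) Q G \<Longrightarrow> norm (kaction_density G x \<xi>) \<le> C * Q * (prod_majorant x * prod_majorant \<xi>)" using kaction_order(2) by blast
  define I where "I = (LINT y|lborel. prod_majorant (y::'a))"
  have I: "I \<ge> 0" unfolding I_def by (intro integral_nonneg_AE AE_I2 less_imp_le[OF prod_majorant_pos])
  have "norm (kaction G) \<le> C * (I * I + 1) * Q" if G: "sbound kaction_order Q G" for G Q
  proof -
    have bd: "norm (kaction_density G x \<xi>) \<le> (C * Q * prod_majorant x) * prod_majorant \<xi>" for x \<xi> using C(2)[OF G, of x \<xi>] by (simp add: mult_ac)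
    have 1: "norm (LINT \<xi>|lborel. kaction_density G x \<xi>) \<le> (C * Q * I) * prod_majorant x" for x
      using integral_norm_le[OF integrable_mult_right[OF prod_majorant_integrable] bd, of x] by (simp add: mult_ac I_def)
    have "norm (kaction G) \<le> C * Q * I * I"
      unfolding kaction_def using integral_norm_le[OF integrable_mult_right[OF prod_majorant_integrable] 1] by (simp add: I_def)
    also have "\<dots> \<le> C * (I * I + 1) * Q" using C(1) sbound_nonneg[OF G] by (simp add: algebra_simps)
    finally show ?thesis .
  qed
  moreover have "C * (I * I + 1) > 0" using C(1) I by (simp add: add_nonneg_pos)
  ultimately show ?thesis by blast
qed

lemma kaction_linear:
  assumes f: "sbound kaction_order Q f" and g: "sbound kaction_order Q' g"
  shows "kaction (\<lambda>z. f z + g z) = kaction f + kaction g" "kaction (\<lambda>z. c * f z) = c * kaction f" "kaction (\<lambda>z. f z - g z) = kaction f - kaction g"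
proof -
  have i: "integrable lborel (\<lambda>y. exp (\<i> * complex_of_real ((x - y) \<bullet> \<xi>)) * a (x, y, \<xi>) * f (x, y))"
    "integrable lborel (\<lambda>y. exp (\<i> * complex_of_real ((x - y) \<bullet> \<xi>)) * a (x, y, \<xi>) * g (x, y))" for x \<xi>
    using kaction_order(2) f g by blast+
  have a: "kaction_density (\<lambda>z. f z + g z) x = (\<lambda>\<xi>. kaction_density f x \<xi> + kaction_density g x \<xi>)" for x
    unfolding kaction_density_def by (rule ext) (simp only: distrib_left Bochner_Integration.integral_add[OF i])
  have m: "kaction_density (\<lambda>z. f z - g z) x = (\<lambda>\<xi>. kaction_density f x \<xi> - kaction_density g x \<xi>)" for x
    unfolding kaction_density_def by (rule ext) (simp only: right_diff_distrib Bochner_Integration.integral_diff[OF i])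
  have s: "kaction_density (\<lambda>z. c * f z) x = (\<lambda>\<xi>. c * kaction_density f x \<xi>)" for x
    unfolding kaction_density_def by (subst integral_mult_right_zero[symmetric]) (simp add: mult_ac)
  show "kaction (\<lambda>z. f z + g z) = kaction f + kaction g" unfolding kaction_def a
    using kaction_integrable[OF f] kaction_integrable[OF g] by simp
  show "kaction (\<lambda>z. f z - g z) = kaction f - kaction g" unfolding kaction_def m
    using kaction_integrable[OF f] kaction_integrable[OF g] by simp
  show "kaction (\<lambda>z. c * f z) = c * kaction f" unfolding kaction_def s by simp
qed

text \<open>The cutoffs are bounded by 1 and eventually equal to 1 at each \<xi>. Dominated
  convergence applies to the \<xi>-integral and then to the x-integral, with the product
  majorants.\<close>

lemma dyadic_cutoff_kaction_density_limit:
  assumes F: "sbound kaction_order Q F"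
  shows "(\<lambda>j. LINT x|lborel. LINT \<xi>|lborel. dyadic_cutoff j \<xi> * kaction_density F x \<xi>) \<longlonglongrightarrow> kaction F"
proof -
  obtain C where C: "C > 0" "\<And>G Q x \<xi>. sbound (real kaction_order) Q G \<Longrightarrow> norm (kaction_density G x \<xi>) \<le> C * Q * (prod_majorant x * prod_majorant \<xi>)" using kaction_order(2) by blast
  have FC: "Cinf_on UNIV F" using F by (simp add: sbound_def)
  have chm: "dyadic_cutoff j \<in> borel_measurable borel" for j by (intro borel_measurable_continuous_onI dyadic_cutoff_cont)
  have bd: "norm (dyadic_cutoff j \<xi> * kaction_density F x \<xi>) \<le> (C * Q * prod_majorant x) * prod_majorant \<xi>" for x \<xi> j
  proof -
    have "norm (dyadic_cutoff j \<xi> * kaction_density F x \<xi>) \<le> 1 * norm (kaction_density F x \<xi>)"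
      unfolding norm_mult by (intro mult_right_mono dyadic_cutoff_norm) auto
    then show ?thesis using C(2)[OF F, of x \<xi>] by (simp add: mult_ac)
  qed
  have lim1: "(\<lambda>j. dyadic_cutoff j \<xi>) \<longlonglongrightarrow> 1" for \<xi>
  proof -
    obtain J where J: "norm \<xi> < 2 ^ J" using real_arch_pow[of 2 "norm \<xi>"] by auto
    have "dyadic_cutoff j \<xi> = 1" if "j \<ge> J" for j
    proof -
      have "(2::real) ^ J \<le> 2 ^ j" using that by (intro power_increasing) auto
      then have "norm \<xi> < 2 ^ j" using J by linarith
      then have "\<bar>\<xi> \<bullet> b\<bar> < 2 ^ j" if "b \<in> Basis" for b using Basis_le_norm[OF that, of \<xi>] by linarith
      then show ?thesis unfolding dyadic_cutoff_def using dyadic_order_bounds(3) by (intro chi_eq_1) auto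
    qed
    then show ?thesis by (intro tendsto_eventually) (auto simp: eventually_sequentially)
  qed
  have inner: "(\<lambda>j. LINT \<xi>|lborel. dyadic_cutoff j \<xi> * kaction_density F x \<xi>) \<longlonglongrightarrow> (LINT \<xi>|lborel. kaction_density F x \<xi>)" for x
  proof (rule integral_dominated_convergence)
    show "kaction_density F x \<in> borel_measurable lborel" "(\<lambda>\<xi>. dyadic_cutoff j \<xi> * kaction_density F x \<xi>) \<in> borel_measurable lborel" for j
      using kaction_density_measurable(2)[OF FC, of x] chm by simp_all
    show "integrable lborel (\<lambda>\<xi>. (C * Q * prod_majorant x) * prod_majorant \<xi>)" by (intro integrable_mult_right prod_majorant_integrable)
    show "AE \<xi> in lborel. (\<lambda>j. dyadic_cutoff j \<xi> * kaction_density F x \<xi>) \<longlonglongrightarrow> kaction_density F x \<xi>"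
      using tendsto_mult[OF lim1 tendsto_const] by (intro AE_I2) (metis mult_1)
  qed (use bd in auto)
  have m: "(\<lambda>x. LINT \<xi>|lborel. dyadic_cutoff j \<xi> * kaction_density F x \<xi>) \<in> borel_measurable borel" for j
  proof -
    have "(\<lambda>p. dyadic_cutoff j (snd p)) \<in> borel_measurable ((borel :: 'a measure) \<Otimes>\<^sub>M (borel :: 'a measure))"
      by (rule measurable_compose[OF measurable_snd chm])
    then have "case_prod (\<lambda>x \<xi>. dyadic_cutoff j \<xi> * kaction_density F x \<xi>) \<in> borel_measurable ((borel :: 'a measure) \<Otimes>\<^sub>M (lborel :: 'a measure))"
      using kaction_density_measurable(1)[OF FC] by (simp add: case_prod_unfold measurable_cong_sets[OF sets_pair_measure_cong[OF refl sets_lborel] refl])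
    from lborel.borel_measurable_lebesgue_integral[OF this] show ?thesis .
  qed
  show ?thesis
    unfolding kaction_def
  proof (rule integral_dominated_convergence)
    show "(\<lambda>x. LINT \<xi>|lborel. kaction_density F x \<xi>) \<in> borel_measurable lborel" "(\<lambda>x. LINT \<xi>|lborel. dyadic_cutoff j \<xi> * kaction_density F x \<xi>) \<in> borel_measurable lborel" for j
      using borel_measurable_integrable[OF kaction_integrable(2)[OF F]] m by simp_all
    show "integrable lborel (\<lambda>x::'a. (C * Q * (LINT \<xi>|lborel. prod_majorant (\<xi>::'a))) * prod_majorant x)" by (intro integrable_mult_right prod_majorant_integrable)
    show "AE x in lborel. norm (LINT \<xi>|lborel. dyadic_cutoff j \<xi> * kaction_density F x \<xi>) \<le> (C * Q * (LINT \<xi>|lborel. prod_majorant (\<xi>::'a))) * prod_majorant x" for j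
    proof (rule AE_I2)
      fix x
      have "norm (LINT \<xi>|lborel. dyadic_cutoff j \<xi> * kaction_density F x \<xi>) \<le> (LINT \<xi>|lborel. (C * Q * prod_majorant x) * prod_majorant (\<xi>::'a))"
        by (rule integral_norm_le[OF integrable_mult_right[OF prod_majorant_integrable] bd])
      also have "\<dots> = (C * Q * (LINT \<xi>|lborel. prod_majorant (\<xi>::'a))) * prod_majorant x" by simp
      finally show "norm (LINT \<xi>|lborel. dyadic_cutoff j \<xi> * kaction_density F x \<xi>) \<le> (C * Q * (LINT \<xi>|lborel. prod_majorant (\<xi>::'a))) * prod_majorant x" .
    qed
  qed (use inner in auto)
qed

text \<open>With a cutoff in \<xi> and F of compact support the integrand is continuous with compact
  support in (\<xi>, y). Fubini now permits integrating in \<xi> first, which produces the truncated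
  kernel.\<close>

lemma dyadic_cutoff_kaction_density_kernel:
  assumes F: "continuous_on UNIV F" and supp: "\<And>z. z \<notin> cbox (- c) c \<Longrightarrow> F z = 0"
  shows "(LINT x|lborel. LINT \<xi>|lborel. dyadic_cutoff j \<xi> * kaction_density F x \<xi>) = (LINT z|lborel. kernel_trunc j [] z * F z)"
proof -
  define e where "e = (\<lambda>x \<xi> y. dyadic_cutoff j \<xi> * osc_deriv [] (x, y) \<xi> * F (x, y))"
  have kaction_density: "dyadic_cutoff j \<xi> * kaction_density F x \<xi> = (LINT y|lborel. e x \<xi> y)" for x \<xi>
    unfolding kaction_density_def e_def
    by (subst integral_mult_right_zero[symmetric], rule Bochner_Integration.integral_cong)
      (simp_all add: osc_deriv_def inner_commute mult_ac)
  have KK: "kernel_trunc j [] (x, y) * F (x, y) = (LINT \<xi>|lborel. e x \<xi> y)" for x y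
    unfolding kernel_trunc_def e_def by (subst integral_mult_left_zero[symmetric]) simp
  have ec: "continuous_on UNIV (\<lambda>p. e x (fst p) (snd p))" for x
  proof -
    have "continuous_on UNIV (\<lambda>p. case ((x, snd p), fst p) of (z, \<xi>) \<Rightarrow> dyadic_cutoff j \<xi> * osc_deriv [] z \<xi>)"
      by (rule continuous_on_compose2[OF dyadic_cutoff_osc_deriv_cont[of "[]" j]]) (auto intro!: continuous_intros)
    moreover have "continuous_on UNIV (\<lambda>p::'a \<times> 'a. F (x, snd p))"
      by (rule continuous_on_compose2[OF F]) (auto intro!: continuous_intros)
    ultimately show ?thesis unfolding e_def by (simp add: continuous_on_mult)
  qed
  have e0: "e x (fst p) (snd p) = 0" if "p \<notin> cbox (- (2 * 2 ^ j) *\<^sub>R One, - snd c) ((2 * 2 ^ j) *\<^sub>R One, snd c)" for x p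
  proof (cases "fst p \<in> cbox (- (2 * 2 ^ j) *\<^sub>R One) ((2 * 2 ^ j) *\<^sub>R One)")
    case True
    then have "snd p \<notin> cbox (- snd c) (snd c)" using that by (cases p) (simp add: cbox_Pair_eq)
    then have "(x, snd p) \<notin> cbox (- c) c" by (cases c) (simp add: cbox_Pair_eq)
    then show ?thesis by (simp add: e_def supp)
  qed (simp add: e_def dyadic_cutoff_outside)
  have ei: "integrable (lborel \<Otimes>\<^sub>M lborel) (case_prod (e x))" for x
    using integral_compact_support(1)[OF ec e0] by (simp add: lborel_prod case_prod_unfold)
  have "(LINT \<xi>|lborel. dyadic_cutoff j \<xi> * kaction_density F x \<xi>) = (LINT y|lborel. kernel_trunc j [] (x, y) * F (x, y))" for x
    unfolding kaction_density KK by (rule lborel_pair.Fubini_integral[OF ei, symmetric])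
  moreover have "integrable (lborel \<Otimes>\<^sub>M lborel) (case_prod (\<lambda>x y. kernel_trunc j [] (x, y) * F (x, y)))"
  proof -
    have "continuous_on UNIV (\<lambda>z. kernel_trunc j [] z * F z)" using kernel_trunc_cont[of "[]" j] F by (intro continuous_intros) auto
    from integral_compact_support(1)[OF this, of "- c" c] show ?thesis
      using supp by (simp add: lborel_prod case_prod_unfold)
  qed
  from lborel_pair.integral_fst[OF this]
  have "(LINT x|lborel. LINT y|lborel. kernel_trunc j [] (x, y) * F (x, y)) = (LINT z|lborel. kernel_trunc j [] z * F z)"
    by (simp add: lborel_prod case_prod_unfold)
  ultimately show ?thesis by simp
qed

text \<open>Both sides are limits of the truncated integrals. On \<open>K0\<close>, which is bounded
  and at distance from the diagonal, the truncations are uniformly bounded for j \<ge> J, so the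
  index is shifted by J before dominated convergence is used.\<close>

lemma kaction_kernel:
  assumes F: "sbound kaction_order Q F" and K0: "compact K0" "\<And>z. z \<notin> K0 \<Longrightarrow> F z = 0"
    and r: "r > 0" "\<And>z. z \<in> K0 \<Longrightarrow> r \<le> norm (fst z - snd z)"
  shows "kaction F = (LINT z|lborel. kernel_lim [] z * F z)"
proof -
  have Fc: "continuous_on UNIV F" using F Cinf_cont[of UNIV F "[]"] by (simp add: sbound_def)
  obtain c where c: "K0 \<subseteq> cbox (- c) c" using bounded_subset_cbox_symmetric[OF compact_imp_bounded[OF K0(1)]] by blast
  have F0: "F z = 0" if "z \<notin> cbox (- c) c" for z using K0(2) c that by blast
  have Fi: "integrable lborel F" by (rule integral_compact_support(1)[OF Fc F0])
  obtain R where R: "\<And>z. z \<in> K0 \<Longrightarrow> norm z \<le> R" using compact_imp_bounded[OF K0(1)] unfolding bounded_iff by blast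
  obtain J where J: "R < 2 ^ J" using real_arch_pow[of 2 R] by auto
  obtain C where C: "\<And>J x y w. r \<le> norm (x - y) \<Longrightarrow> norm x \<le> 2 * 2 ^ J \<Longrightarrow> norm y \<le> 2 * 2 ^ J \<Longrightarrow> set w \<subseteq> Basis \<Longrightarrow>
    (\<lambda>j. kernel_trunc j w (x, y)) \<longlonglongrightarrow> kernel_lim w (x, y) \<and>
    (\<forall>j\<ge>J. norm (kernel_trunc j w (x, y) - kernel_lim w (x, y)) \<le> C * exp (- 1 * \<omega> (2 ^ J)) * (12 ^ length w * young_exp 1 (length w)) * (1/2) ^ j)"
    using kernel_trunc_limit[OF r(1), of 1 1] by (meson zero_less_one)
  obtain C' where C': "\<And>x y w. r \<le> norm (x - y) \<Longrightarrow> set w \<subseteq> Basis \<Longrightarrow>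
    norm (kernel_lim w (x, y)) \<le> C' * young_exp 1 (length w) * exp (- 1 * \<omega> (norm x)) * exp (- 1 * \<omega> (norm y))" "C' > 0"
    using kernel_lim_bound[OF r(1), of 1] by (meson zero_less_one)
  define D where "D = C * exp (- 1 * \<omega> (2 ^ J)) * young_exp 1 0"
  have near: "(\<lambda>j. kernel_trunc j [] z) \<longlonglongrightarrow> kernel_lim [] z \<and> (\<forall>j\<ge>J. norm (kernel_trunc j [] z) \<le> \<bar>D\<bar> + C')" if z: "z \<in> K0" for z
  proof -
    obtain x y where xy: "z = (x, y)" by (cases z)
    have a: "r \<le> norm (x - y)" using r(2)[OF z] by (simp add: xy)
    have b: "norm x \<le> 2 * 2 ^ J" "norm y \<le> 2 * 2 ^ J"
      using R[OF z] J norm_fst_le[of x y] norm_snd_le[of y x] zero_less_power[of "2::real" J] unfolding xy by linarith+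
    have k: "norm (kernel_lim [] (x, y)) \<le> C'"
    proof -
      have "exp (- 1 * \<omega> (norm x)) * exp (- 1 * \<omega> (norm y)) \<le> 1 * 1"
        by (intro mult_mono) (auto simp: w_nonneg)
      then have "C' * (exp (- 1 * \<omega> (norm x)) * exp (- 1 * \<omega> (norm y))) \<le> C' * 1" using C'(2) by (intro mult_left_mono) auto
      then show ?thesis using C'(1)[OF a, of "[]"] young_exp_0[of 1] by (simp add: mult.assoc)
    qed
    have "norm (kernel_trunc j [] (x, y)) \<le> \<bar>D\<bar> + C'" if j: "j \<ge> J" for j
    proof -
      have "norm (kernel_trunc j [] (x, y) - kernel_lim [] (x, y)) \<le> D * (1/2) ^ j"
        using C[OF a b, of "[]"] j by (simp add: D_def)
      also have "\<dots> \<le> \<bar>D\<bar> * 1" by (intro mult_mono) (auto simp: power_le_one)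
      finally show ?thesis using k norm_triangle_sub[of "kernel_trunc j [] (x, y)" "kernel_lim [] (x, y)"] by linarith
    qed
    then show ?thesis using C[OF a b, of "[]"] by (simp add: xy)
  qed
  have km: "(\<lambda>z. kernel_trunc j [] z * F z) \<in> borel_measurable borel" for j
    using kernel_trunc_cont[of "[]" j] Fc by (intro borel_measurable_continuous_onI continuous_intros) auto
  have lim: "(\<lambda>j. kernel_trunc (j + J) [] z * F z) \<longlonglongrightarrow> kernel_lim [] z * F z" for z
  proof (cases "z \<in> K0")
    case True
    then show ?thesis using near by (intro tendsto_intros LIMSEQ_ignore_initial_segment) auto
  qed (simp add: K0(2))
  have "(\<lambda>j. LINT z|lborel. kernel_trunc (j + J) [] z * F z) \<longlonglongrightarrow> (LINT z|lborel. kernel_lim [] z * F z)"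
  proof (rule integral_dominated_convergence)
    show "(\<lambda>z. kernel_trunc (j + J) [] z * F z) \<in> borel_measurable lborel" for j using km by simp
    show "(\<lambda>z. kernel_lim [] z * F z) \<in> borel_measurable lborel"
      by (rule borel_measurable_LIMSEQ_metric[OF _ lim]) (use km in simp)
    show "integrable lborel (\<lambda>z. (\<bar>D\<bar> + C') * norm (F z))" by (intro integrable_mult_right integrable_norm Fi)
    show "AE z in lborel. norm (kernel_trunc (j + J) [] z * F z) \<le> (\<bar>D\<bar> + C') * norm (F z)" for j
    proof (rule AE_I2)
      fix z show "norm (kernel_trunc (j + J) [] z * F z) \<le> (\<bar>D\<bar> + C') * norm (F z)"
        using near[of z] K0(2)[of z] by (cases "z \<in> K0") (auto simp: norm_mult intro!: mult_right_mono)
    qed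
  qed (use lim in auto)
  moreover have "(\<lambda>j. LINT z|lborel. kernel_trunc (j + J) [] z * F z) \<longlonglongrightarrow> kaction F"
    using LIMSEQ_ignore_initial_segment[OF dyadic_cutoff_kaction_density_limit[OF F], of J] by (simp add: dyadic_cutoff_kaction_density_kernel[OF Fc F0])
  ultimately show ?thesis using LIMSEQ_unique by blast
qed

end

section \<open>Gaussian functions\<close>

text \<open>The characteristic function of the standard normal distribution, rescaled by sqrt
  s.\<close>

lemma gauss_fourier_1d:
  fixes s t :: real
  assumes s: "s > 0"
  shows "integrable lborel (\<lambda>x. exp (\<i> * complex_of_real (t * x)) * complex_of_real (exp (- (s / 2) * x\<^sup>2)))"
    "(LINT x|lborel. exp (\<i> * complex_of_real (t * x)) * complex_of_real (exp (- (s / 2) * x\<^sup>2))) =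
       complex_of_real (sqrt (2 * pi / s) * exp (- t\<^sup>2 / (2 * s)))"
proof -
  define \<tau> where "\<tau> = t / sqrt s"
  define f where "f = (\<lambda>x::real. complex_of_real (std_normal_density x) * exp (\<i> * complex_of_real (\<tau> * x)))"
  have "integrable lborel (\<lambda>x. complex_of_real (std_normal_density x))"
    by (intro integrable_of_real integrable_normal_density) simp
  then have fi: "integrable lborel f"
    by (rule Bochner_Integration.integrable_bound) (auto simp: f_def norm_mult)
  have "(LINT x|std_normal_distribution. exp (\<i> * complex_of_real (\<tau> * x))) = (LINT x|lborel. std_normal_density x *\<^sub>R exp (\<i> * complex_of_real (\<tau> * x)))"
    by (rule integral_density) auto
  then have fint: "(LINT x|lborel. f x) = complex_of_real (exp (- \<tau>\<^sup>2 / 2))"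
    using char_std_normal_distribution by (simp add: char_def fun_eq_iff f_def scaleR_conv_of_real)
  have sq: "sqrt s > 0" "sqrt s \<noteq> 0" "(sqrt s)\<^sup>2 = s" using s by auto
  have g: "complex_of_real (sqrt (2 * pi)) * f (0 + sqrt s * x) = exp (\<i> * complex_of_real (t * x)) * complex_of_real (exp (- (s / 2) * x\<^sup>2))" for x
    using sq s by (simp add: f_def std_normal_density_def \<tau>_def power_mult_distrib)
  have "integrable lborel (\<lambda>x. f (0 + sqrt s * x))" by (rule lborel_integrable_real_affine[OF fi sq(2)])
  then have "integrable lborel (\<lambda>x. complex_of_real (sqrt (2 * pi)) * f (0 + sqrt s * x))" by (rule integrable_mult_right)
  then show "integrable lborel (\<lambda>x. exp (\<i> * complex_of_real (t * x)) * complex_of_real (exp (- (s / 2) * x\<^sup>2)))"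
    unfolding g .
  have "complex_of_real (exp (- \<tau>\<^sup>2 / 2)) = \<bar>sqrt s\<bar> *\<^sub>R (LINT x|lborel. f (0 + sqrt s * x))"
    unfolding fint[symmetric] by (rule lborel_integral_real_affine[OF sq(2)])
  then have "(LINT x|lborel. f (0 + sqrt s * x)) = complex_of_real (exp (- \<tau>\<^sup>2 / 2) / sqrt s)"
    using sq by (simp add: scaleR_conv_of_real field_simps)
  then have "(LINT x|lborel. complex_of_real (sqrt (2 * pi)) * f (0 + sqrt s * x)) = complex_of_real (sqrt (2 * pi) * (exp (- \<tau>\<^sup>2 / 2) / sqrt s))"
    by simp
  moreover have "sqrt (2 * pi) * (exp (- \<tau>\<^sup>2 / 2) / sqrt s) = sqrt (2 * pi / s) * exp (- t\<^sup>2 / (2 * s))"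
    using s by (simp add: \<tau>_def real_sqrt_divide power_divide)
  ultimately show "(LINT x|lborel. exp (\<i> * complex_of_real (t * x)) * complex_of_real (exp (- (s / 2) * x\<^sup>2))) =
       complex_of_real (sqrt (2 * pi / s) * exp (- t\<^sup>2 / (2 * s)))"
    unfolding g by (simp only:)
qed

text \<open>Products of entire functions of the single coordinates. Letter counts of a word give
  every derivative explicitly, and Cauchy's inequality can be applied to each factor.\<close>

definition gp :: "('a::euclidean_space \<Rightarrow> complex \<Rightarrow> complex) \<Rightarrow> ('a \<Rightarrow> nat) \<Rightarrow> 'a \<Rightarrow> complex"
  where "gp F k z = (\<Prod>b\<in>Basis. (- \<i>) ^ k b * (deriv ^^ k b) (F b) (complex_of_real (z \<bullet> b)))"

lemma gp_smooth:
  fixes F :: "'a::euclidean_space \<Rightarrow> complex \<Rightarrow> complex"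
  assumes F: "\<And>b. F b holomorphic_on UNIV"
  shows "Cinf_on UNIV (gp F (\<lambda>_. 0))" "set w \<subseteq> Basis \<Longrightarrow> Dw w (gp F (\<lambda>_. 0)) z = gp F (count (mset w)) z"
proof -
  define G where "G = (\<lambda>w. gp F (count (mset w)))"
  have hol: "(deriv ^^ k) (F b) holomorphic_on UNIV" for k b
    using F by (intro holomorphic_higher_deriv) auto
  have cont: "continuous_on UNIV (G w)" for w
    unfolding G_def gp_def
    by (intro continuous_intros continuous_on_compose2[OF holomorphic_on_imp_continuous_on[OF hol]]) auto
  have der: "has_partial c (G w) z \<and> Dpartial c (G w) z = G (c # w) z" if c: "c \<in> Basis" for w c z
  proof -
    define k where "k = count (mset w)"
    define R where "R = (\<Prod>b\<in>Basis - {c}. (- \<i>) ^ k b * (deriv ^^ k b) (F b) (complex_of_real (z \<bullet> b)))"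
    let ?f = "(deriv ^^ k c) (F c)"
    have Gt: "G w (z + t *\<^sub>R c) = (- \<i>) ^ k c * ?f (complex_of_real (z \<bullet> c) + complex_of_real t) * R" for t
    proof -
      have "(\<Prod>b\<in>Basis - {c}. (- \<i>) ^ k b * (deriv ^^ k b) (F b) (complex_of_real ((z + t *\<^sub>R c) \<bullet> b))) = R"
        unfolding R_def using c by (intro prod.cong) (auto simp: inner_simps inner_Basis)
      then show ?thesis
        unfolding G_def gp_def k_def[symmetric] prod.remove[OF finite_Basis c]
        using c by (simp only: inner_add_left inner_scaleR_left inner_same_Basis mult_1_right of_real_add)
    qed
    have "(?f has_field_derivative deriv ?f (complex_of_real (z \<bullet> c))) (at (complex_of_real (z \<bullet> c) + complex_of_real 0))"
      using holomorphic_derivI[OF hol open_UNIV UNIV_I, of "k c" c "complex_of_real (z \<bullet> c)"] by simp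
    then have "((\<lambda>\<zeta>. ?f (complex_of_real (z \<bullet> c) + \<zeta>)) has_field_derivative deriv ?f (complex_of_real (z \<bullet> c))) (at (complex_of_real 0))"
      using DERIV_shift[of ?f "deriv ?f (complex_of_real (z \<bullet> c))" "complex_of_real 0" "complex_of_real (z \<bullet> c)"]
      by (simp add: add.commute)
    then have "((\<lambda>t. ?f (complex_of_real (z \<bullet> c) + complex_of_real t)) has_vector_derivative deriv ?f (complex_of_real (z \<bullet> c))) (at 0)"
      by (rule has_vector_derivative_real_field)
    then have "((\<lambda>t. (- \<i>) ^ k c * ?f (complex_of_real (z \<bullet> c) + complex_of_real t) * R) has_vector_derivative
      (- \<i>) ^ k c * deriv ?f (complex_of_real (z \<bullet> c)) * R) (at 0)"
      by (intro has_vector_derivative_mult_left has_vector_derivative_mult_right)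
    then have "((\<lambda>t. G w (z + t *\<^sub>R c)) has_vector_derivative (- \<i>) ^ k c * deriv ?f (complex_of_real (z \<bullet> c)) * R) (at 0)"
      unfolding Gt .
    note p = has_partialI[OF this]
    have "count (mset (c # w)) = k(c := Suc (k c))" by (auto simp: k_def fun_eq_iff)
    moreover have "(\<Prod>b\<in>Basis - {c}. (- \<i>) ^ (k(c := Suc (k c))) b * (deriv ^^ (k(c := Suc (k c))) b) (F b) (complex_of_real (z \<bullet> b))) = R"
      unfolding R_def by (rule prod.cong) simp_all
    ultimately have "G (c # w) z = (- \<i>) ^ Suc (k c) * (deriv ^^ Suc (k c)) (F c) (complex_of_real (z \<bullet> c)) * R"
      unfolding G_def gp_def prod.remove[OF finite_Basis c] by (simp only: fun_upd_same)
    then have "G (c # w) z = - \<i> * ((- \<i>) ^ k c * deriv ?f (complex_of_real (z \<bullet> c)) * R)"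
      by (simp only: power_Suc funpow.simps comp_apply mult.assoc)
    then show ?thesis using p by simp
  qed
  have z: "gp F (\<lambda>_. 0) = G []" by (simp add: G_def zero_multiset.rep_eq[abs_def])
  note co = Cinf_coinduct[OF open_UNIV fun_cong[OF z[symmetric]] cont der]
  show "Cinf_on UNIV (gp F (\<lambda>_. 0))" by (rule co(1))
  show "Dw w (gp F (\<lambda>_. 0)) z = gp F (count (mset w)) z" if "set w \<subseteq> Basis"
  proof -
    have "Dw w (gp F (\<lambda>_. 0)) z = G w z" by (rule co(2)) (use that in auto)
    then show ?thesis by (simp add: G_def)
  qed
qed

lemma prod_fact_le: "finite A \<Longrightarrow> (\<Prod>b\<in>A. fact (k b) :: real) \<le> fact (\<Sum>b\<in>A. k b)"
proof (induction A rule: finite_induct)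
  case (insert b A)
  have "(\<Prod>b\<in>insert b A. fact (k b) :: real) \<le> fact (k b) * fact (\<Sum>b\<in>A. k b)"
    using insert by (simp add: mult_left_mono)
  also have "\<dots> = real (fact (k b) * fact (\<Sum>b\<in>A. k b))" by simp
  also have "\<dots> \<le> real (fact (k b + (\<Sum>b\<in>A. k b)))"
    by (intro of_nat_mono dvd_imp_le fact_fact_dvd_fact fact_gt_zero)
  finally show ?case using insert by simp
qed simp

definition gf :: "real \<Rightarrow> real \<Rightarrow> real \<Rightarrow> complex \<Rightarrow> complex"
  where "gf s p q \<zeta> = exp (- complex_of_real (s / 2) * (\<zeta> - complex_of_real p)\<^sup>2 - \<i> * complex_of_real q * \<zeta>)"

text \<open>Width parameter s, centre p, frequency q. The modulation is needed because the Fourier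
  transform of a translated Gaussian is a modulated one.\<close>

definition mod_gaussian :: "real \<Rightarrow> 'a \<Rightarrow> 'a \<Rightarrow> 'a::euclidean_space \<Rightarrow> complex"
  where "mod_gaussian s p q = gp (\<lambda>b. gf s (p \<bullet> b) (q \<bullet> b)) (\<lambda>_. 0)"

abbreviation gaussian :: "real \<Rightarrow> 'a \<Rightarrow> 'a::euclidean_space \<Rightarrow> complex"
  where "gaussian s p \<equiv> mod_gaussian s p 0"

lemma gf_holomorphic: "gf s p q holomorphic_on UNIV"
  unfolding gf_def by (intro holomorphic_intros)

lemma mod_gaussian_smooth: "Cinf_on UNIV (mod_gaussian s p q)"
  unfolding mod_gaussian_def by (rule gp_smooth(1)[OF gf_holomorphic])

lemma mod_gaussian_eq: "mod_gaussian s p q z = exp (- complex_of_real (s / 2 * (norm (z - p))\<^sup>2) - \<i> * complex_of_real (q \<bullet> z))"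
proof -
  have n: "(norm (z - p))\<^sup>2 = (\<Sum>b\<in>Basis. (z \<bullet> b - p \<bullet> b)\<^sup>2)"
    unfolding power2_norm_eq_inner by (subst euclidean_inner) (simp add: inner_simps power2_eq_square)
  have i: "q \<bullet> z = (\<Sum>b\<in>Basis. (q \<bullet> b) * (z \<bullet> b))" by (rule euclidean_inner)
  have "mod_gaussian s p q z = exp (\<Sum>b\<in>Basis. - complex_of_real (s / 2) * (complex_of_real (z \<bullet> b) - complex_of_real (p \<bullet> b))\<^sup>2 - \<i> * complex_of_real (q \<bullet> b) * complex_of_real (z \<bullet> b))"
    unfolding mod_gaussian_def gp_def gf_def by (simp add: exp_sum)
  also have "\<dots> = exp (- complex_of_real (s / 2 * (norm (z - p))\<^sup>2) - \<i> * complex_of_real (q \<bullet> z))"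
    unfolding n i by (simp add: sum_subtractf sum_distrib_left sum_negf mult.assoc)
  finally show ?thesis .
qed

lemma gaussian_eq: "gaussian s p z = complex_of_real (exp (- (s / 2) * (norm (z - p))\<^sup>2))"
proof -
  have "gaussian s p z = exp (complex_of_real (- (s / 2) * (norm (z - p))\<^sup>2))" by (simp add: mod_gaussian_eq)
  then show ?thesis unfolding exp_of_real .
qed

lemma gaussian_pair: "gaussian s (p1, p2) (x, y) = gaussian s p1 x * gaussian s p2 y"
  unfolding gaussian_eq of_real_mult[symmetric] mult_exp_exp by (simp add: norm_Pair distrib_left)

text \<open>Cauchy's inequality on circles of radius 1 in each coordinate. On such a circle the real
  part of (u + h)^2 is at least u^2/2 - 1, so half of the Gaussian exponent survives: s/2 becomes
  s/4.\<close>

lemma mod_gaussian_deriv_bound: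
  fixes p q z :: "'a::euclidean_space"
  assumes s: "s > 0" and w: "set w \<subseteq> Basis"
  shows "norm (Dw w (mod_gaussian s p q) z) \<le> exp ((s / 2 + norm q) * DIM('a)) * fact (length w) * exp (- (s / 4) * (norm (z - p))\<^sup>2)"
proof -
  let ?k = "count (mset w)"
  have one: "norm ((deriv ^^ k) (gf s P Q) (complex_of_real x)) \<le> fact k * (exp (s / 2 + \<bar>Q\<bar>) * exp (- (s / 4) * (x - P)\<^sup>2))" for k P Q x
  proof -
    have "norm ((deriv ^^ k) (gf s P Q) (complex_of_real x)) \<le> fact k * (exp (s / 2 + \<bar>Q\<bar>) * exp (- (s / 4) * (x - P)\<^sup>2)) / 1 ^ k"
    proof (rule Cauchy_inequality)
      show "gf s P Q holomorphic_on ball (complex_of_real x) 1" using gf_holomorphic holomorphic_on_subset by blast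
      show "continuous_on (cball (complex_of_real x) 1) (gf s P Q)"
        using gf_holomorphic holomorphic_on_imp_continuous_on continuous_on_subset by blast
      fix \<zeta> assume z: "norm (complex_of_real x - \<zeta>) = 1"
      define h where "h = \<zeta> - complex_of_real x"
      have "norm h = 1" using z by (simp add: h_def norm_minus_commute)
      then have h: "(Re h)\<^sup>2 + (Im h)\<^sup>2 = 1" "\<bar>Im h\<bar> \<le> 1"
        using cmod_power2[of h] abs_Im_le_cmod[of h] by auto
      define u where "u = x - P"
      have ze: "\<zeta> - complex_of_real P = complex_of_real u + h" by (simp add: u_def h_def)
      have "Re ((complex_of_real u + h)\<^sup>2) = (u + Re h)\<^sup>2 - (Im h)\<^sup>2" by (simp add: power2_eq_square)
      also have "\<dots> \<ge> u\<^sup>2 / 2 - 1"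
      proof -
        have "2 * (u + Re h)\<^sup>2 + 2 * (Re h)\<^sup>2 - u\<^sup>2 = (u + 2 * Re h)\<^sup>2" by (simp add: power2_eq_square algebra_simps)
        then show ?thesis using h(1) zero_le_power2[of "u + 2 * Re h"] by linarith
      qed
      finally have re: "u\<^sup>2 / 2 - 1 \<le> Re ((complex_of_real u + h)\<^sup>2)" .
      have "Q * Im \<zeta> \<le> \<bar>Q\<bar>"
      proof -
        have "\<bar>Im \<zeta>\<bar> \<le> 1" using h(2) by (simp add: h_def)
        then have "\<bar>Q\<bar> * \<bar>Im \<zeta>\<bar> \<le> \<bar>Q\<bar> * 1" by (intro mult_left_mono) auto
        then show ?thesis using abs_ge_self[of "Q * Im \<zeta>"] by (simp add: abs_mult)
      qed
      moreover have "s / 2 * (u\<^sup>2 / 2 - 1) \<le> s / 2 * Re ((complex_of_real u + h)\<^sup>2)" using re s by (intro mult_left_mono) auto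
      ultimately have "- (s / 2) * Re ((complex_of_real u + h)\<^sup>2) + Q * Im \<zeta> \<le> (s / 2 + \<bar>Q\<bar>) + - (s / 4) * u\<^sup>2"
        by (simp add: algebra_simps)
      then show "norm (gf s P Q \<zeta>) \<le> exp (s / 2 + \<bar>Q\<bar>) * exp (- (s / 4) * (x - P)\<^sup>2)"
        unfolding gf_def norm_exp_eq_Re ze mult_exp_exp u_def[symmetric] by simp
    qed auto
    then show ?thesis by simp
  qed
  have "norm (Dw w (mod_gaussian s p q) z) = (\<Prod>b\<in>Basis. norm ((deriv ^^ ?k b) (gf s (p \<bullet> b) (q \<bullet> b)) (complex_of_real (z \<bullet> b))))"
    unfolding mod_gaussian_def gp_smooth(2)[OF gf_holomorphic w] gp_def by (simp add: prod_norm[symmetric] norm_mult norm_power)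
  also have "\<dots> \<le> (\<Prod>b\<in>Basis. fact (?k b) * (exp (s / 2 + norm q) * exp (- (s / 4) * (z \<bullet> b - p \<bullet> b)\<^sup>2)))"
  proof (intro prod_mono conjI norm_ge_zero)
    fix b :: 'a assume b: "b \<in> Basis"
    have "exp (s / 2 + \<bar>q \<bullet> b\<bar>) \<le> exp (s / 2 + norm q)" using Basis_le_norm[OF b, of q] by simp
    then have "fact (?k b) * (exp (s / 2 + \<bar>q \<bullet> b\<bar>) * exp (- (s / 4) * (z \<bullet> b - p \<bullet> b)\<^sup>2)) \<le> fact (?k b) * (exp (s / 2 + norm q) * exp (- (s / 4) * (z \<bullet> b - p \<bullet> b)\<^sup>2))"
      by (intro mult_left_mono mult_right_mono) auto
    then show "norm ((deriv ^^ ?k b) (gf s (p \<bullet> b) (q \<bullet> b)) (complex_of_real (z \<bullet> b))) \<le> fact (?k b) * (exp (s / 2 + norm q) * exp (- (s / 4) * (z \<bullet> b - p \<bullet> b)\<^sup>2))"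
      using one[of "?k b" "p \<bullet> b" "q \<bullet> b" "z \<bullet> b"] by linarith
  qed
  also have "\<dots> = (\<Prod>b\<in>Basis. fact (?k b)) * (exp (s / 2 + norm q) ^ DIM('a) * exp (\<Sum>b\<in>Basis. - (s / 4) * (z \<bullet> b - p \<bullet> b)\<^sup>2))"
    by (simp add: prod.distrib exp_sum)
  also have "(\<Sum>b\<in>Basis. - (s / 4) * (z \<bullet> b - p \<bullet> b)\<^sup>2) = - (s / 4) * (norm (z - p))\<^sup>2"
    unfolding power2_norm_eq_inner by (subst euclidean_inner) (simp add: inner_simps power2_eq_square sum_distrib_left)
  also have "exp (s / 2 + norm q) ^ DIM('a) = exp ((s / 2 + norm q) * DIM('a))"
    by (simp add: exp_of_nat_mult[symmetric] mult.commute)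
  also have "(\<Prod>b\<in>Basis. fact (?k b)) * (exp ((s / 2 + norm q) * DIM('a)) * exp (- (s / 4) * (norm (z - p))\<^sup>2))
    \<le> fact (length w) * (exp ((s / 2 + norm q) * DIM('a)) * exp (- (s / 4) * (norm (z - p))\<^sup>2))"
  proof (rule mult_right_mono)
    have "(\<Sum>b\<in>Basis. ?k b) = length w"
      using sum_count_set[OF w finite_Basis] by (simp add: count_mset)
    then show "(\<Prod>b\<in>Basis. fact (?k b)) \<le> (fact (length w) :: real)" using prod_fact_le[of Basis ?k] by simp
  qed simp
  finally show ?thesis by (simp add: mult_ac)
qed

text \<open>Completing the square gives |z-p| \<le> (s/4)|z-p|^2 + 1/s. Exponential decay is all
  that is needed since \<omega>(t) = o(t), and the dependence on the centre is kept explicit for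
  integrals over p.\<close>

lemma mod_gaussian_exp_bound:
  fixes p q z :: "'a::euclidean_space"
  assumes s: "s > 0" and w: "set w \<subseteq> Basis"
  shows "norm (Dw w (mod_gaussian s p q) z) \<le> exp ((s / 2 + norm q) * DIM('a) + 1 / s + norm p) * fact (length w) * exp (- norm z)"
proof -
  define u where "u = norm (z - p)"
  have "(s / 2 * u - 1)\<^sup>2 = s * (s / 4 * u\<^sup>2 - u + 1 / s)" using s by (simp add: power2_eq_square field_simps)
  then have "0 \<le> s / 4 * u\<^sup>2 - u + 1 / s" using s zero_le_power2[of "s / 2 * u - 1"] by (simp add: zero_le_mult_iff)
  moreover have "norm z \<le> norm p + u" unfolding u_def by (rule norm_triangle_sub)
  ultimately have "- (s / 4) * u\<^sup>2 \<le> 1 / s + norm p + - norm z" by simp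
  then have "exp (- (s / 4) * u\<^sup>2) \<le> exp (1 / s + norm p) * exp (- norm z)" unfolding mult_exp_exp by simp
  then have "exp ((s / 2 + norm q) * DIM('a)) * fact (length w) * exp (- (s / 4) * u\<^sup>2) \<le>
    exp ((s / 2 + norm q) * DIM('a)) * fact (length w) * (exp (1 / s + norm p) * exp (- norm z))"
    by (intro mult_left_mono) auto
  also have "\<dots> = exp ((s / 2 + norm q) * DIM('a) + 1 / s + norm p) * fact (length w) * exp (- norm z)"
    by (simp add: exp_add mult_ac)
  finally show ?thesis using mod_gaussian_deriv_bound[OF s w, of p q z] unfolding u_def[symmetric] by linarith
qed

lemma gaussian_fourier:
  fixes z :: "'a::euclidean_space"
  assumes s: "s > 0"
  shows "(LINT \<xi>|lborel. exp (\<i> * complex_of_real (z \<bullet> \<xi>)) * gaussian s 0 \<xi>) = complex_of_real (sqrt (2 * pi / s) ^ DIM('a)) * gaussian (1 / s) 0 z"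
    "integrable lborel (gaussian s (p::'a))" "(LINT \<xi>|lborel. gaussian s 0 (\<xi>::'a)) = complex_of_real (sqrt (2 * pi / s) ^ DIM('a))"
proof -
  define f where "f = (\<lambda>(z::'a) b x. exp (\<i> * complex_of_real ((z \<bullet> b) * x)) * complex_of_real (exp (- (s / 2) * x\<^sup>2)))"
  have n: "(norm (\<xi>::'a))\<^sup>2 = (\<Sum>b\<in>Basis. (\<xi> \<bullet> b)\<^sup>2)" for \<xi>
    unfolding power2_norm_eq_inner by (subst euclidean_inner) (simp add: power2_eq_square)
  have eq: "exp (\<i> * complex_of_real (z \<bullet> \<xi>)) * gaussian s 0 \<xi> = (\<Prod>b\<in>Basis. f z b (\<xi> \<bullet> b))" for \<xi> z :: 'a
  proof -
    have "exp (\<i> * complex_of_real (z \<bullet> \<xi>)) = (\<Prod>b\<in>Basis. exp (\<i> * complex_of_real ((z \<bullet> b) * (\<xi> \<bullet> b))))"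
      by (subst euclidean_inner) (simp add: exp_sum[symmetric] sum_distrib_left)
    moreover have "gaussian s 0 \<xi> = (\<Prod>b\<in>Basis. complex_of_real (exp (- (s / 2) * (\<xi> \<bullet> b)\<^sup>2)))"
      unfolding gaussian_eq by (simp add: n sum_distrib_left exp_sum flip: sum_negf)
    ultimately show ?thesis by (simp add: f_def prod.distrib)
  qed
  have fi: "integrable lborel (f z b)" "(LINT x|lborel. f z b x) = complex_of_real (sqrt (2 * pi / s) * exp (- (z \<bullet> b)\<^sup>2 / (2 * s)))" for z b
    unfolding f_def using gauss_fourier_1d[OF s, of "z \<bullet> b"] by auto
  show main: "(LINT \<xi>|lborel. exp (\<i> * complex_of_real (z \<bullet> \<xi>)) * gaussian s 0 \<xi>) = complex_of_real (sqrt (2 * pi / s) ^ DIM('a)) * gaussian (1 / s) 0 z" for z :: 'a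
  proof -
    have "(LINT \<xi>|lborel. exp (\<i> * complex_of_real (z \<bullet> \<xi>)) * gaussian s 0 \<xi>) = (\<Prod>b\<in>Basis. complex_of_real (sqrt (2 * pi / s) * exp (- (z \<bullet> b)\<^sup>2 / (2 * s))))"
      unfolding eq lborel_prod_integral(2)[OF fi(1)] fi(2) ..
    also have "\<dots> = complex_of_real (sqrt (2 * pi / s) ^ DIM('a)) * (\<Prod>b\<in>Basis. complex_of_real (exp (- (z \<bullet> b)\<^sup>2 / (2 * s))))"
      by (simp add: prod.distrib)
    also have "(\<Prod>b\<in>Basis. complex_of_real (exp (- (z \<bullet> b)\<^sup>2 / (2 * s)))) = gaussian (1 / s) 0 z"
      unfolding gaussian_eq by (simp add: n exp_sum[symmetric] sum_divide_distrib sum_negf mult.commute[of s] flip: of_real_prod)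
    finally show ?thesis .
  qed
  show "(LINT \<xi>|lborel. gaussian s 0 (\<xi>::'a)) = complex_of_real (sqrt (2 * pi / s) ^ DIM('a))"
    using main[of 0] by (simp add: gaussian_eq[of _ _ 0])
  have "integrable lborel (\<lambda>\<xi>::'a. \<Prod>b\<in>Basis. f 0 b (\<xi> \<bullet> b))" by (rule lborel_prod_integral(1)[OF fi(1)])
  moreover have "gaussian s (0::'a) = (\<lambda>\<xi>. \<Prod>b\<in>Basis. f 0 b (\<xi> \<bullet> b))" using eq[of 0] by (simp add: fun_eq_iff)
  ultimately have i0: "integrable lborel (gaussian s (0::'a))" by simp
  have "gaussian s p = (\<lambda>\<xi>. gaussian s 0 (\<xi> + - p))" by (auto simp: gaussian_eq)
  then show "integrable lborel (gaussian s p)"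
    using lborel_integral_shift(2)[OF borel_measurable_integrable[OF i0, simplified], of "- p"] i0 by simp
qed

lemma fourier_gaussian:
  fixes p :: "'a::euclidean_space"
  assumes s: "s > 0"
  shows "fourier (gaussian s p) = (\<lambda>\<xi>. complex_of_real (sqrt (2 * pi / s) ^ DIM('a)) * mod_gaussian (1 / s) 0 p \<xi>)"
proof
  fix \<xi> :: 'a
  have "fourier (gaussian s p) \<xi> = (LINT x|lborel. gaussian s p (x + p) * exp (- \<i> * complex_of_real ((x + p) \<bullet> \<xi>)))"
    unfolding fourier_def
    by (rule lborel_integral_shift(1)[symmetric], intro borel_measurable_continuous_onI continuous_intros)
      (use Cinf_cont[OF mod_gaussian_smooth, of "[]" s p 0] in simp)
  also have "\<dots> = (LINT x|lborel. exp (- \<i> * complex_of_real (p \<bullet> \<xi>)) * (exp (\<i> * complex_of_real ((- \<xi>) \<bullet> x)) * gaussian s 0 x))"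
  proof (intro Bochner_Integration.integral_cong refl)
    fix x
    have "- \<i> * complex_of_real ((x + p) \<bullet> \<xi>) = - \<i> * complex_of_real (p \<bullet> \<xi>) + \<i> * complex_of_real ((- \<xi>) \<bullet> x)"
      by (simp add: inner_add_left inner_commute[of \<xi> x] distrib_left)
    then have "exp (- \<i> * complex_of_real ((x + p) \<bullet> \<xi>)) = exp (- \<i> * complex_of_real (p \<bullet> \<xi>)) * exp (\<i> * complex_of_real ((- \<xi>) \<bullet> x))"
      by (simp only: exp_add)
    moreover have "gaussian s p (x + p) = gaussian s 0 x" by (simp add: gaussian_eq)
    ultimately show "gaussian s p (x + p) * exp (- \<i> * complex_of_real ((x + p) \<bullet> \<xi>)) = exp (- \<i> * complex_of_real (p \<bullet> \<xi>)) * (exp (\<i> * complex_of_real ((- \<xi>) \<bullet> x)) * gaussian s 0 x)"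
      by (simp only: mult_ac)
  qed
  also have "\<dots> = exp (- \<i> * complex_of_real (p \<bullet> \<xi>)) * (complex_of_real (sqrt (2 * pi / s) ^ DIM('a)) * gaussian (1 / s) 0 (- \<xi>))"
    using gaussian_fourier(1)[OF s, of "- \<xi>"] by simp
  also have "\<dots> = complex_of_real (sqrt (2 * pi / s) ^ DIM('a)) * mod_gaussian (1 / s) 0 p \<xi>"
  proof -
    have "mod_gaussian (1 / s) 0 p \<xi> = exp (- \<i> * complex_of_real (p \<bullet> \<xi>)) * gaussian (1 / s) 0 (- \<xi>)"
      unfolding mod_gaussian_eq exp_add[symmetric] by (rule arg_cong[where f = exp]) simp
    then show ?thesis by (simp only: mult_ac)
  qed
  finally show "fourier (gaussian s p) \<xi> = complex_of_real (sqrt (2 * pi / s) ^ DIM('a)) * mod_gaussian (1 / s) 0 p \<xi>" .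
qed

section \<open>Gaussian functions as elements of the test space\<close>

context weight
begin

lemma exp_norm_weight: assumes "\<mu> > 0" shows "\<exists>C\<ge>1. \<forall>z::'z::euclidean_space. exp (- norm z) \<le> C * exp (- \<mu> * \<omega> (norm z))"
proof -
  obtain C where C: "C \<ge> 0" "\<And>t. t \<ge> 0 \<Longrightarrow> \<omega> t \<le> (1 / \<mu>) * t + C" using w_small[of "1 / \<mu>"] assms by auto
  have "exp (- norm z) \<le> exp (\<mu> * C) * exp (- \<mu> * \<omega> (norm z))" for z :: 'z
  proof -
    have "\<mu> * \<omega> (norm z) \<le> \<mu> * ((1 / \<mu>) * norm z + C)" using C(2)[of "norm z"] assms by (intro mult_left_mono) auto
    then show ?thesis using assms by (simp add: mult_exp_exp algebra_simps)
  qed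
  moreover have "exp (\<mu> * C) \<ge> 1" using C assms by simp
  ultimately show ?thesis by blast
qed

lemma sbound_mod_gaussian: assumes s: "s > 0" and mu: "\<mu> > 0" shows "\<exists>Q. sbound \<mu> Q (mod_gaussian s p (q::'z::euclidean_space))"
proof -
  obtain C where C: "C \<ge> 1" "\<And>z::'z. exp (- norm z) \<le> C * exp (- \<mu> * \<omega> (norm z))" using exp_norm_weight[OF mu] by blast
  obtain D where D: "D \<ge> 1" "\<And>k::nat. fact k \<le> D * young_exp \<mu> (real k)" using young_exp_fact[OF mu] by blast
  define E where "E = exp ((s / 2 + norm q) * DIM('z) + 1 / s + norm p)"
  have "norm (Dw w (mod_gaussian s p q) z) \<le> (E * D * C) * young_exp \<mu> (length w) * exp (- \<mu> * \<omega> (norm z))" if w: "set w \<subseteq> Basis" for w z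
  proof -
    have "norm (Dw w (mod_gaussian s p q) z) \<le> E * fact (length w) * exp (- norm z)"
      unfolding E_def by (rule mod_gaussian_exp_bound[OF s w])
    also have "\<dots> \<le> E * (D * young_exp \<mu> (length w)) * (C * exp (- \<mu> * \<omega> (norm z)))"
      using C(2)[of z] D by (intro mult_mono mult_left_mono) (auto simp: E_def)
    finally show ?thesis by (simp add: mult_ac)
  qed
  then show ?thesis using mod_gaussian_smooth by (auto simp: sbound_def)
qed

text \<open>Bounds uniform in the order of differentiation for f and its transform. They imply
  membership in \<open>S_space\<close>, are stable under linear combinations, and hold for
  Gaussians.\<close>

definition rapid :: "('z::euclidean_space \<Rightarrow> complex) \<Rightarrow> bool" where
  "rapid f \<longleftrightarrow> (\<forall>\<mu>>0. \<exists>Q. sbound \<mu> Q f) \<and> (\<forall>\<mu>>0. \<exists>Q. sbound \<mu> Q (fourier f))"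

lemma sbound_integrable: assumes "sbound 1 Q (f :: 'z::euclidean_space \<Rightarrow> complex)" shows "integrable lborel f"
proof -
  obtain C where C: "C \<ge> 1" "\<And>y::'z. exp (- \<omega> (norm y)) \<le> C * prod_majorant y" using prod_majorant_weight by blast
  have Q: "Q \<ge> 0" by (rule sbound_nonneg[OF assms])
  have c: "continuous_on UNIV f" using assms Cinf_cont[of UNIV f "[]"] by (simp add: sbound_def)
  show ?thesis
  proof (rule prod_majorant_integrable_bound)
    show "f \<in> borel_measurable borel" using c by (rule borel_measurable_continuous_onI)
    fix x
    have "norm (Dw [] f x) \<le> Q * young_exp 1 (length ([]::'z list)) * exp (- 1 * \<omega> (norm x))"
      using assms unfolding sbound_def by (metis empty_set empty_subsetI)
    also have "\<dots> \<le> Q * (C * prod_majorant x)" using C(2)[of x] Q young_exp_0[of 1] by (simp add: mult_left_mono)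
    finally show "norm (f x) \<le> (Q * C) * prod_majorant x" by (simp add: mult.assoc)
  qed
qed

lemma rapid_S_space: assumes "rapid f" shows "f \<in> S_space \<omega>"
proof -
  have bdd: "bdd_above (range (\<lambda>x. exp (\<mu> * \<omega> (norm x)) * norm (Dmulti \<alpha> g x)))"
    if s: "sbound \<mu> Q g" for \<mu> Q \<alpha> and g :: "'a \<Rightarrow> complex"
  proof (rule bdd_aboveI[of _ "Q * young_exp \<mu> (length (mword \<alpha>))"])
    fix y assume "y \<in> range (\<lambda>x. exp (\<mu> * \<omega> (norm x)) * norm (Dmulti \<alpha> g x))"
    then obtain x where y: "y = exp (\<mu> * \<omega> (norm x)) * norm (Dmulti \<alpha> g x)" by auto
    have "norm (Dmulti \<alpha> g x) \<le> Q * young_exp \<mu> (length (mword \<alpha>)) * exp (- \<mu> * \<omega> (norm x))"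
      using s set_mword[of \<alpha>] unfolding Dmulti_eq sbound_def by blast
    then have "y \<le> exp (\<mu> * \<omega> (norm x)) * (Q * young_exp \<mu> (length (mword \<alpha>)) * exp (- \<mu> * \<omega> (norm x)))"
      unfolding y by (intro mult_left_mono) auto
    also have "\<dots> = Q * young_exp \<mu> (length (mword \<alpha>)) * (exp (\<mu> * \<omega> (norm x)) * exp (- \<mu> * \<omega> (norm x)))" by (simp add: mult_ac)
    also have "\<dots> = Q * young_exp \<mu> (length (mword \<alpha>))" by (simp add: mult_exp_exp)
    finally show "y \<le> Q * young_exp \<mu> (length (mword \<alpha>))" .
  qed
  have "\<exists>Q. sbound 1 Q f" "\<exists>Q. sbound 1 Q (fourier f)" using assms unfolding rapid_def by (meson zero_less_one)+
  then have "integrable lborel f" "Cinf_on UNIV f" "Cinf_on UNIV (fourier f)"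
    using sbound_integrable by (auto simp: sbound_def)
  moreover have "bdd_above (range (\<lambda>x. exp (\<mu> * \<omega> (norm x)) * norm (Dmulti \<alpha> f x)))"
    "bdd_above (range (\<lambda>x. exp (\<mu> * \<omega> (norm x)) * norm (Dmulti \<alpha> (fourier f) x)))" if "\<mu> > 0" for \<mu> \<alpha>
    using assms that bdd unfolding rapid_def by meson+
  ultimately show ?thesis unfolding S_space_def by simp
qed

lemma rapid_gaussian: assumes "s > 0" shows "rapid (gaussian s p)"
proof -
  have "\<exists>Q. sbound \<mu> Q (\<lambda>\<xi>. complex_of_real (sqrt (2 * pi / s) ^ DIM('a)) * mod_gaussian (1 / s) 0 p \<xi>)" if "\<mu> > 0" for \<mu>
    using sbound_mod_gaussian[of "1 / s" \<mu> 0 p] sbound_cmult assms that by (metis zero_less_divide_1_iff)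
  then show ?thesis unfolding rapid_def fourier_gaussian[OF assms] using sbound_mod_gaussian[OF assms] by blast
qed

lemma rapid_integrable: "rapid f \<Longrightarrow> integrable lborel f"
  using sbound_integrable unfolding rapid_def by (meson zero_less_one)

lemma rapid_add: assumes "rapid f" "rapid g" shows "rapid (\<lambda>x. f x + g x)"
proof -
  have i: "integrable lborel (\<lambda>x. h x * exp (- \<i> * complex_of_real (x \<bullet> \<xi>)))" if "rapid h" for h :: "'a \<Rightarrow> complex" and \<xi>
  proof (rule Bochner_Integration.integrable_bound[OF rapid_integrable[OF that]])
    show "(\<lambda>x. h x * exp (- \<i> * complex_of_real (x \<bullet> \<xi>))) \<in> borel_measurable lborel"
      using borel_measurable_integrable[OF rapid_integrable[OF that]]
      by (intro borel_measurable_times) (auto intro!: borel_measurable_continuous_onI continuous_intros)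
  qed (simp add: norm_mult)
  have "fourier (\<lambda>x. f x + g x) = (\<lambda>\<xi>. fourier f \<xi> + fourier g \<xi>)"
    unfolding fourier_def using i[OF assms(1)] i[OF assms(2)] by (simp add: distrib_right)
  then show ?thesis using assms sbound_add unfolding rapid_def by (simp only:) blast
qed

lemma rapid_cmult: assumes "rapid f" shows "rapid (\<lambda>x. c * f x)"
proof -
  have "fourier (\<lambda>x. c * f x) = (\<lambda>\<xi>. c * fourier f \<xi>)"
    unfolding fourier_def by (simp add: mult.assoc)
  then show ?thesis using assms sbound_cmult unfolding rapid_def by (simp only:) blast
qed

end

section \<open>Test functions with compact support\<close>

lemma lborel_integral_affine:
  fixes g :: "'a::euclidean_space \<Rightarrow> complex"
  assumes g: "g \<in> borel_measurable borel" and t: "t > 0"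
  shows "(LINT x|lborel. g x) = complex_of_real (t ^ DIM('a)) * (LINT v|lborel. g (z + t *\<^sub>R v))"
proof -
  have m: "(\<lambda>x. z + t *\<^sub>R x) \<in> lborel \<rightarrow>\<^sub>M borel" by simp
  have "(LINT x|lborel. g x) = (LINT x|density (distr lborel borel (\<lambda>x. z + t *\<^sub>R x)) (\<lambda>_. ennreal (\<bar>t\<bar> ^ DIM('a))). g x)"
    using lborel_affine[of t z] t by simp
  also have "\<dots> = (LINT x|distr lborel borel (\<lambda>x. z + t *\<^sub>R x). (\<bar>t\<bar> ^ DIM('a)) *\<^sub>R g x)"
    by (rule integral_density) (use g in auto)
  also have "\<dots> = (LINT v|lborel. (\<bar>t\<bar> ^ DIM('a)) *\<^sub>R g (z + t *\<^sub>R v))"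
    by (rule integral_distr[OF m]) (use g in simp)
  also have "\<dots> = complex_of_real (t ^ DIM('a)) * (LINT v|lborel. g (z + t *\<^sub>R v))"
    using t by (simp add: scaleR_conv_of_real)
  finally show ?thesis .
qed

lemma gaussian_norm: "s \<ge> 0 \<Longrightarrow> norm (gaussian s p z) \<le> 1"
  unfolding gaussian_eq by simp

lemma gaussian_cont: "continuous_on A (gaussian s p)"
  using Cinf_cont[OF mod_gaussian_smooth, of "[]" s p 0] continuous_on_subset by simp blast

text \<open>The inequality half of Fourier inversion. Damping the transform by a Gaussian and
  interchanging integrals gives a Gaussian mean of f around z. As the width 1/t shrinks, it tends to
  (2 pi)^d f(z), while its modulus never exceeds the right side.\<close>

lemma fourier_inversion_bound:
  fixes f :: "'a::euclidean_space \<Rightarrow> complex"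
  assumes c: "continuous_on UNIV f" and fi: "integrable lborel f" and M: "\<And>x. norm (f x) \<le> M"
    and hi: "integrable lborel (fourier f)"
  shows "(2 * pi) ^ DIM('a) * norm (f z) \<le> (LINT \<xi>|lborel. norm (fourier f \<xi>))"
proof -
  define I where "I = (\<lambda>s. LINT \<xi>|lborel. fourier f \<xi> * (exp (\<i> * complex_of_real (z \<bullet> \<xi>)) * gaussian s 0 \<xi>))"
  have Ib: "norm (I s) \<le> (LINT \<xi>|lborel. norm (fourier f \<xi>))" if "s \<ge> 0" for s
    unfolding I_def
  proof (rule integral_norm_le[OF integrable_norm[OF hi]])
    fix \<xi> show "norm (fourier f \<xi> * (exp (\<i> * complex_of_real (z \<bullet> \<xi>)) * gaussian s 0 \<xi>)) \<le> norm (fourier f \<xi>)"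
      using gaussian_norm[OF that, of 0 \<xi>] mult_left_mono[of "norm (gaussian s 0 \<xi>)" 1 "norm (fourier f \<xi>)"] by (simp add: norm_mult)
  qed
  define c0 where "c0 = complex_of_real (sqrt (2 * pi) ^ DIM('a))"
  have main: "I (1 / t\<^sup>2) = c0 * (LINT v|lborel. f (z + (1 / t) *\<^sub>R v) * gaussian 1 0 v)" if t: "t > 0" for t
  proof -
    define s where "s = 1 / t\<^sup>2"
    have s: "s > 0" using t by (simp add: s_def)
    define N where "N = complex_of_real (sqrt (2 * pi / s) ^ DIM('a))"
    define h where "h = (\<lambda>x \<xi>. f x * (exp (\<i> * complex_of_real ((z - x) \<bullet> \<xi>)) * gaussian s 0 \<xi>))"
    have nh: "norm (h x \<xi>) = norm (f x) * norm (gaussian s 0 \<xi>)" for x \<xi> by (simp add: h_def norm_mult)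
    have hc: "continuous_on UNIV (\<lambda>p. h (fst p) (snd p))"
    proof -
      have "continuous_on UNIV (\<lambda>p::'a \<times> 'a. f (fst p))" by (rule continuous_on_compose2[OF c]) (auto intro!: continuous_intros)
      moreover have "continuous_on UNIV (\<lambda>p::'a \<times> 'a. gaussian s 0 (snd p))"
        by (rule continuous_on_compose2[OF gaussian_cont[of UNIV]]) (auto intro!: continuous_intros)
      ultimately show ?thesis unfolding h_def by (intro continuous_intros)
    qed
    have int: "integrable (lborel \<Otimes>\<^sub>M lborel) (case_prod h)"
    proof (rule lborel_pair.Fubini_integrable)
      show "case_prod h \<in> borel_measurable (lborel \<Otimes>\<^sub>M lborel)"
        using borel_measurable_continuous_onI[OF hc] by (simp add: lborel_prod case_prod_unfold)
      show "integrable lborel (\<lambda>x. LINT \<xi>|lborel. norm (case (x, \<xi>) of (x, \<xi>) \<Rightarrow> h x \<xi>))"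
        by (simp add: nh integrable_norm[OF fi])
      have "integrable lborel (h x)" for x
      proof (rule Bochner_Integration.integrable_bound)
        show "integrable lborel (\<lambda>\<xi>. norm (f x) * norm (gaussian s 0 (\<xi>::'a)))"
          by (intro integrable_mult_right integrable_norm gaussian_fourier(2) s)
        show "h x \<in> borel_measurable lborel"
          unfolding h_def by (simp, intro borel_measurable_continuous_onI continuous_intros gaussian_cont)
      qed (simp add: nh)
      then show "AE x in lborel. integrable lborel (\<lambda>\<xi>. case (x, \<xi>) of (x, \<xi>) \<Rightarrow> h x \<xi>)" by simp
    qed
    have "I s = (LINT \<xi>|lborel. LINT x|lborel. h x \<xi>)"
      unfolding I_def
    proof (intro Bochner_Integration.integral_cong refl)
      fix \<xi>
      have "exp (\<i> * complex_of_real ((z - x) \<bullet> \<xi>)) = exp (- \<i> * complex_of_real (x \<bullet> \<xi>)) * exp (\<i> * complex_of_real (z \<bullet> \<xi>))" for x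
        unfolding mult_exp_exp by (rule arg_cong[where f = exp]) (simp add: inner_diff_left algebra_simps)
      then have "h x \<xi> = f x * exp (- \<i> * complex_of_real (x \<bullet> \<xi>)) * (exp (\<i> * complex_of_real (z \<bullet> \<xi>)) * gaussian s 0 \<xi>)" for x
        unfolding h_def by (simp only: mult_ac)
      then show "fourier f \<xi> * (exp (\<i> * complex_of_real (z \<bullet> \<xi>)) * gaussian s 0 \<xi>) = (LINT x|lborel. h x \<xi>)"
        unfolding fourier_def by (simp only: integral_mult_left_zero)
    qed
    also have "\<dots> = (LINT x|lborel. LINT \<xi>|lborel. h x \<xi>)" by (rule lborel_pair.Fubini_integral[OF int])
    also have "\<dots> = (LINT x|lborel. f x * (N * gaussian (1 / s) 0 (z - x)))"
      unfolding h_def by (simp only: integral_mult_right_zero gaussian_fourier(1)[OF s] N_def)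
    also have "\<dots> = complex_of_real ((1 / t) ^ DIM('a)) * (LINT v|lborel. f (z + (1 / t) *\<^sub>R v) * (N * gaussian (1 / s) 0 (z - (z + (1 / t) *\<^sub>R v))))"
    proof (rule lborel_integral_affine)
      have "continuous_on UNIV (\<lambda>x. gaussian (1 / s) 0 (z - x))"
        by (rule continuous_on_compose2[OF gaussian_cont[of UNIV]]) (auto intro!: continuous_intros)
      then show "(\<lambda>x. f x * (N * gaussian (1 / s) 0 (z - x))) \<in> borel_measurable borel"
        using c by (intro borel_measurable_continuous_onI continuous_intros)
    qed (use t in simp)
    also have "\<dots> = complex_of_real ((1 / t) ^ DIM('a)) * (LINT v|lborel. N * (f (z + (1 / t) *\<^sub>R v) * gaussian 1 0 v))"
    proof -
      have "gaussian (1 / s) 0 (z - (z + (1 / t) *\<^sub>R v)) = gaussian 1 0 v" for v :: 'a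
        using t by (simp add: gaussian_eq s_def power_divide)
      then show ?thesis by (simp only: mult.left_commute)
    qed
    also have "\<dots> = (complex_of_real ((1 / t) ^ DIM('a)) * N) * (LINT v|lborel. f (z + (1 / t) *\<^sub>R v) * gaussian 1 0 v)"
      by (simp only: integral_mult_right_zero mult.assoc)
    also have "complex_of_real ((1 / t) ^ DIM('a)) * N = c0"
    proof -
      have "(1 / t) * sqrt (2 * pi / s) = sqrt (2 * pi)" using t by (simp add: s_def real_sqrt_mult)
      then show ?thesis unfolding N_def c0_def of_real_mult[symmetric] power_mult_distrib[symmetric] by simp
    qed
    finally show ?thesis unfolding s_def .
  qed
  have lim: "(\<lambda>j. LINT v|lborel. f (z + (1 / real (Suc j)) *\<^sub>R v) * gaussian 1 0 v) \<longlonglongrightarrow> (LINT v|lborel. f z * gaussian 1 0 (v::'a))"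
  proof (rule integral_dominated_convergence[of "\<lambda>v::'a. f z * gaussian 1 0 v" lborel "\<lambda>j v. f (z + (1 / real (Suc j)) *\<^sub>R v) * gaussian 1 0 v" "\<lambda>v::'a. M * norm (gaussian 1 0 v)"])
    show "integrable lborel (\<lambda>v::'a. M * norm (gaussian 1 0 v))"
      by (intro integrable_mult_right integrable_norm gaussian_fourier(2)) simp
    show "(\<lambda>v. f z * gaussian 1 0 v) \<in> borel_measurable lborel"
      by (simp, intro borel_measurable_continuous_onI continuous_intros gaussian_cont)
    have fc: "continuous_on UNIV (\<lambda>v. f (z + r *\<^sub>R v))" for r
      by (rule continuous_on_compose2[OF c]) (auto intro!: continuous_intros)
    show "(\<lambda>v. f (z + (1 / real (Suc j)) *\<^sub>R v) * gaussian 1 0 v) \<in> borel_measurable lborel" for j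
      using fc[of "1 / real (Suc j)"] by (simp, intro borel_measurable_continuous_onI continuous_intros gaussian_cont)
    show "AE v in lborel. norm (f (z + (1 / real (Suc j)) *\<^sub>R v) * gaussian 1 0 v) \<le> M * norm (gaussian 1 0 v)" for j
      by (intro AE_I2) (simp add: norm_mult mult_right_mono M del: of_nat_Suc)
    show "AE v in lborel. (\<lambda>j. f (z + (1 / real (Suc j)) *\<^sub>R v) * gaussian 1 0 v) \<longlonglongrightarrow> f z * gaussian 1 0 v"
    proof (rule AE_I2)
      fix v
      have "(\<lambda>j. 1 / real (Suc j)) \<longlonglongrightarrow> 0" by real_asymp
      then have "(\<lambda>j. z + (1 / real (Suc j)) *\<^sub>R v) \<longlonglongrightarrow> z + 0 *\<^sub>R v" by (intro tendsto_intros)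
      then have "(\<lambda>j. f (z + (1 / real (Suc j)) *\<^sub>R v)) \<longlonglongrightarrow> f (z + 0 *\<^sub>R v)"
        by (rule continuous_on_tendsto_compose[OF c]) auto
      then have "(\<lambda>j. f (z + (1 / real (Suc j)) *\<^sub>R v) * gaussian 1 0 v) \<longlonglongrightarrow> f (z + 0 *\<^sub>R v) * gaussian 1 0 v"
        by (rule tendsto_mult_right)
      then show "(\<lambda>j. f (z + (1 / real (Suc j)) *\<^sub>R v) * gaussian 1 0 v) \<longlonglongrightarrow> f z * gaussian 1 0 v" by simp
    qed
  qed
  have c0: "c0 * (LINT v|lborel. f z * gaussian 1 0 (v::'a)) = complex_of_real ((2 * pi) ^ DIM('a)) * f z"
  proof -
    have "c0 * (LINT v|lborel. f z * gaussian 1 0 (v::'a)) = complex_of_real (sqrt (2 * pi) ^ DIM('a)) * (f z * complex_of_real (sqrt (2 * pi) ^ DIM('a)))"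
      unfolding c0_def using gaussian_fourier(3)[where 'a = 'a, of 1] by simp
    also have "\<dots> = complex_of_real ((sqrt (2 * pi) * sqrt (2 * pi)) ^ DIM('a)) * f z"
      unfolding power_mult_distrib by (simp only: of_real_mult mult_ac)
    finally show ?thesis by (simp only: real_sqrt_mult_self abs_mult abs_numeral) simp
  qed
  have "(\<lambda>j. norm (c0 * (LINT v|lborel. f (z + (1 / real (Suc j)) *\<^sub>R v) * gaussian 1 0 v))) \<longlonglongrightarrow> norm (complex_of_real ((2 * pi) ^ DIM('a)) * f z)"
    unfolding c0[symmetric] by (intro tendsto_norm tendsto_mult_left lim)
  then have "norm (complex_of_real ((2 * pi) ^ DIM('a)) * f z) \<le> (LINT \<xi>|lborel. norm (fourier f \<xi>))"
  proof (rule LIMSEQ_le_const2)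
    show "\<exists>N. \<forall>j\<ge>N. norm (c0 * (LINT v|lborel. f (z + (1 / real (Suc j)) *\<^sub>R v) * gaussian 1 0 v)) \<le> (LINT \<xi>|lborel. norm (fourier f \<xi>))"
    proof (intro exI allI impI)
      fix j
      have "0 < real (Suc j)" by simp
      show "norm (c0 * (LINT v|lborel. f (z + (1 / real (Suc j)) *\<^sub>R v) * gaussian 1 0 v)) \<le> (LINT \<xi>|lborel. norm (fourier f \<xi>))"
        unfolding main[OF \<open>0 < real (Suc j)\<close>, symmetric] by (rule Ib) simp
    qed
  qed
  then show ?thesis by (simp add: norm_mult norm_power)
qed

lemma Dw_outside:
  fixes F :: "'a::euclidean_space \<Rightarrow> complex"
  assumes K: "closed K" and F: "\<And>z. z \<notin> K \<Longrightarrow> F z = 0" and z: "z \<notin> K"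
  shows "Dw w F z = 0"
  using z
proof (induction w arbitrary: z)
  case (Cons b w)
  have "Dpartial b (Dw w F) z = Dpartial b (\<lambda>_. 0) z"
    by (rule Dpartial_cong_open(2)[of "- K"]) (use K Cons in auto)
  then show ?case by (simp add: Dpartial_const)
qed (simp add: F)

lemma compact_support_prod_majorant:
  fixes f :: "'a::euclidean_space \<Rightarrow> complex"
  assumes f: "continuous_on UNIV f" and K: "compact K" "\<And>z. z \<notin> K \<Longrightarrow> f z = 0"
  shows "\<exists>C\<ge>0. \<forall>z. norm (f z) \<le> C * prod_majorant z"
proof -
  have "continuous_on K (\<lambda>z. norm (f z) / prod_majorant z)"
    using continuous_on_subset[OF f subset_UNIV] by (intro continuous_intros prod_majorant_cont) (auto simp: less_imp_neq[OF prod_majorant_pos, symmetric])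
  then have "bounded ((\<lambda>z. norm (f z) / prod_majorant z) ` K)" using K(1) compact_continuous_image compact_imp_bounded by blast
  then obtain C where C: "C > 0" "\<And>z. z \<in> K \<Longrightarrow> \<bar>norm (f z) / prod_majorant z\<bar> \<le> C" by (auto simp: bounded_pos)
  have "norm (f z) \<le> C * prod_majorant z" for z
  proof (cases "z \<in> K")
    case True
    then have "norm (f z) / prod_majorant z \<le> C" using C(2)[of z] by linarith
    then show ?thesis using prod_majorant_pos[of z] by (simp add: divide_le_eq)
  qed (use K C prod_majorant_pos[of z] in simp)
  then show ?thesis using C by (intro exI[of _ C]) auto
qed

lemma fourier_Dpartial:
  fixes f :: "'a::euclidean_space \<Rightarrow> complex"
  assumes hp: "\<And>x. has_partial b f x" and c: "continuous_on UNIV f" and c': "continuous_on UNIV (Dpartial b f)"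
    and b: "b \<in> Basis" and bd: "\<And>x. norm (f x) \<le> C * prod_majorant x" and bd': "\<And>x. norm (Dpartial b f x) \<le> C * prod_majorant x"
  shows "fourier (Dpartial b f) \<xi> = complex_of_real (b \<bullet> \<xi>) * fourier f \<xi>"
proof -
  define e where "e = (\<lambda>x::'a. exp (\<i> * complex_of_real (x \<bullet> (- \<xi>))))"
  have e: "exp (- \<i> * complex_of_real (x \<bullet> \<xi>)) = e x" for x by (simp add: e_def)
  have e1: "norm (e x) = 1" for x by (simp add: e_def)
  have ec: "continuous_on UNIV e" unfolding e_def by (intro continuous_intros)
  have ep: "has_partial b e x" "Dpartial b e x = - complex_of_real (b \<bullet> \<xi>) * e x" for x
    using exp_inner_partial[of b "- \<xi>" x] by (simp_all add: e_def)
  have D: "Dpartial b (\<lambda>x. f x * e x) x = Dpartial b f x * e x - complex_of_real (b \<bullet> \<xi>) * (f x * e x)" for x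
    unfolding Dpartial_mult(2)[OF hp ep(1)] ep(2) by simp
  define C' where "C' = C * (1 + norm \<xi>)"
  have C: "C \<ge> 0" using bd[of 0] prod_majorant_pos[of "0::'a"] by (smt (verit) norm_ge_zero zero_le_mult_iff)
  have bx: "\<bar>b \<bullet> \<xi>\<bar> \<le> norm \<xi>" using Cauchy_Schwarz_ineq2[of b \<xi>] b by simp
  have CJ: "C * prod_majorant x \<le> C' * prod_majorant x" for x
    unfolding C'_def using C prod_majorant_pos[of x] by (intro mult_right_mono) (auto simp: mult_le_cancel_left1)
  have i: "integrable lborel (\<lambda>x. f x * e x)" "integrable lborel (\<lambda>x. Dpartial b f x * e x)"
    by (rule prod_majorant_integrable_bound[where C = C]; use c c' ec bd bd' in \<open>auto simp: norm_mult e1 intro!: borel_measurable_continuous_onI continuous_intros\<close>)+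
  have "(LINT x|lborel. Dpartial b (\<lambda>x. f x * e x) x) = 0"
  proof (rule integral_Dpartial[OF Dpartial_mult(1)[OF hp ep(1)] _ _ b])
    show "continuous_on UNIV (\<lambda>x. f x * e x)" using c ec by (intro continuous_intros)
    show "continuous_on UNIV (Dpartial b (\<lambda>x. f x * e x))" unfolding D using c c' ec by (intro continuous_intros)
    show "norm (f x * e x) \<le> C' * prod_majorant x" for x using order.trans[OF bd CJ] by (simp add: norm_mult e1)
    show "norm (Dpartial b (\<lambda>x. f x * e x) x) \<le> C' * prod_majorant x" for x
    proof -
      have "norm (Dpartial b (\<lambda>x. f x * e x) x) \<le> norm (Dpartial b f x) + \<bar>b \<bullet> \<xi>\<bar> * norm (f x)"
        unfolding D using norm_triangle_ineq4[of "Dpartial b f x * e x" "complex_of_real (b \<bullet> \<xi>) * (f x * e x)"]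
        by (simp add: norm_mult e1)
      also have "\<dots> \<le> C * prod_majorant x + norm \<xi> * (C * prod_majorant x)" using bd bd' bx by (intro add_mono mult_mono) auto
      finally show ?thesis by (simp add: C'_def algebra_simps)
    qed
  qed
  then show ?thesis unfolding D fourier_def e using i by simp
qed

lemma fourier_Dw:
  fixes F :: "'a::euclidean_space \<Rightarrow> complex"
  assumes F: "Cinf_on UNIV F" and K: "compact K" "\<And>z. z \<notin> K \<Longrightarrow> F z = 0" and w: "set w \<subseteq> Basis"
  shows "fourier (Dw w F) \<xi> = (\<Prod>b\<leftarrow>w. complex_of_real (b \<bullet> \<xi>)) * fourier F \<xi>"
  using w
proof (induction w)
  case (Cons b w)
  then have b: "b \<in> Basis" and w: "set w \<subseteq> Basis" by auto
  have c: "continuous_on UNIV (Dw w F)" "continuous_on UNIV (Dpartial b (Dw w F))"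
    using Cinf_cont[OF F, of w] Cinf_cont[OF F, of "b # w"] b w by auto
  have o: "Dw w F z = 0" "Dpartial b (Dw w F) z = 0" if "z \<notin> K" for z
    using Dw_outside[of K F z w] Dw_outside[of K F z "b # w"] K that by (auto simp: compact_imp_closed)
  obtain C1 where C1: "\<And>z. norm (Dw w F z) \<le> C1 * prod_majorant z" using compact_support_prod_majorant[OF c(1) K(1) o(1)] by auto
  obtain C2 where C2: "\<And>z. norm (Dpartial b (Dw w F) z) \<le> C2 * prod_majorant z" using compact_support_prod_majorant[OF c(2) K(1) o(2)] by auto
  have "fourier (Dpartial b (Dw w F)) \<xi> = complex_of_real (b \<bullet> \<xi>) * fourier (Dw w F) \<xi>"
  proof (rule fourier_Dpartial[OF _ c b])
    show "has_partial b (Dw w F) x" for x using Cinf_partial[OF F w b] by simp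
    show "norm (Dw w F x) \<le> max C1 C2 * prod_majorant x" for x
      using C1[of x] mult_right_mono[of C1 "max C1 C2" "prod_majorant x"] prod_majorant_pos[of x] by linarith
    show "norm (Dpartial b (Dw w F) x) \<le> max C1 C2 * prod_majorant x" for x
      using C2[of x] mult_right_mono[of C2 "max C1 C2" "prod_majorant x"] prod_majorant_pos[of x] by linarith
  qed
  then show ?case using Cons.IH[OF w] by (simp add: mult.assoc)
qed simp

section \<open>Uniform derivative bounds for compactly supported test functions\<close>

context weight
begin

text \<open>\<open>S_space\<close> bounds each derivative separately, with constants that may depend
  on the order. Uniformity comes from the Fourier side: the decay of the transform itself, |\<xi>|^k
  \<le> \<open>young_exp\<close> times e^{\<mu>\<omega>}, and the inversion bound. On the compact
  support the spatial weight is only a constant.\<close>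

lemma test_function_sbound:
  fixes F :: "'z::euclidean_space \<Rightarrow> complex"
  assumes F: "F \<in> S_space \<omega>" and K: "compact K" "\<And>z. z \<notin> K \<Longrightarrow> F z = 0" and mu: "\<mu> > 0"
  shows "\<exists>Q. sbound \<mu> Q F"
proof -
  have sm: "Cinf_on UNIV F" "Cinf_on UNIV (fourier F)" using F by (auto simp: S_space_def)
  \<comment> \<open>The index \<mu> + 1 pays e^{\<mu>\<omega>} for the powers of \<xi> and leaves
    e^{-\<omega>} for integrability.\<close>
  have "bdd_above (range (\<lambda>\<xi>. exp ((\<mu> + 1) * \<omega> (norm \<xi>)) * norm (Dmulti (\<lambda>_. 0) (fourier F) \<xi>)))"
    using F mu unfolding S_space_def by (simp add: add_pos_pos)
  moreover have "mword (\<lambda>_::'z. 0) = []" using length_mword[of "\<lambda>_::'z. 0"] by (simp add: mi_size_def)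
  ultimately have "bdd_above (range (\<lambda>\<xi>. exp ((\<mu> + 1) * \<omega> (norm \<xi>)) * norm (fourier F \<xi>)))" by (simp add: Dmulti_eq)
  then obtain B where B: "\<And>\<xi>. exp ((\<mu> + 1) * \<omega> (norm \<xi>)) * norm (fourier F \<xi>) \<le> B" by (auto simp: bdd_above_def)
  have B0: "B \<ge> 0" using order.trans[OF _ B[of 0]] by simp
  obtain C where C: "C \<ge> 1" "\<And>y::'z. exp (- \<omega> (norm y)) \<le> C * prod_majorant y" using prod_majorant_weight by blast
  define J where "J = (LINT \<xi>|lborel. prod_majorant (\<xi>::'z))"
  have hat: "norm (fourier (Dw w F) \<xi>) \<le> (B * C * young_exp \<mu> (length w)) * prod_majorant \<xi>" if w: "set w \<subseteq> Basis" for w \<xi>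
  proof -
    have "norm (\<Prod>b\<leftarrow>w. complex_of_real (b \<bullet> \<xi>)) \<le> norm \<xi> ^ length w"
      using w
    proof (induction w)
      case (Cons b w)
      have "\<bar>b \<bullet> \<xi>\<bar> \<le> norm \<xi>" using Cauchy_Schwarz_ineq2[of b \<xi>] Cons.prems by simp
      then show ?case using Cons by (simp add: norm_mult mult_mono)
    qed simp
    also have "\<dots> \<le> young_exp \<mu> (length w) * exp (\<mu> * \<omega> (norm \<xi>))"
    proof (cases "norm \<xi> \<ge> 1")
      case True
      then show ?thesis using young_exp_power[OF mu] by simp
    next
      case False
      then have "norm \<xi> ^ length w \<le> 1" by (simp add: power_le_one)
      also have "\<dots> \<le> young_exp \<mu> (length w) * exp (\<mu> * \<omega> (norm \<xi>))"
        using mult_mono[of 1 "young_exp \<mu> (length w)" 1 "exp (\<mu> * \<omega> (norm \<xi>))"] young_exp_ge1[OF mu] mu w_nonneg[of "norm \<xi>"] by simp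
      finally show ?thesis .
    qed
    finally have p: "norm (\<Prod>b\<leftarrow>w. complex_of_real (b \<bullet> \<xi>)) \<le> young_exp \<mu> (length w) * exp (\<mu> * \<omega> (norm \<xi>))" .
    have "norm (fourier (Dw w F) \<xi>) \<le> young_exp \<mu> (length w) * exp (\<mu> * \<omega> (norm \<xi>)) * norm (fourier F \<xi>)"
      using mult_right_mono[OF p norm_ge_zero[of "fourier F \<xi>"]] fourier_Dw[OF sm(1) K(1) _ w, of \<xi>] K(2) by (simp add: norm_mult)
    also have "\<dots> = young_exp \<mu> (length w) * (exp (- \<omega> (norm \<xi>)) * (exp ((\<mu> + 1) * \<omega> (norm \<xi>)) * norm (fourier F \<xi>)))"
      by (simp add: exp_minus distrib_right exp_add)
    also have "\<dots> \<le> young_exp \<mu> (length w) * ((C * prod_majorant \<xi>) * B)"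
      using B C(2)[of \<xi>] prod_majorant_pos[of \<xi>] C(1) by (intro mult_left_mono mult_mono) auto
    finally show ?thesis by (simp add: mult_ac)
  qed
  obtain R where R: "R \<ge> 0" "\<And>z. z \<in> K \<Longrightarrow> norm z \<le> R"
    using compact_imp_bounded[OF K(1)] unfolding bounded_iff by (metis abs_ge_self abs_ge_zero order.trans)
  define Q where "Q = B * C * J * exp (\<mu> * \<omega> R)"
  have "norm (Dw w F z) \<le> Q * young_exp \<mu> (length w) * exp (- \<mu> * \<omega> (norm z))" if w: "set w \<subseteq> Basis" for w z
  proof (cases "z \<in> K")
    case True
    have c: "continuous_on UNIV (Dw w F)" by (rule Cinf_cont[OF sm(1) w])
    have o: "\<And>z. z \<notin> K \<Longrightarrow> Dw w F z = 0" using Dw_outside[of K F] K by (simp add: compact_imp_closed)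
    obtain M where M: "M \<ge> 0" "\<And>z. norm (Dw w F z) \<le> M * prod_majorant z" using compact_support_prod_majorant[OF c K(1) o] by auto
    have "fourier (Dw w F) = (\<lambda>\<xi>. (\<Prod>b\<leftarrow>w. complex_of_real (b \<bullet> \<xi>)) * fourier F \<xi>)"
      using fourier_Dw[OF sm(1) K w] by auto
    moreover have "continuous_on UNIV (\<lambda>\<xi>. (\<Prod>b\<leftarrow>w. complex_of_real (b \<bullet> \<xi>)))" by (induction w) (auto intro!: continuous_intros)
    ultimately have fm: "fourier (Dw w F) \<in> borel_measurable borel"
      using Cinf_cont[OF sm(2), of "[]"] by (auto intro!: borel_measurable_continuous_onI continuous_intros)
    have hi: "integrable lborel (fourier (Dw w F))" by (rule prod_majorant_integrable_bound[OF fm hat[OF w]])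
    have "norm (Dw w F z) \<le> (2 * pi) ^ DIM('z) * norm (Dw w F z)"
      using one_le_power[of "2 * pi" "DIM('z)"] pi_ge_two by (simp add: mult_le_cancel_right1)
    also have "\<dots> \<le> (LINT \<xi>|lborel. norm (fourier (Dw w F) \<xi>))"
    proof (rule fourier_inversion_bound[OF c _ _ hi])
      show "integrable lborel (Dw w F)" by (rule prod_majorant_integrable_bound[OF borel_measurable_continuous_onI[OF c] M(2)])
      show "norm (Dw w F x) \<le> M" for x using M(2)[of x] mult_left_mono[OF prod_majorant_le1 M(1), of x] by simp
    qed
    also have "\<dots> \<le> (LINT \<xi>|lborel. (B * C * young_exp \<mu> (length w)) * prod_majorant (\<xi>::'z))"
      by (rule integral_mono[OF integrable_norm[OF hi] integrable_mult_right[OF prod_majorant_integrable] hat[OF w]])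
    also have "\<dots> = B * C * young_exp \<mu> (length w) * J" by (simp add: J_def)
    also have "\<dots> = (B * C * young_exp \<mu> (length w) * J) * 1" by simp
    also have "\<dots> \<le> (B * C * young_exp \<mu> (length w) * J) * (exp (\<mu> * \<omega> R) * exp (- \<mu> * \<omega> (norm z)))"
    proof (rule mult_left_mono)
      have "\<mu> * \<omega> (norm z) \<le> \<mu> * \<omega> R" using w_mono[of "norm z" R] R(2)[OF True] mu by simp
      then show "1 \<le> exp (\<mu> * \<omega> R) * exp (- \<mu> * \<omega> (norm z))" by (simp add: mult_exp_exp)
      have "J \<ge> 0" unfolding J_def using less_imp_le[OF prod_majorant_pos] by (intro Bochner_Integration.integral_nonneg) auto
      then show "0 \<le> B * C * young_exp \<mu> (length w) * J" using B0 C(1) by simp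
    qed
    finally show ?thesis by (simp add: Q_def mult_ac)
  next
    case False
    have "J \<ge> 0" unfolding J_def using less_imp_le[OF prod_majorant_pos] by (intro Bochner_Integration.integral_nonneg) auto
    then have "Q \<ge> 0" using B0 C(1) by (simp add: Q_def)
    then show ?thesis using Dw_outside[of K F z w] K False by (simp add: compact_imp_closed)
  qed
  then show ?thesis using sm(1) unfolding sbound_def by blast
qed

end

section \<open>Density of linear combinations of Gaussian functions\<close>

text \<open>The segment from x to x + h is replaced by a path that changes one coordinate at a time.
  \<open>p A\<close> carries the coordinates in A of h, so no point of the path is farther from x
  than |h|.\<close>

lemma Cinf_lipschitz:
  fixes f :: "'a::euclidean_space \<Rightarrow> complex"
  assumes hp: "\<And>b y. b \<in> Basis \<Longrightarrow> has_partial b f y"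
    and M: "\<And>b y. b \<in> Basis \<Longrightarrow> norm (y - x) \<le> norm h \<Longrightarrow> norm (Dpartial b f y) \<le> M"
  shows "norm (f (x + h) - f x) \<le> DIM('a) * (M * norm h)"
proof -
  define p where "p = (\<lambda>A. \<Sum>b\<in>A. (h \<bullet> b) *\<^sub>R b)"
  have pin: "p A \<bullet> b = (if b \<in> A then h \<bullet> b else 0)" if "A \<subseteq> Basis" "b \<in> Basis" for A b
  proof -
    have "p A \<bullet> b = (\<Sum>c\<in>A. if c = b then h \<bullet> c else 0)"
      unfolding p_def inner_sum_left using that by (intro sum.cong) (auto simp: inner_Basis)
    also have "\<dots> = (if b \<in> A then h \<bullet> b else 0)"
      using finite_subset[OF that(1) finite_Basis] by simp
    finally show ?thesis .
  qed
  have "norm (f (x + p A) - f x) \<le> card A * (M * norm h)" if "A \<subseteq> Basis" for A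
    using finite_subset[OF that finite_Basis] that
  proof (induction A rule: finite_induct)
    case (insert c A)
    then have A: "A \<subseteq> Basis" and c: "c \<in> Basis" "c \<notin> A" by auto
    have pi: "p (insert c A) = p A + (h \<bullet> c) *\<^sub>R c" using insert(1,2) by (simp add: p_def)
    have "norm (f (x + p A + (h \<bullet> c) *\<^sub>R c) - f (x + p A + 0 *\<^sub>R c)) \<le> M * \<bar>h \<bullet> c - 0\<bar>"
    proof (rule vector_mvt[where S = "closed_segment 0 (h \<bullet> c)" and f' = "\<lambda>t. \<i> * Dpartial c f (x + p A + t *\<^sub>R c)"])
      fix t assume t: "t \<in> closed_segment 0 (h \<bullet> c)"
      show "((\<lambda>t. f (x + p A + t *\<^sub>R c)) has_vector_derivative \<i> * Dpartial c f (x + p A + t *\<^sub>R c)) (at t)"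
        by (rule has_partial_shift[OF hp[OF c(1)]])
      have tc: "\<bar>t\<bar> \<le> \<bar>h \<bullet> c\<bar>" using t by (auto simp: closed_segment_eq_real_ivl split: if_splits)
      have "norm (p A + t *\<^sub>R c) \<le> norm h"
      proof (rule norm_le_componentwise)
        fix b :: 'a assume b: "b \<in> Basis"
        show "\<bar>(p A + t *\<^sub>R c) \<bullet> b\<bar> \<le> \<bar>h \<bullet> b\<bar>"
          using tc c b pin[OF A b] by (auto simp: inner_add_left inner_Basis)
      qed
      then show "norm (\<i> * Dpartial c f (x + p A + t *\<^sub>R c)) \<le> M"
        using M[OF c(1), of "x + p A + t *\<^sub>R c"] by (simp add: norm_mult add.assoc)
    qed auto
    also have "M * \<bar>h \<bullet> c - 0\<bar> \<le> M * norm h"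
    proof (rule mult_left_mono)
      show "\<bar>h \<bullet> c - 0\<bar> \<le> norm h" using Cauchy_Schwarz_ineq2[of h c] c by simp
      show "M \<ge> 0" using order.trans[OF norm_ge_zero M[OF c(1), of x]] by simp
    qed
    finally have "norm (f (x + p (insert c A)) - f (x + p A)) \<le> M * norm h" by (simp add: pi add.assoc)
    moreover have "norm (f (x + p (insert c A)) - f x) \<le> norm (f (x + p (insert c A)) - f (x + p A)) + norm (f (x + p A) - f x)"
      using norm_triangle_ineq[of "f (x + p (insert c A)) - f (x + p A)" "f (x + p A) - f x"] by simp
    ultimately show ?case using insert.IH[OF A] insert(1,2) by (simp add: distrib_right)
  qed (simp add: p_def)
  from this[OF order.refl] show ?thesis unfolding p_def euclidean_representation .
qed

text \<open>\<open>Cinf_coinduct\<close> for parameter integrals: the integrals of the h w are the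
  candidates, and a majorant independent of z for each word yields continuity and
  differentiability.\<close>

lemma Cinf_integral:
  fixes h :: "'z::euclidean_space list \<Rightarrow> 'z \<Rightarrow> 'u \<Rightarrow> complex"
  assumes der: "\<And>w b z u. set w \<subseteq> Basis \<Longrightarrow> b \<in> Basis \<Longrightarrow> has_partial b (\<lambda>z. h w z u) z \<and> Dpartial b (\<lambda>z. h w z u) z = h (b # w) z u"
    and cont: "\<And>w u. set w \<subseteq> Basis \<Longrightarrow> continuous_on UNIV (\<lambda>z. h w z u)"
    and meas: "\<And>w z. set w \<subseteq> Basis \<Longrightarrow> h w z \<in> borel_measurable M"
    and bound: "\<And>w. set w \<subseteq> Basis \<Longrightarrow> \<exists>g. integrable M g \<and> (\<forall>z u. norm (h w z u) \<le> g u)"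
  shows "Cinf_on UNIV (\<lambda>z. LINT u|M. h [] z u)"
    "set w \<subseteq> Basis \<Longrightarrow> Dw w (\<lambda>z. LINT u|M. h [] z u) z = (LINT u|M. h w z u)"
proof -
  define G where "G = (\<lambda>w z. LINT u|M. h w z u)"
  have int: "integrable M (h w z)" if w: "set w \<subseteq> Basis" for w z
  proof -
    obtain g where g: "integrable M g" "\<And>z u. norm (h w z u) \<le> g u" using bound[OF w] by blast
    show ?thesis
      by (rule Bochner_Integration.integrable_bound[OF g(1) meas[OF w]]) (use g(2) order.trans abs_ge_self in \<open>fastforce\<close>)
  qed
  have c: "continuous_on UNIV (G w)" if w: "set w \<subseteq> Basis" for w
    unfolding continuous_on_sequentially
  proof (intro allI ballI impI)
    fix X :: "nat \<Rightarrow> 'z" and a assume X: "(\<forall>n. X n \<in> UNIV) \<and> X \<longlonglongrightarrow> a"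
    obtain g where g: "integrable M g" "\<And>z u. norm (h w z u) \<le> g u" using bound[OF w] by blast
    have "(\<lambda>n. LINT u|M. h w (X n) u) \<longlonglongrightarrow> (LINT u|M. h w a u)"
    proof (rule integral_dominated_convergence[of "h w a" M "\<lambda>n. h w (X n)" g])
      show "AE u in M. (\<lambda>n. h w (X n) u) \<longlonglongrightarrow> h w a u"
        by (rule AE_I2, rule continuous_on_tendsto_compose[OF cont[OF w]]) (use X in auto)
    qed (use g meas[OF w] in auto)
    then show "(G w \<circ> X) \<longlonglongrightarrow> G w a" by (simp add: G_def o_def)
  qed
  have d: "has_partial b (G w) z \<and> Dpartial b (G w) z = G (b # w) z" if w: "set w \<subseteq> Basis" and b: "b \<in> Basis" for w b z
  proof -
    have bw: "set (b # w) \<subseteq> Basis" using w b by simp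
    obtain g where g: "integrable M g" "\<And>z u. norm (h (b # w) z u) \<le> g u" using bound[OF bw] by blast
    have "((\<lambda>t. LINT u|M. h w (z + t *\<^sub>R b) u) has_vector_derivative (LINT u|M. \<i> * h (b # w) (z + 0 *\<^sub>R b) u)) (at 0)"
    proof (rule has_vector_derivative_integral(1)[where g = g])
      fix t :: real and u
      show "((\<lambda>t. h w (z + t *\<^sub>R b) u) has_vector_derivative \<i> * h (b # w) (z + t *\<^sub>R b) u) (at t)"
        using has_partial_shift[of b "\<lambda>z. h w z u" z t] der[OF w b] by simp
      show "norm (\<i> * h (b # w) (z + t *\<^sub>R b) u) \<le> g u" using g(2) by (simp add: norm_mult)
    qed (use g int[OF w] in auto)
    then have "((\<lambda>t. G w (z + t *\<^sub>R b)) has_vector_derivative \<i> * G (b # w) z) (at 0)" by (simp add: G_def)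
    from has_partialI[OF this] show ?thesis by simp
  qed
  have z: "(\<lambda>z. LINT u|M. h [] z u) = G []" by (simp add: G_def)
  show "Cinf_on UNIV (\<lambda>z. LINT u|M. h [] z u)"
    unfolding z by (rule Cinf_coinduct(1)[OF open_UNIV refl c d])
  show "Dw w (\<lambda>z. LINT u|M. h [] z u) z = (LINT u|M. h w z u)" if "set w \<subseteq> Basis"
  proof -
    have "Dw w (G []) z = G w z" by (rule Cinf_coinduct(2)[OF open_UNIV refl c d]) (use that in auto)
    then show ?thesis by (simp add: z) (simp add: G_def)
  qed
qed

lemma Dw_shift: "Dw w (\<lambda>z. f (z + c)) z = Dw w f (z + c)"
proof -
  have "Dw w (\<lambda>z. f (z + c)) = (\<lambda>z. Dw w f (z + c))"
    by (induction w) (auto simp: Dpartial_def add_ac)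
  then show ?thesis by simp
qed

lemma has_partial_translate: "has_partial b (\<lambda>z. f (z + c)) z \<longleftrightarrow> has_partial b f (z + c)"
  by (simp add: has_partial_def add_ac)

lemma gaussian_shift: "Dw w (gaussian s p) z = Dw w (gaussian s 0) (z - p)"
proof -
  have "gaussian s p = (\<lambda>z. gaussian s 0 (z + - p))" by (auto simp: gaussian_eq)
  then show ?thesis using Dw_shift[of w "gaussian s 0" "- p" z] by simp
qed

lemma Dw_bounded:
  fixes F :: "'z::euclidean_space \<Rightarrow> complex"
  assumes F: "Cinf_on UNIV F" and K: "compact K" "\<And>z. z \<notin> K \<Longrightarrow> F z = 0" and w: "set w \<subseteq> Basis"
  shows "\<exists>C\<ge>0. \<forall>z. norm (Dw w F z) \<le> C"
proof -
  obtain C where C: "C \<ge> 0" "\<And>z. norm (Dw w F z) \<le> C * prod_majorant z"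
    using compact_support_prod_majorant[OF Cinf_cont[OF F w] K(1)] Dw_outside[of K F] K by (auto simp: compact_imp_closed)
  have "norm (Dw w F z) \<le> C" for z
    using C(2)[of z] mult_left_mono[OF prod_majorant_le1 C(1), of z] by simp
  then show ?thesis using C(1) by blast
qed

lemma compact_support_integrable:
  fixes f :: "'z::euclidean_space \<Rightarrow> complex"
  assumes "continuous_on UNIV f" "compact K" "\<And>z. z \<notin> K \<Longrightarrow> f z = 0"
  shows "integrable lborel f"
proof -
  obtain C where C: "C \<ge> 0" "\<And>z. norm (f z) \<le> C * prod_majorant z" using compact_support_prod_majorant[OF assms] by auto
  show ?thesis by (rule prod_majorant_integrable_bound[OF borel_measurable_continuous_onI[OF assms(1)] C(2)])
qed

text \<open>The same convolution, differentiated once through F and once through the Gaussian. The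
  first form is compared with the derivative of F, the second is discretised by a Riemann
  sum.\<close>

lemma convolution_gaussian_deriv:
  fixes F :: "'z::euclidean_space \<Rightarrow> complex"
  assumes F: "Cinf_on UNIV F" and K: "compact K" "\<And>z. z \<notin> K \<Longrightarrow> F z = 0" and w: "set w \<subseteq> Basis" and s: "s > 0"
  shows "(LINT v|lborel. Dw w F (z + v) * gaussian s 0 v) = (LINT p|lborel. F p * Dw w (gaussian s p) z)"
proof -
  have Fc: "continuous_on UNIV F" using Cinf_cont[OF F, of "[]"] by simp
  have "(\<lambda>z. LINT v|lborel. F (z + v) * gaussian s 0 v) = (\<lambda>z. LINT p|lborel. F p * gaussian s p z)"
  proof
    fix z
    have "(LINT v|lborel. F (v + z) * gaussian s z (v + z)) = (LINT v|lborel. F v * gaussian s z v)"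
      by (rule lborel_integral_shift(1)) (intro borel_measurable_continuous_onI continuous_intros gaussian_cont Fc)
    then show "(LINT v|lborel. F (z + v) * gaussian s 0 v) = (LINT p|lborel. F p * gaussian s p z)"
      by (simp add: gaussian_eq add.commute norm_minus_commute)
  qed
  moreover have "Dw w (\<lambda>z. LINT v|lborel. Dw [] F (z + v) * gaussian s 0 v) z = (LINT v|lborel. Dw w F (z + v) * gaussian s 0 v)"
  proof (rule Cinf_integral(2)[where h = "\<lambda>w z v. Dw w F (z + v) * gaussian s 0 v", OF _ _ _ _ w])
    fix w :: "'z list" and z v assume w: "set w \<subseteq> Basis"
    have fc: "continuous_on A (\<lambda>z. Dw w F (g z))" if "continuous_on A g" for A and g :: "'z \<Rightarrow> 'z"
      by (rule continuous_on_compose2[OF Cinf_cont[OF F w] that]) simp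
    show "continuous_on UNIV (\<lambda>z. Dw w F (z + v) * gaussian s 0 v)" by (intro continuous_intros fc)
    show "(\<lambda>v. Dw w F (z + v) * gaussian s 0 v) \<in> borel_measurable lborel"
      by (simp, intro borel_measurable_continuous_onI continuous_intros fc gaussian_cont)
    show "has_partial b (\<lambda>z. Dw w F (z + v) * gaussian s 0 v) z \<and> Dpartial b (\<lambda>z. Dw w F (z + v) * gaussian s 0 v) z = Dw (b # w) F (z + v) * gaussian s 0 v"
      if "b \<in> Basis" for b
    proof -
      have "has_partial b (\<lambda>z. Dw w F (z + v)) z" using Cinf_partial[OF F w that] by (simp add: has_partial_translate)
      from Dpartial_cmult[OF this, of "gaussian s 0 v"] show ?thesis
        using Dw_shift[of "[b]" "Dw w F" v z] by (simp add: mult.commute)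
    qed
    obtain C where C: "C \<ge> 0" "\<And>z. norm (Dw w F z) \<le> C" using Dw_bounded[OF F K w] by blast
    have "integrable lborel (\<lambda>v::'z. C * norm (gaussian s 0 v))" by (intro integrable_mult_right integrable_norm gaussian_fourier(2) s)
    moreover have "norm (Dw w F (z + v) * gaussian s 0 v) \<le> C * norm (gaussian s 0 v)" for z v
      using C by (simp add: norm_mult mult_right_mono)
    ultimately show "\<exists>g. integrable lborel g \<and> (\<forall>z v. norm (Dw w F (z + v) * gaussian s 0 v) \<le> g v)" by blast
  qed
  moreover have "Dw w (\<lambda>z. LINT p|lborel. F p * Dw [] (gaussian s p) z) z = (LINT p|lborel. F p * Dw w (gaussian s p) z)"
  proof (rule Cinf_integral(2)[where h = "\<lambda>w z p. F p * Dw w (gaussian s p) z", OF _ _ _ _ w])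
    fix w :: "'z list" and z p assume w: "set w \<subseteq> Basis"
    show "continuous_on UNIV (\<lambda>z. F p * Dw w (gaussian s p) z)" using Cinf_cont[OF mod_gaussian_smooth w] by (intro continuous_intros)
    show "has_partial b (\<lambda>z. F p * Dw w (gaussian s p) z) z \<and> Dpartial b (\<lambda>z. F p * Dw w (gaussian s p) z) z = F p * Dw (b # w) (gaussian s p) z"
      if "b \<in> Basis" for b
      using Dpartial_cmult[OF Cinf_partial[OF mod_gaussian_smooth w that UNIV_I]] by simp
    have "continuous_on UNIV (\<lambda>p. Dw w (gaussian s 0) (z - p))"
      by (rule continuous_on_compose2[OF Cinf_cont[OF mod_gaussian_smooth w]]) (auto intro!: continuous_intros)
    then show "(\<lambda>p. F p * Dw w (gaussian s p) z) \<in> borel_measurable lborel"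
      unfolding gaussian_shift[of w s _ z] by (simp, intro borel_measurable_continuous_onI continuous_intros Fc)
    define E where "E = (\<lambda>p::'z. exp ((s / 2 + norm (0::'z)) * DIM('z) + 1 / s + norm p) * fact (length w))"
    have "continuous_on UNIV (\<lambda>p. F p * complex_of_real (E p))" unfolding E_def by (intro continuous_intros Fc)
    from compact_support_integrable[OF this K(1)] have "integrable lborel (\<lambda>p. norm (F p * complex_of_real (E p)))"
      using K(2) by (intro integrable_norm) simp
    moreover have "norm (F p * Dw w (gaussian s p) z) \<le> norm (F p * complex_of_real (E p))" for z p
    proof -
      have "norm (Dw w (gaussian s p) z) \<le> E p * exp (- norm z)" unfolding E_def by (rule mod_gaussian_exp_bound[OF s w])
      also have "\<dots> \<le> E p * 1" by (intro mult_left_mono) (auto simp: E_def)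
      finally have "norm (Dw w (gaussian s p) z) \<le> \<bar>E p\<bar>" by simp
      then show ?thesis by (simp add: norm_mult mult_left_mono)
    qed
    ultimately show "\<exists>g. integrable lborel g \<and> (\<forall>z p. norm (F p * Dw w (gaussian s p) z) \<le> g p)" by blast
  qed
  ultimately show ?thesis by simp
qed

text \<open>With x = sqrt s |v| the factor |v| e^{|v|} is absorbed by doubling the variance, and the
  factor |v| leaves a gain 1 / sqrt s.\<close>

lemma gaussian_moment_bound:
  fixes v :: "'z::euclidean_space"
  assumes s: "s \<ge> 1" shows "norm v * exp (norm v) * norm (gaussian s 0 v) \<le> (2 * exp 2 / sqrt s) * norm (gaussian (s / 2) 0 v)"
proof -
  define x where "x = sqrt s * norm v"
  have s0: "sqrt s \<ge> 1" "sqrt s > 0" using s by auto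
  have x2: "x\<^sup>2 = s * (norm v)\<^sup>2" using s by (simp add: x_def power_mult_distrib)
  \<comment> \<open>This square yields x \<le> 2 + x^2/8, used for both factors. The exponents add
    up to 1/16 + 1/8 - 1/2 = -5/16, below the required -1/4.\<close>
  have "0 \<le> (x - 4)\<^sup>2" by simp
  then have q: "x \<le> 2 + x\<^sup>2 / 8" by (simp add: power2_eq_square algebra_simps)
  have "1 + x\<^sup>2 / 16 \<le> exp (x\<^sup>2 / 16)" by (rule exp_ge_add_one_self)
  then have a: "x \<le> 2 * exp (x\<^sup>2 / 16)" using q by linarith
  have "norm v \<le> x" using s0 mult_right_mono[of 1 "sqrt s" "norm v"] by (simp add: x_def)
  then have b: "exp (norm v) \<le> exp (2 + x\<^sup>2 / 8)" using q by simp
  have "norm v = x / sqrt s" using s0 by (simp add: x_def)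
  then have "norm v * exp (norm v) * norm (gaussian s 0 v) = (x * exp (norm v)) * exp (- (x\<^sup>2 / 2)) / sqrt s"
    by (simp add: gaussian_eq x2)
  also have "\<dots> \<le> ((2 * exp (x\<^sup>2 / 16)) * exp (2 + x\<^sup>2 / 8)) * exp (- (x\<^sup>2 / 2)) / sqrt s"
    using a b s0 by (intro divide_right_mono mult_right_mono mult_mono) auto
  also have "\<dots> = (2 * exp 2 / sqrt s) * exp (- (5 / 16) * x\<^sup>2)"
  proof -
    have "exp (x\<^sup>2 / 16) * exp (2 + x\<^sup>2 / 8) * exp (- (x\<^sup>2 / 2)) = exp 2 * exp (- (5 / 16) * x\<^sup>2)"
      unfolding mult_exp_exp by (rule arg_cong[where f = exp]) simp
    then show ?thesis by (simp add: mult.assoc)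
  qed
  also have "\<dots> \<le> (2 * exp 2 / sqrt s) * exp (- (1 / 4) * x\<^sup>2)"
    using s0 by (intro mult_left_mono) auto
  also have "exp (- (1 / 4) * x\<^sup>2) = norm (gaussian (s / 2) 0 v)" by (simp add: gaussian_eq x2)
  finally show ?thesis .
qed

lemma gaussian_norm_integral:
  assumes "s > 0" shows "(LINT v|lborel. norm (gaussian s 0 (v::'z::euclidean_space))) = sqrt (2 * pi / s) ^ DIM('z)"
proof -
  have "complex_of_real (LINT v|lborel. norm (gaussian s 0 (v::'z))) = (LINT v|lborel. complex_of_real (norm (gaussian s 0 (v::'z))))"
    by (rule integral_complex_of_real[symmetric])
  also have "\<dots> = (LINT v|lborel. gaussian s 0 (v::'z))" by (simp add: gaussian_eq)
  also have "\<dots> = complex_of_real (sqrt (2 * pi / s) ^ DIM('z))" by (rule gaussian_fourier(3)[OF assms])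
  finally show ?thesis by (simp only: of_real_eq_iff)
qed

text \<open>The mean value inequality gives |v|, and the decay in z is inserted by hand. Either |z|
  \<le> R + |v| and e^{R - |z| + |v|} \<ge> 1, or z and z + v both lie outside K and the difference
  is 0. The subtracted factor is the mass of the Gaussian.\<close>

lemma mollify_error:
  fixes F :: "'z::euclidean_space \<Rightarrow> complex"
  assumes F: "Cinf_on UNIV F" and K: "compact K" "\<And>z. z \<notin> K \<Longrightarrow> F z = 0" and R: "\<And>z. z \<in> K \<Longrightarrow> norm z \<le> R"
    and w: "set w \<subseteq> Basis" and M: "\<And>b z. b \<in> Basis \<Longrightarrow> norm (Dw (b # w) F z) \<le> M" and s: "s \<ge> 1"
  shows "norm ((LINT v|lborel. Dw w F (z + v) * gaussian s 0 v) - complex_of_real (sqrt (2 * pi / s) ^ DIM('z)) * Dw w F z)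
    \<le> sqrt (2 * pi / s) ^ DIM('z) * (DIM('z) * exp R * (2 * exp 2) * sqrt 2 ^ DIM('z)) * M / sqrt s * exp (- norm z)"
proof -
  have s0: "s > 0" using s by simp
  obtain b0 :: 'z where "b0 \<in> Basis" using nonempty_Basis by blast
  then have M0: "M \<ge> 0" using order.trans[OF norm_ge_zero M] by blast
  have fc: "continuous_on UNIV (\<lambda>v. Dw w F (z + v))"
    by (rule continuous_on_compose2[OF Cinf_cont[OF F w]]) (auto intro!: continuous_intros)
  obtain C where C: "C \<ge> 0" "\<And>z. norm (Dw w F z) \<le> C" using Dw_bounded[OF F K w] by blast
  have gi: "integrable lborel (gaussian s (0::'z))" by (rule gaussian_fourier(2)[OF s0])
  have i1: "integrable lborel (\<lambda>v. Dw w F (z + v) * gaussian s 0 v)"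
  proof (rule Bochner_Integration.integrable_bound[OF integrable_mult_right[OF integrable_norm[OF gi], of C]])
    show "(\<lambda>v. Dw w F (z + v) * gaussian s 0 v) \<in> borel_measurable lborel"
      using fc by (simp, intro borel_measurable_continuous_onI continuous_intros gaussian_cont)
  qed (use C in \<open>simp add: norm_mult mult_right_mono\<close>)
  define A where "A = DIM('z) * M * exp R * exp (- norm z)"
  have A0: "A \<ge> 0" using M0 by (simp add: A_def)
  have "(LINT v|lborel. Dw w F (z + v) * gaussian s 0 v) - complex_of_real (sqrt (2 * pi / s) ^ DIM('z)) * Dw w F z =
    (LINT v|lborel. Dw w F (z + v) * gaussian s 0 v) - (LINT v|lborel. Dw w F z * gaussian s 0 (v::'z))"
    using gaussian_fourier(3)[where 'a = 'z, OF s0] by simp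
  also have "\<dots> = (LINT v|lborel. Dw w F (z + v) * gaussian s 0 v - Dw w F z * gaussian s 0 v)"
    by (rule Bochner_Integration.integral_diff[symmetric, OF i1 integrable_mult_right[OF gi]])
  also have "norm \<dots> \<le> (LINT v|lborel. A * ((2 * exp 2 / sqrt s) * norm (gaussian (s / 2) 0 (v::'z))))"
  proof (rule integral_norm_le)
    show "integrable lborel (\<lambda>v::'z. A * ((2 * exp 2 / sqrt s) * norm (gaussian (s / 2) 0 v)))"
      using s0 by (intro integrable_mult_right integrable_norm gaussian_fourier(2)) simp
    fix v
    have d: "norm (Dw w F (z + v) - Dw w F z) \<le> A * (norm v * exp (norm v))"
    proof (cases "norm z \<le> R + norm v")
      case True
      have "norm (Dw w F (z + v) - Dw w F z) \<le> DIM('z) * (M * norm v)"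
        by (rule Cinf_lipschitz) (use Cinf_partial[OF F w] M in auto)
      also have "\<dots> \<le> DIM('z) * (M * norm v) * (exp R * exp (- norm z) * exp (norm v))"
        using True M0 mult_left_mono[of 1 "exp R * exp (- norm z) * exp (norm v)" "DIM('z) * (M * norm v)"] by (simp add: mult_exp_exp)
      finally show ?thesis by (simp add: A_def mult_ac)
    next
      case False
      have "norm z \<le> norm (z + v) + norm v" using norm_triangle_ineq4[of "z + v" v] by simp
      then have "z \<notin> K" "z + v \<notin> K" using False R[of z] R[of "z + v"] norm_ge_zero[of v] by linarith+
      then have "Dw w F (z + v) = 0" "Dw w F z = 0" using Dw_outside[of K F] K by (auto simp: compact_imp_closed)
      then show ?thesis using A0 by simp
    qed
    have "norm (Dw w F (z + v) * gaussian s 0 v - Dw w F z * gaussian s 0 v) = norm (Dw w F (z + v) - Dw w F z) * norm (gaussian s 0 v)"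
      by (simp only: norm_mult[symmetric] left_diff_distrib)
    also have "\<dots> \<le> A * (norm v * exp (norm v)) * norm (gaussian s 0 v)" using d by (rule mult_right_mono) simp
    also have "\<dots> \<le> A * ((2 * exp 2 / sqrt s) * norm (gaussian (s / 2) 0 v))"
      using mult_left_mono[OF gaussian_moment_bound[OF s, of v] A0] by (simp add: mult.assoc)
    finally show "norm (Dw w F (z + v) * gaussian s 0 v - Dw w F z * gaussian s 0 v) \<le> A * ((2 * exp 2 / sqrt s) * norm (gaussian (s / 2) 0 v))" .
  qed
  also have "\<dots> = A * ((2 * exp 2 / sqrt s) * sqrt (2 * pi / (s / 2)) ^ DIM('z))"
    using gaussian_norm_integral[where 'z = 'z, of "s / 2"] s0 by simp
  also have "sqrt (2 * pi / (s / 2)) = sqrt 2 * sqrt (2 * pi / s)" by (simp add: real_sqrt_mult[symmetric])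
  also have "A * ((2 * exp 2 / sqrt s) * (sqrt 2 * sqrt (2 * pi / s)) ^ DIM('z)) =
     sqrt (2 * pi / s) ^ DIM('z) * (DIM('z) * exp R * (2 * exp 2) * sqrt 2 ^ DIM('z)) * M / sqrt s * exp (- norm z)"
    unfolding A_def power_mult_distrib by (simp add: mult_ac)
  finally show ?thesis .
qed

section \<open>Discretisation of the mollified function\<close>

definition grid :: "real \<Rightarrow> 'z::euclidean_space \<Rightarrow> 'z"
  where "grid \<eta> p = (\<Sum>b\<in>Basis. (\<eta> * of_int \<lfloor>(p \<bullet> b) / \<eta>\<rfloor>) *\<^sub>R b)"

lemma grid_dist:
  fixes p :: "'z::euclidean_space" and \<eta> :: real
  assumes "\<eta> > 0" shows "norm (p - grid \<eta> p) \<le> DIM('z) * \<eta>"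
proof -
  have "norm (p - grid \<eta> p) \<le> (\<Sum>b\<in>Basis. \<bar>(p - grid \<eta> p) \<bullet> b\<bar>)" by (rule norm_le_l1)
  also have "\<dots> \<le> (\<Sum>b\<in>(Basis::'z set). \<eta>)"
  proof (rule sum_mono)
    fix b :: 'z assume b: "b \<in> Basis"
    have "(p - grid \<eta> p) \<bullet> b = \<eta> * ((p \<bullet> b) / \<eta> - of_int \<lfloor>(p \<bullet> b) / \<eta>\<rfloor>)"
      using assms b by (simp add: grid_def inner_diff_left right_diff_distrib)
    also have "\<bar>\<dots>\<bar> \<le> \<eta> * 1" unfolding abs_mult
      using assms floor_correct[of "(p \<bullet> b) / \<eta>"] by (intro mult_mono) (auto simp: abs_le_iff, linarith)
    finally show "\<bar>(p - grid \<eta> p) \<bullet> b\<bar> \<le> \<eta>" by simp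
  qed
  finally show ?thesis by simp
qed

lemma grid_finite:
  fixes K :: "'z::euclidean_space set" and \<eta> :: real
  assumes "\<eta> > 0" and K: "\<And>p. p \<in> K \<Longrightarrow> norm p \<le> R" shows "finite (grid \<eta> ` K)"
proof -
  define m where "m = \<lceil>R / \<eta>\<rceil> + 1"
  define T where "T = (\<lambda>k::'z \<Rightarrow> int. \<Sum>b\<in>Basis. (\<eta> * of_int (k b)) *\<^sub>R b)"
  have "grid \<eta> p \<in> T ` (PiE Basis (\<lambda>_. {- m..m}))" if p: "p \<in> K" for p
  proof
    let ?k = "restrict (\<lambda>b. \<lfloor>(p \<bullet> b) / \<eta>\<rfloor>) Basis"
    show "grid \<eta> p = T ?k" unfolding grid_def T_def by (rule sum.cong) auto
    show "?k \<in> PiE Basis (\<lambda>_. {- m..m})"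
    proof (rule restrict_PiE_iff[THEN iffD2], intro ballI)
      fix b :: 'z assume b: "b \<in> Basis"
      have "\<bar>p \<bullet> b\<bar> \<le> R" using Cauchy_Schwarz_ineq2[of p b] b K[OF p] by simp
      then have "p \<bullet> b \<le> R" "- R \<le> p \<bullet> b" by linarith+
      then have "(p \<bullet> b) / \<eta> \<le> R / \<eta>" "(- R) / \<eta> \<le> (p \<bullet> b) / \<eta>" using assms(1) by (intro divide_right_mono; simp)+
      then have "real_of_int (- m) \<le> of_int \<lfloor>(p \<bullet> b) / \<eta>\<rfloor>" "real_of_int \<lfloor>(p \<bullet> b) / \<eta>\<rfloor> \<le> of_int m"
        using floor_correct[of "(p \<bullet> b) / \<eta>"] le_of_int_ceiling[of "R / \<eta>"] by (simp_all add: m_def) linarith+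
      then show "\<lfloor>(p \<bullet> b) / \<eta>\<rfloor> \<in> {- m..m}" by (simp only: of_int_le_iff atLeastAtMost_iff)
    qed
  qed
  then have "grid \<eta> ` K \<subseteq> T ` (PiE Basis (\<lambda>_. {- m..m}))" by auto
  then show ?thesis by (rule finite_subset) (intro finite_imageI finite_PiE finite_Basis finite_atLeastAtMost_int)
qed

lemma grid_measurable: "grid \<eta> \<in> borel_measurable borel"
  unfolding grid_def by measurable

definition gauss_comb :: "('z::euclidean_space \<Rightarrow> complex) \<Rightarrow> bool" where
  "gauss_comb f \<longleftrightarrow> (\<exists>s>0. \<exists>W c. finite W \<and> f = (\<lambda>z. \<Sum>q\<in>W. c q * gaussian s q z))"

text \<open>The coefficient of a grid point is the integral of F over its cell, so the sum is the
  convolution with p replaced by \<open>grid \<eta> p\<close>. The error is an increment of a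
  derivative of the Gaussian over a distance at most DIM times \<eta>. One choice of points and
  coefficients serves all words.\<close>

lemma riemann_error:
  fixes F :: "'z::euclidean_space \<Rightarrow> complex" and \<eta> :: real
  assumes Fc: "continuous_on UNIV F" and K: "compact K" "\<And>z. z \<notin> K \<Longrightarrow> F z = 0" and R: "\<And>z. z \<in> K \<Longrightarrow> norm z \<le> R"
    and s: "s > 0" and eta: "\<eta> > 0" "DIM('z) * \<eta> \<le> 1"
  shows "\<exists>W c. finite W \<and> (\<forall>w z. set w \<subseteq> Basis \<longrightarrow>
    norm ((\<Sum>q\<in>W. c q * Dw w (gaussian s q) z) - (LINT p|lborel. F p * Dw w (gaussian s p) z))
     \<le> (LINT p|lborel. norm (F p)) * (DIM('z) * (exp (s / 2 * DIM('z) + 1 / s) * exp (R + 1) * (DIM('z) * \<eta>))) * fact (Suc (length w)) * exp (- norm z))"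
proof -
  define W where "W = grid \<eta> ` K"
  define c where "c = (\<lambda>q. LINT p|lborel. F p * indicator {p. grid \<eta> p = q} p)"
  have W: "finite W" unfolding W_def by (rule grid_finite[OF eta(1) R])
  have Fi: "integrable lborel F" by (rule compact_support_integrable[OF Fc K])
  have cell: "{p. grid \<eta> p = q} \<in> sets borel" for q :: 'z
    using measurable_sets[OF grid_measurable, of "{q}" \<eta>] by (simp add: vimage_def)
  have ci: "integrable lborel (\<lambda>p. F p * indicator {p. grid \<eta> p = q} p)" for q
  proof -
    have "integrable lborel (\<lambda>p. indicator {p. grid \<eta> p = q} p *\<^sub>R F p)"
      by (rule integrable_mult_indicator) (use cell Fi in auto)
    then show ?thesis by (simp add: scaleR_conv_of_real of_real_indicator mult.commute)
  qed
  have "norm ((\<Sum>q\<in>W. c q * Dw w (gaussian s q) z) - (LINT p|lborel. F p * Dw w (gaussian s p) z))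
     \<le> (LINT p|lborel. norm (F p)) * (DIM('z) * (exp (s / 2 * DIM('z) + 1 / s) * exp (R + 1) * (DIM('z) * \<eta>))) * fact (Suc (length w)) * exp (- norm z)"
    if w: "set w \<subseteq> Basis" for w z
  proof -
    define g where "g = Dw w (gaussian s (0::'z))"
    have gs: "Dw w (gaussian s q) z = g (z - q)" for q unfolding g_def by (rule gaussian_shift)
    have gc: "continuous_on UNIV g" unfolding g_def by (rule Cinf_cont[OF mod_gaussian_smooth w])
    \<comment> \<open>The cells are disjoint, so the sum over q keeps only the grid point of
      p.\<close>
    have pw: "(\<Sum>q\<in>W. F p * indicator {p. grid \<eta> p = q} p * g (z - q)) = F p * g (z - grid \<eta> p)" for p
    proof (cases "p \<in> K")
      case True
      then have "grid \<eta> p \<in> W" by (simp add: W_def)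
      have "(\<Sum>q\<in>W. F p * indicator {p. grid \<eta> p = q} p * g (z - q)) = (\<Sum>q\<in>W. if grid \<eta> p = q then F p * g (z - q) else 0)"
        by (rule sum.cong) (auto simp: indicator_def)
      also have "\<dots> = F p * g (z - grid \<eta> p)" using W \<open>grid \<eta> p \<in> W\<close> by simp
      finally show ?thesis .
    qed (simp add: K(2))
    have i1: "integrable lborel (\<lambda>p. F p * g (z - grid \<eta> p))"
      unfolding pw[symmetric] by (intro Bochner_Integration.integrable_sum integrable_mult_left ci)
    have i2: "integrable lborel (\<lambda>p. F p * g (z - p))"
    proof (rule compact_support_integrable[OF _ K(1)])
      have "continuous_on UNIV (\<lambda>p. g (z - p))" by (rule continuous_on_compose2[OF gc]) (auto intro!: continuous_intros)
      then show "continuous_on UNIV (\<lambda>p. F p * g (z - p))" using Fc by (intro continuous_intros)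
    qed (simp add: K(2))
    have "(\<Sum>q\<in>W. c q * g (z - q)) = (\<Sum>q\<in>W. (LINT p|lborel. F p * indicator {p. grid \<eta> p = q} p * g (z - q)))"
      unfolding c_def by (simp only: integral_mult_left_zero)
    also have "\<dots> = (LINT p|lborel. (\<Sum>q\<in>W. F p * indicator {p. grid \<eta> p = q} p * g (z - q)))"
      by (rule Bochner_Integration.integral_sum[symmetric]) (intro integrable_mult_left ci)
    finally have "(\<Sum>q\<in>W. c q * g (z - q)) - (LINT p|lborel. F p * g (z - p)) = (LINT p|lborel. F p * g (z - grid \<eta> p) - F p * g (z - p))"
      unfolding pw using Bochner_Integration.integral_diff[OF i1 i2] by simp
    moreover have "norm (LINT p|lborel. F p * g (z - grid \<eta> p) - F p * g (z - p)) \<le>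
      (LINT p|lborel. norm (F p) * (DIM('z) * (exp (s / 2 * DIM('z) + 1 / s) * fact (Suc (length w)) * exp (R + 1) * exp (- norm z) * (DIM('z) * \<eta>))))"
    proof (rule integral_norm_le)
      show "integrable lborel (\<lambda>p. norm (F p) * (DIM('z) * (exp (s / 2 * DIM('z) + 1 / s) * fact (Suc (length w)) * exp (R + 1) * exp (- norm z) * (DIM('z) * \<eta>))))"
        by (intro integrable_mult_left integrable_norm Fi)
      fix p
      show "norm (F p * g (z - grid \<eta> p) - F p * g (z - p)) \<le> norm (F p) * (DIM('z) * (exp (s / 2 * DIM('z) + 1 / s) * fact (Suc (length w)) * exp (R + 1) * exp (- norm z) * (DIM('z) * \<eta>)))"
      proof (cases "p \<in> K")
        case True
        define h where "h = p - grid \<eta> p"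
        have h: "norm h \<le> DIM('z) * \<eta>" unfolding h_def by (rule grid_dist[OF eta(1)])
        define M where "M = exp (s / 2 * DIM('z) + 1 / s) * fact (Suc (length w)) * exp (R + 1) * exp (- norm z)"
        have "norm (g ((z - p) + h) - g (z - p)) \<le> DIM('z) * (M * norm h)"
        proof (rule Cinf_lipschitz)
          show "has_partial b g y" if "b \<in> Basis" for b y unfolding g_def using Cinf_partial[OF mod_gaussian_smooth w that] by simp
          fix b y :: 'z assume b: "b \<in> Basis" and y: "norm (y - (z - p)) \<le> norm h"
          have "norm (Dpartial b g y) \<le> exp (s / 2 * DIM('z) + 1 / s) * fact (Suc (length w)) * exp (- norm y)"
            unfolding g_def using mod_gaussian_exp_bound[OF s, of "b # w" 0 0 y] b w by simp
          also have "\<dots> \<le> exp (s / 2 * DIM('z) + 1 / s) * fact (Suc (length w)) * (exp (R + 1) * exp (- norm z))"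
          proof (rule mult_left_mono)
            have "norm z \<le> norm y + norm (z - y)" by (rule norm_triangle_sub)
            moreover have "norm (z - y) \<le> norm (y - (z - p)) + norm p"
              using norm_triangle_ineq[of "(z - p) - y" p] by (simp add: norm_minus_commute)
            ultimately have "- norm y \<le> R + 1 + - norm z" using y h eta(2) R[OF True] by linarith
            then show "exp (- norm y) \<le> exp (R + 1) * exp (- norm z)" unfolding mult_exp_exp by simp
          qed simp
          finally show "norm (Dpartial b g y) \<le> M" by (simp add: M_def mult_ac)
        qed
        also have "\<dots> \<le> DIM('z) * (M * (DIM('z) * \<eta>))" using h by (intro mult_left_mono) (auto simp: M_def)
        finally have "norm (g (z - grid \<eta> p) - g (z - p)) \<le> DIM('z) * (M * (DIM('z) * \<eta>))" by (simp add: h_def)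
        then have "norm (F p) * norm (g (z - grid \<eta> p) - g (z - p)) \<le> norm (F p) * (DIM('z) * (M * (DIM('z) * \<eta>)))"
          by (rule mult_left_mono) simp
        then show ?thesis unfolding M_def by (simp only: norm_mult[symmetric] right_diff_distrib)
      qed (simp add: K(2))
    qed
    ultimately show ?thesis unfolding gs by (simp add: mult_ac)
  qed
  then show ?thesis using W by (intro exI[of _ W] exI[of _ c]) blast
qed

text \<open>Two scales in succession: s = (i+1)^2 makes the mollification error of order 1/(i+1),
  and \<eta> is then chosen in terms of s to make the Riemann error equally small. Division by N
  normalises the mass of the Gaussian.\<close>

lemma gauss_approx_step:
  fixes F :: "'z::euclidean_space \<Rightarrow> complex"
  assumes F: "Cinf_on UNIV F" and K: "compact K" "\<And>z. z \<notin> K \<Longrightarrow> F z = 0" and R: "\<And>z. z \<in> K \<Longrightarrow> norm z \<le> R"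
  shows "\<exists>S. gauss_comb S \<and> (\<forall>w M z. set w \<subseteq> Basis \<longrightarrow> (\<forall>b\<in>Basis. \<forall>z. norm (Dw (b # w) F z) \<le> M) \<longrightarrow>
    norm (Dw w S z - Dw w F z) \<le> (fact (Suc (length w)) + DIM('z) * exp R * (2 * exp 2) * sqrt 2 ^ DIM('z) * M) / Suc i * exp (- norm z))"
proof -
  define s where "s = (real (Suc i))\<^sup>2"
  have s: "s \<ge> 1" "s > 0" "sqrt s = real (Suc i)" by (auto simp: s_def simp del: of_nat_Suc)
  define N where "N = sqrt (2 * pi / s) ^ DIM('z)"
  have N: "N > 0" using s(2) by (simp add: N_def)
  have Fc: "continuous_on UNIV F" using Cinf_cont[OF F, of "[]"] by simp
  define L where "L = (LINT p|lborel. norm (F p)) * (DIM('z) * (exp (s / 2 * DIM('z) + 1 / s) * exp (R + 1) * DIM('z)))"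
  have L: "L \<ge> 0" unfolding L_def by (intro mult_nonneg_nonneg Bochner_Integration.integral_nonneg) auto
  define \<eta> where "\<eta> = min (1 / DIM('z)) (N / ((L + 1) * Suc i))"
  have eta: "\<eta> > 0" "DIM('z) * \<eta> \<le> 1" "L * \<eta> \<le> N / Suc i"
  proof -
    show "\<eta> > 0" using N L by (simp add: \<eta>_def)
    have "DIM('z) * \<eta> \<le> DIM('z) * (1 / DIM('z))" unfolding \<eta>_def by (intro mult_left_mono) auto
    then show "DIM('z) * \<eta> \<le> 1" by simp
    have "L * \<eta> \<le> (L + 1) * (N / ((L + 1) * Suc i))" using L N unfolding \<eta>_def by (intro mult_mono) auto
    also have "\<dots> = N / Suc i" using L by (simp del: of_nat_Suc)
    finally show "L * \<eta> \<le> N / Suc i" .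
  qed
  obtain W c where W: "finite W" and e: "\<And>w z. set w \<subseteq> Basis \<Longrightarrow>
    norm ((\<Sum>q\<in>W. c q * Dw w (gaussian s q) z) - (LINT p|lborel. F p * Dw w (gaussian s p) z))
     \<le> (LINT p|lborel. norm (F p)) * (DIM('z) * (exp (s / 2 * DIM('z) + 1 / s) * exp (R + 1) * (DIM('z) * \<eta>))) * fact (Suc (length w)) * exp (- norm z)"
    using riemann_error[OF Fc K R s(2) eta(1,2)] by blast
  define S where "S = (\<lambda>z. \<Sum>q\<in>W. (c q / complex_of_real N) * gaussian s q z)"
  have "gauss_comb S" unfolding gauss_comb_def S_def
    by (intro exI[of _ s] conjI exI[of _ W] exI[of _ "\<lambda>q. c q / complex_of_real N"] s(2) W refl)
  moreover have "norm (Dw w S z - Dw w F z) \<le> (fact (Suc (length w)) + DIM('z) * exp R * (2 * exp 2) * sqrt 2 ^ DIM('z) * M) / Suc i * exp (- norm z)"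
    if w: "set w \<subseteq> Basis" and M: "\<forall>b\<in>Basis. \<forall>z. norm (Dw (b # w) F z) \<le> M" for w M z
  proof -
    define A where "A = DIM('z) * exp R * (2 * exp 2) * sqrt 2 ^ DIM('z)"
    define I where "I = (LINT p|lborel. F p * Dw w (gaussian s p) z)"
    define D where "D = (\<Sum>q\<in>W. c q * Dw w (gaussian s q) z)"
    have "Dw w S z = (\<Sum>q\<in>W. Dw w (\<lambda>z. (c q / complex_of_real N) * gaussian s q z) z)"
      unfolding S_def by (rule Cinf_sum(2)[OF Cinf_cmult(1)[OF mod_gaussian_smooth] w])
    also have "\<dots> = (\<Sum>q\<in>W. (c q / complex_of_real N) * Dw w (gaussian s q) z)"
      by (intro sum.cong refl Cinf_cmult(2)[OF mod_gaussian_smooth w])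
    also have "\<dots> = D / complex_of_real N" by (simp add: D_def sum_divide_distrib)
    finally have DS: "Dw w S z = D / complex_of_real N" .
    have a: "norm (D - I) \<le> N / Suc i * fact (Suc (length w)) * exp (- norm z)"
    proof -
      have "norm (D - I) \<le> (L * \<eta>) * fact (Suc (length w)) * exp (- norm z)"
        using e[OF w, of z] unfolding D_def I_def L_def by (simp only: mult_ac)
      also have "\<dots> \<le> N / Suc i * fact (Suc (length w)) * exp (- norm z)" by (intro mult_right_mono eta(3)) auto
      finally show ?thesis .
    qed
    have b: "norm (I - complex_of_real N * Dw w F z) \<le> N * A * M / Suc i * exp (- norm z)"
    proof -
      have "(LINT v|lborel. Dw w F (z + v) * gaussian s 0 v) = I"
        unfolding I_def by (rule convolution_gaussian_deriv[OF F K(1) _ w s(2)]) (rule K(2))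
      moreover have "norm ((LINT v|lborel. Dw w F (z + v) * gaussian s 0 v) - complex_of_real N * Dw w F z) \<le> N * A * M / sqrt s * exp (- norm z)"
        unfolding N_def A_def by (rule mollify_error[OF F K(1) _ _ w _ s(1)]) (use K(2) R M in auto)
      ultimately show ?thesis unfolding s(3) by simp
    qed
    have "Dw w S z - Dw w F z = ((D - I) + (I - complex_of_real N * Dw w F z)) / complex_of_real N"
      unfolding DS using N by (simp add: divide_simps)
    then have "norm (Dw w S z - Dw w F z) = norm ((D - I) + (I - complex_of_real N * Dw w F z)) / N"
      using N by (simp only: norm_divide norm_of_real abs_of_pos)
    also have "\<dots> \<le> (N / Suc i * fact (Suc (length w)) * exp (- norm z) + N * A * M / Suc i * exp (- norm z)) / N"
      using norm_triangle_ineq[of "D - I" "I - complex_of_real N * Dw w F z"] a b N by (intro divide_right_mono) auto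
    also have "\<dots> = (fact (Suc (length w)) + A * M) / Suc i * exp (- norm z)"
      using N by (simp add: field_simps del: of_nat_Suc fact_Suc)
    finally show ?thesis by (simp only: A_def)
  qed
  ultimately show ?thesis by blast
qed

section \<open>Approximation in all seminorms at once\<close>

context weight
begin

lemma gauss_comb_rapid: assumes "gauss_comb (f :: 'z::euclidean_space \<Rightarrow> complex)" shows "rapid f"
proof -
  obtain s W c where s: "s > 0" and W: "finite W" and f: "f = (\<lambda>z. \<Sum>q\<in>W. c q * gaussian s q z)"
    using assms unfolding gauss_comb_def by blast
  show ?thesis unfolding f using W
  proof (induction W rule: finite_induct)
    case empty
    have "rapid (\<lambda>z. 0 * gaussian s (0::'z) z)" by (intro rapid_cmult rapid_gaussian s)
    then show ?case by simp
  next
    case (insert q W)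
    have "rapid (\<lambda>z. c q * gaussian s q z + (\<Sum>q\<in>W. c q * gaussian s q z))" by (intro rapid_add rapid_cmult rapid_gaussian s insert.IH)
    then show ?case using insert(1,2) by simp
  qed
qed

text \<open>The errors involve one derivative more than is being estimated. Starting from the index
  2\<mu>, \<open>young_exp_split\<close> returns it at the price of the constant P. The sequence is
  fixed before \<mu>, as convergence in the topology demands.\<close>

lemma gauss_dense:
  fixes F :: "'z::euclidean_space \<Rightarrow> complex"
  assumes F: "F \<in> S_space \<omega>" and K: "compact K" "\<And>z. z \<notin> K \<Longrightarrow> F z = 0"
  shows "\<exists>S. (\<forall>i. gauss_comb (S i)) \<and> (\<forall>\<mu>>0. \<exists>C\<ge>0. \<forall>i. sbound \<mu> (C / Suc i) (\<lambda>z. S i z - F z))"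
proof -
  have sm: "Cinf_on UNIV F" using F by (auto simp: S_space_def)
  obtain R where R: "R \<ge> 0" "\<And>z. z \<in> K \<Longrightarrow> norm z \<le> R"
    using compact_imp_bounded[OF K(1)] unfolding bounded_iff by (metis abs_ge_self abs_ge_zero order.trans)
  define A where "A = DIM('z) * exp R * (2 * exp 2) * sqrt 2 ^ DIM('z)"
  have A: "A \<ge> 0" by (simp add: A_def)
  have "\<exists>S. \<forall>i. gauss_comb (S i) \<and> (\<forall>w M z. set w \<subseteq> Basis \<longrightarrow> (\<forall>b\<in>Basis. \<forall>z. norm (Dw (b # w) F z) \<le> M) \<longrightarrow>
    norm (Dw w (S i) z - Dw w F z) \<le> (fact (Suc (length w)) + A * M) / Suc i * exp (- norm z))"
    using gauss_approx_step[OF sm K R(2)] unfolding A_def by (intro choice) blast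
  then obtain S where S: "\<And>i. gauss_comb (S i)" and e: "\<And>i w M z. set w \<subseteq> Basis \<Longrightarrow> (\<forall>b\<in>Basis. \<forall>z. norm (Dw (b # w) F z) \<le> M) \<Longrightarrow>
    norm (Dw w (S i) z - Dw w F z) \<le> (fact (Suc (length w)) + A * M) / Suc i * exp (- norm z)" by blast
  have Ssm: "Cinf_on UNIV (S i)" for i
    using gauss_comb_rapid[OF S[of i]] unfolding rapid_def sbound_def by (meson zero_less_one)
  have "\<exists>C\<ge>0. \<forall>i. sbound \<mu> (C / Suc i) (\<lambda>z. S i z - F z)" if mu: "\<mu> > 0" for \<mu>
  proof -
    have mu2: "2 * \<mu> > 0" using mu by simp
    obtain Q where Q: "sbound (2 * \<mu>) Q F" using test_function_sbound[OF F K mu2] by blast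
    have Q0: "Q \<ge> 0" by (rule sbound_nonneg[OF Q])
    obtain D where D: "D \<ge> 1" "\<And>k::nat. fact k \<le> D * young_exp (2 * \<mu>) (real k)" using young_exp_fact[OF mu2] by blast
    obtain E where E: "E \<ge> 1" "\<And>z::'z. exp (- norm z) \<le> E * exp (- \<mu> * \<omega> (norm z))" using exp_norm_weight[OF mu] by blast
    define P where "P = young_exp \<mu> 1"
    have P: "young_exp (2 * \<mu>) (real (Suc k)) \<le> P * young_exp \<mu> (real k)" for k
      using young_exp_split[OF mu2, of 1 "real k"] by (simp add: P_def)
    define C where "C = (D * P + A * (Q * P)) * E"
    have C: "C \<ge> 0" using A Q0 D(1) E(1) by (simp add: C_def P_def)
    have "sbound \<mu> (C / Suc i) (\<lambda>z. S i z - F z)" for i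
      unfolding sbound_def
    proof (intro conjI allI impI)
      show "Cinf_on UNIV (\<lambda>z. S i z - F z)" by (rule Cinf_minus(1)[OF Ssm sm])
      fix w :: "'z list" and z assume w: "set w \<subseteq> Basis"
      have M: "\<forall>b\<in>Basis. \<forall>z. norm (Dw (b # w) F z) \<le> Q * (P * young_exp \<mu> (length w))"
      proof (intro ballI allI)
        fix b z :: 'z assume b: "b \<in> Basis"
        have "norm (Dw (b # w) F z) \<le> Q * young_exp (2 * \<mu>) (length (b # w)) * exp (- (2 * \<mu>) * \<omega> (norm z))"
        proof -
          have "set (b # w) \<subseteq> Basis" using b w by simp
          then show ?thesis using Q unfolding sbound_def by blast
        qed
        also have "\<dots> \<le> Q * young_exp (2 * \<mu>) (length (b # w)) * 1"
          using mu Q0 w_nonneg[of "norm z"] by (intro mult_left_mono) auto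
        also have "\<dots> \<le> Q * (P * young_exp \<mu> (length w))" using P[of "length w"] Q0 by (simp add: mult_left_mono del: of_nat_Suc)
        finally show "norm (Dw (b # w) F z) \<le> Q * (P * young_exp \<mu> (length w))" .
      qed
      have "norm (Dw w (\<lambda>z. S i z - F z) z) = norm (Dw w (S i) z - Dw w F z)" using Cinf_minus(2)[OF Ssm sm w] by simp
      also have "\<dots> \<le> (fact (Suc (length w)) + A * (Q * (P * young_exp \<mu> (length w)))) / Suc i * exp (- norm z)"
        by (rule e[OF w M])
      also have "\<dots> \<le> (D * (P * young_exp \<mu> (length w)) + A * (Q * (P * young_exp \<mu> (length w)))) / Suc i * (E * exp (- \<mu> * \<omega> (norm z)))"
      proof (intro mult_mono divide_right_mono add_right_mono)
        show "fact (Suc (length w)) \<le> D * (P * young_exp \<mu> (length w))"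
          using order.trans[OF D(2) mult_left_mono[OF P]] D(1) by simp
        show "0 \<le> (D * (P * young_exp \<mu> (length w)) + A * (Q * (P * young_exp \<mu> (length w)))) / Suc i"
          using A Q0 D(1) by (simp add: P_def)
      qed (use E in auto)
      also have "\<dots> = C / Suc i * young_exp \<mu> (length w) * exp (- \<mu> * \<omega> (norm z))"
        by (simp add: C_def algebra_simps add_divide_distrib del: of_nat_Suc)
      finally show "norm (Dw w (\<lambda>z. S i z - F z) z) \<le> C / Suc i * young_exp \<mu> (length w) * exp (- \<mu> * \<omega> (norm z))" .
    qed
    then show ?thesis using C by blast
  qed
  then show ?thesis using S by blast
qed

end

section \<open>Identification of the distribution kernel\<close>

context weight
begin

lemma S_seminorm_le:
  fixes f :: "'z::euclidean_space \<Rightarrow> complex"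
  assumes f: "sbound \<mu> Q f" and mu: "\<mu> > 0" shows "S_seminorm \<omega> \<mu> f \<le> ennreal Q"
  unfolding S_seminorm_def
proof (intro SUP_least ennreal_leI)
  fix \<alpha> :: "'z multi_index" and x
  define E where "E = young_exp \<mu> (mi_size \<alpha>)"
  have E: "E > 0" "exp (- \<mu> * phi_star \<omega> (real (mi_size \<alpha>) / \<mu>)) = inverse E"
    by (simp_all add: E_def) (simp add: young_exp_def exp_minus)
  have "norm (Dmulti \<alpha> f x) \<le> Q * E * exp (- \<mu> * \<omega> (norm x))"
    using f set_mword[of \<alpha>] unfolding Dmulti_eq sbound_def E_def length_mword[symmetric] by blast
  then have "norm (Dmulti \<alpha> f x) * (inverse E * exp (\<mu> * \<omega> (norm x))) \<le> Q * E * exp (- \<mu> * \<omega> (norm x)) * (inverse E * exp (\<mu> * \<omega> (norm x)))"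
    using E(1) by (intro mult_right_mono) auto
  also have "\<dots> = Q * (E * inverse E) * (exp (- \<mu> * \<omega> (norm x)) * exp (\<mu> * \<omega> (norm x)))" by (simp only: mult_ac)
  also have "\<dots> = Q" using E(1) by (simp add: mult_exp_exp)
  finally show "norm (Dmulti \<alpha> f x) * exp (- \<mu> * phi_star \<omega> (real (mi_size \<alpha>) / \<mu>)) * exp (\<mu> * \<omega> (norm x)) \<le> Q"
    unfolding E(2) by (simp only: mult.assoc)
qed

lemma S_seminorm_triangle:
  fixes f g :: "'z::euclidean_space \<Rightarrow> complex"
  assumes "Cinf_on UNIV f" "Cinf_on UNIV g"
  shows "S_seminorm \<omega> \<mu> (\<lambda>x. f x + g x) \<le> S_seminorm \<omega> \<mu> f + S_seminorm \<omega> \<mu> g"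
proof -
  define e where "e = (\<lambda>(\<alpha>::'z multi_index) (x::'z). exp (- \<mu> * phi_star \<omega> (real (mi_size \<alpha>) / \<mu>)) * exp (\<mu> * \<omega> (norm x)))"
  have S: "S_seminorm \<omega> \<mu> h = (SUP \<alpha>. SUP x. ennreal (norm (Dmulti \<alpha> h x) * e \<alpha> x))" for h
    unfolding S_seminorm_def e_def by (simp only: mult.assoc)
  have up: "ennreal (norm (Dmulti \<alpha> h x) * e \<alpha> x) \<le> S_seminorm \<omega> \<mu> h" for h \<alpha> x
    unfolding S by (rule SUP_upper2[OF UNIV_I], rule SUP_upper[OF UNIV_I])
  show ?thesis
    unfolding S[of "\<lambda>x. f x + g x"]
  proof (intro SUP_least)
    fix \<alpha> :: "'z multi_index" and x
    have e: "e \<alpha> x \<ge> 0" by (simp add: e_def)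
    have "norm (Dmulti \<alpha> (\<lambda>x. f x + g x) x) \<le> norm (Dmulti \<alpha> f x) + norm (Dmulti \<alpha> g x)"
      unfolding Dmulti_eq Cinf_add(2)[OF assms set_mword] by (rule norm_triangle_ineq)
    then have "ennreal (norm (Dmulti \<alpha> (\<lambda>x. f x + g x) x) * e \<alpha> x) \<le> ennreal (norm (Dmulti \<alpha> f x) * e \<alpha> x + norm (Dmulti \<alpha> g x) * e \<alpha> x)"
      unfolding distrib_right[symmetric] by (intro ennreal_leI mult_right_mono e)
    also have "\<dots> = ennreal (norm (Dmulti \<alpha> f x) * e \<alpha> x) + ennreal (norm (Dmulti \<alpha> g x) * e \<alpha> x)"
      using e by (intro ennreal_plus) auto
    also have "\<dots> \<le> S_seminorm \<omega> \<mu> f + S_seminorm \<omega> \<mu> g" by (intro add_mono up)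
    finally show "ennreal (norm (Dmulti \<alpha> (\<lambda>x. f x + g x) x) * e \<alpha> x) \<le> S_seminorm \<omega> \<mu> f + S_seminorm \<omega> \<mu> g" .
  qed
qed

text \<open>The topology is only generated by the balls, so eventual membership is proved by
  induction over generated sets. For a ball around f that contains F the distance is strictly below
  \<epsilon>, and the triangle inequality leaves room for the vanishing error.\<close>

lemma S_dual_tendsto:
  fixes F :: "'z::euclidean_space \<Rightarrow> complex"
  assumes T: "T \<in> S_dual \<omega>" and F: "F \<in> S_space \<omega>" and S: "\<And>i. S i \<in> S_space \<omega>"
    and lim: "\<And>\<mu>. \<mu> > 0 \<Longrightarrow> \<exists>C\<ge>0. \<forall>i. sbound \<mu> (C / Suc i) (\<lambda>z. S i z - F z)"
  shows "(\<lambda>i. T (S i)) \<longlonglongrightarrow> T F"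
proof -
  define B where "B = {{g \<in> S_space \<omega>. S_seminorm \<omega> \<mu> (\<lambda>x. g x - f x) < ennreal \<epsilon>} | (f :: 'z \<Rightarrow> complex) \<mu> \<epsilon>. f \<in> S_space \<omega> \<and> \<mu> > 0 \<and> \<epsilon> > 0}"
  have top: "S_topology \<omega> = topology_generated_by B" by (simp add: S_topology_def B_def)
  have sm: "Cinf_on UNIV f" if "f \<in> S_space \<omega>" for f :: "'z \<Rightarrow> complex" using that by (simp add: S_space_def)
  have ev: "\<forall>\<^sub>F i in sequentially. S i \<in> U" if "generate_topology_on B U" "F \<in> U" for U
    using that
  proof (induction rule: generate_topology_on.induct)
    case (Int U V)
    then show ?case by (simp add: eventually_conj)
  next
    case (UN \<U>)
    then obtain U where U: "U \<in> \<U>" "F \<in> U" by blast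
    show ?case using UN.IH[OF U] by (rule eventually_mono) (use U in blast)
  next
    case (Basis U)
    then obtain f \<mu> \<epsilon> where U: "U = {g \<in> S_space \<omega>. S_seminorm \<omega> \<mu> (\<lambda>x. g x - f x) < ennreal \<epsilon>}" and f: "f \<in> S_space \<omega>" and mu: "\<mu> > 0"
      by (auto simp: B_def)
    define A where "A = S_seminorm \<omega> \<mu> (\<lambda>x. F x - f x)"
    have A: "A < ennreal \<epsilon>" using Basis.prems by (simp add: U A_def)
    obtain C where C: "C \<ge> 0" "\<And>i. sbound \<mu> (C / Suc i) (\<lambda>z. S i z - F z)" using lim[OF mu] by blast
    have le: "S_seminorm \<omega> \<mu> (\<lambda>x. S i x - f x) \<le> ennreal (C / Suc i) + A" for i
    proof -
      have "S_seminorm \<omega> \<mu> (\<lambda>x. (S i x - F x) + (F x - f x)) \<le> S_seminorm \<omega> \<mu> (\<lambda>x. S i x - F x) + A"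
        unfolding A_def by (rule S_seminorm_triangle) (intro Cinf_minus(1) sm S F f)+
      also have "\<dots> \<le> ennreal (C / Suc i) + A" by (intro add_right_mono S_seminorm_le[OF C(2) mu])
      finally show ?thesis by simp
    qed
    have "(\<lambda>i. C / Suc i) \<longlonglongrightarrow> 0" by real_asymp
    then have "(\<lambda>i. ennreal (C / Suc i) + A) \<longlonglongrightarrow> ennreal 0 + A" by (intro tendsto_intros tendsto_ennrealI)
    then have "\<forall>\<^sub>F i in sequentially. ennreal (C / Suc i) + A < ennreal \<epsilon>" using A by (intro order_tendstoD(2)) auto
    then show ?case by (rule eventually_mono) (use le S in \<open>auto simp: U intro: le_less_trans\<close>)
  qed simp
  have "S_seminorm \<omega> 1 (\<lambda>x. F x - F x) < ennreal 1"
  proof -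
    have "S_seminorm \<omega> 1 (\<lambda>x. F x - F x) \<le> ennreal 0" using S_seminorm_le[OF sbound_0[where 'z = 'z], of 1] by simp
    then show ?thesis by (rule le_less_trans) simp
  qed
  \<comment> \<open>F lies in a ball around itself, hence in the underlying space of the generated
    topology.\<close>
  then have "F \<in> \<Union>B" using F unfolding B_def by (intro UnionI[of "{g \<in> S_space \<omega>. S_seminorm \<omega> 1 (\<lambda>x. g x - F x) < ennreal 1}"]) (auto intro!: exI[of _ F] exI[of _ "1::real"])
  then have "limitin (S_topology \<omega>) S F sequentially"
    unfolding limitin_def top using ev by (simp add: openin_topology_generated_by_iff)
  from continuous_map_limit[OF _ this, of euclidean T] show ?thesis
    using T by (simp add: S_dual_def o_def)
qed

end

section \<open>Equality of the two functionals and the final estimates\<close>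

context amplitude
begin

text \<open>A Gaussian on the product space is a tensor product of Gaussians. There both functionals
  equal the pairing of the operator, and linearity extends this to combinations.\<close>

lemma kernel_gauss_comb:
  assumes K: "is_kernel_of \<omega> K (pdo a)" and f: "gauss_comb f" shows "K f = kaction f"
proof -
  obtain s W c where s: "s > 0" and W: "finite W" and f: "f = (\<lambda>z. \<Sum>q\<in>W. c q * gaussian s q z)"
    using f unfolding gauss_comb_def by blast
  have nT0: "real kaction_order > 0" using kaction_order(1) by simp
  have sb: "\<exists>Q. sbound kaction_order Q g" if "rapid g" for g :: "'a \<times> 'a \<Rightarrow> complex" using that nT0 unfolding rapid_def by blast
  have lin: "K (\<lambda>z. g z + h z) = K g + K h" "K (\<lambda>z. b * g z) = b * K g" if "rapid g" "rapid h" for g h b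
    using K rapid_S_space[OF that(1)] rapid_S_space[OF that(2)] unfolding is_kernel_of_def S_dual_def by blast+
  have TTl: "kaction (\<lambda>z. g z + h z) = kaction g + kaction h" "kaction (\<lambda>z. b * g z) = b * kaction g" if "rapid g" "rapid h" for g h b
    using sb[OF that(1)] sb[OF that(2)] kaction_linear(1,2) by blast+
  have one: "K (gaussian s q) = kaction (gaussian s q)" for q
  proof -
    obtain p1 p2 where q: "q = (p1, p2)" by (cases q)
    have g: "gaussian s q = (\<lambda>(x, y). gaussian s p1 x * gaussian s p2 y)" by (auto simp: q gaussian_pair)
    show ?thesis
      using K rapid_S_space[OF rapid_gaussian[OF s, of p1]] rapid_S_space[OF rapid_gaussian[OF s, of p2]]
      unfolding g kaction_tensor is_kernel_of_def by blast
  qed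
  have nc: "rapid (\<lambda>z. \<Sum>q\<in>V. c q * gaussian s q z)" if "finite V" for V
    using that s by (intro gauss_comb_rapid) (auto simp: gauss_comb_def)
  show ?thesis unfolding f using W
  proof (induction W rule: finite_induct)
    case empty
    \<comment> \<open>The empty sum is written as 0 times a Gaussian, so that homogeneity gives the
      value 0 on both sides.\<close>
    note n = rapid_gaussian[OF s, of "0 :: 'a \<times> 'a"]
    show ?case using lin(2)[OF n n, of 0] TTl(2)[OF n n, of 0] by simp
  next
    case (insert q W)
    note n = rapid_gaussian[OF s, of q] nc[OF insert(1)]
    show ?case
      unfolding sum.insert[OF insert(1,2)]
      unfolding lin(1)[OF rapid_cmult[OF n(1)] n(2)] TTl(1)[OF rapid_cmult[OF n(1)] n(2)] lin(2)[OF n(1) n(1)] TTl(2)[OF n(1) n(1)]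
      by (simp only: one insert.IH)
  qed
qed

text \<open>Both functionals are continuous along the same sequence of Gaussian combinations:
  \<open>K\<close> for the topology, \<open>kaction\<close> for its one seminorm.\<close>

lemma kernel_test_function:
  assumes K: "is_kernel_of \<omega> K (pdo a)" and F: "F \<in> S_space \<omega>" and K0: "compact K0" "\<And>z. z \<notin> K0 \<Longrightarrow> F z = 0"
  shows "K F = kaction F"
proof -
  obtain S where S: "\<And>i. gauss_comb (S i)" and lim: "\<And>\<mu>. \<mu> > 0 \<Longrightarrow> \<exists>C\<ge>0. \<forall>i. sbound \<mu> (C / Suc i) (\<lambda>z. S i z - F z)"
    using gauss_dense[OF F K0] by blast
  have nT0: "real kaction_order > 0" using kaction_order(1) by simp
  have "K \<in> S_dual \<omega>" using K by (simp add: is_kernel_of_def)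
  then have 1: "(\<lambda>i. K (S i)) \<longlonglongrightarrow> K F"
    by (rule S_dual_tendsto[OF _ F rapid_S_space[OF gauss_comb_rapid[OF S]] lim])
  obtain C where C: "C \<ge> 0" "\<And>i. sbound kaction_order (C / Suc i) (\<lambda>z. S i z - F z)" using lim[OF nT0] by blast
  obtain C' where C': "C' > 0" "\<And>G Q. sbound kaction_order Q G \<Longrightarrow> norm (kaction G) \<le> C' * Q" using kaction_bound by blast
  obtain Q where Q: "sbound kaction_order Q F" using test_function_sbound[OF F K0 nT0] by blast
  have "norm (kaction (S i) - kaction F) \<le> C' * (C / Suc i)" for i
  proof -
    obtain Q' where Q': "sbound kaction_order Q' (S i)" using gauss_comb_rapid[OF S] nT0 unfolding rapid_def by blast
    show ?thesis using C'(2)[OF C(2)[of i]] unfolding kaction_linear(3)[OF Q' Q] .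
  qed
  moreover have "(\<lambda>i. C' * (C / Suc i)) \<longlonglongrightarrow> 0" by real_asymp
  ultimately have "(\<lambda>i. kaction (S i) - kaction F) \<longlonglongrightarrow> 0"
    by (intro Lim_null_comparison[of "\<lambda>i. kaction (S i) - kaction F" "\<lambda>i. C' * (C / Suc i)"]) auto
  then have "(\<lambda>i. K (S i)) \<longlonglongrightarrow> kaction F" unfolding kernel_gauss_comb[OF K S] by (simp only: LIM_zero_iff)
  then show ?thesis using 1 LIMSEQ_unique by blast
qed

lemma kernel_smooth:
  assumes r: "r > 0" shows "Cinf_on (- closure (Delta r)) (kernel_lim [])"
proof -
  have "- closure (Delta r) \<subseteq> offdiag"
  proof
    fix z :: "'a \<times> 'a" assume "z \<in> - closure (Delta r)"
    then have "z \<notin> Delta r" using closure_subset[of "Delta r"] by blast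
    then show "z \<in> offdiag" using r by (auto simp: Delta_def offdiag_def)
  qed
  then show ?thesis using kernel_lim_smooth(1) unfolding Cinf_iff by (meson continuous_on_subset subsetD)
qed

lemma kernel_given_by:
  assumes K: "is_kernel_of \<omega> K (pdo a)" and r: "r > 0"
  shows "given_by_on \<omega> K (- closure (Delta r)) (kernel_lim [])"
  unfolding given_by_on_def
proof (intro ballI impI)
  fix F :: "'a \<times> 'a \<Rightarrow> complex" assume F: "F \<in> S_space \<omega>"
  define K0 where "K0 = closure {z. F z \<noteq> 0}"
  assume "compact (closure {z. F z \<noteq> 0}) \<and> closure {z. F z \<noteq> 0} \<subseteq> - closure (Delta r)"
  then have K0: "compact K0" "K0 \<inter> closure (Delta r) = {}" by (auto simp: K0_def)
  have F0: "F z = 0" if "z \<notin> K0" for z using that closure_subset[of "{z. F z \<noteq> 0}"] by (auto simp: K0_def)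
  have far: "r \<le> norm (fst z - snd z)" if "z \<in> K0" for z
  proof -
    have "z \<notin> Delta r" using that K0(2) closure_subset[of "Delta r"] by blast
    then show ?thesis by (cases z) (simp add: Delta_def)
  qed
  have "real kaction_order > 0" using kaction_order(1) by simp
  then obtain Q where "sbound kaction_order Q F" using test_function_sbound[OF F K0(1) F0] by blast
  from kaction_kernel[OF this K0(1) F0 r far] show "K F = (LINT z|lborel. kernel_lim [] z * F z)"
    using kernel_test_function[OF K F K0(1) F0] by simp
qed

lemma kernel_bound:
  assumes r: "r > 0" and mu: "\<mu> > 0"
  shows "\<exists>C>0. \<forall>x y. (x, y) \<notin> Delta r \<longrightarrow> (\<forall>\<alpha> \<beta>.
       norm (Dmulti \<alpha> (\<lambda>x. Dmulti \<beta> (\<lambda>y. kernel_lim [] (x, y)) y) x)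
         \<le> C * exp (\<mu> * phi_star \<omega> (real (mi_size (\<lambda>i. \<alpha> i + \<beta> i)) / \<mu>))
             * exp (- \<mu> * \<omega> (norm x)) * exp (- \<mu> * \<omega> (norm y)))"
proof -
  obtain C where C: "C > 0" "\<And>x y w. r \<le> norm (x - y) \<Longrightarrow> set w \<subseteq> Basis \<Longrightarrow>
    norm (kernel_lim w (x, y)) \<le> C * young_exp \<mu> (length w) * exp (- \<mu> * \<omega> (norm x)) * exp (- \<mu> * \<omega> (norm y))"
    using kernel_lim_bound[OF r mu] by blast
  have "norm (Dmulti \<alpha> (\<lambda>x. Dmulti \<beta> (\<lambda>y. kernel_lim [] (x, y)) y) x)
         \<le> C * exp (\<mu> * phi_star \<omega> (real (mi_size (\<lambda>i. \<alpha> i + \<beta> i)) / \<mu>))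
             * exp (- \<mu> * \<omega> (norm x)) * exp (- \<mu> * \<omega> (norm y))" if "(x, y) \<notin> Delta r" for x y \<alpha> \<beta>
  proof -
    define w where "w = map (\<lambda>b. (b, 0)) (mword \<alpha>) @ map (\<lambda>b. (0, b)) (mword \<beta>)"
    have w: "set w \<subseteq> (Basis :: ('a \<times> 'a) set)" using set_mword[of \<alpha>] set_mword[of \<beta>] by (auto simp: w_def Basis_prod_def)
    have lw: "length w = mi_size (\<lambda>i. \<alpha> i + \<beta> i)" by (simp add: w_def length_mword mi_size_def sum.distrib)
    have far: "r \<le> norm (x - y)" using that by (simp add: Delta_def)
    then have "(x, y) \<in> offdiag" using r by (auto simp: offdiag_def)
    then have "Dmulti \<alpha> (\<lambda>x. Dmulti \<beta> (\<lambda>y. kernel_lim [] (x, y)) y) x = kernel_lim w (x, y)"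
      unfolding Dmulti_pair w_def[symmetric] by (rule kernel_lim_smooth(2)[OF w])
    then show ?thesis using C(2)[OF far w] unfolding lw young_exp_def by simp
  qed
  then show ?thesis using C(1) by blast
qed

end

theorem theorem5p2:
  fixes \<omega> \<sigma> :: "real \<Rightarrow> real" and m \<rho> :: real
    and a :: "(real^'d) \<times> (real^'d) \<times> (real^'d) \<Rightarrow> complex"
    and K :: "((real^'d) \<times> (real^'d) \<Rightarrow> complex) \<Rightarrow> complex"
  assumes "weight_function \<omega>" and "normalised \<omega>"
    and "0 < \<rho>" and "\<rho> \<le> 1"
    and "weight_function \<sigma>" and "(\<lambda>t. \<omega> (t powr (1 / \<rho>))) \<in> O[at_top](\<sigma>)"
    and "a \<in> GA m \<omega> \<rho>"
    and "is_kernel_of \<omega> K (pdo a)"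
  shows "\<exists>k :: (real^'d) \<times> (real^'d) \<Rightarrow> complex. \<forall>r>0.
    (Cinf_on (- closure (Delta r)) k \<and> given_by_on \<omega> K (- closure (Delta r)) k) \<and>
    (\<forall>\<mu>>0. \<exists>C>0. \<forall>x y. (x, y) \<notin> Delta r \<longrightarrow> (\<forall>\<alpha> \<beta>.
       norm (Dmulti \<alpha> (\<lambda>x. Dmulti \<beta> (\<lambda>y. k (x, y)) y) x)
         \<le> C * exp (\<mu> * phi_star \<omega> (real (mi_size (\<lambda>i. \<alpha> i + \<beta> i)) / \<mu>))
             * exp (- \<mu> * \<omega> (norm x)) * exp (- \<mu> * \<omega> (norm y))))"
proof -
  interpret amplitude \<omega> a m \<rho> by unfold_locales (fact assms)+
  \<comment> \<open>The limit kernel is built without reference to r, so one function serves for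
    every r > 0.\<close>
  show ?thesis
    using kernel_smooth kernel_given_by[OF \<open>is_kernel_of \<omega> K (pdo a)\<close>] kernel_bound
    by (intro exI[of _ "kernel_lim []"] allI impI conjI)
qed

end
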